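(* Let $\sigma>0$ and $T>0$, and let $\{B(t)\}_{t\ge 0}$ be a standard one-dimensional Brownian motion. The Cauchy problem for the Stratonovich stochastic partial differential equation $$ \begin{cases} dU(t,x) = V(t,x)\, dt+ \sigma\, \partial_xU(t,x)\circ dB(t),& t\in(0,T],\ x\in\mathbb{R},\\ dV(t,x) = -i\,\partial_x U(t,x)\,dt, & t\in(0,T],\ x\in\mathbb{R},\\ U(0,x)=\varphi_0(x),\quad V(0,x)=\varphi_1(x),& x\in\mathbb{R}, \end{cases} $$ is well-posed in $H_x^\infty$ in the continuous sense, i.e. for all $\varphi_0,\varphi_1\in H_x^\infty$ it has a unique solution process $(U,V)$ with $$ U\in \bigcap_{k\ge0}C\big([0,T];L^2(\Omega;H_x^k)\big) , \qquad V\in \bigcap_{k\ge0} C\big([0,T];L^2(\Omega;H_x^{k-\frac12})\big). $$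
   Context: $H_x^{k}$, $k\in\mathbb{R}$, is the usual ($L^2$-based, complex-valued) Sobolev space on $\mathbb{R}$ in the variable $x$, and $H_x^\infty:=\bigcap_{k\ge 0}H_x^k$. $(\Omega,\mathcal F,\mathbb P)$ is the probability space, with its filtration, on which $B$ is defined; the initial data are deterministic. The symbol $\circ$ denotes Stratonovich integration. The equation is understood through the Fourier transform in $x$, $\widehat u(\xi)=\int_{\mathbb{R}}e^{-ix\xi}u(x)\,dx$. For each $\xi\in\mathbb{R}$ the modes satisfy the It\^o form of the transformed equation: $$ \begin{cases} d\widehat U(t;\xi) = \left[\widehat V(t;\xi)-\frac{\sigma^2}{2}\xi^2\widehat U(t;\xi)\right]dt + i\sigma\xi\,\widehat U(t;\xi)\,dB(t),\\ d\widehat V(t;\xi) = \xi\,\widehat U(t;\xi)\,dt,\\ \widehat U(0;\xi)=\widehat\varphi_0(\xi),\quad \widehat V(0;\xi)=\widehat\varphi_1(\xi). \end{cases} $$ A solution is an adapted process $(U,V)$ for which there is a jointly measurable field $(\widehat U(t;\xi),\widehat V(t;\xi))$ such that, for a.e. $\xi$, it is the continuous adapted solution on $[0,T]$ of this linear It\^o system, and, for every $t\in[0,T]$, almost surely the Fourier transforms of $U(t)$ and $V(t)$ equal $\widehat U(t;\cdot)$ and $\widehat V(t;\cdot)$ a.e. Uniqueness is up to modification. *)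

theory Defs
  imports "HOL-Probability.Probability"
begin

section \<open>Tempered distributions and Sobolev spaces on the real line\<close>

definition vderiv :: "(real \<Rightarrow> complex) \<Rightarrow> real \<Rightarrow> complex" where
  "vderiv f = (\<lambda>x. vector_derivative f (at x))"

definition schwartz :: "(real \<Rightarrow> complex) \<Rightarrow> bool" where
  "schwartz \<phi> \<longleftrightarrow>
     (\<forall>n x. ((vderiv ^^ n) \<phi>) differentiable (at x)) \<and>
     (\<forall>m n. bounded (range (\<lambda>x. of_real (x ^ m) * (vderiv ^^ n) \<phi> x)))"

definition schwartz_seminorm :: "nat \<Rightarrow> nat \<Rightarrow> (real \<Rightarrow> complex) \<Rightarrow> real" where
  "schwartz_seminorm m n \<phi> = (SUP x. cmod (of_real (x ^ m) * (vderiv ^^ n) \<phi> x))"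

lemma schwartz_seminorm_nonneg:
  assumes "schwartz \<phi>"
  shows "0 \<le> schwartz_seminorm m n \<phi>"
proof -
  let ?f = "\<lambda>x. of_real (x ^ m) * (vderiv ^^ n) \<phi> x"
  have "bounded (range ?f)"
    using assms by (simp add: schwartz_def)
  then have "bdd_above (range (\<lambda>x. cmod (?f x)))"
    by (auto simp: bounded_iff bdd_above_def)
  then have "cmod (?f 0) \<le> (SUP x. cmod (?f x))"
    by (rule cSUP_upper2[where x = 0]) auto
  then show ?thesis
    unfolding schwartz_seminorm_def using norm_ge_zero[of "?f 0"] by linarith
qed

text \<open>
  A tempered distribution is a continuous complex-linear functional on Schwartz functions. The
  functional is set to 0 outside the Schwartz space, so that equality of elements of the type is
  equality of distributions.
\<close>

definition is_tempered :: "((real \<Rightarrow> complex) \<Rightarrow> complex) \<Rightarrow> bool" where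
  "is_tempered u \<longleftrightarrow>
     (\<forall>\<phi> \<psi>. schwartz \<phi> \<longrightarrow> schwartz \<psi> \<longrightarrow> u (\<lambda>x. \<phi> x + \<psi> x) = u \<phi> + u \<psi>) \<and>
     (\<forall>c \<phi>. schwartz \<phi> \<longrightarrow> u (\<lambda>x. c * \<phi> x) = c * u \<phi>) \<and>
     (\<exists>C N. \<forall>\<phi>. schwartz \<phi> \<longrightarrow> cmod (u \<phi>) \<le> C * (\<Sum>m\<le>N. \<Sum>n\<le>N. schwartz_seminorm m n \<phi>)) \<and>
     (\<forall>\<phi>. \<not> schwartz \<phi> \<longrightarrow> u \<phi> = 0)"

lemma is_tempered_zero: "is_tempered (\<lambda>_. 0)"
  unfolding is_tempered_def by (auto intro!: exI[of _ 0])

typedef tempered = "{u. is_tempered u}"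
  morphisms pairing Abs_tempered
  using is_tempered_zero by auto

setup_lifting type_definition_tempered

lemma is_tempered_uminus:
  assumes "is_tempered u"
  shows "is_tempered (\<lambda>\<phi>. - u \<phi>)"
  using assms unfolding is_tempered_def by simp

lemma is_tempered_add:
  assumes u: "is_tempered u" and v: "is_tempered v"
  shows "is_tempered (\<lambda>\<phi>. u \<phi> + v \<phi>)"
proof -
  let ?p = "\<lambda>N \<phi>. \<Sum>m\<le>N::nat. \<Sum>n\<le>N::nat. schwartz_seminorm m n \<phi>"
  obtain C N where C: "\<And>\<phi>. schwartz \<phi> \<Longrightarrow> cmod (u \<phi>) \<le> C * ?p N \<phi>"
    using u unfolding is_tempered_def by blast
  obtain D K where D: "\<And>\<phi>. schwartz \<phi> \<Longrightarrow> cmod (v \<phi>) \<le> D * ?p K \<phi>"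
    using v unfolding is_tempered_def by blast
  have nonneg: "0 \<le> ?p n \<phi>" if "schwartz \<phi>" for n \<phi>
    using that by (intro sum_nonneg schwartz_seminorm_nonneg)
  have mono: "?p n \<phi> \<le> ?p (max N K) \<phi>" if "schwartz \<phi>" "n \<le> max N K" for n \<phi>
  proof -
    have "?p n \<phi> \<le> (\<Sum>m\<le>n. \<Sum>j\<le>max N K. schwartz_seminorm m j \<phi>)"
      using that by (intro sum_mono sum_mono2 schwartz_seminorm_nonneg) auto
    also have "\<dots> \<le> ?p (max N K) \<phi>"
      using that by (intro sum_mono2 sum_nonneg schwartz_seminorm_nonneg) auto
    finally show ?thesis .
  qed
  have "cmod (u \<phi> + v \<phi>) \<le> (\<bar>C\<bar> + \<bar>D\<bar>) * ?p (max N K) \<phi>" if \<phi>: "schwartz \<phi>" for \<phi>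
  proof -
    have "C * ?p N \<phi> \<le> \<bar>C\<bar> * ?p (max N K) \<phi>"
      using nonneg[OF \<phi>] mono[OF \<phi>, of N] by (intro mult_mono) auto
    moreover have "D * ?p K \<phi> \<le> \<bar>D\<bar> * ?p (max N K) \<phi>"
      using nonneg[OF \<phi>] mono[OF \<phi>, of K] by (intro mult_mono) auto
    ultimately show ?thesis
      using C[OF \<phi>] D[OF \<phi>] norm_triangle_ineq[of "u \<phi>" "v \<phi>"]
      unfolding distrib_right by linarith
  qed
  then have "\<exists>C N. \<forall>\<phi>. schwartz \<phi> \<longrightarrow> cmod (u \<phi> + v \<phi>) \<le> C * ?p N \<phi>"
    by blast
  with u v show ?thesis
    unfolding is_tempered_def by (simp add: algebra_simps)
qed

instantiation tempered :: ab_group_add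
begin

lift_definition zero_tempered :: tempered is "\<lambda>_. 0"
  by (rule is_tempered_zero)

lift_definition uminus_tempered :: "tempered \<Rightarrow> tempered" is "\<lambda>u \<phi>. - u \<phi>"
  by (rule is_tempered_uminus)

lift_definition plus_tempered :: "tempered \<Rightarrow> tempered \<Rightarrow> tempered" is "\<lambda>u v \<phi>. u \<phi> + v \<phi>"
  by (rule is_tempered_add)

lift_definition minus_tempered :: "tempered \<Rightarrow> tempered \<Rightarrow> tempered" is "\<lambda>u v \<phi>. u \<phi> - v \<phi>"
  using is_tempered_add is_tempered_uminus by fastforce

instance
  by standard (transfer; simp add: algebra_simps)+

end

definition fourier :: "(real \<Rightarrow> complex) \<Rightarrow> real \<Rightarrow> complex" where
  "fourier \<phi> \<xi> = (LINT x|lborel. exp (- \<i> * of_real (x * \<xi>)) * \<phi> x)"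

text \<open>
  The Fourier transform of \<open>u\<close>, defined by duality, is (the distribution given by) the
  function \<open>g\<close>. Such a \<open>g\<close> is determined up to a null set.
\<close>

definition has_fourier :: "tempered \<Rightarrow> (real \<Rightarrow> complex) \<Rightarrow> bool" where
  "has_fourier u g \<longleftrightarrow> g \<in> borel_measurable borel \<and>
     (\<forall>\<phi>. schwartz \<phi> \<longrightarrow> integrable lborel (\<lambda>\<xi>. g \<xi> * \<phi> \<xi>) \<and>
        pairing u (fourier \<phi>) = (LINT \<xi>|lborel. g \<xi> * \<phi> \<xi>))"

definition fourier_fn :: "tempered \<Rightarrow> real \<Rightarrow> complex" where
  "fourier_fn u = (SOME g. has_fourier u g)"

definition sobolev :: "real \<Rightarrow> tempered set" where
  "sobolev s = {u. \<exists>g. has_fourier u g \<and>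
     integrable lborel (\<lambda>\<xi>. (1 + \<xi>\<^sup>2) powr s * (cmod (g \<xi>))\<^sup>2)}"

definition sobolev_norm :: "real \<Rightarrow> tempered \<Rightarrow> real" where
  "sobolev_norm s u = sqrt (LINT \<xi>|lborel. (1 + \<xi>\<^sup>2) powr s * (cmod (fourier_fn u \<xi>))\<^sup>2)"

definition sobolev_inf :: "tempered set" where
  "sobolev_inf = (\<Inter>k\<in>{0..}. sobolev k)"


section \<open>The Bochner spaces of Sobolev-valued random variables\<close>

definition strongly_measurable :: "'a measure \<Rightarrow> real \<Rightarrow> ('a \<Rightarrow> tempered) \<Rightarrow> bool" where
  "strongly_measurable M s X \<longleftrightarrow>
     (\<exists>S :: nat \<Rightarrow> 'a \<Rightarrow> tempered.
        (\<forall>n. simple_function M (S n) \<and> S n ` space M \<subseteq> sobolev s) \<and>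
        (AE \<omega> in M. X \<omega> \<in> sobolev s \<and> (\<lambda>n. sobolev_norm s (S n \<omega> - X \<omega>)) \<longlonglongrightarrow> 0))"

text \<open>
  For \<open>M\<close> not complete, the norm of a strongly measurable function need only agree almost
  everywhere with a measurable function; for such functions the nonnegative integral over
  \<open>M\<close> is the one over the completion of \<open>M\<close>.
\<close>

definition L2_sobolev :: "'a measure \<Rightarrow> real \<Rightarrow> ('a \<Rightarrow> tempered) set" where
  "L2_sobolev M s = {X. strongly_measurable M s X \<and>
     (\<integral>\<^sup>+\<omega>. ennreal ((sobolev_norm s (X \<omega>))\<^sup>2) \<partial>M) < \<infinity>}"

definition continuous_L2_sobolev ::
    "'a measure \<Rightarrow> real \<Rightarrow> real \<Rightarrow> (real \<Rightarrow> 'a \<Rightarrow> tempered) \<Rightarrow> bool" where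
  "continuous_L2_sobolev M T s X \<longleftrightarrow>
     (\<forall>t\<in>{0..T}. X t \<in> L2_sobolev M s) \<and>
     (\<forall>r\<in>{0..T}. ((\<lambda>t. \<integral>\<^sup>+\<omega>. ennreal ((sobolev_norm s (X t \<omega> - X r \<omega>))\<^sup>2) \<partial>M) \<longlongrightarrow> 0)
        (at r within {0..T}))"


section \<open>Brownian motion and the Ito integral\<close>

locale brownian_motion = prob_space M + filtration "space M" F
  for M :: "'a measure" and F :: "real \<Rightarrow> 'a measure" +
  fixes B :: "real \<Rightarrow> 'a \<Rightarrow> real"
  assumes filtration_subalgebra: "0 \<le> t \<Longrightarrow> subalgebra M (F t)"
    and BM_adapted: "0 \<le> t \<Longrightarrow> B t \<in> borel_measurable (F t)"
    and BM_zero: "AE \<omega> in M. B 0 \<omega> = 0"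
    and BM_continuous: "AE \<omega> in M. continuous_on {0..} (\<lambda>t. B t \<omega>)"
    and BM_normal: "0 \<le> s \<Longrightarrow> s < t \<Longrightarrow>
          distributed M lborel (\<lambda>\<omega>. B t \<omega> - B s \<omega>) (normal_density 0 (sqrt (t - s)))"
    and BM_indep: "0 \<le> s \<Longrightarrow> s < t \<Longrightarrow>
          indep_set (sets (F s)) {(\<lambda>\<omega>. B t \<omega> - B s \<omega>) -` A \<inter> space M | A. A \<in> sets borel}"

definition null_in_probability :: "'a measure \<Rightarrow> (nat \<Rightarrow> 'a \<Rightarrow> ennreal) \<Rightarrow> bool" where
  "null_in_probability M Z \<longleftrightarrow>
     (\<forall>\<epsilon>>0. (\<lambda>n. measure M {\<omega> \<in> space M. Z n \<omega> > \<epsilon>}) \<longlonglongrightarrow> 0)"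

text \<open>
  The data \<open>N\<close>, \<open>\<tau>\<close>, \<open>c\<close> encode the simple process equal to \<open>c i\<close> on
  \<open>{\<tau> i <.. \<tau> (Suc i)}\<close> for \<open>i < N\<close>, and to 0 elsewhere.
\<close>

definition simple_process ::
    "'a measure \<Rightarrow> (real \<Rightarrow> 'a measure) \<Rightarrow> real \<Rightarrow> nat \<Rightarrow> (nat \<Rightarrow> real) \<Rightarrow> (nat \<Rightarrow> 'a \<Rightarrow> complex) \<Rightarrow> bool"
where
  "simple_process M F T N \<tau> c \<longleftrightarrow>
     0 \<le> \<tau> 0 \<and> \<tau> N \<le> T \<and> (\<forall>i<N. \<tau> i \<le> \<tau> (Suc i)) \<and>
     (\<forall>i<N. c i \<in> borel_measurable (F (\<tau> i))) \<and>
     (\<exists>K. \<forall>i<N. \<forall>\<omega>\<in>space M. cmod (c i \<omega>) \<le> K)"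

definition simple_value ::
    "nat \<Rightarrow> (nat \<Rightarrow> real) \<Rightarrow> (nat \<Rightarrow> 'a \<Rightarrow> complex) \<Rightarrow> real \<Rightarrow> 'a \<Rightarrow> complex" where
  "simple_value N \<tau> c t \<omega> = (\<Sum>i<N. indicator {\<tau> i <.. \<tau> (Suc i)} t * c i \<omega>)"

definition simple_ito ::
    "(real \<Rightarrow> 'a \<Rightarrow> real) \<Rightarrow> nat \<Rightarrow> (nat \<Rightarrow> real) \<Rightarrow> (nat \<Rightarrow> 'a \<Rightarrow> complex) \<Rightarrow> real \<Rightarrow> 'a \<Rightarrow> complex"
where
  "simple_ito B N \<tau> c t \<omega> =
     (\<Sum>i<N. c i \<omega> * of_real (B (min t (\<tau> (Suc i))) \<omega> - B (min t (\<tau> i)) \<omega>))"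

text \<open>
  \<open>J t\<close> is the Ito integral of \<open>H\<close> over \<open>[0, t]\<close>, for \<open>t \<in> [0, T]\<close>. Since the
  filtration is not assumed to contain the null sets, \<open>J t\<close> is only required to be
  \<open>M\<close>-measurable; it agrees almost surely with an \<open>F t\<close>-measurable variable because it is a
  limit in probability of such variables.
\<close>

definition has_ito_integral ::
    "'a measure \<Rightarrow> (real \<Rightarrow> 'a measure) \<Rightarrow> (real \<Rightarrow> 'a \<Rightarrow> real) \<Rightarrow> real \<Rightarrow>
     (real \<Rightarrow> 'a \<Rightarrow> complex) \<Rightarrow> (real \<Rightarrow> 'a \<Rightarrow> complex) \<Rightarrow> bool"
where
  "has_ito_integral M F B T H J \<longleftrightarrow>
     (\<lambda>(t, \<omega>). H t \<omega>) \<in> borel_measurable (restrict_space borel {0..T} \<Otimes>\<^sub>M M) \<and>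
     (\<forall>t\<in>{0..T}. H t \<in> borel_measurable (F t)) \<and>
     (AE \<omega> in M. (\<integral>\<^sup>+s\<in>{0..T}. ennreal ((cmod (H s \<omega>))\<^sup>2) \<partial>lborel) < \<infinity>) \<and>
     (\<forall>t\<in>{0..T}. J t \<in> borel_measurable M) \<and>
     (AE \<omega> in M. continuous_on {0..T} (\<lambda>t. J t \<omega>)) \<and>
     (\<exists>N \<tau> c. (\<forall>n. simple_process M F T (N n) (\<tau> n) (c n)) \<and>
        null_in_probability M (\<lambda>n \<omega>. \<integral>\<^sup>+s\<in>{0..T}.
           ennreal ((cmod (simple_value (N n) (\<tau> n) (c n) s \<omega> - H s \<omega>))\<^sup>2) \<partial>lborel) \<and>
        (\<forall>t\<in>{0..T}. null_in_probability M (\<lambda>n \<omega>.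
           ennreal (cmod (simple_ito B (N n) (\<tau> n) (c n) t \<omega> - J t \<omega>)))))"


section \<open>The Cauchy problem\<close>

text \<open>
  The Ito system satisfied by the mode \<open>\<xi>\<close>:
  \<open>du = (v - \<sigma>\<^sup>2/2 \<xi>\<^sup>2 u) dt + i \<sigma> \<xi> u dB\<close>, \<open>dv = \<xi> u dt\<close>, \<open>u(0) = a\<close>, \<open>v(0) = b\<close>.
\<close>

definition mode_solution ::
    "'a measure \<Rightarrow> (real \<Rightarrow> 'a measure) \<Rightarrow> (real \<Rightarrow> 'a \<Rightarrow> real) \<Rightarrow> real \<Rightarrow> real \<Rightarrow> real \<Rightarrow>
     complex \<Rightarrow> complex \<Rightarrow> (real \<Rightarrow> 'a \<Rightarrow> complex) \<Rightarrow> (real \<Rightarrow> 'a \<Rightarrow> complex) \<Rightarrow> bool"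
where
  "mode_solution M F B \<sigma> T \<xi> a b u v \<longleftrightarrow>
     (\<forall>t\<in>{0..T}. u t \<in> borel_measurable (F t) \<and> v t \<in> borel_measurable (F t)) \<and>
     (AE \<omega> in M. continuous_on {0..T} (\<lambda>t. u t \<omega>) \<and> continuous_on {0..T} (\<lambda>t. v t \<omega>)) \<and>
     (\<exists>J. has_ito_integral M F B T (\<lambda>s \<omega>. \<i> * of_real (\<sigma> * \<xi>) * u s \<omega>) J \<and>
        (AE \<omega> in M. \<forall>t\<in>{0..T}.
           u t \<omega> = a + integral {0..t} (\<lambda>s. v s \<omega> - of_real (\<sigma>\<^sup>2 / 2 * \<xi>\<^sup>2) * u s \<omega>) + J t \<omega>)) \<and>
     (AE \<omega> in M. \<forall>t\<in>{0..T}. v t \<omega> = b + integral {0..t} (\<lambda>s. of_real \<xi> * u s \<omega>))"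

text \<open>
  Adaptedness is measurability with respect to the \<open>\<sigma>\<close>-algebra generated by the evaluations
  at test functions; on each of the (separable) spaces \<open>sobolev s\<close> this is the Borel
  \<open>\<sigma>\<close>-algebra.
\<close>

definition adapted_process ::
    "(real \<Rightarrow> 'a measure) \<Rightarrow> real \<Rightarrow> (real \<Rightarrow> 'a \<Rightarrow> tempered) \<Rightarrow> bool" where
  "adapted_process F T X \<longleftrightarrow>
     (\<forall>t\<in>{0..T}. \<forall>\<phi>. schwartz \<phi> \<longrightarrow> (\<lambda>\<omega>. pairing (X t \<omega>) \<phi>) \<in> borel_measurable (F t))"

text \<open>
  Solutions of
  \<open>dU = V dt + \<sigma> \<partial>\<^sub>xU \<circ> dB\<close>, \<open>dV = - i \<partial>\<^sub>xU dt\<close>, \<open>U(0) = \<phi>\<^sub>0\<close>, \<open>V(0) = \<phi>\<^sub>1\<close>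
  with the Stratonovich equation understood through the Ito form of its Fourier transform in
  \<open>x\<close>. The choice of the representatives \<open>a\<close>, \<open>b\<close> of the transformed data is irrelevant,
  since the modes are only constrained for almost every \<open>\<xi>\<close>.
\<close>

definition cauchy_solution ::
    "'a measure \<Rightarrow> (real \<Rightarrow> 'a measure) \<Rightarrow> (real \<Rightarrow> 'a \<Rightarrow> real) \<Rightarrow> real \<Rightarrow> real \<Rightarrow>
     tempered \<Rightarrow> tempered \<Rightarrow> (real \<Rightarrow> 'a \<Rightarrow> tempered) \<Rightarrow> (real \<Rightarrow> 'a \<Rightarrow> tempered) \<Rightarrow> bool"
where
  "cauchy_solution M F B \<sigma> T \<phi>0 \<phi>1 U V \<longleftrightarrow>
     adapted_process F T U \<and> adapted_process F T V \<and>
     (\<exists>(u :: real \<Rightarrow> 'a \<Rightarrow> real \<Rightarrow> complex) (v :: real \<Rightarrow> 'a \<Rightarrow> real \<Rightarrow> complex) a b.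
        has_fourier \<phi>0 a \<and> has_fourier \<phi>1 b \<and>
        (\<lambda>(t, \<omega>, \<xi>). u t \<omega> \<xi>) \<in> borel_measurable (restrict_space borel {0..T} \<Otimes>\<^sub>M M \<Otimes>\<^sub>M borel) \<and>
        (\<lambda>(t, \<omega>, \<xi>). v t \<omega> \<xi>) \<in> borel_measurable (restrict_space borel {0..T} \<Otimes>\<^sub>M M \<Otimes>\<^sub>M borel) \<and>
        (AE \<xi> in lborel.
           mode_solution M F B \<sigma> T \<xi> (a \<xi>) (b \<xi>) (\<lambda>t \<omega>. u t \<omega> \<xi>) (\<lambda>t \<omega>. v t \<omega> \<xi>)) \<and>
        (\<forall>t\<in>{0..T}. AE \<omega> in M. has_fourier (U t \<omega>) (u t \<omega>) \<and> has_fourier (V t \<omega>) (v t \<omega>)))"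

end

theory Submission
  imports Defs
begin

text \<open>
  For each frequency, \<open>exp (i \<sigma> \<xi> B)\<close> is an integrating factor which removes the noise: the
  mode becomes a linear system with random coefficients, solved path by path. This solution is
  only bounded by a quantity exponential in \<open>\<bar>\<xi>\<bar>\<close>, but its second moments solve a closed linear
  system in which the Gaussian decorrelation of the factor dominates, and
  \<open>E (\<bar>u\<bar>\<^sup>2 + \<bar>v\<bar>\<^sup>2) \<le> C (1 + \<xi>\<^sup>2) (\<bar>a\<bar>\<^sup>2 + \<bar>b\<bar>\<^sup>2)\<close>. A polynomial loss is harmless in \<open>H\<^sup>\<infinity>\<close>, so
  integration in \<open>\<xi>\<close> gives a process in every Sobolev space, with continuity in time by
  dominated convergence. Two solutions with square integrable modes agree mode by mode, by the
  Ito inequality and Gronwall's lemma; Plancherel supplies the square integrability for almost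
  every \<open>\<xi>\<close>.
\<close>

section \<open>Schwartz functions and the Fourier transform\<close>

text \<open>With the noise frozen, \<open>p' = cnj e v\<close>, \<open>v' = \<xi> e p\<close> gives
  \<open>p'' = \<xi> p\<close>, with growth exp (sqrt \<xi> t) for \<xi> > 0, so no estimate uniform
  in \<xi> can be pathwise.

  The noise enters through one fact: against a variable known at time s, exp (i l (B t - B s))
  averages to exp (- l^2 (t - s) / 2). It yields an exact Duhamel formula,
  \<open>exp_evolution\<close>, which does the work of Ito's formula twice. Tested against 1 it
  gives the moment system; tested against an arbitrary past variable it shows that the one-step
  residuals of the mode equation are martingale differences. Their second moments are of the order
  of the squared step, so their sum over a partition vanishes with the mesh, which identifies the
  Ito integral.

  Two features of the setting shape the rest. Completeness of the filtration is not assumed and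
  paths of B are continuous only almost surely, so the construction has to be adapted at every
  sample point. And an integrand is only almost surely square integrable in time, so second moments
  of Ito integrals are reached by truncation.\<close>

lemma schwartz_has_vector_derivative:
  assumes "schwartz \<phi>"
  shows "((vderiv ^^ n) \<phi> has_vector_derivative (vderiv ^^ Suc n) \<phi> x) (at x)"
  using assms vector_derivative_works[of "(vderiv ^^ n) \<phi>" "at x"]
  by (simp add: schwartz_def vderiv_def)

lemma schwartz_bound:
  assumes "schwartz \<phi>"
  shows "cmod (of_real (x ^ m) * (vderiv ^^ n) \<phi> x) \<le> schwartz_seminorm m n \<phi>"
proof -
  have "bounded (range (\<lambda>x. of_real (x ^ m) * (vderiv ^^ n) \<phi> x))"
    using assms by (simp add: schwartz_def)
  then have "bdd_above (range (\<lambda>x. cmod (of_real (x ^ m) * (vderiv ^^ n) \<phi> x)))"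
    by (auto simp: bounded_iff bdd_above_def)
  then show ?thesis
    unfolding schwartz_seminorm_def by (rule cSUP_upper[rotated]) simp
qed

text \<open>\<open>vderiv\<close> picks a derivative pointwise, so its iterates are awkward to
  compute directly. Exhibiting the whole sequence of derivatives, with bounds, identifies them by
  induction; the closure properties of Schwartz functions below are proved by writing down such a
  sequence.\<close>

lemma schwartzI_derivs:
  assumes D: "\<And>n x. (D n has_vector_derivative D (Suc n) x) (at x)"
    and bdd: "\<And>m n. \<exists>C. \<forall>x. cmod (of_real (x ^ m) * D n x) \<le> C"
  shows "schwartz (D 0)" and "(vderiv ^^ n) (D 0) = D n"
proof -
  have eq: "(vderiv ^^ n) (D 0) = D n" for n
  proof (induction n)
    case (Suc n)
    then show ?case
      using vector_derivative_at[OF D, of n] by (simp add: vderiv_def)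
  qed simp
  show "(vderiv ^^ n) (D 0) = D n"
    by (rule eq)
  show "schwartz (D 0)"
    unfolding schwartz_def
  proof (intro conjI allI)
    fix n x
    show "(vderiv ^^ n) (D 0) differentiable (at x)"
      unfolding eq using D differentiableI_vector by blast
  next
    fix m n
    show "bounded (range (\<lambda>x. of_real (x ^ m) * (vderiv ^^ n) (D 0) x))"
      unfolding eq bounded_iff using bdd[of m n] by auto
  qed
qed

lemma schwartz_add:
  assumes "schwartz \<phi>" "schwartz \<psi>"
  shows "schwartz (\<lambda>x. \<phi> x + \<psi> x)"
proof -
  let ?D = "\<lambda>n x. (vderiv ^^ n) \<phi> x + (vderiv ^^ n) \<psi> x"
  have "schwartz (?D 0)"
  proof (rule schwartzI_derivs(1))
    show "(?D n has_vector_derivative ?D (Suc n) x) (at x)" for n x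
      by (intro has_vector_derivative_add schwartz_has_vector_derivative assms)
    have "cmod (of_real (x ^ m) * ?D n x) \<le> schwartz_seminorm m n \<phi> + schwartz_seminorm m n \<psi>" for m n x
      using norm_triangle_mono[OF schwartz_bound[OF assms(1)] schwartz_bound[OF assms(2)]]
      by (simp add: algebra_simps)
    then show "\<exists>C. \<forall>x. cmod (of_real (x ^ m) * ?D n x) \<le> C" for m n
      by blast
  qed
  then show ?thesis by simp
qed

lemma schwartz_cmult:
  assumes "schwartz \<phi>"
  shows "schwartz (\<lambda>x. c * \<phi> x)"
proof -
  let ?D = "\<lambda>n x. c * (vderiv ^^ n) \<phi> x"
  have "schwartz (?D 0)"
  proof (rule schwartzI_derivs(1))
    show "(?D n has_vector_derivative ?D (Suc n) x) (at x)" for n x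
      by (intro has_vector_derivative_mult_right schwartz_has_vector_derivative assms)
    have "cmod (of_real (x ^ m) * ?D n x) \<le> cmod c * schwartz_seminorm m n \<phi>" for m n x
      using mult_left_mono[OF schwartz_bound[OF assms, of x m n], of "cmod c"]
      by (simp add: norm_mult algebra_simps)
    then show "\<exists>C. \<forall>x. cmod (of_real (x ^ m) * ?D n x) \<le> C" for m n
      by blast
  qed
  then show ?thesis by simp
qed

lemma schwartz_vderiv:
  assumes "schwartz \<phi>"
  shows "schwartz (vderiv \<phi>)"
proof -
  let ?D = "\<lambda>n. (vderiv ^^ Suc n) \<phi>"
  have 1: "(?D n has_vector_derivative ?D (Suc n) x) (at x)" for n x
    by (rule schwartz_has_vector_derivative[OF assms])
  have 2: "\<exists>C. \<forall>x. cmod (of_real (x ^ m) * ?D n x) \<le> C" for m n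
    using schwartz_bound[OF assms, of _ m "Suc n"] by blast
  show ?thesis
    using schwartzI_derivs(1)[of ?D, OF 1 2] by simp
qed

lemma schwartz_mult_x:
  assumes "schwartz \<phi>"
  shows "schwartz (\<lambda>x. of_real x * \<phi> x)"
proof -
  \<comment> \<open>Leibniz rule. For n = 0 the truncated index \<open>n - 1\<close> is harmless
    because of the factor n.\<close>
  let ?D = "\<lambda>n x. of_real x * (vderiv ^^ n) \<phi> x + of_nat n * (vderiv ^^ (n - 1)) \<phi> x"
  have "schwartz (?D 0)"
  proof (rule schwartzI_derivs(1))
    show "(?D n has_vector_derivative ?D (Suc n) x) (at x)" for n x
    proof -
      have "(?D n has_vector_derivative
          (of_real x * (vderiv ^^ Suc n) \<phi> x + of_real 1 * (vderiv ^^ n) \<phi> x) + of_nat n * (vderiv ^^ n) \<phi> x) (at x)"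
      proof (rule has_vector_derivative_add)
        have "(of_real has_vector_derivative (of_real 1 :: complex)) (at x)"
          using has_vector_derivative_of_real[OF DERIV_ident] .
        then show "((\<lambda>x. of_real x * (vderiv ^^ n) \<phi> x) has_vector_derivative
            of_real x * (vderiv ^^ Suc n) \<phi> x + of_real 1 * (vderiv ^^ n) \<phi> x) (at x)"
          by (rule has_vector_derivative_mult[OF _ schwartz_has_vector_derivative[OF assms]])
        show "((\<lambda>a. of_nat n * (vderiv ^^ (n - 1)) \<phi> a) has_vector_derivative of_nat n * (vderiv ^^ n) \<phi> x) (at x)"
          using schwartz_has_vector_derivative[OF assms, of "n - 1" x]
          by (cases n) (auto intro!: has_vector_derivative_mult_right)
      qed
      then show ?thesis
        by (simp add: algebra_simps)
    qed
    have "cmod (of_real (x ^ m) * ?D n x) \<le>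
        schwartz_seminorm (Suc m) n \<phi> + of_nat n * schwartz_seminorm m (n - 1) \<phi>" for m n x
    proof -
      have "of_real (x ^ m) * ?D n x = of_real (x ^ Suc m) * (vderiv ^^ n) \<phi> x
          + of_nat n * (of_real (x ^ m) * (vderiv ^^ (n - 1)) \<phi> x)"
        by (simp add: algebra_simps)
      also have "cmod \<dots> \<le> schwartz_seminorm (Suc m) n \<phi> + of_nat n * schwartz_seminorm m (n - 1) \<phi>"
        using mult_left_mono[OF schwartz_bound[OF assms, of x m "n - 1"], of "of_nat n"]
        by (intro norm_triangle_mono schwartz_bound[OF assms]) (simp add: norm_mult)
      finally show ?thesis .
    qed
    then show "\<exists>C. \<forall>x. cmod (of_real (x ^ m) * ?D n x) \<le> C" for m n
      by blast
  qed
  then show ?thesis by simp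
qed

lemma schwartz_reflect:
  assumes "schwartz \<phi>"
  shows "schwartz (\<lambda>x. \<phi> (- x))"
proof -
  let ?D = "\<lambda>n x. (-1) ^ n * (vderiv ^^ n) \<phi> (- x)"
  have "schwartz (?D 0)"
  proof (rule schwartzI_derivs(1))
    show "(?D n has_vector_derivative ?D (Suc n) x) (at x)" for n x
    proof -
      have "((vderiv ^^ n) \<phi> \<circ> uminus has_vector_derivative (-1) *\<^sub>R (vderiv ^^ Suc n) \<phi> (- x)) (at x)"
        by (intro vector_diff_chain_at schwartz_has_vector_derivative assms)
          (auto intro!: derivative_eq_intros)
      from has_vector_derivative_mult_right[OF this, of "(-1) ^ n"] show ?thesis
        by (simp add: o_def)
    qed
    have "cmod (of_real (x ^ m) * ?D n x) \<le> schwartz_seminorm m n \<phi>" for m n x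
      using schwartz_bound[OF assms, of "- x" m n] by (simp add: norm_mult norm_power)
    then show "\<exists>C. \<forall>x. cmod (of_real (x ^ m) * ?D n x) \<le> C" for m n
      by blast
  qed
  then show ?thesis by simp
qed

lemma schwartz_continuous:
  assumes "schwartz \<phi>"
  shows "continuous_on A \<phi>"
  using schwartz_has_vector_derivative[OF assms, of 0]
  by (auto intro!: continuous_at_imp_continuous_on has_vector_derivative_continuous)

lemma schwartz_borel [measurable_dest]:
  assumes "schwartz \<phi>"
  shows "\<phi> \<in> borel_measurable borel"
  by (rule borel_measurable_continuous_onI[OF schwartz_continuous[OF assms]])

section \<open>Integrability and the Fourier transform on Schwartz functions\<close>

lemma has_bochner_integral_cauchy:
  "has_bochner_integral lborel (\<lambda>x::real. inverse (1 + x\<^sup>2)) pi"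
  using integrable_inverse_1_plus_square LBINT_inverse_1_plus_square
  by (simp add: interval_lebesgue_integral_def set_integrable_def set_lebesgue_integral_def
      has_bochner_integral_iff)

lemma one_plus_square_pos: "0 < 1 + (x::real)\<^sup>2"
  by (simp add: add_pos_nonneg)

text \<open>The majorant 1 / (1 + x^2), of integral pi, costs only the seminorms with m = 0 and m =
  2; this is the origin of pi in the bounds for the transform.\<close>

lemma schwartz_decay:
  assumes "schwartz \<phi>"
  shows "cmod (\<phi> x) \<le> (schwartz_seminorm 0 0 \<phi> + schwartz_seminorm 2 0 \<phi>) * inverse (1 + x\<^sup>2)"
proof -
  have "cmod (\<phi> x) * (1 + x\<^sup>2) \<le> schwartz_seminorm 0 0 \<phi> + schwartz_seminorm 2 0 \<phi>"
    using schwartz_bound[OF assms, of x 0 0] schwartz_bound[OF assms, of x 2 0]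
    by (simp add: norm_mult norm_power algebra_simps)
  then show ?thesis
    using one_plus_square_pos[of x] by (simp add: field_simps)
qed

lemma schwartz_integrable:
  assumes "schwartz \<phi>"
  shows "integrable lborel \<phi>"
proof (rule Bochner_Integration.integrable_bound)
  show "integrable lborel (\<lambda>x. (schwartz_seminorm 0 0 \<phi> + schwartz_seminorm 2 0 \<phi>) * inverse (1 + x\<^sup>2))"
    using has_bochner_integral_cauchy by (auto simp: has_bochner_integral_iff)
  show "\<phi> \<in> borel_measurable lborel"
    using schwartz_borel[OF assms] by simp
  show "AE x in lborel. cmod (\<phi> x) \<le> norm ((schwartz_seminorm 0 0 \<phi> + schwartz_seminorm 2 0 \<phi>) * inverse (1 + x\<^sup>2))"
    using schwartz_decay[OF assms] by (auto intro: order_trans[OF _ abs_ge_self])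
qed

lemma schwartz_integral_bound:
  assumes "schwartz \<phi>"
  shows "(LINT x|lborel. cmod (\<phi> x)) \<le> pi * (schwartz_seminorm 0 0 \<phi> + schwartz_seminorm 2 0 \<phi>)"
proof -
  have "(LINT x|lborel. cmod (\<phi> x))
      \<le> (LINT x|lborel. (schwartz_seminorm 0 0 \<phi> + schwartz_seminorm 2 0 \<phi>) * inverse (1 + x\<^sup>2))"
    using schwartz_integrable[OF assms] schwartz_decay[OF assms] has_bochner_integral_cauchy
    by (intro integral_mono integrable_norm) (auto simp: has_bochner_integral_iff)
  also have "\<dots> = pi * (schwartz_seminorm 0 0 \<phi> + schwartz_seminorm 2 0 \<phi>)"
    using has_bochner_integral_cauchy by (simp add: has_bochner_integral_iff)
  finally show ?thesis .
qed

lemma cmod_exp_imag [simp]: "cmod (exp (- \<i> * of_real t)) = 1"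
  using norm_exp_i_times[of "- t"] by simp

lemma fourier_integrable:
  assumes "schwartz \<phi>"
  shows "integrable lborel (\<lambda>x. exp (- \<i> * of_real (x * \<xi>)) * \<phi> x)"
  by (rule Bochner_Integration.integrable_bound[OF schwartz_integrable[OF assms]])
    (use schwartz_borel[OF assms] in \<open>auto simp: norm_mult\<close>)

lemma fourier_bound:
  assumes "schwartz \<phi>"
  shows "cmod (fourier \<phi> \<xi>) \<le> pi * (schwartz_seminorm 0 0 \<phi> + schwartz_seminorm 2 0 \<phi>)"
proof -
  have "cmod (fourier \<phi> \<xi>) \<le> (LINT x|lborel. cmod (exp (- \<i> * of_real (x * \<xi>)) * \<phi> x))"
    unfolding fourier_def by (rule integral_norm_bound)
  also have "\<dots> = (LINT x|lborel. cmod (\<phi> x))"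
    by (simp add: norm_mult)
  finally show ?thesis
    using schwartz_integral_bound[OF assms] by linarith
qed

text \<open>A Taylor remainder of order h^2 with a constant independent of h gives the derivative at
  once; for the Fourier integral such a remainder is obtained under the integral sign, without
  exchanging limits.\<close>

lemma has_vector_derivative_quadratic_bound:
  fixes f :: "real \<Rightarrow> complex"
  assumes "\<And>h. cmod (f (x + h) - f x - of_real h * d) \<le> C * h\<^sup>2"
  shows "(f has_vector_derivative d) (at x)"
proof -
  have "((\<lambda>y. (f y - f x - (y - x) *\<^sub>R d) /\<^sub>R norm (y - x)) \<longlongrightarrow> 0) (at x)"
  proof (rule Lim_null_comparison)
    show "\<forall>\<^sub>F y in at x. norm ((f y - f x - (y - x) *\<^sub>R d) /\<^sub>R norm (y - x)) \<le> C * \<bar>y - x\<bar>"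
    proof (rule eventually_at_filter[THEN iffD2], rule always_eventually, intro allI impI)
      fix y :: real assume "y \<noteq> x"
      then show "norm ((f y - f x - (y - x) *\<^sub>R d) /\<^sub>R norm (y - x)) \<le> C * \<bar>y - x\<bar>"
        using assms[of "y - x"]
        by (simp add: scaleR_conv_of_real power2_eq_square norm_mult norm_divide divide_simps)
    qed
    show "((\<lambda>y. C * \<bar>y - x\<bar>) \<longlongrightarrow> 0) (at x)"
      by (auto intro!: tendsto_eq_intros)
  qed
  then show ?thesis
    by (simp add: has_vector_derivative_def has_derivative_at_within bounded_linear_scaleR_left)
qed

lemma cmod_exp_minus_linear: "cmod (exp (\<i> * of_real x) - 1 - \<i> * of_real x) \<le> x\<^sup>2 / 2"
  using iexp_approx1[of x 1] by (simp add: power2_eq_square diff_diff_eq)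

text \<open>The second order remainder of exp (- i x h) is at most (x h)^2 / 2, so the constant is
  half the integral of x^2 |\<phi> x|, finite because x^2 \<phi> is again Schwartz.\<close>

lemma fourier_has_vector_derivative:
  assumes "schwartz \<phi>"
  shows "(fourier \<phi> has_vector_derivative fourier (\<lambda>x. - \<i> * (of_real x * \<phi> x)) \<xi>) (at \<xi>)"
proof (rule has_vector_derivative_quadratic_bound)
  fix h :: real
  let ?\<psi> = "\<lambda>x. - \<i> * (of_real x * \<phi> x)"
  let ?e = "\<lambda>\<xi> x. exp (- \<i> * of_real (x * \<xi>))"
  have sx: "schwartz (\<lambda>x. of_real x * \<phi> x)" and s\<psi>: "schwartz ?\<psi>"
    by (intro schwartz_cmult schwartz_mult_x assms)+
  have sxx: "schwartz (\<lambda>x. of_real x * (of_real x * \<phi> x))"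
    by (intro schwartz_mult_x assms)
  have lin: "(LINT x|lborel. f x) - (LINT x|lborel. g x) - c * (LINT x|lborel. k x)
      = (LINT x|lborel. f x - g x - c * k x)"
    if "integrable lborel f" "integrable lborel g" "integrable lborel k"
    for f g k :: "real \<Rightarrow> complex" and c
    using that by simp
  note int = fourier_integrable[OF assms, of "\<xi> + h"] fourier_integrable[OF assms, of \<xi>]
    fourier_integrable[OF s\<psi>, of \<xi>]
  have eq: "fourier \<phi> (\<xi> + h) - fourier \<phi> \<xi> - of_real h * fourier ?\<psi> \<xi> =
      (LINT x|lborel. ?e (\<xi> + h) x * \<phi> x - ?e \<xi> x * \<phi> x - of_real h * (?e \<xi> x * ?\<psi> x))"
    unfolding fourier_def by (rule lin[OF int])
  have "cmod (fourier \<phi> (\<xi> + h) - fourier \<phi> \<xi> - of_real h * fourier ?\<psi> \<xi>)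
      \<le> (LINT x|lborel. cmod (?e (\<xi> + h) x * \<phi> x - ?e \<xi> x * \<phi> x - of_real h * (?e \<xi> x * ?\<psi> x)))"
    unfolding eq by (rule integral_norm_bound)
  also have "\<dots> \<le> (LINT x|lborel. h\<^sup>2 / 2 * cmod (of_real x * (of_real x * \<phi> x)))"
  proof (rule integral_mono)
    show "integrable lborel (\<lambda>x. cmod (?e (\<xi> + h) x * \<phi> x - ?e \<xi> x * \<phi> x - of_real h * (?e \<xi> x * ?\<psi> x)))"
      by (intro integrable_norm Bochner_Integration.integrable_diff integrable_mult_right int)
    show "integrable lborel (\<lambda>x. h\<^sup>2 / 2 * cmod (of_real x * (of_real x * \<phi> x)))"
      by (intro integrable_mult_right integrable_norm schwartz_integrable[OF sxx])
    fix x :: real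
    have "?e (\<xi> + h) x = ?e \<xi> x * exp (\<i> * of_real (- (x * h)))"
      by (simp add: algebra_simps flip: exp_add)
    moreover have "e * g * f - e * f - of_real h * (e * (- \<i> * (of_real x * f)))
       = e * (g - 1 - \<i> * of_real (- (x * h))) * f" for e f g :: complex
      by (simp add: algebra_simps)
    ultimately have "?e (\<xi> + h) x * \<phi> x - ?e \<xi> x * \<phi> x - of_real h * (?e \<xi> x * ?\<psi> x)
       = ?e \<xi> x * (exp (\<i> * of_real (- (x * h))) - 1 - \<i> * of_real (- (x * h))) * \<phi> x"
      by (simp only:)
    then have "cmod (?e (\<xi> + h) x * \<phi> x - ?e \<xi> x * \<phi> x - of_real h * (?e \<xi> x * ?\<psi> x))
       = cmod (exp (\<i> * of_real (- (x * h))) - 1 - \<i> * of_real (- (x * h))) * cmod (\<phi> x)"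
      by (simp only: norm_mult cmod_exp_imag mult_1)
    also have "\<dots> \<le> (- (x * h))\<^sup>2 / 2 * cmod (\<phi> x)"
      by (intro mult_right_mono cmod_exp_minus_linear norm_ge_zero)
    also have "\<dots> = h\<^sup>2 / 2 * cmod (of_real x * (of_real x * \<phi> x))"
      by (simp add: norm_mult power2_eq_square)
    finally show "cmod (?e (\<xi> + h) x * \<phi> x - ?e \<xi> x * \<phi> x - of_real h * (?e \<xi> x * ?\<psi> x))
        \<le> h\<^sup>2 / 2 * cmod (of_real x * (of_real x * \<phi> x))" .
  qed
  also have "\<dots> = (LINT x|lborel. cmod (of_real x * (of_real x * \<phi> x))) / 2 * h\<^sup>2"
    by (simp only: integral_mult_right_zero) simp
  finally show "cmod (fourier \<phi> (\<xi> + h) - fourier \<phi> \<xi> - of_real h * fourier ?\<psi> \<xi>)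
     \<le> (LINT x|lborel. cmod (of_real x * (of_real x * \<phi> x))) / 2 * h\<^sup>2" .
qed

text \<open>The filter is characterised by x^2 tending to infinity so that one proof serves both
  ends of the line.\<close>

lemma schwartz_tendsto_0:
  assumes "schwartz \<phi>" and F: "filterlim (\<lambda>x. x\<^sup>2) at_top F"
  shows "(\<phi> \<longlongrightarrow> 0) F"
proof (rule Lim_null_comparison)
  show "\<forall>\<^sub>F x in F. cmod (\<phi> x) \<le> (schwartz_seminorm 0 0 \<phi> + schwartz_seminorm 2 0 \<phi>) * inverse (1 + x\<^sup>2)"
    using schwartz_decay[OF assms(1)] by auto
  have "filterlim (\<lambda>x. 1 + x\<^sup>2) at_top F"
    by (intro filterlim_tendsto_add_at_top[OF tendsto_const] F)
  then show "((\<lambda>x. (schwartz_seminorm 0 0 \<phi> + schwartz_seminorm 2 0 \<phi>) * inverse (1 + x\<^sup>2)) \<longlongrightarrow> 0) F"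
    by (intro tendsto_mult_right_zero tendsto_inverse_0_at_top)
qed

text \<open>Integration by parts: the derivative of exp (- i x \<xi>) \<phi> x has integral 0
  because that product vanishes at both ends.\<close>

lemma fourier_vderiv:
  assumes "schwartz \<phi>"
  shows "of_real \<xi> * fourier \<phi> \<xi> = - \<i> * fourier (vderiv \<phi>) \<xi>"
proof -
  let ?e = "\<lambda>x. exp (- \<i> * of_real (x * \<xi>))"
  let ?f = "\<lambda>x. ?e x * \<phi> x" and ?f' = "\<lambda>x. ?e x * vderiv \<phi> x - \<i> * of_real \<xi> * (?e x * \<phi> x)"
  note s' = schwartz_vderiv[OF assms]
  have int: "integrable lborel ?f'"
    using fourier_integrable[OF assms, of \<xi>] fourier_integrable[OF s', of \<xi>] by simp
  have deriv_e: "(?e has_vector_derivative - \<i> * of_real \<xi> * ?e x) (at x)" for x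
  proof -
    have "((\<lambda>z. exp (- \<i> * (z * of_real \<xi>))) has_field_derivative - \<i> * of_real \<xi> * ?e x) (at (of_real x))"
      by (auto intro!: derivative_eq_intros)
    from has_vector_derivative_real_field[OF this] show ?thesis
      by simp
  qed
  have deriv: "(?f has_vector_derivative ?f' x) (at x)" for x
  proof -
    have "(?f has_vector_derivative ?e x * vderiv \<phi> x + - \<i> * of_real \<xi> * ?e x * \<phi> x) (at x)"
      using has_vector_derivative_mult[OF deriv_e schwartz_has_vector_derivative[OF assms, of 0]]
      by simp
    moreover have "e * g + - \<i> * of_real \<xi> * e * h = e * g - \<i> * of_real \<xi> * (e * h)" for e g h :: complex
      by simp
    ultimately show ?thesis
      by (simp only:)
  qed
  have lim: "(?f \<longlongrightarrow> 0) F" if "filterlim (\<lambda>x. x\<^sup>2) at_top F" for F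
    using schwartz_tendsto_0[OF assms that] by (subst tendsto_norm_zero_iff[symmetric]) (simp add: norm_mult tendsto_norm_zero_iff)
  have "(LBINT x=-\<infinity>..\<infinity>. ?f' x) = 0 - 0"
  proof (rule interval_integral_FTC_integrable)
    show "isCont ?f' x" for x
    proof -
      have "isCont (vderiv \<phi>) x" "isCont \<phi> x"
        using schwartz_continuous[OF s', of UNIV] schwartz_continuous[OF assms, of UNIV]
        by (simp_all add: continuous_on_eq_continuous_at)
      then show ?thesis
        by (intro continuous_intros)
    qed
    show "set_integrable lborel (einterval (- \<infinity>) \<infinity>) ?f'"
      using int by (simp add: set_integrable_def)
    show "((?f \<circ> real_of_ereal) \<longlongrightarrow> 0) (at_right (- \<infinity>))"
      using lim[OF filterlim_pow_at_bot_even[OF _ filterlim_ident]] by (simp add: ereal_tendsto_simps)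
    show "((?f \<circ> real_of_ereal) \<longlongrightarrow> 0) (at_left \<infinity>)"
      using lim[OF filterlim_pow_at_top[OF _ filterlim_ident]] by (simp add: ereal_tendsto_simps)
  qed (use deriv in auto)
  then have "(LINT x|lborel. ?f' x) = 0"
    by (simp add: interval_lebesgue_integral_def set_lebesgue_integral_def)
  then have "fourier (vderiv \<phi>) \<xi> = \<i> * of_real \<xi> * fourier \<phi> \<xi>"
    using fourier_integrable[OF assms, of \<xi>] fourier_integrable[OF s', of \<xi>]
    by (simp add: fourier_def)
  moreover have "- \<i> * (\<i> * z) = z" for z
    by (simp flip: mult.assoc)
  ultimately show ?thesis
    by (simp only: mult.assoc)
qed

text \<open>The n-th derivative of the transform is the transform of (- i x)^n \<phi>, while a power
  of \<xi> is traded for a derivative of the function by \<open>fourier_vderiv\<close>. Each such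
  step changes the function, hence the induction over m with \<psi> arbitrary; it ends at the
  boundedness of a transform.\<close>

lemma schwartz_fourier:
  assumes "schwartz \<phi>"
  shows "schwartz (fourier \<phi>)"
proof -
  define d where "d n = ((\<lambda>f x. - \<i> * (of_real x * f x)) ^^ n) \<phi>" for n
  have dSuc: "d (Suc n) = (\<lambda>x. - \<i> * (of_real x * d n x))" for n
    by (simp add: d_def)
  have sd: "schwartz (d n)" for n
  proof (induction n)
    case (Suc n)
    show ?case
      unfolding dSuc by (intro schwartz_cmult schwartz_mult_x Suc)
  qed (simp add: d_def assms)
  have bdd: "\<exists>C. \<forall>x. cmod (of_real (x ^ m) * fourier \<psi> x) \<le> C" if "schwartz \<psi>" for m \<psi>
    using that
  proof (induction m arbitrary: \<psi>)
    case 0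
    then show ?case
      using fourier_bound[OF 0] by (intro exI[of _ "pi * (schwartz_seminorm 0 0 \<psi> + schwartz_seminorm 2 0 \<psi>)"]) simp
  next
    case (Suc m)
    have "of_real (x ^ Suc m) * fourier \<psi> x = - \<i> * (of_real (x ^ m) * fourier (vderiv \<psi>) x)" for x
      using arg_cong[OF fourier_vderiv[OF Suc.prems, of x], of "\<lambda>z. of_real (x ^ m) * z"]
      by (simp only: power_Suc of_real_mult mult.assoc mult.left_commute)
    then have "cmod (of_real (x ^ Suc m) * fourier \<psi> x) = cmod (of_real (x ^ m) * fourier (vderiv \<psi>) x)" for x
      by (simp only: norm_mult norm_minus_cancel norm_ii mult_1)
    then show ?case
      using Suc.IH[OF schwartz_vderiv[OF Suc.prems]] by (simp only:)
  qed
  have deriv: "(fourier (d n) has_vector_derivative fourier (d (Suc n)) x) (at x)" for n x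
    unfolding dSuc by (rule fourier_has_vector_derivative[OF sd])
  have d0: "d 0 = \<phi>"
    by (simp add: d_def)
  have "schwartz (fourier (d 0))"
    by (rule schwartzI_derivs(1)[of "\<lambda>n. fourier (d n)", OF deriv bdd[OF sd]])
  then show ?thesis
    unfolding d0 .
qed

text \<open>The bound uses a single sum of seminorms of \<phi>, the shape that continuity of a
  tempered distribution demands; it is applied to \<open>tempered_functional\<close>.\<close>

lemma fourier_decay:
  assumes "schwartz \<phi>"
  shows "cmod (fourier \<phi> \<xi>) \<le> pi * (\<Sum>m\<le>2. \<Sum>n\<le>2. schwartz_seminorm m n \<phi>) * inverse (1 + \<xi>\<^sup>2)"
proof -
  note s1 = schwartz_vderiv[OF assms]
  note s2 = schwartz_vderiv[OF s1]
  have "of_real \<xi> * (of_real \<xi> * fourier \<phi> \<xi>) = - fourier (vderiv (vderiv \<phi>)) \<xi>"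
    unfolding fourier_vderiv[OF assms] mult.left_commute[of "of_real \<xi>"] fourier_vderiv[OF s1]
    by (simp flip: mult.assoc)
  then have "cmod (of_real \<xi> * (of_real \<xi> * fourier \<phi> \<xi>)) = cmod (fourier (vderiv (vderiv \<phi>)) \<xi>)"
    by simp
  also have "\<dots> \<le> pi * (schwartz_seminorm 0 2 \<phi> + schwartz_seminorm 2 2 \<phi>)"
    using fourier_bound[OF s2, of \<xi>]
    by (simp add: schwartz_seminorm_def numeral_2_eq_2)
  finally have "cmod (fourier \<phi> \<xi>) * (1 + \<xi>\<^sup>2) \<le>
     pi * (schwartz_seminorm 0 0 \<phi> + schwartz_seminorm 2 0 \<phi> + (schwartz_seminorm 0 2 \<phi> + schwartz_seminorm 2 2 \<phi>))"
    using fourier_bound[OF assms, of \<xi>]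
    by (simp add: norm_mult norm_power power2_eq_square algebra_simps)
  also have "\<dots> \<le> pi * (\<Sum>m\<le>2. \<Sum>n\<le>2. schwartz_seminorm m n \<phi>)"
  proof (rule mult_left_mono)
    have "(\<Sum>m\<le>2. \<Sum>n\<le>2. schwartz_seminorm m n \<phi>) =
      schwartz_seminorm 0 0 \<phi> + schwartz_seminorm 0 1 \<phi> + schwartz_seminorm 0 2 \<phi> +
      (schwartz_seminorm 1 0 \<phi> + schwartz_seminorm 1 1 \<phi> + schwartz_seminorm 1 2 \<phi>) +
      (schwartz_seminorm 2 0 \<phi> + schwartz_seminorm 2 1 \<phi> + schwartz_seminorm 2 2 \<phi>)"
      by (simp add: numeral_2_eq_2)
    then show "schwartz_seminorm 0 0 \<phi> + schwartz_seminorm 2 0 \<phi> + (schwartz_seminorm 0 2 \<phi> + schwartz_seminorm 2 2 \<phi>)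
        \<le> (\<Sum>m\<le>2. \<Sum>n\<le>2. schwartz_seminorm m n \<phi>)"
      using schwartz_seminorm_nonneg[OF assms, of 0 1] schwartz_seminorm_nonneg[OF assms, of 1 0]
        schwartz_seminorm_nonneg[OF assms, of 1 1] schwartz_seminorm_nonneg[OF assms, of 1 2]
        schwartz_seminorm_nonneg[OF assms, of 2 1]
      by linarith
  qed simp
  finally show ?thesis
    using one_plus_square_pos[of \<xi>] by (simp add: field_simps)
qed

section \<open>Fourier inversion by Gaussian regularisation\<close>

lemma gaussian_fourier:
  assumes "0 < (\<epsilon>::real)"
  shows "(LINT \<xi>|lborel. exp (\<i> * of_real (w * \<xi>)) * of_real (exp (- (\<epsilon> * \<xi>)\<^sup>2 / 2)))
    = of_real (sqrt (2 * pi) / \<epsilon> * exp (- (w / \<epsilon>)\<^sup>2 / 2))"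
proof -
  let ?G = "\<lambda>z. exp (- z\<^sup>2 / 2)"
  have "char std_normal_distribution (w / \<epsilon>) = of_real (?G (w / \<epsilon>))"
    by (simp add: char_std_normal_distribution)
  moreover have "char std_normal_distribution (w / \<epsilon>)
      = (LINT z|lborel. std_normal_density z *\<^sub>R iexp (w / \<epsilon> * z))"
    unfolding char_def by (subst integral_density) auto
  ultimately have "(LINT z|lborel. std_normal_density z *\<^sub>R iexp (w / \<epsilon> * z)) = of_real (?G (w / \<epsilon>))"
    by simp
  moreover have "(LINT z|lborel. std_normal_density z *\<^sub>R iexp (w / \<epsilon> * z))
      = \<bar>\<epsilon>\<bar> *\<^sub>R (LINT \<xi>|lborel. std_normal_density (0 + \<epsilon> * \<xi>) *\<^sub>R iexp (w / \<epsilon> * (0 + \<epsilon> * \<xi>)))"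
    using assms by (intro lborel_integral_real_affine) auto
  moreover have "(LINT \<xi>|lborel. std_normal_density (0 + \<epsilon> * \<xi>) *\<^sub>R iexp (w / \<epsilon> * (0 + \<epsilon> * \<xi>)))
      = (LINT \<xi>|lborel. of_real (1 / sqrt (2 * pi)) * (exp (\<i> * of_real (w * \<xi>)) * of_real (?G (\<epsilon> * \<xi>))))"
    using assms by (intro Bochner_Integration.integral_cong) (auto simp: std_normal_density_def scaleR_conv_of_real)
  ultimately have "of_real \<epsilon> * (of_real (1 / sqrt (2 * pi)) *
      (LINT \<xi>|lborel. exp (\<i> * of_real (w * \<xi>)) * of_real (?G (\<epsilon> * \<xi>)))) = complex_of_real (?G (w / \<epsilon>))"
    using assms by (simp only: integral_mult_right_zero scaleR_conv_of_real abs_of_pos)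
  then show ?thesis
    using assms by (simp add: field_simps)
qed

lemma integrable_gaussian:
  assumes "0 < (\<epsilon>::real)"
  shows "integrable lborel (\<lambda>\<xi>. exp (- (\<epsilon> * \<xi>)\<^sup>2 / 2))"
proof -
  have "integrable lborel (\<lambda>z. sqrt (2 * pi) * std_normal_density (0 + \<epsilon> * z))"
    using assms by (intro integrable_mult_right lborel_integrable_real_affine) auto
  then show ?thesis
    by (simp add: std_normal_density_def)
qed

lemma integrable_pair_mult:
  fixes f g :: "real \<Rightarrow> complex"
  assumes "integrable lborel f" "integrable lborel g"
  shows "integrable (lborel \<Otimes>\<^sub>M lborel) (\<lambda>(x, y). f x * g y)"
proof (rule lborel_pair.Fubini_integrable)
  show "(\<lambda>(x, y). f x * g y) \<in> borel_measurable (lborel \<Otimes>\<^sub>M lborel)"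
    using assms by measurable
qed (use assms in \<open>auto simp: norm_mult\<close>)

text \<open>The double integral behind inversion is not absolutely convergent; the Gaussian factor
  in \<xi> makes it so and Fubini applies. The inner integral is then a Gaussian kernel of width
  \<epsilon>, and the substitution y = - x + \<epsilon> z turns the whole into a mean of \<phi> near
  - x.\<close>

lemma fourier_gaussian_mean:
  assumes \<phi>: "schwartz \<phi>" and \<epsilon>: "0 < \<epsilon>"
  shows "(LINT \<xi>|lborel. exp (- \<i> * of_real (\<xi> * x)) * fourier \<phi> \<xi> * of_real (exp (- (\<epsilon> * \<xi>)\<^sup>2 / 2)))
    = of_real (2 * pi) * (LINT z|lborel. \<phi> (- x + \<epsilon> * z) * of_real (std_normal_density z))"
proof -
  let ?G = "\<lambda>z. exp (- z\<^sup>2 / 2)"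
  let ?f = "\<lambda>y \<xi>. exp (- \<i> * of_real (\<xi> * (x + y))) * (\<phi> y * of_real (?G (\<epsilon> * \<xi>)))"
  have [measurable]: "\<phi> \<in> borel_measurable borel"
    by (rule schwartz_borel[OF \<phi>])
  have intG: "integrable lborel (\<lambda>\<xi>. complex_of_real (?G (\<epsilon> * \<xi>)))"
    using integrable_gaussian[OF \<epsilon>] by (rule integrable_of_real)
  have int: "integrable (lborel \<Otimes>\<^sub>M lborel) (\<lambda>(y, \<xi>). ?f y \<xi>)"
  proof (rule Bochner_Integration.integrable_bound[OF integrable_pair_mult[OF schwartz_integrable[OF \<phi>] intG]])
    show "AE p in lborel \<Otimes>\<^sub>M lborel. cmod (case p of (y, \<xi>) \<Rightarrow> ?f y \<xi>)
        \<le> cmod (case p of (y, \<xi>) \<Rightarrow> \<phi> y * of_real (?G (\<epsilon> * \<xi>)))"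
      by (rule AE_I2) (simp only: norm_mult cmod_exp_imag split: prod.split, simp)
  qed measurable
  have "(LINT \<xi>|lborel. exp (- \<i> * of_real (\<xi> * x)) * fourier \<phi> \<xi> * of_real (?G (\<epsilon> * \<xi>)))
      = (LINT \<xi>|lborel. (LINT y|lborel. ?f y \<xi>))"
  proof (rule Bochner_Integration.integral_cong[OF refl])
    fix \<xi> :: real
    have "(LINT y|lborel. ?f y \<xi>) =
      (LINT y|lborel. (exp (- \<i> * of_real (\<xi> * x)) * of_real (?G (\<epsilon> * \<xi>))) * (exp (- \<i> * of_real (y * \<xi>)) * \<phi> y))"
    proof (rule Bochner_Integration.integral_cong[OF refl])
      fix y :: real
      have "exp (- \<i> * of_real (\<xi> * (x + y))) = exp (- \<i> * of_real (\<xi> * x)) * exp (- \<i> * of_real (y * \<xi>))"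
        by (simp add: algebra_simps flip: exp_add)
      then show "?f y \<xi> = (exp (- \<i> * of_real (\<xi> * x)) * of_real (?G (\<epsilon> * \<xi>))) * (exp (- \<i> * of_real (y * \<xi>)) * \<phi> y)"
        by (simp only: ac_simps)
    qed
    then show "exp (- \<i> * of_real (\<xi> * x)) * fourier \<phi> \<xi> * of_real (?G (\<epsilon> * \<xi>)) = (LINT y|lborel. ?f y \<xi>)"
      unfolding fourier_def by (simp only: integral_mult_right_zero) (simp only: ac_simps)
  qed
  moreover have "(LINT \<xi>|lborel. (LINT y|lborel. ?f y \<xi>)) = (LINT y|lborel. (LINT \<xi>|lborel. ?f y \<xi>))"
    using int by (rule lborel_pair.Fubini_integral)
  moreover have "(LINT y|lborel. (LINT \<xi>|lborel. ?f y \<xi>))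
      = (LINT y|lborel. of_real (sqrt (2 * pi) / \<epsilon>) * (\<phi> y * of_real (?G ((x + y) / \<epsilon>))))"
  proof (rule Bochner_Integration.integral_cong[OF refl])
    fix y :: real
    have "(LINT \<xi>|lborel. ?f y \<xi>)
       = (LINT \<xi>|lborel. \<phi> y * (exp (\<i> * of_real (- (x + y) * \<xi>)) * of_real (?G (\<epsilon> * \<xi>))))"
      by (rule Bochner_Integration.integral_cong[OF refl]) (simp add: algebra_simps)
    also have "\<dots> = \<phi> y * of_real (sqrt (2 * pi) / \<epsilon> * ?G (- (x + y) / \<epsilon>))"
      by (simp only: integral_mult_right_zero gaussian_fourier[OF \<epsilon>])
    finally show "(LINT \<xi>|lborel. ?f y \<xi>) = of_real (sqrt (2 * pi) / \<epsilon>) * (\<phi> y * of_real (?G ((x + y) / \<epsilon>)))"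
      by (simp add: power_divide power2_eq_square algebra_simps)
  qed
  moreover have "(LINT y|lborel. of_real (sqrt (2 * pi) / \<epsilon>) * (\<phi> y * of_real (?G ((x + y) / \<epsilon>))))
    = \<bar>\<epsilon>\<bar> *\<^sub>R (LINT z|lborel. of_real (sqrt (2 * pi) / \<epsilon>) * (\<phi> (- x + \<epsilon> * z) * of_real (?G ((x + (- x + \<epsilon> * z)) / \<epsilon>))))"
    using \<epsilon> by (intro lborel_integral_real_affine) auto
  moreover have "(LINT z|lborel. of_real (sqrt (2 * pi) / \<epsilon>) * (\<phi> (- x + \<epsilon> * z) * of_real (?G ((x + (- x + \<epsilon> * z)) / \<epsilon>))))
    = (LINT z|lborel. of_real (2 * pi / \<epsilon>) * (\<phi> (- x + \<epsilon> * z) * of_real (std_normal_density z)))"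
  proof (rule Bochner_Integration.integral_cong[OF refl])
    fix z :: real
    have "sqrt (2 * pi) * ?G z = 2 * pi * std_normal_density z"
      using real_sqrt_mult_self[of "2 * pi"] unfolding std_normal_density_def
      by (simp add: field_simps)
    then have "complex_of_real (sqrt (2 * pi) / \<epsilon>) * of_real (?G z) = of_real (2 * pi / \<epsilon>) * of_real (std_normal_density z)"
      by (simp only: of_real_mult[symmetric] times_divide_eq_left)
    then show "of_real (sqrt (2 * pi) / \<epsilon>) * (\<phi> (- x + \<epsilon> * z) * of_real (?G ((x + (- x + \<epsilon> * z)) / \<epsilon>)))
       = of_real (2 * pi / \<epsilon>) * (\<phi> (- x + \<epsilon> * z) * of_real (std_normal_density z))"
      using \<epsilon> by simp
  qed
  ultimately show ?thesis
    using \<epsilon> by (simp only: integral_mult_right_zero) (simp add: scaleR_conv_of_real)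
qed

text \<open>The limit of the regularised integrals \<open>L n\<close> is computed twice by dominated
  convergence: from the definition, with majorant |fourier \<phi>|, and from the mean value formula,
  with a multiple of the normal density as majorant.\<close>

lemma fourier_inversion:
  assumes \<phi>: "schwartz \<phi>"
  shows "fourier (fourier \<phi>) x = of_real (2 * pi) * \<phi> (- x)"
proof -
  let ?G = "\<lambda>z. exp (- z\<^sup>2 / 2)"
  define \<epsilon> where "\<epsilon> n = inverse (real (Suc n))" for n
  have \<epsilon>: "0 < \<epsilon> n" for n
    by (simp add: \<epsilon>_def)
  have \<epsilon>0: "\<epsilon> \<longlonglongrightarrow> 0"
    unfolding \<epsilon>_def by (rule LIMSEQ_inverse_real_of_nat)
  have [measurable]: "\<phi> \<in> borel_measurable borel" "fourier \<phi> \<in> borel_measurable borel"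
    using schwartz_borel \<phi> schwartz_fourier by auto
  define L where "L n = (LINT \<xi>|lborel. exp (- \<i> * of_real (\<xi> * x)) * fourier \<phi> \<xi> * of_real (?G (\<epsilon> n * \<xi>)))" for n
  have "L \<longlonglongrightarrow> fourier (fourier \<phi>) x"
    unfolding L_def fourier_def[of "fourier \<phi>"]
  proof (rule integral_dominated_convergence[where w = "\<lambda>\<xi>. cmod (fourier \<phi> \<xi>)"])
    show "integrable lborel (\<lambda>\<xi>. cmod (fourier \<phi> \<xi>))"
      by (intro integrable_norm schwartz_integrable schwartz_fourier \<phi>)
    show "AE \<xi> in lborel. (\<lambda>n. exp (- \<i> * of_real (\<xi> * x)) * fourier \<phi> \<xi> * of_real (?G (\<epsilon> n * \<xi>)))
        \<longlonglongrightarrow> exp (- \<i> * of_real (\<xi> * x)) * fourier \<phi> \<xi>"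
    proof (rule AE_I2)
      fix \<xi> :: real
      have "(\<lambda>n. complex_of_real (?G (\<epsilon> n * \<xi>))) \<longlonglongrightarrow> of_real (?G (0 * \<xi>))"
        by (intro tendsto_intros \<epsilon>0) auto
      from tendsto_mult[OF tendsto_const this]
      show "(\<lambda>n. exp (- \<i> * of_real (\<xi> * x)) * fourier \<phi> \<xi> * of_real (?G (\<epsilon> n * \<xi>)))
        \<longlonglongrightarrow> exp (- \<i> * of_real (\<xi> * x)) * fourier \<phi> \<xi>"
        by simp
    qed
    show "AE \<xi> in lborel. cmod (exp (- \<i> * of_real (\<xi> * x)) * fourier \<phi> \<xi> * of_real (?G (\<epsilon> n * \<xi>))) \<le> cmod (fourier \<phi> \<xi>)" for n
      by (rule AE_I2) (simp only: norm_mult cmod_exp_imag, simp add: mult_left_le)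
  qed measurable
  moreover have "L \<longlonglongrightarrow> of_real (2 * pi) * (LINT z|lborel. \<phi> (- x) * of_real (std_normal_density z))"
    unfolding L_def fourier_gaussian_mean[OF \<phi> \<epsilon>]
  proof (intro tendsto_mult[OF tendsto_const] integral_dominated_convergence)
    let ?w = "\<lambda>z. schwartz_seminorm 0 0 \<phi> * std_normal_density z"
    show "integrable lborel ?w"
      by simp
    have "isCont \<phi> (- x)"
      using schwartz_continuous[OF \<phi>, of UNIV] by (simp add: continuous_on_eq_continuous_at)
    then have "(\<lambda>n. \<phi> (- x + \<epsilon> n * z)) \<longlonglongrightarrow> \<phi> (- x)" for z
      by (rule isCont_tendsto_compose) (use tendsto_add[OF tendsto_const tendsto_mult[OF \<epsilon>0 tendsto_const], of "- x" z] in simp)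
    then show "AE z in lborel. (\<lambda>n. \<phi> (- x + \<epsilon> n * z) * of_real (std_normal_density z))
        \<longlonglongrightarrow> \<phi> (- x) * of_real (std_normal_density z)"
      by (intro AE_I2 tendsto_mult tendsto_const)
    show "AE z in lborel. cmod (\<phi> (- x + \<epsilon> n * z) * of_real (std_normal_density z)) \<le> ?w z" for n
      using schwartz_bound[OF \<phi>, of _ 0 0] by (intro AE_I2) (simp add: norm_mult mult_right_mono)
  qed measurable
  moreover have "(LINT z|lborel. \<phi> (- x) * of_real (std_normal_density z)) = \<phi> (- x)"
    using integral_normal_density[of 1 0] by (simp del: integral_normal_density)
  ultimately show ?thesis
    using LIMSEQ_unique by fastforce
qed

text \<open>\<open>has_fourier\<close> only tests a distribution on transforms of Schwartz
  functions; surjectivity turns this into a test on all Schwartz functions.\<close>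

lemma fourier_surj:
  assumes "schwartz \<psi>"
  obtains \<phi> where "schwartz \<phi>" "fourier \<phi> = \<psi>"
proof
  let ?\<phi> = "\<lambda>x. of_real (1 / (2 * pi)) * fourier \<psi> (- x)"
  show "schwartz ?\<phi>"
    by (intro schwartz_cmult schwartz_reflect schwartz_fourier assms)
  show "fourier ?\<phi> = \<psi>"
  proof
    fix x
    have "fourier ?\<phi> x = of_real (1 / (2 * pi)) * (LINT y|lborel. exp (- \<i> * of_real (y * x)) * fourier \<psi> (- y))"
      unfolding fourier_def[of ?\<phi>] by (simp only: mult.left_commute[of _ "of_real (1 / (2 * pi))"] integral_mult_right_zero)
    also have "(LINT y|lborel. exp (- \<i> * of_real (y * x)) * fourier \<psi> (- y))
        = \<bar>- 1\<bar> *\<^sub>R (LINT y|lborel. exp (- \<i> * of_real ((0 + - 1 * y) * x)) * fourier \<psi> (- (0 + - 1 * y)))"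
      by (rule lborel_integral_real_affine) simp
    also have "\<dots> = fourier (fourier \<psi>) (- x)"
      by (simp add: fourier_def)
    finally show "fourier ?\<phi> x = \<psi> x"
      using fourier_inversion[OF assms, of "- x"] by simp
  qed
qed

section \<open>Gaussian test functions and injectivity of the Fourier transform\<close>

lemma polynomial_gaussian_bounded:
  fixes q :: "complex poly"
  shows "\<exists>C. \<forall>x::real. \<bar>x\<bar> ^ m * cmod (poly q (of_real x)) * exp (- x\<^sup>2 / 2) \<le> C"
proof (induction q arbitrary: m)
  case 0
  then show ?case by auto
next
  case (pCons a q)
  \<comment> \<open>From |x| \<le> exp |x| the power is at most exp (m |x|), and completing the
    square bounds m |x| - x^2 / 2 by m^2 / 2.\<close>
  have 1: "\<bar>x\<bar> ^ m * exp (- x\<^sup>2 / 2) \<le> exp ((real m)\<^sup>2 / 2)" for x :: real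
  proof -
    have "\<bar>x\<bar> \<le> exp \<bar>x\<bar>"
      using exp_ge_add_one_self[of "\<bar>x\<bar>"] by linarith
    then have "\<bar>x\<bar> ^ m \<le> exp (m * \<bar>x\<bar>)"
      by (metis abs_ge_zero exp_of_nat_mult power_mono)
    then have "\<bar>x\<bar> ^ m * exp (- x\<^sup>2 / 2) \<le> exp (m * \<bar>x\<bar>) * exp (- x\<^sup>2 / 2)"
      by simp
    also have "\<dots> = exp (m * \<bar>x\<bar> - x\<^sup>2 / 2)"
      by (simp flip: exp_add)
    also have "\<dots> \<le> exp ((real m)\<^sup>2 / 2)"
      using zero_le_power2[of "real m - \<bar>x\<bar>"] by (simp add: power2_eq_square algebra_simps)
    finally show ?thesis .
  qed
  obtain C where C: "\<And>x::real. \<bar>x\<bar> ^ Suc m * cmod (poly q (of_real x)) * exp (- x\<^sup>2 / 2) \<le> C"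
    using pCons.IH by blast
  have "\<bar>x\<bar> ^ m * cmod (poly (pCons a q) (of_real x)) * exp (- x\<^sup>2 / 2)
      \<le> cmod a * exp ((real m)\<^sup>2 / 2) + C" for x :: real
  proof -
    have "cmod (poly (pCons a q) (of_real x)) \<le> cmod a + \<bar>x\<bar> * cmod (poly q (of_real x))"
      using norm_triangle_ineq[of a "of_real x * poly q (of_real x)"] by (simp add: norm_mult)
    then have "\<bar>x\<bar> ^ m * cmod (poly (pCons a q) (of_real x)) * exp (- x\<^sup>2 / 2)
       \<le> \<bar>x\<bar> ^ m * (cmod a + \<bar>x\<bar> * cmod (poly q (of_real x))) * exp (- x\<^sup>2 / 2)"
      by (intro mult_right_mono mult_left_mono) auto
    also have "\<dots> = cmod a * (\<bar>x\<bar> ^ m * exp (- x\<^sup>2 / 2)) + \<bar>x\<bar> ^ Suc m * cmod (poly q (of_real x)) * exp (- x\<^sup>2 / 2)"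
      by (simp add: algebra_simps)
    also have "\<dots> \<le> cmod a * exp ((real m)\<^sup>2 / 2) + C"
      by (intro add_mono mult_left_mono 1 C) auto
    finally show ?thesis .
  qed
  then show ?case by blast
qed

text \<open>Test functions that combine integrability with all characters: pairing with them reads
  off the Fourier integral of a function damped by a Gaussian. Derivatives stay of the form
  polynomial times \<open>E\<close>, and the recursion for \<open>q\<close> comes from the
  logarithmic derivative - z - i \<eta> of \<open>E\<close>.\<close>

lemma schwartz_gaussian_character:
  "schwartz (\<lambda>x. exp (- \<i> * of_real (x * \<eta>)) * of_real (exp (- x\<^sup>2 / 2)))"
proof -
  define E where "E z = exp (- z\<^sup>2 / 2 - \<i> * of_real \<eta> * z)" for z :: complex
  define q where "q n = ((\<lambda>p. pderiv p + [:- \<i> * of_real \<eta>, - 1:] * p) ^^ n) [:1:]" for n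
  define D where "D n x = poly (q n) (of_real x) * E (of_real x)" for n and x :: real
  have E: "E (of_real x) = exp (- \<i> * of_real (x * \<eta>)) * of_real (exp (- x\<^sup>2 / 2))" for x :: real
  proof -
    have "- (complex_of_real x)\<^sup>2 / 2 - \<i> * of_real \<eta> * of_real x
       = - \<i> * of_real (x * \<eta>) + of_real (- x\<^sup>2 / 2)"
      by simp
    then show ?thesis
      unfolding E_def by (simp only: exp_add exp_of_real)
  qed
  have "schwartz (D 0)"
  proof (rule schwartzI_derivs(1))
    fix n x
    have "((\<lambda>z. poly (q n) z * E z) has_field_derivative
       poly (pderiv (q n)) z * E z + (E z * (- z - \<i> * of_real \<eta>)) * poly (q n) z) (at z)" for z
      unfolding E_def
      by (rule DERIV_mult[OF poly_DERIV]) (auto intro!: derivative_eq_intros simp: field_simps)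
    then have "((\<lambda>z. poly (q n) z * E z) has_field_derivative poly (q (Suc n)) z * E z) (at z)" for z
      by (simp add: q_def algebra_simps)
    from has_vector_derivative_real_field[OF this]
    show "(D n has_vector_derivative D (Suc n) x) (at x)"
      unfolding D_def .
  next
    fix m n
    obtain C where "\<And>x::real. \<bar>x\<bar> ^ m * cmod (poly (q n) (of_real x)) * exp (- x\<^sup>2 / 2) \<le> C"
      using polynomial_gaussian_bounded by blast
    then have "cmod (of_real (x ^ m) * D n x) \<le> C" for x
      unfolding D_def E by (simp only: norm_mult cmod_exp_imag) (simp add: norm_power power_abs mult.assoc)
    then show "\<exists>C. \<forall>x. cmod (of_real (x ^ m) * D n x) \<le> C"
      by blast
  qed
  moreover have "D 0 = (\<lambda>x. exp (- \<i> * of_real (x * \<eta>)) * of_real (exp (- x\<^sup>2 / 2)))"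
    unfolding D_def E by (simp add: q_def)
  ultimately show ?thesis
    by simp
qed

text \<open>The positive and negative parts have the same mass c, by \<eta> = 0. Divided by c they
  are probability densities with equal characteristic functions, hence equal by Levy's uniqueness
  theorem. For c = 0, where one cannot normalise, both parts vanish anyway.\<close>

lemma AE_zero_of_fourier_zero_real:
  fixes f :: "real \<Rightarrow> real"
  assumes int: "integrable lborel f"
    and zero: "\<And>\<eta>. (LINT \<xi>|lborel. of_real (f \<xi>) * iexp (\<eta> * \<xi>)) = 0"
  shows "AE \<xi> in lborel. f \<xi> = 0"
proof -
  have [measurable]: "f \<in> borel_measurable borel"
    using int by auto
  define p n where "p = (\<lambda>x. max 0 (f x))" and "n = (\<lambda>x. max 0 (- f x))"
  have [measurable]: "p \<in> borel_measurable borel" "n \<in> borel_measurable borel"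
    by (auto simp: p_def n_def)
  have intp: "integrable lborel p" and intn: "integrable lborel n"
    unfolding p_def n_def using int by (auto intro: integrable_max)
  have f: "f x = p x - n x" for x
    by (auto simp: p_def n_def)
  have ints: "integrable lborel (\<lambda>\<xi>. complex_of_real (p \<xi>) * iexp (\<eta> * \<xi>))"
    "integrable lborel (\<lambda>\<xi>. complex_of_real (n \<xi>) * iexp (\<eta> * \<xi>))" for \<eta>
    by (rule Bochner_Integration.integrable_bound[OF intp], simp, simp add: norm_mult)
      (rule Bochner_Integration.integrable_bound[OF intn], simp, simp add: norm_mult)
  have eq: "(LINT \<xi>|lborel. of_real (p \<xi>) * iexp (\<eta> * \<xi>)) = (LINT \<xi>|lborel. of_real (n \<xi>) * iexp (\<eta> * \<xi>))" for \<eta>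
    using zero[of \<eta>] ints[of \<eta>] by (simp add: f left_diff_distrib)
  define c where "c = (LINT x|lborel. p x)"
  have cn: "c = (LINT x|lborel. n x)"
    using eq[of 0] intp intn by (simp add: c_def)
  have "0 \<le> c"
    by (simp add: c_def p_def)
  show ?thesis
  proof (cases "c = 0")
    case True
    have "AE x in lborel. p x = 0"
      using integral_nonneg_eq_0_iff_AE[OF intp] True by (simp add: c_def p_def)
    moreover have "AE x in lborel. n x = 0"
      using integral_nonneg_eq_0_iff_AE[OF intn] True cn by (simp add: n_def)
    ultimately show ?thesis
      by eventually_elim (simp add: f)
  next
    case False
    with \<open>0 \<le> c\<close> have c: "0 < c"
      by simp
    have prob: "real_distribution (density lborel (\<lambda>x. ennreal (h x / c)))"
      if "integrable lborel h" "\<And>x. 0 \<le> h x" "(LINT x|lborel. h x) = c" for h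
    proof -
      have "(\<integral>\<^sup>+x. ennreal (h x / c) \<partial>lborel) = ennreal (LINT x|lborel. h x / c)"
        using that c by (intro nn_integral_eq_integral) auto
      then have "emeasure (density lborel (\<lambda>x. ennreal (h x / c))) (space (density lborel (\<lambda>x. ennreal (h x / c)))) = 1"
        using that c borel_measurable_integrable[OF that(1)] by (subst emeasure_density) auto
      then show ?thesis
        by (auto simp: real_distribution_def real_distribution_axioms_def intro!: prob_spaceI)
    qed
    have char: "char (density lborel (\<lambda>x. ennreal (h x / c))) \<eta> = (LINT \<xi>|lborel. of_real (h \<xi>) * iexp (\<eta> * \<xi>)) / of_real c"
      if "h \<in> borel_measurable borel" "\<And>x. 0 \<le> h x" for h \<eta>
    proof -
      have "char (density lborel (\<lambda>x. ennreal (h x / c))) \<eta> = (LINT \<xi>|lborel. (h \<xi> / c) *\<^sub>R iexp (\<eta> * \<xi>))"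
        unfolding char_def using that c by (intro integral_density) auto
      also have "\<dots> = (LINT \<xi>|lborel. of_real (h \<xi>) * iexp (\<eta> * \<xi>) / of_real c)"
        by (rule Bochner_Integration.integral_cong) (simp_all add: scaleR_conv_of_real)
      finally show ?thesis
        by simp
    qed
    have "density lborel (\<lambda>x. ennreal (p x / c)) = density lborel (\<lambda>x. ennreal (n x / c))"
    proof (rule Levy_uniqueness)
      show "char (density lborel (\<lambda>x. ennreal (p x / c))) = char (density lborel (\<lambda>x. ennreal (n x / c)))"
        using eq by (simp add: fun_eq_iff char p_def n_def)
      show "real_distribution (density lborel (\<lambda>x. ennreal (p x / c)))"
        by (rule prob[OF intp]) (simp_all add: c_def p_def)
      show "real_distribution (density lborel (\<lambda>x. ennreal (n x / c)))"
        by (rule prob[OF intn]) (simp_all add: cn n_def)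
    qed
    then have "AE x in lborel. ennreal (p x / c) = ennreal (n x / c)"
      by (intro sigma_finite_measure.density_unique[OF lborel.sigma_finite_measure_axioms]) auto
    then show ?thesis
    proof eventually_elim
      case (elim x)
      then have "p x = n x"
        using c by (subst (asm) ennreal_inj) (auto simp: p_def n_def)
      then show ?case by (simp add: f)
    qed
  qed
qed

text \<open>Since the hypothesis holds for \<eta> and - \<eta>, it passes to the complex conjugate
  of f, and so to the real and imaginary parts.\<close>

lemma AE_zero_of_fourier_zero:
  fixes f :: "real \<Rightarrow> complex"
  assumes int: "integrable lborel f"
    and zero: "\<And>\<eta>. (LINT \<xi>|lborel. f \<xi> * iexp (\<eta> * \<xi>)) = 0"
  shows "AE \<xi> in lborel. f \<xi> = 0"
proof -
  have [measurable]: "f \<in> borel_measurable borel"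
    using int by auto
  have [measurable]: "(\<lambda>\<xi>. cnj (f \<xi>)) \<in> borel_measurable borel"
    by (rule borel_measurable_integrable[of lborel, simplified]) (simp only: complex_integrable_cnj int)
  have intf: "integrable lborel (\<lambda>\<xi>. f \<xi> * iexp (\<eta> * \<xi>))" for \<eta>
    by (rule Bochner_Integration.integrable_bound[OF int]) (auto simp: norm_mult)
  have intc: "integrable lborel (\<lambda>\<xi>. cnj (f \<xi>) * iexp (\<eta> * \<xi>))" for \<eta>
    by (rule Bochner_Integration.integrable_bound[OF int]) (auto simp: norm_mult)
  have zeroc: "(LINT \<xi>|lborel. cnj (f \<xi>) * iexp (\<eta> * \<xi>)) = 0" for \<eta>
  proof -
    have "(LINT \<xi>|lborel. cnj (f \<xi>) * iexp (\<eta> * \<xi>)) = (LINT \<xi>|lborel. cnj (f \<xi> * iexp (- \<eta> * \<xi>)))"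
      by (rule Bochner_Integration.integral_cong) (simp_all add: exp_cnj)
    also have "\<dots> = cnj (LINT \<xi>|lborel. f \<xi> * iexp (- \<eta> * \<xi>))"
      by (rule Bochner_Integration.integral_cnj)
    finally show ?thesis
      by (simp only: zero) simp
  qed
  have "AE \<xi> in lborel. Re (f \<xi>) = 0"
  proof (rule AE_zero_of_fourier_zero_real)
    fix \<eta> :: real
    have "(LINT \<xi>|lborel. of_real (Re (f \<xi>)) * iexp (\<eta> * \<xi>))
        = (LINT \<xi>|lborel. (f \<xi> * iexp (\<eta> * \<xi>) + cnj (f \<xi>) * iexp (\<eta> * \<xi>)) / 2)"
    proof (rule Bochner_Integration.integral_cong[OF refl])
      fix \<xi>
      have "of_real (Re (f \<xi>)) = (f \<xi> + cnj (f \<xi>)) / 2"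
        by (simp add: complex_add_cnj)
      then show "of_real (Re (f \<xi>)) * iexp (\<eta> * \<xi>) = (f \<xi> * iexp (\<eta> * \<xi>) + cnj (f \<xi>) * iexp (\<eta> * \<xi>)) / 2"
        by (simp only: distrib_right times_divide_eq_left add_divide_distrib)
    qed
    then show "(LINT \<xi>|lborel. of_real (Re (f \<xi>)) * iexp (\<eta> * \<xi>)) = 0"
      using intf[of \<eta>] intc[of \<eta>] by (simp only: integral_divide_zero Bochner_Integration.integral_add zero zeroc) simp
  qed (use int in simp)
  moreover have "AE \<xi> in lborel. Im (f \<xi>) = 0"
  proof (rule AE_zero_of_fourier_zero_real)
    fix \<eta> :: real
    have "(LINT \<xi>|lborel. of_real (Im (f \<xi>)) * iexp (\<eta> * \<xi>))
        = (LINT \<xi>|lborel. (f \<xi> * iexp (\<eta> * \<xi>) - cnj (f \<xi>) * iexp (\<eta> * \<xi>)) / (2 * \<i>))"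
    proof (rule Bochner_Integration.integral_cong[OF refl])
      fix \<xi>
      have "of_real (Im (f \<xi>)) = (f \<xi> - cnj (f \<xi>)) / (2 * \<i>)"
        by (simp add: complex_eq_iff)
      then show "of_real (Im (f \<xi>)) * iexp (\<eta> * \<xi>) = (f \<xi> * iexp (\<eta> * \<xi>) - cnj (f \<xi>) * iexp (\<eta> * \<xi>)) / (2 * \<i>)"
        by (simp only: left_diff_distrib times_divide_eq_left diff_divide_distrib)
    qed
    then show "(LINT \<xi>|lborel. of_real (Im (f \<xi>)) * iexp (\<eta> * \<xi>)) = 0"
      using intf[of \<eta>] intc[of \<eta>] by (simp only: integral_divide_zero Bochner_Integration.integral_diff zero zeroc) simp
  qed (use int in simp)
  ultimately show ?thesis
    by eventually_elim (simp add: complex_eq_iff)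
qed


section \<open>Distributions with a given Fourier transform\<close>

lemma has_fourierD:
  assumes "has_fourier u g"
  shows "g \<in> borel_measurable borel"
    and "schwartz \<phi> \<Longrightarrow> integrable lborel (\<lambda>\<xi>. g \<xi> * \<phi> \<xi>)"
    and "schwartz \<phi> \<Longrightarrow> pairing u (fourier \<phi>) = (LINT \<xi>|lborel. g \<xi> * \<phi> \<xi>)"
  using assms by (auto simp: has_fourier_def)

text \<open>Neither representative has to be integrable, but their products with a Gaussian are, the
  Gaussian being a test function; the characters needed for injectivity are absorbed into the test
  function.\<close>

lemma has_fourier_unique:
  assumes g: "has_fourier u g" and h: "has_fourier u h"
  shows "AE \<xi> in lborel. g \<xi> = h \<xi>"
proof -
  let ?E = "\<lambda>\<eta> x. exp (- \<i> * of_real (x * \<eta>)) * of_real (exp (- x\<^sup>2 / 2))"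
  let ?f = "\<lambda>x. (g x - h x) * of_real (exp (- x\<^sup>2 / 2))"
  have E: "schwartz (?E \<eta>)" for \<eta>
    by (rule schwartz_gaussian_character)
  note intg = has_fourierD(2)[OF g E] and inth = has_fourierD(2)[OF h E]
  note eq = has_fourierD(3)[OF g E, symmetric, unfolded has_fourierD(3)[OF h E]]
  have "AE \<xi> in lborel. ?f \<xi> = 0"
  proof (rule AE_zero_of_fourier_zero)
    show "integrable lborel ?f"
      using Bochner_Integration.integrable_diff[OF intg[of 0] inth[of 0]] by (simp add: left_diff_distrib)
    fix \<eta> :: real
    have "(LINT \<xi>|lborel. ?f \<xi> * iexp (\<eta> * \<xi>)) = (LINT \<xi>|lborel. g \<xi> * ?E (- \<eta>) \<xi> - h \<xi> * ?E (- \<eta>) \<xi>)"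
      by (rule Bochner_Integration.integral_cong) (simp_all add: algebra_simps)
    also have "\<dots> = 0"
      by (simp only: Bochner_Integration.integral_diff[OF intg inth] eq) simp
    finally show "(LINT \<xi>|lborel. ?f \<xi> * iexp (\<eta> * \<xi>)) = 0" .
  qed
  then show ?thesis
    by eventually_elim simp
qed

lemma tempered_eqI:
  assumes "\<And>\<phi>. schwartz \<phi> \<Longrightarrow> pairing u \<phi> = pairing v \<phi>"
  shows "u = v"
proof -
  have "pairing u \<phi> = pairing v \<phi>" for \<phi>
    using assms pairing[of u] pairing[of v] by (cases "schwartz \<phi>") (auto simp: is_tempered_def)
  then show ?thesis
    by (metis ext pairing_inject)
qed

lemma has_fourier_eqI:
  assumes g: "has_fourier u g" and h: "has_fourier v h" and eq: "AE \<xi> in lborel. g \<xi> = h \<xi>"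
  shows "u = v"
proof (rule tempered_eqI)
  fix \<psi> assume "schwartz \<psi>"
  then obtain \<phi> where \<phi>: "schwartz \<phi>" "fourier \<phi> = \<psi>"
    by (rule fourier_surj)
  then have [measurable]: "\<phi> \<in> borel_measurable borel" "g \<in> borel_measurable borel" "h \<in> borel_measurable borel"
    using schwartz_borel g h by (auto simp: has_fourier_def)
  have "pairing u (fourier \<phi>) = (LINT \<xi>|lborel. g \<xi> * \<phi> \<xi>)"
    by (rule has_fourierD(3)[OF g \<phi>(1)])
  also have "\<dots> = (LINT \<xi>|lborel. h \<xi> * \<phi> \<xi>)"
    using eq by (intro integral_cong_AE) auto
  also have "\<dots> = pairing v (fourier \<phi>)"
    by (rule has_fourierD(3)[OF h \<phi>(1), symmetric])
  finally show "pairing u \<psi> = pairing v \<psi>"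
    using \<phi> by simp
qed

lemma has_fourier_diff:
  assumes "has_fourier u g" and "has_fourier v h"
  shows "has_fourier (u - v) (\<lambda>\<xi>. g \<xi> - h \<xi>)"
  using assms unfolding has_fourier_def
  by (auto intro!: borel_measurable_diff simp: minus_tempered.rep_eq left_diff_distrib)

lemma sobolev_norm_eq:
  assumes "has_fourier u g"
  shows "sobolev_norm s u = sqrt (LINT \<xi>|lborel. (1 + \<xi>\<^sup>2) powr s * (cmod (g \<xi>))\<^sup>2)"
proof -
  have f: "has_fourier u (fourier_fn u)"
    unfolding fourier_fn_def using assms by (metis someI)
  have [measurable]: "g \<in> borel_measurable borel" "fourier_fn u \<in> borel_measurable borel"
    using assms f by (auto simp: has_fourier_def)
  have "AE \<xi> in lborel. fourier_fn u \<xi> = g \<xi>"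
    using f assms by (rule has_fourier_unique)
  then show ?thesis
    unfolding sobolev_norm_def by (intro arg_cong[where f = sqrt] integral_cong_AE) auto
qed

lemma sobolev_iff:
  assumes "has_fourier u g"
  shows "u \<in> sobolev s \<longleftrightarrow> integrable lborel (\<lambda>\<xi>. (1 + \<xi>\<^sup>2) powr s * (cmod (g \<xi>))\<^sup>2)"
proof
  assume "u \<in> sobolev s"
  then obtain h where h: "has_fourier u h" "integrable lborel (\<lambda>\<xi>. (1 + \<xi>\<^sup>2) powr s * (cmod (h \<xi>))\<^sup>2)"
    by (auto simp: sobolev_def)
  have [measurable]: "g \<in> borel_measurable borel" "h \<in> borel_measurable borel"
    using assms h by (auto simp: has_fourier_def)
  show "integrable lborel (\<lambda>\<xi>. (1 + \<xi>\<^sup>2) powr s * (cmod (g \<xi>))\<^sup>2)"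
    by (rule integrable_cong_AE_imp[OF h(2)]) (use has_fourier_unique[OF h(1) assms] in auto)
qed (use assms in \<open>auto simp: sobolev_def\<close>)

text \<open>The inverse Fourier transform of g by duality. The reflection and the factor 1 / (2 pi)
  are those of the inversion formula, so that pairing with \<open>fourier \<phi>\<close> returns the
  integral of g \<phi>.\<close>

definition tempered_functional :: "(real \<Rightarrow> complex) \<Rightarrow> (real \<Rightarrow> complex) \<Rightarrow> complex" where
  "tempered_functional g \<psi> = (if schwartz \<psi> then
     of_real (1 / (2 * pi)) * (LINT \<xi>|lborel. g \<xi> * fourier \<psi> (- \<xi>)) else 0)"

definition tempered_of :: "(real \<Rightarrow> complex) \<Rightarrow> tempered" where
  "tempered_of g = Abs_tempered (tempered_functional g)"

definition square_integrable :: "(real \<Rightarrow> complex) \<Rightarrow> bool" where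
  "square_integrable g \<longleftrightarrow> g \<in> borel_measurable borel \<and> integrable lborel (\<lambda>\<xi>. (cmod (g \<xi>))\<^sup>2)"

lemma square_integrable_decay:
  assumes g: "square_integrable g" and f: "f \<in> borel_measurable borel"
    and K: "\<And>\<xi>. cmod (f \<xi>) \<le> K * inverse (1 + \<xi>\<^sup>2)"
  shows "integrable lborel (\<lambda>\<xi>. g \<xi> * f \<xi>)"
    and "cmod (LINT \<xi>|lborel. g \<xi> * f \<xi>) \<le> K * (LINT \<xi>|lborel. cmod (g \<xi>) * inverse (1 + \<xi>\<^sup>2))"
proof -
  have [measurable]: "g \<in> borel_measurable borel" "f \<in> borel_measurable borel"
    using g f by (auto simp: square_integrable_def)
  have int: "integrable lborel (\<lambda>\<xi>. cmod (g \<xi>) * inverse (1 + \<xi>\<^sup>2))"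
  proof (rule Bochner_Integration.integrable_bound)
    show "integrable lborel (\<lambda>\<xi>. (cmod (g \<xi>))\<^sup>2 + inverse (1 + \<xi>\<^sup>2))"
      using g has_bochner_integral_cauchy by (auto simp: square_integrable_def has_bochner_integral_iff)
    \<comment> \<open>A crude replacement for the Cauchy-Schwarz inequality: for c at most 1 the
      product is below i, otherwise below c^2. Only finiteness matters here.\<close>
    have "c * i \<le> c\<^sup>2 + i" if "0 \<le> c" "0 \<le> i" "i \<le> 1" for c i :: real
    proof (cases "c \<le> 1")
      case True
      then have "c * i \<le> 1 * i"
        using that by (intro mult_right_mono) auto
      then show ?thesis using zero_le_power2[of c] by linarith
    next
      case False
      then have "c * i \<le> c * c"
        using that by (intro mult_left_mono) auto
      then show ?thesis using that by (simp add: power2_eq_square)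
    qed
    moreover have "inverse (1 + \<xi>\<^sup>2) \<le> 1" for \<xi> :: real
      by (simp add: inverse_le_1_iff)
    ultimately show "AE \<xi> in lborel. norm (cmod (g \<xi>) * inverse (1 + \<xi>\<^sup>2)) \<le> norm ((cmod (g \<xi>))\<^sup>2 + inverse (1 + \<xi>\<^sup>2))"
      by (intro AE_I2) (simp add: abs_mult order_trans[OF _ abs_ge_self])
  qed measurable
  then have intK: "integrable lborel (\<lambda>\<xi>. K * (cmod (g \<xi>) * inverse (1 + \<xi>\<^sup>2)))"
    by simp
  have le: "cmod (g \<xi> * f \<xi>) \<le> K * (cmod (g \<xi>) * inverse (1 + \<xi>\<^sup>2))" for \<xi>
    using mult_left_mono[OF K[of \<xi>], of "cmod (g \<xi>)"] by (simp add: norm_mult algebra_simps)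
  show i: "integrable lborel (\<lambda>\<xi>. g \<xi> * f \<xi>)"
    by (rule Bochner_Integration.integrable_bound[OF intK])
      (use le in \<open>auto intro: order_trans[OF _ abs_ge_self]\<close>)
  have "cmod (LINT \<xi>|lborel. g \<xi> * f \<xi>) \<le> (LINT \<xi>|lborel. cmod (g \<xi> * f \<xi>))"
    by (rule integral_norm_bound)
  also have "\<dots> \<le> (LINT \<xi>|lborel. K * (cmod (g \<xi>) * inverse (1 + \<xi>\<^sup>2)))"
    by (intro integral_mono integrable_norm i intK le)
  finally show "cmod (LINT \<xi>|lborel. g \<xi> * f \<xi>) \<le> K * (LINT \<xi>|lborel. cmod (g \<xi>) * inverse (1 + \<xi>\<^sup>2))"
    by simp
qed

lemma fourier_add:
  assumes "schwartz \<phi>" "schwartz \<psi>"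
  shows "fourier (\<lambda>x. \<phi> x + \<psi> x) \<xi> = fourier \<phi> \<xi> + fourier \<psi> \<xi>"
  using fourier_integrable[OF assms(1), of \<xi>] fourier_integrable[OF assms(2), of \<xi>]
  unfolding fourier_def by (simp only: distrib_left Bochner_Integration.integral_add)

lemma fourier_cmult: "fourier (\<lambda>x. c * \<phi> x) \<xi> = c * fourier \<phi> \<xi>"
  unfolding fourier_def by (simp only: mult.left_commute[of _ c] integral_mult_right_zero)

lemma schwartz_decayE:
  assumes "schwartz \<psi>"
  obtains K where "\<And>\<xi>. cmod (\<psi> \<xi>) \<le> K * inverse (1 + \<xi>\<^sup>2)"
  using schwartz_decay[OF assms] by blast

lemma is_tempered_functional:
  assumes g: "square_integrable g"
  shows "is_tempered (tempered_functional g)"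
proof -
  have int: "integrable lborel (\<lambda>\<xi>. g \<xi> * fourier \<psi> (- \<xi>))" if "schwartz \<psi>" for \<psi>
  proof -
    note s = schwartz_reflect[OF schwartz_fourier[OF that]]
    obtain K where "\<And>\<xi>. cmod (fourier \<psi> (- \<xi>)) \<le> K * inverse (1 + \<xi>\<^sup>2)"
      using schwartz_decayE[OF s] by blast
    then show ?thesis
      by (rule square_integrable_decay(1)[OF g schwartz_borel[OF s]])
  qed
  have 1: "tempered_functional g (\<lambda>x. \<phi> x + \<psi> x) = tempered_functional g \<phi> + tempered_functional g \<psi>"
    if "schwartz \<phi>" "schwartz \<psi>" for \<phi> \<psi>
    using that int[OF that(1)] int[OF that(2)] schwartz_add[OF that]
    by (simp add: tempered_functional_def fourier_add distrib_left add_divide_distrib)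
  have 2: "tempered_functional g (\<lambda>x. c * \<phi> x) = c * tempered_functional g \<phi>" if "schwartz \<phi>" for c \<phi>
    using that schwartz_cmult[OF that, of c]
    by (simp add: tempered_functional_def fourier_cmult mult.left_commute[of _ c])
  define A where "A = (LINT \<xi>|lborel. cmod (g \<xi>) * inverse (1 + \<xi>\<^sup>2))"
  \<comment> \<open>The constant is pi A, from the decay of the transform, divided by the 2 pi of
    the definition.\<close>
  have 3: "cmod (tempered_functional g \<psi>) \<le> A / 2 * (\<Sum>m\<le>2. \<Sum>n\<le>2. schwartz_seminorm m n \<psi>)"
    if "schwartz \<psi>" for \<psi>
  proof -
    let ?S = "\<Sum>m\<le>2::nat. \<Sum>n\<le>2::nat. schwartz_seminorm m n \<psi>"
    have "cmod (LINT \<xi>|lborel. g \<xi> * fourier \<psi> (- \<xi>)) \<le> (pi * ?S) * A"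
      unfolding A_def
      by (rule square_integrable_decay(2)[OF g schwartz_borel[OF schwartz_reflect[OF schwartz_fourier[OF that]]]])
        (use fourier_decay[OF that] in \<open>metis power2_minus\<close>)
    then show ?thesis
      using that by (simp add: tempered_functional_def norm_mult norm_divide field_simps)
  qed
  have "\<exists>C N. \<forall>\<psi>. schwartz \<psi> \<longrightarrow> cmod (tempered_functional g \<psi>) \<le> C * (\<Sum>m\<le>N. \<Sum>n\<le>N. schwartz_seminorm m n \<psi>)"
    using 3 by blast
  then show ?thesis
    unfolding is_tempered_def using 1 2 by (simp add: tempered_functional_def)
qed

lemma pairing_tempered_of:
  assumes "square_integrable g" "schwartz \<psi>"
  shows "pairing (tempered_of g) \<psi> = of_real (1 / (2 * pi)) * (LINT \<xi>|lborel. g \<xi> * fourier \<psi> (- \<xi>))"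
  unfolding tempered_of_def using is_tempered_functional[OF assms(1)] assms(2)
  by (simp add: Abs_tempered_inverse) (simp add: tempered_functional_def)

lemma has_fourier_tempered_of:
  assumes g: "square_integrable g"
  shows "has_fourier (tempered_of g) g"
  unfolding has_fourier_def
proof (intro conjI allI impI)
  show "g \<in> borel_measurable borel"
    using g by (simp add: square_integrable_def)
  fix \<phi> assume \<phi>: "schwartz \<phi>"
  obtain K where "\<And>\<xi>. cmod (\<phi> \<xi>) \<le> K * inverse (1 + \<xi>\<^sup>2)"
    using schwartz_decayE[OF \<phi>] by blast
  then show "integrable lborel (\<lambda>\<xi>. g \<xi> * \<phi> \<xi>)"
    by (rule square_integrable_decay(1)[OF g schwartz_borel[OF \<phi>]])
  have "pairing (tempered_of g) (fourier \<phi>)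
      = of_real (1 / (2 * pi)) * (LINT \<xi>|lborel. of_real (2 * pi) * (g \<xi> * \<phi> \<xi>))"
    unfolding pairing_tempered_of[OF g schwartz_fourier[OF \<phi>]] fourier_inversion[OF \<phi>]
    by (simp add: mult.left_commute)
  then show "pairing (tempered_of g) (fourier \<phi>) = (LINT \<xi>|lborel. g \<xi> * \<phi> \<xi>)"
    by simp
qed

section \<open>Brownian increments\<close>

lemma normal_density_fourier:
  assumes "0 < s"
  shows "(LINT x|lborel. normal_density 0 s x *\<^sub>R iexp (l * x)) = of_real (exp (- l\<^sup>2 * s\<^sup>2 / 2))"
proof -
  have "(LINT x|lborel. normal_density 0 s x *\<^sub>R iexp (l * x))
    = (LINT x|lborel. of_real (1 / (sqrt (2 * pi) * s)) * (exp (\<i> * of_real (l * x)) * of_real (exp (- (1 / s * x)\<^sup>2 / 2))))"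
    using assms by (intro Bochner_Integration.integral_cong)
      (auto simp: normal_density_def scaleR_conv_of_real real_sqrt_mult power_divide)
  also have "\<dots> = of_real (1 / (sqrt (2 * pi) * s)) * of_real (sqrt (2 * pi) / (1 / s) * exp (- (l / (1 / s))\<^sup>2 / 2))"
    using gaussian_fourier[of "1 / s" l] assms by (simp only: integral_mult_right_zero) simp
  also have "\<dots> = of_real (exp (- l\<^sup>2 * s\<^sup>2 / 2))"
    using assms by (simp add: power_mult_distrib)
  finally show ?thesis .
qed

context brownian_motion
begin

lemma adapted_mono:
  assumes "f \<in> borel_measurable (F s)" "s \<le> t"
  shows "f \<in> borel_measurable (F t)"
proof (rule measurable_from_subalg[OF _ assms(1)])
  show "subalgebra (F t) (F s)"
    using assms(2) sets_F_mono space_F by (auto simp: subalgebra_def)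
qed

lemma adapted_measurable:
  assumes "f \<in> borel_measurable (F s)" "0 \<le> s"
  shows "f \<in> borel_measurable M"
  using measurable_from_subalg[OF filtration_subalgebra assms(1)] assms(2) by blast

lemma B_measurable [measurable]: "0 \<le> s \<Longrightarrow> B s \<in> borel_measurable M"
  using BM_adapted adapted_measurable by blast

lemma B_adapted: "0 \<le> s \<Longrightarrow> s \<le> t \<Longrightarrow> B s \<in> borel_measurable (F t)"
  using BM_adapted adapted_mono by blast

lemma increment_indep_var:
  fixes X :: "'a \<Rightarrow> 'b::topological_space"
  assumes st: "0 \<le> s" "s < t" and X: "X \<in> borel_measurable (F s)" and g: "g \<in> borel_measurable borel"
  shows "indep_var borel X borel (\<lambda>\<omega>. g (B t \<omega> - B s \<omega>))"
  unfolding indep_var_def indep_vars_def2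
proof
  let ?D = "\<lambda>\<omega>. B t \<omega> - B s \<omega>"
  have D: "?D \<in> borel_measurable M"
    using st by auto
  show "\<forall>i\<in>UNIV. random_variable (case i of True \<Rightarrow> borel | False \<Rightarrow> borel) (case i of True \<Rightarrow> X | False \<Rightarrow> \<lambda>\<omega>. g (?D \<omega>))"
    using adapted_measurable[OF X st(1)] measurable_compose[OF D g] by (auto split: bool.split)
  show "indep_sets (\<lambda>i. {(case i of True \<Rightarrow> X | False \<Rightarrow> \<lambda>\<omega>. g (?D \<omega>)) -` A \<inter> space M |A.
      A \<in> sets (case i of True \<Rightarrow> borel | False \<Rightarrow> borel)}) UNIV"
  proof (rule indep_sets_mono_sets)
    show "indep_sets (case_bool (sets (F s)) {?D -` A \<inter> space M |A. A \<in> sets borel}) UNIV"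
      using BM_indep[OF st] by (simp add: indep_set_def)
    fix i
    show "{(case i of True \<Rightarrow> X | False \<Rightarrow> \<lambda>\<omega>. g (?D \<omega>)) -` A \<inter> space M |A.
      A \<in> sets (case i of True \<Rightarrow> borel | False \<Rightarrow> borel)} \<subseteq> (case i of True \<Rightarrow> sets (F s) | False \<Rightarrow> {?D -` A \<inter> space M |A. A \<in> sets borel})"
    proof (cases i)
      case True
      then show ?thesis
        using measurable_sets[OF X] space_F by auto
    next
      case False
      have "(\<lambda>\<omega>. g (?D \<omega>)) -` A \<inter> space M \<in> {?D -` A \<inter> space M |A. A \<in> sets borel}" if "A \<in> sets borel" for A
        using measurable_sets[OF g that] by (auto intro!: exI[of _ "g -` A"])
      with False show ?thesis
        by auto
    qed
  qed
qed

lemma increment_mult: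
  fixes X :: "'a \<Rightarrow> complex" and g :: "real \<Rightarrow> complex"
  assumes st: "0 \<le> s" "s \<le> t" and X: "X \<in> borel_measurable (F s)" "integrable M X"
    and g: "g \<in> borel_measurable borel" "integrable M (\<lambda>\<omega>. g (B t \<omega> - B s \<omega>))"
  shows "integrable M (\<lambda>\<omega>. X \<omega> * g (B t \<omega> - B s \<omega>))"
    and "(LINT \<omega>|M. X \<omega> * g (B t \<omega> - B s \<omega>)) = (LINT \<omega>|M. X \<omega>) * (LINT \<omega>|M. g (B t \<omega> - B s \<omega>))"
proof -
  have "integrable M (\<lambda>\<omega>. X \<omega> * g (B t \<omega> - B s \<omega>)) \<and>
    (LINT \<omega>|M. X \<omega> * g (B t \<omega> - B s \<omega>)) = (LINT \<omega>|M. X \<omega>) * (LINT \<omega>|M. g (B t \<omega> - B s \<omega>))"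
  \<comment> \<open>Independence is available only for s < t. For s = t the increment is 0, so g is
    evaluated at a constant.\<close>
  proof (cases "s = t")
    case True
    then show ?thesis
      using X by (simp add: prob_space)
  next
    case False
    with st have "s < t" by simp
    note i = increment_indep_var[OF st(1) this X(1) g(1)]
    show ?thesis
      by (intro conjI indep_var_integrable[OF i X(2) g(2)] indep_var_lebesgue_integral[OF i X(2) g(2)])
  qed
  then show "integrable M (\<lambda>\<omega>. X \<omega> * g (B t \<omega> - B s \<omega>))"
    "(LINT \<omega>|M. X \<omega> * g (B t \<omega> - B s \<omega>)) = (LINT \<omega>|M. X \<omega>) * (LINT \<omega>|M. g (B t \<omega> - B s \<omega>))"
    by auto
qed

lemma increment_moments:
  assumes st: "0 \<le> s" "s \<le> t"
  shows "integrable M (\<lambda>\<omega>. (B t \<omega> - B s \<omega>) ^ k)"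
    and "(LINT \<omega>|M. B t \<omega> - B s \<omega>) = 0"
    and "(LINT \<omega>|M. (B t \<omega> - B s \<omega>)\<^sup>2) = t - s"
    and "(LINT \<omega>|M. (B t \<omega> - B s \<omega>) ^ 4) = 3 * (t - s)\<^sup>2"
proof -
  have "integrable M (\<lambda>\<omega>. (B t \<omega> - B s \<omega>) ^ k) \<and> (LINT \<omega>|M. B t \<omega> - B s \<omega>) = 0 \<and>
    (LINT \<omega>|M. (B t \<omega> - B s \<omega>)\<^sup>2) = t - s \<and> (LINT \<omega>|M. (B t \<omega> - B s \<omega>) ^ 4) = 3 * (t - s)\<^sup>2"
  proof (cases "s = t")
    case True
    then show ?thesis by simp
  next
    case False
    with st have "s < t" by simp
    define v where "v = sqrt (t - s)"
    have v: "0 < v" "v\<^sup>2 = t - s"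
      using \<open>s < t\<close> by (simp_all add: v_def)
    note d = BM_normal[OF st(1) \<open>s < t\<close>, folded v_def]
    have int: "integrable M (\<lambda>\<omega>. (B t \<omega> - B s \<omega>) ^ k)" for k
      using distributed_integrable[OF d, of "\<lambda>x. x ^ k"] integrable_normal_moment[OF v(1), of 0 k] by simp
    have eq: "(LINT \<omega>|M. (B t \<omega> - B s \<omega>) ^ k) = (LINT x|lborel. normal_density 0 v x * x ^ k)" for k
      using distributed_integral[OF d, of "\<lambda>x. x ^ k"] by simp
    have "v ^ 4 = (v\<^sup>2)\<^sup>2"
      by simp
    then show ?thesis
      using int eq[of 1] eq[of 2] eq[of 4] integral_normal_moment_nz_1[OF v(1), of 0]
        integral_normal_moment_even[OF v(1), of 0 1] integral_normal_moment_even[OF v(1), of 0 2] v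
      by (simp add: fact_numeral power_divide)
  qed
  then show "integrable M (\<lambda>\<omega>. (B t \<omega> - B s \<omega>) ^ k)" "(LINT \<omega>|M. B t \<omega> - B s \<omega>) = 0"
    "(LINT \<omega>|M. (B t \<omega> - B s \<omega>)\<^sup>2) = t - s" "(LINT \<omega>|M. (B t \<omega> - B s \<omega>) ^ 4) = 3 * (t - s)\<^sup>2"
    by auto
qed

lemma increment_char:
  assumes st: "0 \<le> s" "s \<le> t"
  shows "(LINT \<omega>|M. iexp (l * (B t \<omega> - B s \<omega>))) = of_real (exp (- l\<^sup>2 / 2 * (t - s)))"
proof (cases "s = t")
  case True
  then show ?thesis by (simp add: prob_space)
next
  case False
  with st have "s < t" by simp
  then have v: "0 < sqrt (t - s)" by simp
  note d = BM_normal[OF st(1) \<open>s < t\<close>]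
  have [measurable]: "B t \<in> borel_measurable M" "B s \<in> borel_measurable M"
    using st by auto
  have "(LINT \<omega>|M. iexp (l * (B t \<omega> - B s \<omega>))) = (LINT x|distr M lborel (\<lambda>\<omega>. B t \<omega> - B s \<omega>). iexp (l * x))"
    by (subst integral_distr) auto
  also have "distr M lborel (\<lambda>\<omega>. B t \<omega> - B s \<omega>) = density lborel (normal_density 0 (sqrt (t - s)))"
    by (rule distributed_distr_eq_density[OF d])
  also have "(LINT x|density lborel (normal_density 0 (sqrt (t - s))). iexp (l * x))
     = (LINT x|lborel. normal_density 0 (sqrt (t - s)) x *\<^sub>R iexp (l * x))"
    by (subst integral_density) auto
  finally show ?thesis
    using normal_density_fourier[OF v, of l] \<open>s < t\<close> by simp
qed

text \<open>The decorrelation on which both the moment bound and the Ito equation rest: an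
  independent Gaussian phase acts on everything known at time s as multiplication by a decaying
  exponential.\<close>

lemma increment_char_mult:
  fixes X :: "'a \<Rightarrow> complex"
  assumes st: "0 \<le> s" "s \<le> t" and X: "X \<in> borel_measurable (F s)" "integrable M X"
  shows "(LINT \<omega>|M. X \<omega> * iexp (l * (B t \<omega> - B s \<omega>))) = of_real (exp (- l\<^sup>2 / 2 * (t - s))) * (LINT \<omega>|M. X \<omega>)"
proof -
  have [measurable]: "B t \<in> borel_measurable M" "B s \<in> borel_measurable M"
    using st by auto
  show ?thesis
    by (subst increment_mult(2)[OF st X, of "\<lambda>x. iexp (l * x)"])
      (auto simp: increment_char[OF st] intro!: integrable_const_bound[where B = 1] simp del: of_real_mult)
qed

lemma increment_mean_mult:
  fixes X :: "'a \<Rightarrow> complex"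
  assumes st: "0 \<le> s" "s \<le> t" and X: "X \<in> borel_measurable (F s)" "integrable M X"
  shows "integrable M (\<lambda>\<omega>. X \<omega> * of_real (B t \<omega> - B s \<omega>))"
    and "(LINT \<omega>|M. X \<omega> * of_real (B t \<omega> - B s \<omega>)) = 0"
proof -
  have *: "integrable M (\<lambda>\<omega>. complex_of_real (B t \<omega> - B s \<omega>))"
    using increment_moments(1)[OF st, of 1] by (simp only: power_one_right integrable_of_real)
  show "integrable M (\<lambda>\<omega>. X \<omega> * of_real (B t \<omega> - B s \<omega>))"
    by (rule increment_mult(1)[OF st X _ *]) simp
  have "(LINT \<omega>|M. complex_of_real (B t \<omega> - B s \<omega>)) = 0"
    by (simp only: integral_complex_of_real increment_moments(2)[OF st] of_real_0)
  then show "(LINT \<omega>|M. X \<omega> * of_real (B t \<omega> - B s \<omega>)) = 0"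
    by (subst increment_mult(2)[OF st X _ *]) auto
qed

lemma increment_square_mult:
  fixes X :: "'a \<Rightarrow> complex"
  assumes st: "0 \<le> s" "s \<le> t" and X: "X \<in> borel_measurable (F s)" "integrable M (\<lambda>\<omega>. (cmod (X \<omega>))\<^sup>2)"
  shows "integrable M (\<lambda>\<omega>. (cmod (X \<omega> * of_real (B t \<omega> - B s \<omega>)))\<^sup>2)"
    and "(LINT \<omega>|M. (cmod (X \<omega> * of_real (B t \<omega> - B s \<omega>)))\<^sup>2) = (t - s) * (LINT \<omega>|M. (cmod (X \<omega>))\<^sup>2)"
proof -
  let ?X = "\<lambda>\<omega>. complex_of_real ((cmod (X \<omega>))\<^sup>2)" and ?g = "\<lambda>x. complex_of_real (x\<^sup>2)"
  have *: "integrable M (\<lambda>\<omega>. ?g (B t \<omega> - B s \<omega>))"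
    by (intro integrable_of_real increment_moments(1)[OF st])
  have X': "?X \<in> borel_measurable (F s)" "integrable M ?X"
    using X by (auto intro!: integrable_of_real simp del: of_real_power)
  have eq: "(cmod (X \<omega> * of_real (B t \<omega> - B s \<omega>)))\<^sup>2 = Re (?X \<omega> * ?g (B t \<omega> - B s \<omega>))" for \<omega>
    by (simp add: norm_mult power_mult_distrib del: of_real_diff of_real_power flip: of_real_mult)

  show "integrable M (\<lambda>\<omega>. (cmod (X \<omega> * of_real (B t \<omega> - B s \<omega>)))\<^sup>2)"
    unfolding eq by (intro integrable_Re increment_mult(1)[OF st X' _ *]) simp
  have "(LINT \<omega>|M. (cmod (X \<omega> * of_real (B t \<omega> - B s \<omega>)))\<^sup>2) = Re (LINT \<omega>|M. ?X \<omega> * ?g (B t \<omega> - B s \<omega>))"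
    unfolding eq by (intro integral_Re increment_mult(1)[OF st X' _ *]) simp
  also have "(LINT \<omega>|M. ?X \<omega> * ?g (B t \<omega> - B s \<omega>)) = (LINT \<omega>|M. ?X \<omega>) * (LINT \<omega>|M. ?g (B t \<omega> - B s \<omega>))"
    by (rule increment_mult(2)[OF st X' _ *]) simp
  finally show "(LINT \<omega>|M. (cmod (X \<omega> * of_real (B t \<omega> - B s \<omega>)))\<^sup>2) = (t - s) * (LINT \<omega>|M. (cmod (X \<omega>))\<^sup>2)"
    by (simp only: integral_complex_of_real increment_moments(3)[OF st]) (simp add: mult.commute del: of_real_power)
qed

end

section \<open>A jointly measurable version of the Brownian motion\<close>

text \<open>\<open>lim\<close> is total, so this is defined at every sample point and agrees with B
  wherever the path is continuous. Rounding the time down keeps the value at s measurable with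
  respect to the past of s without completing the filtration.\<close>

definition dyadic_limit :: "(real \<Rightarrow> 'a \<Rightarrow> real) \<Rightarrow> real \<Rightarrow> 'a \<Rightarrow> real" where
  "dyadic_limit B s \<omega> = lim (\<lambda>n. B (real (nat \<lfloor>s * 2 ^ n\<rfloor>) / 2 ^ n) \<omega>)"

text \<open>At each level only countably many times occur, so joint measurability is that of a
  countable patchwork. The reparametrisation r is the identity for joint measurability and
  \<open>min s t\<close>, with G = F t, for progressive measurability.\<close>

lemma dyadic_limit_measurable:
  fixes B :: "real \<Rightarrow> 'a \<Rightarrow> real" and G :: "'a measure" and r :: "real \<Rightarrow> real"
  assumes r: "r \<in> borel_measurable borel"
    and B: "\<And>s n. B (real (nat \<lfloor>r s * 2 ^ n\<rfloor>) / 2 ^ n) \<in> borel_measurable G"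
  shows "(\<lambda>(s, \<omega>). dyadic_limit B (r s) \<omega>) \<in> borel_measurable (borel \<Otimes>\<^sub>M G)"
proof -
  note [measurable] = r
  have "(\<lambda>p. B (real (nat \<lfloor>r (fst p) * 2 ^ n\<rfloor>) / 2 ^ n) (snd p)) \<in> borel_measurable (borel \<Otimes>\<^sub>M G)" for n
  proof -
    \<comment> \<open>Every index has to give a measurable function, including dyadic times that r
      never reaches and at which B may fail to be G-measurable; these receive the default 0.\<close>
    define f where "f i p = (if B (real i / 2 ^ n) \<in> borel_measurable G then B (real i / 2 ^ n) (snd p) else 0)"
      for i :: nat and p :: "real \<times> 'a"
    have "f i \<in> borel_measurable (borel \<Otimes>\<^sub>M G)" for i
      unfolding f_def by (cases "B (real i / 2 ^ n) \<in> borel_measurable G") (auto intro: measurable_compose[OF measurable_snd])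
    then have "(\<lambda>p. f (nat \<lfloor>r (fst p) * 2 ^ n\<rfloor>) p) \<in> borel_measurable (borel \<Otimes>\<^sub>M G)"
      by (rule measurable_compose_countable) measurable
    then show ?thesis
      using B by (simp add: f_def)
  qed
  then show ?thesis
    unfolding dyadic_limit_def case_prod_beta by (rule borel_measurable_lim_metric)
qed

lemma dyadic_approx:
  assumes "0 \<le> s"
  shows "(\<lambda>n. real (nat \<lfloor>s * 2 ^ n\<rfloor>) / 2 ^ n) \<longlonglongrightarrow> s"
proof (rule tendsto_sandwich)
  show "\<forall>\<^sub>F n in sequentially. s - (1 / 2) ^ n \<le> real (nat \<lfloor>s * 2 ^ n\<rfloor>) / 2 ^ n"
  proof (rule always_eventually, rule allI)
    fix n
    have "s * 2 ^ n - 1 \<le> real (nat \<lfloor>s * 2 ^ n\<rfloor>)"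
      using assms by linarith
    then have "(s * 2 ^ n - 1) / 2 ^ n \<le> real (nat \<lfloor>s * 2 ^ n\<rfloor>) / 2 ^ n"
      by (rule divide_right_mono) simp
    then show "s - (1 / 2) ^ n \<le> real (nat \<lfloor>s * 2 ^ n\<rfloor>) / 2 ^ n"
      by (simp add: diff_divide_distrib power_one_over inverse_eq_divide)
  qed
  show "\<forall>\<^sub>F n in sequentially. real (nat \<lfloor>s * 2 ^ n\<rfloor>) / 2 ^ n \<le> s"
    using of_nat_floor[of "s * 2 ^ _"] assms by (simp add: divide_le_eq)
  show "(\<lambda>n. s - (1 / 2) ^ n) \<longlonglongrightarrow> s"
    using tendsto_diff[OF tendsto_const[of s] LIMSEQ_power_zero[of "1/2::real"]] by simp
qed simp

lemma dyadic_limit_eq: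
  assumes "continuous_on {0..} (\<lambda>t. B t \<omega>)" "0 \<le> s"
  shows "dyadic_limit B s \<omega> = B s \<omega>"
  unfolding dyadic_limit_def
proof (rule limI)
  show "(\<lambda>n. B (real (nat \<lfloor>s * 2 ^ n\<rfloor>) / 2 ^ n) \<omega>) \<longlonglongrightarrow> B s \<omega>"
    by (rule continuous_on_tendsto_compose[OF assms(1) dyadic_approx[OF assms(2)]]) (use assms in auto)
qed

context brownian_motion
begin

abbreviation "W \<equiv> dyadic_limit B"

lemma W_eq_B: "AE \<omega> in M. \<forall>s\<ge>0. W s \<omega> = B s \<omega>"
  using BM_continuous by eventually_elim (simp add: dyadic_limit_eq)

lemma W_joint: "(\<lambda>(s, \<omega>). W s \<omega>) \<in> borel_measurable (borel \<Otimes>\<^sub>M M)"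
  by (rule dyadic_limit_measurable[of "\<lambda>s. s"]) auto

lemma W_progressive:
  assumes "0 \<le> t"
  shows "(\<lambda>(s, \<omega>). W (min s t) \<omega>) \<in> borel_measurable (borel \<Otimes>\<^sub>M F t)"
proof (rule dyadic_limit_measurable)
  fix s n
  have "real (nat \<lfloor>min s t * 2 ^ n\<rfloor>) / 2 ^ n \<le> t"
  proof (cases "0 \<le> min s t")
    case True
    then have "real (nat \<lfloor>min s t * 2 ^ n\<rfloor>) \<le> min s t * 2 ^ n"
      by (intro of_nat_floor) simp
    also have "\<dots> \<le> t * 2 ^ n"
      by (intro mult_right_mono) auto
    finally show ?thesis
      by (simp add: divide_le_eq)
  next
    case False
    then have "min s t * 2 ^ n \<le> 0"
      by (intro mult_nonpos_nonneg) auto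
    then have "nat \<lfloor>min s t * 2 ^ n\<rfloor> = 0"
      by (simp add: floor_le_zero)
    then show ?thesis
      using assms by simp
  qed
  then show "B (real (nat \<lfloor>min s t * 2 ^ n\<rfloor>) / 2 ^ n) \<in> borel_measurable (F t)"
    by (intro B_adapted) auto
qed simp

lemma W_adapted: "0 \<le> t \<Longrightarrow> W t \<in> borel_measurable (F t)"
  using measurable_compose[OF measurable_Pair1'[of t borel "F t"] W_progressive[of t]] by simp

end

section \<open>The pathwise linear system\<close>

text \<open>
  With \<open>e = exp (i \<sigma> \<xi> B)\<close>, the substitution \<open>u = e p\<close> turns the mode equation into the linear
  system \<open>p' = cnj e v\<close>, \<open>v' = \<xi> e p\<close>, which makes sense path by path. It is solved by the Picard
  series; the boolean index selects \<open>p\<close> (True) or \<open>v\<close> (False).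
\<close>

definition coef :: "(real \<Rightarrow> complex) \<Rightarrow> real \<Rightarrow> bool \<Rightarrow> real \<Rightarrow> complex" where
  "coef e \<xi> c s = (if c then cnj (e s) else of_real \<xi> * e s)"

primrec picard :: "(real \<Rightarrow> complex) \<Rightarrow> real \<Rightarrow> complex \<Rightarrow> complex \<Rightarrow> nat \<Rightarrow> bool \<Rightarrow> real \<Rightarrow> complex" where
  "picard e \<xi> a b 0 c t = (if c then a else b)"
| "picard e \<xi> a b (Suc n) c t =
     (LINT s|lborel. indicator {0..t} s *\<^sub>R (coef e \<xi> c s * picard e \<xi> a b n (\<not> c) s))"

definition linear_sol :: "(real \<Rightarrow> complex) \<Rightarrow> real \<Rightarrow> complex \<Rightarrow> complex \<Rightarrow> bool \<Rightarrow> real \<Rightarrow> complex" where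
  "linear_sol e \<xi> a b c t = (\<Sum>n. picard e \<xi> a b n c t)"

lemma borel_measurable_cnj [measurable]:
  assumes "f \<in> borel_measurable N"
  shows "(\<lambda>x. cnj (f x)) \<in> borel_measurable N"
  by (rule measurable_compose[OF assms borel_measurable_continuous_onI]) (intro continuous_intros)

text \<open>The parameter x ranges over an arbitrary measurable space. Taking it to be a pair of
  sample point and frequency yields measurability in time, chance and \<xi> together.\<close>

lemma picard_joint:
  fixes e :: "'b \<Rightarrow> real \<Rightarrow> complex"
  assumes e: "(\<lambda>(s, x). e x s) \<in> borel_measurable (borel \<Otimes>\<^sub>M N)"
    and [measurable]: "\<xi> \<in> borel_measurable N" "a \<in> borel_measurable N" "b \<in> borel_measurable N"
  shows "(\<lambda>(s, x). picard (e x) (\<xi> x) (a x) (b x) n c s) \<in> borel_measurable (borel \<Otimes>\<^sub>M N)"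
proof (induction n arbitrary: c)
  case 0
  show ?case by simp
next
  case (Suc n)
  have [measurable]: "(\<lambda>p. e (snd p) (fst p)) \<in> borel_measurable (borel \<Otimes>\<^sub>M N)"
    using e by (simp add: case_prod_beta')
  have [measurable]: "(\<lambda>p. picard (e (snd p)) (\<xi> (snd p)) (a (snd p)) (b (snd p)) n (\<not> c) (fst p)) \<in> borel_measurable (borel \<Otimes>\<^sub>M N)"
    using Suc[of "\<not> c"] by (simp add: case_prod_beta')
  have m: "(\<lambda>q. (snd q, snd (fst q))) \<in> measurable ((borel \<Otimes>\<^sub>M N) \<Otimes>\<^sub>M lborel) (borel \<Otimes>\<^sub>M N)"
    by measurable
  have [measurable]: "(\<lambda>q. e (snd (fst q)) (snd q)) \<in> borel_measurable ((borel \<Otimes>\<^sub>M N) \<Otimes>\<^sub>M lborel)"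
    using measurable_compose[OF m, of "\<lambda>p. e (snd p) (fst p)" borel] by simp
  have [measurable]: "(\<lambda>q. picard (e (snd (fst q))) (\<xi> (snd (fst q))) (a (snd (fst q))) (b (snd (fst q))) n (\<not> c) (snd q))
      \<in> borel_measurable ((borel \<Otimes>\<^sub>M N) \<Otimes>\<^sub>M lborel)"
    using measurable_compose[OF m, of "\<lambda>p. picard (e (snd p)) (\<xi> (snd p)) (a (snd p)) (b (snd p)) n (\<not> c) (fst p)" borel]
    by simp
  have [measurable]: "Measurable.pred ((borel \<Otimes>\<^sub>M N) \<Otimes>\<^sub>M lborel) (\<lambda>q. snd q \<in> {0..fst (fst q) :: real})"
    unfolding atLeastAtMost_iff by measurable
  show ?case
    unfolding case_prod_beta' picard.simps coef_def
    by (rule lborel.borel_measurable_lebesgue_integral) (unfold case_prod_beta', measurable)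
qed

lemma linear_sol_joint:
  fixes e :: "'b \<Rightarrow> real \<Rightarrow> complex"
  assumes "(\<lambda>(s, x). e x s) \<in> borel_measurable (borel \<Otimes>\<^sub>M N)"
    and "\<xi> \<in> borel_measurable N" "a \<in> borel_measurable N" "b \<in> borel_measurable N"
  shows "(\<lambda>(s, x). linear_sol (e x) (\<xi> x) (a x) (b x) c s) \<in> borel_measurable (borel \<Otimes>\<^sub>M N)"
  using picard_joint[OF assms] unfolding linear_sol_def case_prod_beta' by (intro borel_measurable_suminf)

text \<open>Causality: up to time T only the coefficient up to T matters. This is what makes the
  solution adapted.\<close>

lemma picard_cong:
  assumes "\<And>s. 0 \<le> s \<Longrightarrow> s \<le> T \<Longrightarrow> e s = e' s" "t \<le> T"
  shows "picard e \<xi> a b n c t = picard e' \<xi> a b n c t"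
  using assms(2)
proof (induction n arbitrary: c t)
  case (Suc n)
  have "indicator {0..t} s *\<^sub>R (coef e \<xi> c s * picard e \<xi> a b n (\<not> c) s)
      = indicator {0..t} s *\<^sub>R (coef e' \<xi> c s * picard e' \<xi> a b n (\<not> c) s)" for s
    using Suc.IH[of s] Suc.prems assms(1)[of s] by (auto simp: indicator_def coef_def)
  then show ?case
    by (simp only: picard.simps)
qed simp

lemma integrable_const_Icc: "integrable lborel (\<lambda>s::real. (K::real) * indicator {a..b} s)"
  by (intro integrable_mult_right integrable_real_indicator) (auto simp: emeasure_lborel_Icc_eq)

lemma linear_sol_cong:
  assumes "\<And>s. 0 \<le> s \<Longrightarrow> s \<le> T \<Longrightarrow> e s = e' s" "t \<le> T"
  shows "linear_sol e \<xi> a b c t = linear_sol e' \<xi> a b c t"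
  using picard_cong[OF assms] by (simp add: linear_sol_def)

text \<open>Continuity of e is left out on purpose: paths of \<open>W\<close> are continuous only
  almost surely, while existence, measurability and bounds of the solution are wanted at every
  sample point.\<close>

locale unimodular =
  fixes e :: "real \<Rightarrow> complex"
  assumes e_measurable [measurable]: "e \<in> borel_measurable borel"
    and cmod_e [simp]: "cmod (e s) = 1"
begin

lemma picard_measurable [measurable]: "(\<lambda>s. picard e \<xi> a b n c s) \<in> borel_measurable borel"
proof -
  have "(\<lambda>(s, x). picard e \<xi> a b n c s) \<in> borel_measurable (borel \<Otimes>\<^sub>M (borel :: real measure))"
    by (rule picard_joint) measurable
  from measurable_compose[OF measurable_Pair2'[of "0::real"] this] show ?thesis
    by simp
qed

lemma linear_sol_measurable [measurable]: "(\<lambda>s. linear_sol e \<xi> a b c s) \<in> borel_measurable borel"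
  unfolding linear_sol_def by measurable

lemma coef_measurable [measurable]: "(\<lambda>s. coef e \<xi> c s) \<in> borel_measurable borel"
  unfolding coef_def by measurable

lemma coef_bound: "cmod (coef e \<xi> c s) \<le> 1 + \<bar>\<xi>\<bar>"
  by (simp add: coef_def norm_mult)

text \<open>Each iteration multiplies by at most 1 + |\<xi>| and integrates a power of time, so the
  Picard series is dominated by the exponential series.\<close>

lemma picard_bound:
  "0 \<le> t \<Longrightarrow> cmod (picard e \<xi> a b n c t) \<le> (cmod a + cmod b) * (((1 + \<bar>\<xi>\<bar>) * t) ^ n / fact n)"
proof (induction n arbitrary: c t)
  case 0
  then show ?case by simp
next
  case (Suc n)
  let ?k = "1 + \<bar>\<xi>\<bar>"
  let ?K = "?k * ((cmod a + cmod b) * (?k ^ n / fact n))"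
  have int: "integrable lborel (\<lambda>s. ?K * (s ^ n * indicator {0..t} s))"
    using borel_integrable_atLeastAtMost[of 0 t "\<lambda>s. s ^ n"] by (intro integrable_mult_right) auto
  have le: "cmod (indicator {0..t} s *\<^sub>R (coef e \<xi> c s * picard e \<xi> a b n (\<not> c) s)) \<le> ?K * (s ^ n * indicator {0..t} s)" for s
  proof (cases "s \<in> {0..t}")
    case True
    then have "cmod (coef e \<xi> c s) * cmod (picard e \<xi> a b n (\<not> c) s) \<le> ?k * ((cmod a + cmod b) * ((?k * s) ^ n / fact n))"
      by (intro mult_mono coef_bound Suc.IH) auto
    then show ?thesis
      using True by (simp add: norm_mult power_mult_distrib)
  qed simp
  have "cmod (picard e \<xi> a b (Suc n) c t) \<le> (LINT s|lborel. ?K * (s ^ n * indicator {0..t} s))"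
    unfolding picard.simps using Suc.prems
    by (intro order_trans[OF integral_norm_bound] integral_mono'[OF int le]) (auto simp: indicator_def)
  also have "\<dots> = ?K * ((t ^ Suc n - 0 ^ Suc n) / Suc n)"
    by (simp only: integral_mult_right_zero integral_power[OF Suc.prems])
  also have "k * (A * (k ^ n / fact n)) * ((t ^ Suc n - 0 ^ Suc n) / Suc n) = A * ((k * t) ^ Suc n / fact (Suc n))" for k A :: real
    by (simp add: power_mult_distrib field_simps)
  finally show ?case .
qed

lemma picard_summable_norm:
  assumes "0 \<le> t"
  shows "summable (\<lambda>n. cmod (picard e \<xi> a b n c t))"
proof (rule summable_comparison_test)
  show "\<exists>N. \<forall>n\<ge>N. norm (cmod (picard e \<xi> a b n c t)) \<le> (cmod a + cmod b) * (((1 + \<bar>\<xi>\<bar>) * t) ^ n / fact n)"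
    using picard_bound[OF assms] by auto
  show "summable (\<lambda>n. (cmod a + cmod b) * (((1 + \<bar>\<xi>\<bar>) * t) ^ n / fact n))"
    using summable_exp[of "(1 + \<bar>\<xi>\<bar>) * t"] by (intro summable_mult) (simp add: inverse_eq_divide)
qed

lemma linear_sol_bound:
  assumes "0 \<le> t"
  shows "cmod (linear_sol e \<xi> a b c t) \<le> (cmod a + cmod b) * exp ((1 + \<bar>\<xi>\<bar>) * t)"
proof -
  let ?x = "(1 + \<bar>\<xi>\<bar>) * t"
  have s: "(\<lambda>n. (cmod a + cmod b) * (?x ^ n / fact n)) sums ((cmod a + cmod b) * exp ?x)"
    using exp_converges[of ?x] by (intro sums_mult) (simp add: divide_inverse_commute)
  have "cmod (linear_sol e \<xi> a b c t) \<le> (\<Sum>n. cmod (picard e \<xi> a b n c t))"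
    unfolding linear_sol_def by (rule summable_norm[OF picard_summable_norm[OF assms]])
  also have "\<dots> \<le> (\<Sum>n. (cmod a + cmod b) * (?x ^ n / fact n))"
    by (rule suminf_le[OF picard_bound[OF assms] picard_summable_norm[OF assms] sums_summable[OF s]])
  also have "\<dots> = (cmod a + cmod b) * exp ?x"
    using s by (rule sums_unique[symmetric])
  finally show ?thesis .
qed

lemma linear_sol_bound_uniform:
  assumes "0 \<le> t" "t \<le> T"
  shows "cmod (linear_sol e \<xi> a b c t) \<le> (cmod a + cmod b) * exp ((1 + \<bar>\<xi>\<bar>) * T)"
proof -
  have "(cmod a + cmod b) * exp ((1 + \<bar>\<xi>\<bar>) * t) \<le> (cmod a + cmod b) * exp ((1 + \<bar>\<xi>\<bar>) * T)"
    using assms by (intro mult_left_mono) (auto intro: mult_left_mono)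
  then show ?thesis
    using linear_sol_bound[OF assms(1), of \<xi> a b c] by linarith
qed

lemma integrable_picard:
  "integrable lborel (\<lambda>s. indicator {0..t} s *\<^sub>R (coef e \<xi> c s * picard e \<xi> a b n c' s))"
proof (rule Bochner_Integration.integrable_bound)
  let ?K = "(1 + \<bar>\<xi>\<bar>) * ((cmod a + cmod b) * (((1 + \<bar>\<xi>\<bar>) * t) ^ n / fact n))"
  show "integrable lborel (\<lambda>s. ?K * indicator {0..t} s)"
    by (rule integrable_const_Icc)
  have "cmod (indicator {0..t} s *\<^sub>R (coef e \<xi> c s * picard e \<xi> a b n c' s)) \<le> ?K * indicator {0..t} s" for s
  proof (cases "s \<in> {0..t}")
    case True
    then have "cmod (picard e \<xi> a b n c' s) \<le> (cmod a + cmod b) * (((1 + \<bar>\<xi>\<bar>) * s) ^ n / fact n)"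
      by (intro picard_bound) auto
    also have "\<dots> \<le> (cmod a + cmod b) * (((1 + \<bar>\<xi>\<bar>) * t) ^ n / fact n)"
      using True by (intro mult_left_mono divide_right_mono power_mono) auto
    finally have "cmod (coef e \<xi> c s) * cmod (picard e \<xi> a b n c' s) \<le> ?K"
      by (intro mult_mono coef_bound) auto
    then show ?thesis
      using True by (simp add: norm_mult)
  qed simp
  then show "AE s in lborel. norm (indicator {0..t} s *\<^sub>R (coef e \<xi> c s * picard e \<xi> a b n c' s)) \<le> norm (?K * indicator {0..t} s)"
    by (intro AE_I2) (metis order_trans abs_ge_self real_norm_def)
qed measurable

lemma set_integrable_linear_sol:
  "set_integrable lborel {0..t} (\<lambda>s. coef e \<xi> c s * linear_sol e \<xi> a b c' s)"
  unfolding set_integrable_def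
proof (rule Bochner_Integration.integrable_bound)
  let ?K = "(1 + \<bar>\<xi>\<bar>) * ((cmod a + cmod b) * exp ((1 + \<bar>\<xi>\<bar>) * t))"
  show "integrable lborel (\<lambda>s. ?K * indicator {0..t} s)"
    by (rule integrable_const_Icc)
  have "cmod (indicator {0..t} s *\<^sub>R (coef e \<xi> c s * linear_sol e \<xi> a b c' s)) \<le> ?K * indicator {0..t} s" for s
  proof (cases "s \<in> {0..t}")
    case True
    then have "cmod (coef e \<xi> c s) * cmod (linear_sol e \<xi> a b c' s) \<le> ?K"
      by (intro mult_mono coef_bound linear_sol_bound_uniform) auto
    then show ?thesis
      using True by (simp add: norm_mult)
  qed simp
  then show "AE s in lborel. norm (indicator {0..t} s *\<^sub>R (coef e \<xi> c s * linear_sol e \<xi> a b c' s)) \<le> norm (?K * indicator {0..t} s)"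
    by (intro AE_I2) (metis order_trans abs_ge_self real_norm_def)
qed measurable

text \<open>The series is integrated term by term, which shifts the index by one; the term with
  index 0 is the initial value. The integrals of the norms are summable by comparison with the
  exponential series.\<close>

lemma linear_sol_eq:
  assumes "0 \<le> t"
  shows "linear_sol e \<xi> a b c t =
    (if c then a else b) + (LINT s:{0..t}|lborel. coef e \<xi> c s * linear_sol e \<xi> a b (\<not> c) s)"
proof -
  let ?f = "\<lambda>n s. indicator {0..t} s *\<^sub>R (coef e \<xi> c s * picard e \<xi> a b n (\<not> c) s)"
  let ?k = "1 + \<bar>\<xi>\<bar>"
  have sumn: "summable (\<lambda>n. cmod (?f n s))" for s
    using picard_summable_norm[of s \<xi> a b "\<not> c"]
    by (cases "s \<in> {0..t}") (auto simp: norm_mult intro: summable_mult)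
  have "summable (\<lambda>n. LINT s|lborel. cmod (?f n s))"
  proof (rule summable_comparison_test)
    have "norm (LINT s|lborel. cmod (?f n s)) \<le> (?k * (cmod a + cmod b) * t) * ((?k * t) ^ n / fact n)" for n
    proof -
      have "cmod (?f n s) \<le> ?k * ((cmod a + cmod b) * ((?k * t) ^ n / fact n)) * indicator {0..t} s" for s
      proof (cases "s \<in> {0..t}")
        case True
        then have "cmod (picard e \<xi> a b n (\<not> c) s) \<le> (cmod a + cmod b) * ((?k * s) ^ n / fact n)"
          by (intro picard_bound) auto
        also have "\<dots> \<le> (cmod a + cmod b) * ((?k * t) ^ n / fact n)"
          using True by (intro mult_left_mono divide_right_mono power_mono) auto
        finally have "cmod (coef e \<xi> c s) * cmod (picard e \<xi> a b n (\<not> c) s) \<le> ?k * ((cmod a + cmod b) * ((?k * t) ^ n / fact n))"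
          by (intro mult_mono coef_bound) auto
        then show ?thesis
          using True by (simp add: norm_mult)
      qed simp
      then have "(LINT s|lborel. cmod (?f n s)) \<le> (LINT s|lborel. ?k * ((cmod a + cmod b) * ((?k * t) ^ n / fact n)) * indicator {0..t} s)"
        by (intro integral_mono integrable_norm integrable_picard integrable_const_Icc)
      also have "\<dots> = (?k * (cmod a + cmod b) * t) * ((?k * t) ^ n / fact n)"
        using assms by simp
      finally show ?thesis
        by simp
    qed
    then show "\<exists>N. \<forall>n\<ge>N. norm (LINT s|lborel. cmod (?f n s)) \<le> (?k * (cmod a + cmod b) * t) * ((?k * t) ^ n / fact n)"
      by blast
    show "summable (\<lambda>n. (?k * (cmod a + cmod b) * t) * ((?k * t) ^ n / fact n))"
      using summable_exp[of "?k * t"] by (intro summable_mult) (simp add: inverse_eq_divide)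
  qed
  then have "(LINT s|lborel. (\<Sum>n. ?f n s)) = (\<Sum>n. LINT s|lborel. ?f n s)"
    by (intro integral_suminf integrable_picard AE_I2 sumn)
  moreover have "(\<Sum>n. ?f n s) = indicator {0..t} s *\<^sub>R (coef e \<xi> c s * linear_sol e \<xi> a b (\<not> c) s)" for s
  proof (cases "s \<in> {0..t}")
    case True
    then have "summable (\<lambda>n. picard e \<xi> a b n (\<not> c) s)"
      by (intro summable_norm_cancel[OF picard_summable_norm]) auto
    then show ?thesis
      using True by (simp add: linear_sol_def suminf_mult)
  qed simp
  moreover have "linear_sol e \<xi> a b c t = (\<Sum>n. picard e \<xi> a b (Suc n) c t) + picard e \<xi> a b 0 c t"
    unfolding linear_sol_def
    using suminf_split_head[OF summable_norm_cancel[OF picard_summable_norm[OF assms, of \<xi> a b c]]] by simp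
  ultimately show ?thesis
    by (simp add: set_lebesgue_integral_def)
qed

lemma linear_sol_integral:
  assumes "0 \<le> t"
  shows "(\<lambda>s. coef e \<xi> c s * linear_sol e \<xi> a b c' s) integrable_on {0..t}"
    and "linear_sol e \<xi> a b c t =
      (if c then a else b) + integral {0..t} (\<lambda>s. coef e \<xi> c s * linear_sol e \<xi> a b (\<not> c) s)"
  using linear_sol_eq[OF assms] set_borel_integral_eq_integral[OF set_integrable_linear_sol[of t \<xi> c a b]]
  by auto

lemma linear_sol_0 [simp]: "linear_sol e \<xi> a b c 0 = (if c then a else b)"
  using linear_sol_integral(2)[of 0] by simp

lemma linear_sol_continuous: "continuous_on {0..T} (linear_sol e \<xi> a b c)"
proof -
  have "(\<lambda>s. coef e \<xi> c s * linear_sol e \<xi> a b (\<not> c) s) integrable_on {0..T}"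
    by (cases "0 \<le> T") (use linear_sol_integral(1) in auto)
  then have "continuous_on {0..T} (\<lambda>t. (if c then a else b) + integral {0..t} (\<lambda>s. coef e \<xi> c s * linear_sol e \<xi> a b (\<not> c) s))"
    by (intro continuous_intros indefinite_integral_continuous_1)
  then show ?thesis
    by (rule continuous_on_eq) (use linear_sol_integral(2) in auto)
qed

text \<open>The integral equation holds for measurable e; continuity of e upgrades it to a
  differential equation, as the product rules for second moments require.\<close>

lemma linear_sol_derivative:
  assumes "continuous_on {0..T} e" "t \<in> {0..T}"
  shows "(linear_sol e \<xi> a b c has_vector_derivative coef e \<xi> c t * linear_sol e \<xi> a b (\<not> c) t) (at t within {0..T})"
proof -
  have "continuous_on {0..T} (\<lambda>s. coef e \<xi> c s * linear_sol e \<xi> a b (\<not> c) s)"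
    unfolding coef_def by (cases c) (auto intro!: continuous_intros assms linear_sol_continuous)
  then have "((\<lambda>t. integral {0..t} (\<lambda>s. coef e \<xi> c s * linear_sol e \<xi> a b (\<not> c) s)) has_vector_derivative
      coef e \<xi> c t * linear_sol e \<xi> a b (\<not> c) t) (at t within {0..T})"
    using assms(2) by (rule integral_has_vector_derivative)
  then have "((\<lambda>t. (if c then a else b) + integral {0..t} (\<lambda>s. coef e \<xi> c s * linear_sol e \<xi> a b (\<not> c) s)) has_vector_derivative
      coef e \<xi> c t * linear_sol e \<xi> a b (\<not> c) t) (at t within {0..T})"
    by (auto intro!: derivative_eq_intros)
  then show ?thesis
    by (rule has_vector_derivative_transform[rotated 2]) (use assms linear_sol_integral(2) in auto)
qed

end

lemma unimodular_iexp:
  assumes "\<beta> \<in> borel_measurable borel"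
  shows "unimodular (\<lambda>s. iexp (l * \<beta> s))"
  by standard (use assms in \<open>auto simp: norm_exp_i_times simp del: of_real_mult\<close>)

section \<open>Evolution of exponential functionals\<close>

text \<open>From the mild to the integrated form. Taking exp (- m r) out of the Duhamel kernel
  leaves the indefinite integral of a continuous function, so f is differentiable with derivative g
  - m f. Differentiability of f is thus a conclusion.\<close>

lemma variation_of_constants:
  fixes f g :: "real \<Rightarrow> complex" and m :: real
  assumes g: "continuous_on {s..T} g"
    and f: "\<And>r. r \<in> {s..T} \<Longrightarrow>
      f r = of_real (exp (- m * (r - s))) * f s + (LINT q:{s..r}|lborel. of_real (exp (- m * (r - q))) * g q)"
    and r: "r \<in> {s..T}"
  shows "f r - f s = (LINT q:{s..r}|lborel. g q - of_real m * f q)"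
    and "continuous_on {s..T} f"
proof -
  let ?h = "\<lambda>q. of_real (exp (m * q)) * g q"
  define \<Phi> where "\<Phi> r = integral {s..r} ?h" for r
  have h: "continuous_on {s..T} ?h"
    by (intro continuous_intros g)
  have \<Phi>: "(\<Phi> has_vector_derivative ?h r) (at r within {s..T})" if "r \<in> {s..T}" for r
    unfolding \<Phi>_def by (rule integral_has_vector_derivative[OF h that])
  have f_eq: "f r = of_real (exp (- m * (r - s))) * f s + of_real (exp (- m * r)) * \<Phi> r" if r: "r \<in> {s..T}" for r
  proof -
    have "(LINT q:{s..r}|lborel. of_real (exp (- m * (r - q))) * g q)
       = (LINT q:{s..r}|lborel. of_real (exp (- m * r)) * ?h q)"
      by (rule set_lebesgue_integral_cong) (auto simp: algebra_simps simp flip: exp_add of_real_mult)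
    also have "\<dots> = of_real (exp (- m * r)) * (LINT q:{s..r}|lborel. ?h q)"
      by simp
    also have "(LINT q:{s..r}|lborel. ?h q) = \<Phi> r"
      unfolding \<Phi>_def using r
      by (intro set_borel_integral_eq_integral(2) borel_integrable_atLeastAtMost' continuous_on_subset[OF h]) auto
    finally show ?thesis
      using f[OF r] by simp
  qed
  have deriv: "(f has_vector_derivative g r - of_real m * f r) (at r within {s..T})" if r: "r \<in> {s..T}" for r
  proof -
    have e1: "((\<lambda>r. complex_of_real (exp (- m * (r - s)))) has_vector_derivative of_real (- m * exp (- m * (r - s)))) (at r within {s..T})"
      by (rule has_vector_derivative_of_real) (auto intro!: derivative_eq_intros)
    have e2: "((\<lambda>r. complex_of_real (exp (- m * r))) has_vector_derivative of_real (- m * exp (- m * r))) (at r within {s..T})"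
      by (rule has_vector_derivative_of_real) (auto intro!: derivative_eq_intros)
    have "((\<lambda>r. of_real (exp (- m * (r - s))) * f s + of_real (exp (- m * r)) * \<Phi> r) has_vector_derivative
      of_real (- m * exp (- m * (r - s))) * f s +
      (of_real (exp (- m * r)) * ?h r + of_real (- m * exp (- m * r)) * \<Phi> r)) (at r within {s..T})"
      by (intro has_vector_derivative_add has_vector_derivative_mult has_vector_derivative_mult_left e1 e2 \<Phi> r)
    moreover have "of_real (- m * exp (- m * (r - s))) * f s +
      (of_real (exp (- m * r)) * ?h r + of_real (- m * exp (- m * r)) * \<Phi> r) = g r - of_real m * f r"
    proof -
      have "complex_of_real (exp (- m * r)) * of_real (exp (m * r)) = 1"
        by (simp flip: of_real_mult exp_add)
      then have "of_real (exp (- m * r)) * ?h r = g r"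
        by (simp only: mult.assoc[symmetric]) simp
      then show ?thesis
        unfolding f_eq[OF r] by (simp add: algebra_simps)
    qed
    ultimately have "((\<lambda>r. of_real (exp (- m * (r - s))) * f s + of_real (exp (- m * r)) * \<Phi> r) has_vector_derivative
      g r - of_real m * f r) (at r within {s..T})"
      by (simp only:)
    then show ?thesis
      by (rule has_vector_derivative_transform[OF r, rotated]) (rule f_eq)
  qed
  show cont: "continuous_on {s..T} f"
    unfolding continuous_on_eq_continuous_within using has_vector_derivative_continuous[OF deriv] by blast
  have "((\<lambda>q. g q - of_real m * f q) has_integral f r - f s) {s..r}"
    using r by (intro fundamental_theorem_of_calculus has_vector_derivative_within_subset[OF deriv]) auto
  moreover have "set_integrable lborel {s..r} (\<lambda>q. g q - of_real m * f q)"
    using r by (intro borel_integrable_atLeastAtMost' continuous_intros continuous_on_subset[OF g] continuous_on_subset[OF cont]) auto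
  ultimately show "f r - f s = (LINT q:{s..r}|lborel. g q - of_real m * f q)"
    using set_borel_integral_eq_integral(2) integral_unique by metis
qed

section \<open>Expectations of time integrals\<close>

context prob_space
begin

lemma integrable_bounded_mult:
  fixes h Y :: "'a \<Rightarrow> complex"
  assumes h: "h \<in> borel_measurable M" "\<And>\<omega>. \<omega> \<in> space M \<Longrightarrow> cmod (h \<omega>) \<le> K" and Y: "integrable M Y"
  shows "integrable M (\<lambda>\<omega>. h \<omega> * Y \<omega>)"
proof (rule Bochner_Integration.integrable_bound)
  show "integrable M (\<lambda>\<omega>. K * cmod (Y \<omega>))"
    using Y by simp
  show "AE \<omega> in M. norm (h \<omega> * Y \<omega>) \<le> norm (K * cmod (Y \<omega>))"
    using h(2) by (intro AE_I2) (auto simp: norm_mult abs_mult intro!: mult_right_mono order_trans[OF _ abs_ge_self])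
qed (use h Y in auto)

text \<open>Fubini with majorant K |Y| on a bounded time interval: h is bounded, the weight Y merely
  integrable.\<close>

lemma expectation_time_integral:
  fixes h :: "real \<Rightarrow> 'a \<Rightarrow> complex" and Y :: "'a \<Rightarrow> complex"
  assumes h: "(\<lambda>(q, \<omega>). h q \<omega>) \<in> borel_measurable (borel \<Otimes>\<^sub>M M)"
    and bd: "\<And>q \<omega>. q \<in> {s..r} \<Longrightarrow> \<omega> \<in> space M \<Longrightarrow> cmod (h q \<omega>) \<le> K"
    and Y: "integrable M Y"
  shows "(LINT \<omega>|M. (LINT q:{s..r}|lborel. h q \<omega>) * Y \<omega>) = (LINT q:{s..r}|lborel. (LINT \<omega>|M. h q \<omega> * Y \<omega>))"
    and "set_integrable lborel {s..r} (\<lambda>q. (LINT \<omega>|M. h q \<omega> * Y \<omega>))"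
proof -
  interpret P: pair_sigma_finite lborel M ..
  let ?f = "\<lambda>q \<omega>. indicator {s..r} q *\<^sub>R (h q \<omega> * Y \<omega>)"
  have [measurable]: "(\<lambda>(q, \<omega>). h q \<omega>) \<in> borel_measurable (lborel \<Otimes>\<^sub>M M)"
    using h by (simp cong: measurable_cong_sets)
  have [measurable]: "Y \<in> borel_measurable M"
    using Y by auto
  have int: "integrable (lborel \<Otimes>\<^sub>M M) (\<lambda>(q, \<omega>). ?f q \<omega>)"
  proof (rule Bochner_Integration.integrable_bound)
    show "integrable (lborel \<Otimes>\<^sub>M M) (\<lambda>(q, \<omega>). K * indicator {s..r} q * cmod (Y \<omega>))"
    proof (rule P.Fubini_integrable)
      show "integrable lborel (\<lambda>q. LINT \<omega>|M. norm (case (q, \<omega>) of (q, \<omega>) \<Rightarrow> K * indicator {s..r} q * cmod (Y \<omega>)))"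
        using integrable_const_Icc[of "\<bar>K\<bar> * (LINT \<omega>|M. cmod (Y \<omega>))" s r] by (simp add: abs_mult mult_ac)
    qed (use Y in auto)
    show "AE p in lborel \<Otimes>\<^sub>M M. norm (case p of (q, \<omega>) \<Rightarrow> ?f q \<omega>)
        \<le> norm (case p of (q, \<omega>) \<Rightarrow> K * indicator {s..r} q * cmod (Y \<omega>))"
      using bd by (intro AE_I2) (auto simp: space_pair_measure norm_mult abs_mult indicator_def
          intro!: mult_right_mono order_trans[OF _ abs_ge_self])
  qed measurable
  have "(LINT \<omega>|M. (LINT q|lborel. ?f q \<omega>)) = (LINT q|lborel. (LINT \<omega>|M. ?f q \<omega>))"
    using P.Fubini_integral[OF int] .
  moreover have "(LINT q|lborel. ?f q \<omega>) = (LINT q:{s..r}|lborel. h q \<omega>) * Y \<omega>" for \<omega>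
  proof -
    have "?f q \<omega> = (indicator {s..r} q *\<^sub>R h q \<omega>) * Y \<omega>" for q
      by simp
    then show ?thesis
      unfolding set_lebesgue_integral_def by (simp only: integral_mult_left_zero)
  qed
  ultimately show "(LINT \<omega>|M. (LINT q:{s..r}|lborel. h q \<omega>) * Y \<omega>) = (LINT q:{s..r}|lborel. (LINT \<omega>|M. h q \<omega> * Y \<omega>))"
    by (simp add: set_lebesgue_integral_def)
  show "set_integrable lborel {s..r} (\<lambda>q. (LINT \<omega>|M. h q \<omega> * Y \<omega>))"
    using P.integrable_fst'[OF int] by (simp add: set_integrable_def)
qed

lemma continuous_on_expectation:
  fixes w :: "real \<Rightarrow> 'a \<Rightarrow> complex" and Y :: "'a \<Rightarrow> complex"
  assumes w: "\<And>q. q \<in> S \<Longrightarrow> w q \<in> borel_measurable M"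
    and bd: "\<And>q \<omega>. q \<in> S \<Longrightarrow> \<omega> \<in> space M \<Longrightarrow> cmod (w q \<omega>) \<le> K"
    and cont: "AE \<omega> in M. continuous_on S (\<lambda>q. w q \<omega>)"
    and Y: "integrable M Y"
  shows "continuous_on S (\<lambda>q. LINT \<omega>|M. w q \<omega> * Y \<omega>)"
  unfolding continuous_on_sequentially
proof (intro allI ballI impI, elim conjE)
  fix x :: "nat \<Rightarrow> real" and q assume x: "\<forall>n. x n \<in> S" "x \<longlonglongrightarrow> q" and q: "q \<in> S"
  have "(\<lambda>n. LINT \<omega>|M. w (x n) \<omega> * Y \<omega>) \<longlonglongrightarrow> (LINT \<omega>|M. w q \<omega> * Y \<omega>)"
  proof (rule integral_dominated_convergence)
    show "integrable M (\<lambda>\<omega>. K * cmod (Y \<omega>))"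
      using Y by simp
    show "AE \<omega> in M. (\<lambda>n. w (x n) \<omega> * Y \<omega>) \<longlonglongrightarrow> w q \<omega> * Y \<omega>"
      using cont
    proof eventually_elim
      case (elim \<omega>)
      then have "(\<lambda>n. w (x n) \<omega>) \<longlonglongrightarrow> w q \<omega>"
        using x q by (auto simp: continuous_on_sequentially o_def)
      then show ?case by (intro tendsto_intros)
    qed
    show "AE \<omega> in M. norm (w (x n) \<omega> * Y \<omega>) \<le> K * cmod (Y \<omega>)" for n
      using bd x(1) by (intro AE_I2) (auto simp: norm_mult intro!: mult_right_mono)
  qed (use w x q Y in auto)
  then show "((\<lambda>q. LINT \<omega>|M. w q \<omega> * Y \<omega>) \<circ> x) \<longlonglongrightarrow> (LINT \<omega>|M. w q \<omega> * Y \<omega>)"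
    by (simp add: o_def)
qed

end

context brownian_motion
begin

lemma W_measurable [measurable]: "0 \<le> t \<Longrightarrow> W t \<in> borel_measurable M"
  using W_adapted adapted_measurable by blast

lemma W_path_measurable: "\<omega> \<in> space M \<Longrightarrow> (\<lambda>s. W s \<omega>) \<in> borel_measurable borel"
  using measurable_compose[OF measurable_Pair2' W_joint] by simp

text \<open>The quotient of the two phases is the phase of the increment of B, up to the null set on
  which \<open>W\<close> and B differ.\<close>

lemma W_char_mult:
  fixes X :: "'a \<Rightarrow> complex"
  assumes st: "0 \<le> s" "s \<le> t" and X: "X \<in> borel_measurable (F s)" "integrable M X"
  shows "(LINT \<omega>|M. iexp (l * W t \<omega>) * cnj (iexp (l * W s \<omega>)) * X \<omega>) = of_real (exp (- l\<^sup>2 / 2 * (t - s))) * (LINT \<omega>|M. X \<omega>)"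
proof -
  have [measurable]: "B t \<in> borel_measurable M" "B s \<in> borel_measurable M" "W t \<in> borel_measurable M" "W s \<in> borel_measurable M" "X \<in> borel_measurable M"
    using st X by auto
  have "(LINT \<omega>|M. iexp (l * W t \<omega>) * cnj (iexp (l * W s \<omega>)) * X \<omega>) = (LINT \<omega>|M. X \<omega> * iexp (l * (B t \<omega> - B s \<omega>)))"
  proof (rule integral_cong_AE)
    show "AE \<omega> in M. iexp (l * W t \<omega>) * cnj (iexp (l * W s \<omega>)) * X \<omega> = X \<omega> * iexp (l * (B t \<omega> - B s \<omega>))"
      using W_eq_B
    proof eventually_elim
      case (elim \<omega>)
      then have "iexp (l * W t \<omega>) * cnj (iexp (l * W s \<omega>)) = iexp (l * (B t \<omega> - B s \<omega>))"
        using st by (simp add: exp_cnj algebra_simps flip: exp_add)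
      then show ?case by simp
    qed
  qed measurable
  then show ?thesis
    using increment_char_mult[OF st X] by simp
qed

lemma cmod_cnj_iexp [simp]: "cmod (cnj (iexp x)) = 1"
  by (simp only: complex_mod_cnj norm_exp_i_times)

text \<open>Ito's formula in expectation for exp (i l W) p, where p has density cnj (exp (i l W)) w.
  Writing p r as p s plus an integral over q, each phase from q to r averages out to exp (- l^2 (r -
  q) / 2), because w q Y is known at time q. This gives the Duhamel formula, and
  \<open>variation_of_constants\<close> turns it into the integrated equation. The weight Y, any
  integrable variable of the past of s, makes it a statement about conditional expectations; Y = 1
  gives the moment system.\<close>

theorem exp_evolution:
  fixes p w :: "real \<Rightarrow> 'a \<Rightarrow> complex" and Y :: "'a \<Rightarrow> complex"
  assumes s: "0 \<le> s" and r: "r \<in> {s..T}"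
    and w_joint: "(\<lambda>(q, \<omega>). w q \<omega>) \<in> borel_measurable (borel \<Otimes>\<^sub>M M)"
    and w_ad: "\<And>q. q \<in> {s..T} \<Longrightarrow> w q \<in> borel_measurable (F q)"
    and w_bd: "\<And>q \<omega>. q \<in> {s..T} \<Longrightarrow> \<omega> \<in> space M \<Longrightarrow> cmod (w q \<omega>) \<le> K"
    and w_cont: "AE \<omega> in M. continuous_on {s..T} (\<lambda>q. w q \<omega>)"
    and p_ad: "\<And>q. q \<in> {s..T} \<Longrightarrow> p q \<in> borel_measurable (F q)"
    and p_bd: "\<And>\<omega>. \<omega> \<in> space M \<Longrightarrow> cmod (p s \<omega>) \<le> K'"
    and p_eq: "AE \<omega> in M. \<forall>r\<in>{s..T}. p r \<omega> = p s \<omega> + (LINT q:{s..r}|lborel. cnj (iexp (l * W q \<omega>)) * w q \<omega>)"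
    and Y: "Y \<in> borel_measurable (F s)" "integrable M Y"
  shows "(LINT \<omega>|M. iexp (l * W r \<omega>) * p r \<omega> * Y \<omega>) - (LINT \<omega>|M. iexp (l * W s \<omega>) * p s \<omega> * Y \<omega>)
    = (LINT q:{s..r}|lborel. (LINT \<omega>|M. w q \<omega> * Y \<omega>) - of_real (l\<^sup>2 / 2) * (LINT \<omega>|M. iexp (l * W q \<omega>) * p q \<omega> * Y \<omega>))"
    and "(LINT \<omega>|M. iexp (l * W r \<omega>) * p r \<omega> * Y \<omega>) =
      of_real (exp (- (l\<^sup>2 / 2) * (r - s))) * (LINT \<omega>|M. iexp (l * W s \<omega>) * p s \<omega> * Y \<omega>)
      + (LINT q:{s..r}|lborel. of_real (exp (- (l\<^sup>2 / 2) * (r - q))) * (LINT \<omega>|M. w q \<omega> * Y \<omega>))"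
    and "continuous_on {s..T} (\<lambda>r. LINT \<omega>|M. iexp (l * W r \<omega>) * p r \<omega> * Y \<omega>)"
proof -
  define f where "f r = (LINT \<omega>|M. iexp (l * W r \<omega>) * p r \<omega> * Y \<omega>)" for r
  define g where "g q = (LINT \<omega>|M. w q \<omega> * Y \<omega>)" for q
  have [measurable]: "Y \<in> borel_measurable M"
    using Y(2) by auto
  have g: "continuous_on {s..T} g"
    unfolding g_def
  proof (rule continuous_on_expectation[OF _ w_bd w_cont Y(2)])
    show "w q \<in> borel_measurable M" if "q \<in> {s..T}" for q
      using adapted_measurable[OF w_ad[OF that]] that s by simp
  qed
  have f: "f r = of_real (exp (- (l\<^sup>2 / 2) * (r - s))) * f s + (LINT q:{s..r}|lborel. of_real (exp (- (l\<^sup>2 / 2) * (r - q))) * g q)"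
    if r: "r \<in> {s..T}" for r
  proof -
    have r0: "0 \<le> r" "s \<le> r"
      using r s by auto
    let ?h = "\<lambda>q \<omega>. iexp (l * W r \<omega>) * (cnj (iexp (l * W q \<omega>)) * w q \<omega>)"
    have ps [measurable]: "p s \<in> borel_measurable M" and pr [measurable]: "p r \<in> borel_measurable M"
      using adapted_measurable[OF p_ad] r s by auto
    have [measurable]: "W r \<in> borel_measurable M" "W s \<in> borel_measurable M"
      using r0 s by auto
    have h: "(\<lambda>(q, \<omega>). ?h q \<omega>) \<in> borel_measurable (borel \<Otimes>\<^sub>M M)"
    proof -
      have [measurable]: "(\<lambda>p. W (fst p) (snd p)) \<in> borel_measurable (borel \<Otimes>\<^sub>M M)"
        "(\<lambda>p. w (fst p) (snd p)) \<in> borel_measurable (borel \<Otimes>\<^sub>M M)"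
        using W_joint w_joint by (simp_all add: case_prod_beta')
      show ?thesis
        unfolding case_prod_beta' by measurable
    qed
    have hb: "cmod (?h q \<omega>) \<le> K" if "q \<in> {s..r}" "\<omega> \<in> space M" for q \<omega>
      using w_bd[of q \<omega>] that r by (simp only: norm_mult norm_exp_i_times cmod_cnj_iexp mult_1) auto
    have sec: "(\<lambda>q. ?h q \<omega>) \<in> borel_measurable borel" if "\<omega> \<in> space M" for \<omega>
      using measurable_compose[OF measurable_Pair2'[OF that] h] by simp
    have "integrable M (\<lambda>\<omega>. iexp (l * W r \<omega>) * p s \<omega> * Y \<omega>)"
      using p_bd by (intro integrable_bounded_mult[where K = K'] Y(2)) (auto simp: norm_mult simp del: of_real_mult)
    moreover have "integrable M (\<lambda>\<omega>. (LINT q:{s..r}|lborel. ?h q \<omega>) * Y \<omega>)"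
    proof (rule integrable_bounded_mult[OF _ _ Y(2)])
      show "(\<lambda>\<omega>. LINT q:{s..r}|lborel. ?h q \<omega>) \<in> borel_measurable M"
      proof -
        have [measurable]: "(\<lambda>(q, \<omega>). ?h q \<omega>) \<in> borel_measurable (lborel \<Otimes>\<^sub>M M)"
          using h by (simp cong: measurable_cong_sets)
        have "(\<lambda>(\<omega>, q). indicator {s..r} q *\<^sub>R ?h q \<omega>) \<in> borel_measurable (M \<Otimes>\<^sub>M lborel)"
        proof -
          have "(\<lambda>p. indicator {s..r} (fst p) *\<^sub>R (case p of (q, \<omega>) \<Rightarrow> ?h q \<omega>)) \<in> borel_measurable (lborel \<Otimes>\<^sub>M M)"
            by measurable
          from measurable_pair_swap[OF this] show ?thesis
            by (simp only: fst_conv prod.case)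
        qed
        then show ?thesis
          unfolding set_lebesgue_integral_def by (rule lborel.borel_measurable_lebesgue_integral)
      qed
      show "cmod (LINT q:{s..r}|lborel. ?h q \<omega>) \<le> (LINT q|lborel. K * indicator {s..r} q)" if "\<omega> \<in> space M" for \<omega>
        unfolding set_lebesgue_integral_def
        by (rule order_trans[OF integral_norm_bound], rule integral_mono'[OF integrable_const_Icc])
          (use hb[OF _ that] order_trans[OF norm_ge_zero hb[OF _ that]] in \<open>auto simp: indicator_def\<close>)
    qed
    moreover have "f r = (LINT \<omega>|M. iexp (l * W r \<omega>) * p s \<omega> * Y \<omega> + (LINT q:{s..r}|lborel. ?h q \<omega>) * Y \<omega>)"
      unfolding f_def
    proof (rule integral_cong_AE)
      show "AE \<omega> in M. iexp (l * W r \<omega>) * p r \<omega> * Y \<omega> = iexp (l * W r \<omega>) * p s \<omega> * Y \<omega> + (LINT q:{s..r}|lborel. ?h q \<omega>) * Y \<omega>"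
        using p_eq
      proof eventually_elim
        case (elim \<omega>)
        have "(LINT q:{s..r}|lborel. ?h q \<omega>) = iexp (l * W r \<omega>) * (LINT q:{s..r}|lborel. cnj (iexp (l * W q \<omega>)) * w q \<omega>)"
          by (rule set_integral_mult_right)
        moreover have "p r \<omega> = p s \<omega> + (LINT q:{s..r}|lborel. cnj (iexp (l * W q \<omega>)) * w q \<omega>)"
          using elim r by blast
        ultimately show ?case
          by (simp only: distrib_left distrib_right)
      qed
      show "(\<lambda>\<omega>. iexp (l * W r \<omega>) * p r \<omega> * Y \<omega>) \<in> borel_measurable M"
        by measurable
      show "(\<lambda>\<omega>. iexp (l * W r \<omega>) * p s \<omega> * Y \<omega> + (LINT q:{s..r}|lborel. ?h q \<omega>) * Y \<omega>) \<in> borel_measurable M"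
        by (intro borel_measurable_integrable Bochner_Integration.integrable_add calculation)
    qed
    ultimately have "f r = (LINT \<omega>|M. iexp (l * W r \<omega>) * p s \<omega> * Y \<omega>) + (LINT \<omega>|M. (LINT q:{s..r}|lborel. ?h q \<omega>) * Y \<omega>)"
      by (simp only: Bochner_Integration.integral_add)
    moreover have "(LINT \<omega>|M. (LINT q:{s..r}|lborel. ?h q \<omega>) * Y \<omega>) = (LINT q:{s..r}|lborel. (LINT \<omega>|M. ?h q \<omega> * Y \<omega>))"
      by (rule expectation_time_integral(1)[OF h hb Y(2)])
    moreover have "(LINT q:{s..r}|lborel. (LINT \<omega>|M. ?h q \<omega> * Y \<omega>)) = (LINT q:{s..r}|lborel. of_real (exp (- (l\<^sup>2 / 2) * (r - q))) * g q)"
    proof (rule set_lebesgue_integral_cong)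
      show "\<forall>q. q \<in> {s..r} \<longrightarrow> (LINT \<omega>|M. ?h q \<omega> * Y \<omega>) = of_real (exp (- (l\<^sup>2 / 2) * (r - q))) * g q"
      proof (intro allI impI)
        fix q assume q: "q \<in> {s..r}"
        have wq: "w q \<in> borel_measurable (F q)"
          using w_ad q r by auto
        have "(\<lambda>\<omega>. w q \<omega> * Y \<omega>) \<in> borel_measurable (F q)"
          using q by (intro borel_measurable_times wq adapted_mono[OF Y(1)]) auto
        moreover have "integrable M (\<lambda>\<omega>. w q \<omega> * Y \<omega>)"
          using q r s w_bd by (intro integrable_bounded_mult[where K = K] Y(2) adapted_measurable[OF wq]) auto
        ultimately have "(LINT \<omega>|M. iexp (l * W r \<omega>) * cnj (iexp (l * W q \<omega>)) * (w q \<omega> * Y \<omega>)) = of_real (exp (- l\<^sup>2 / 2 * (r - q))) * g q"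
          unfolding g_def using q s by (intro W_char_mult) auto
        then show "(LINT \<omega>|M. ?h q \<omega> * Y \<omega>) = of_real (exp (- (l\<^sup>2 / 2) * (r - q))) * g q"
          by (simp only: mult.assoc minus_divide_left)
      qed
    qed auto
    \<comment> \<open>Inserting cnj (exp (i l W s)) exp (i l W s) = 1 separates the phase of the
      increment from a variable known at time s.\<close>
    moreover have "(LINT \<omega>|M. iexp (l * W r \<omega>) * p s \<omega> * Y \<omega>) = of_real (exp (- (l\<^sup>2 / 2) * (r - s))) * f s"
    proof -
      have [measurable]: "W s \<in> borel_measurable (F s)" "p s \<in> borel_measurable (F s)" "Y \<in> borel_measurable (F s)"
        using W_adapted[OF s] p_ad[of s] Y(1) r by auto
      have m: "(\<lambda>\<omega>. iexp (l * W s \<omega>) * p s \<omega> * Y \<omega>) \<in> borel_measurable (F s)"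
        by measurable
      have i: "integrable M (\<lambda>\<omega>. iexp (l * W s \<omega>) * p s \<omega> * Y \<omega>)"
        using p_bd by (intro integrable_bounded_mult[where K = K'] Y(2)) (auto simp: norm_mult simp del: of_real_mult)
      have "(LINT \<omega>|M. iexp (l * W r \<omega>) * cnj (iexp (l * W s \<omega>)) * (iexp (l * W s \<omega>) * p s \<omega> * Y \<omega>)) = of_real (exp (- l\<^sup>2 / 2 * (r - s))) * f s"
        unfolding f_def using r by (intro W_char_mult s m i) auto
      moreover have "iexp (l * W r \<omega>) * cnj (iexp (l * W s \<omega>)) * (iexp (l * W s \<omega>) * p s \<omega> * Y \<omega>) = iexp (l * W r \<omega>) * p s \<omega> * Y \<omega>" for \<omega>
      proof -
        have "cnj (iexp (l * W s \<omega>)) * iexp (l * W s \<omega>) = 1"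
          by (simp add: exp_cnj flip: exp_add)
        moreover have "x * y * (z * b * c) = x * (y * z) * b * c" for x y z b c :: complex
          by (simp only: mult.assoc)
        ultimately show ?thesis
          by (simp only: mult_1_right)
      qed
      ultimately show ?thesis
        by (simp only: minus_divide_left)
    qed
    ultimately show ?thesis
      by (simp only:)
  qed
  note v = variation_of_constants[of s T g f "l\<^sup>2 / 2", OF g f r]
  show "(LINT \<omega>|M. iexp (l * W r \<omega>) * p r \<omega> * Y \<omega>) - (LINT \<omega>|M. iexp (l * W s \<omega>) * p s \<omega> * Y \<omega>)
    = (LINT q:{s..r}|lborel. (LINT \<omega>|M. w q \<omega> * Y \<omega>) - of_real (l\<^sup>2 / 2) * (LINT \<omega>|M. iexp (l * W q \<omega>) * p q \<omega> * Y \<omega>))"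
    using v(1) unfolding f_def g_def .
  show "continuous_on {s..T} (\<lambda>r. LINT \<omega>|M. iexp (l * W r \<omega>) * p r \<omega> * Y \<omega>)"
    using v(2) unfolding f_def g_def .
  show "(LINT \<omega>|M. iexp (l * W r \<omega>) * p r \<omega> * Y \<omega>) =
      of_real (exp (- (l\<^sup>2 / 2) * (r - s))) * (LINT \<omega>|M. iexp (l * W s \<omega>) * p s \<omega> * Y \<omega>)
      + (LINT q:{s..r}|lborel. of_real (exp (- (l\<^sup>2 / 2) * (r - q))) * (LINT \<omega>|M. w q \<omega> * Y \<omega>))"
    using f[OF r] unfolding f_def g_def .
qed

end

section \<open>The mode process\<close>

lemma (in unimodular) linear_sol_increment:
  assumes "0 \<le> s" "s \<le> r"
  shows "linear_sol e \<xi> a b c r = linear_sol e \<xi> a b c s + (LINT q:{s..r}|lborel. coef e \<xi> c q * linear_sol e \<xi> a b (\<not> c) q)"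
proof -
  let ?f = "\<lambda>q. coef e \<xi> c q * linear_sol e \<xi> a b (\<not> c) q"
  have "integral {0..s} ?f + integral {s..r} ?f = integral {0..r} ?f"
    using assms by (intro Henstock_Kurzweil_Integration.integral_combine linear_sol_integral(1)) auto
  moreover have "(LINT q:{s..r}|lborel. ?f q) = integral {s..r} ?f"
    using assms by (intro set_borel_integral_eq_integral(2) set_integrable_subset[OF set_integrable_linear_sol[of r]]) auto
  ultimately show ?thesis
    using linear_sol_integral(2)[of s \<xi> a b c] linear_sol_integral(2)[of r \<xi> a b c] assms by simp
qed

lemma cmod_add_square: "(cmod (x + y))\<^sup>2 = (cmod x)\<^sup>2 + (cmod y)\<^sup>2 + 2 * Re (y * cnj x)"
  unfolding cmod_power2 by (simp add: power2_eq_square algebra_simps)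

lemma cmod_mult_le_squares: "cmod (x * y) \<le> (cmod x)\<^sup>2 + (cmod y)\<^sup>2"
proof -
  have "2 * cmod x * cmod y \<le> (cmod x)\<^sup>2 + (cmod y)\<^sup>2"
    by (rule sum_squares_bound)
  moreover have "0 \<le> cmod x * cmod y"
    by simp
  ultimately show ?thesis
    unfolding norm_mult by linarith
qed

lemma integrable_mult_squares:
  fixes X Y :: "'a \<Rightarrow> complex"
  assumes "X \<in> borel_measurable M" "Y \<in> borel_measurable M"
    and "integrable M (\<lambda>\<omega>. (cmod (X \<omega>))\<^sup>2)" "integrable M (\<lambda>\<omega>. (cmod (Y \<omega>))\<^sup>2)"
  shows "integrable M (\<lambda>\<omega>. X \<omega> * Y \<omega>)"
proof (rule Bochner_Integration.integrable_bound)
  show "integrable M (\<lambda>\<omega>. (cmod (X \<omega>))\<^sup>2 + (cmod (Y \<omega>))\<^sup>2)"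
    using assms by simp
  show "AE \<omega> in M. norm (X \<omega> * Y \<omega>) \<le> norm ((cmod (X \<omega>))\<^sup>2 + (cmod (Y \<omega>))\<^sup>2)"
    using cmod_mult_le_squares by (intro AE_I2) (auto intro: order_trans[OF _ abs_ge_self])
qed (use assms in auto)

lemma (in finite_measure) integrable_of_square:
  fixes Y :: "'a \<Rightarrow> complex"
  assumes "Y \<in> borel_measurable M" "integrable M (\<lambda>\<omega>. (cmod (Y \<omega>))\<^sup>2)"
  shows "integrable M Y"
  using integrable_mult_squares[of "\<lambda>_. 1" M Y] assms by simp

context brownian_motion
begin

text \<open>Pythagoras for martingale differences: the cross term of the last summand with the
  earlier ones vanishes because the conjugate of the partial sum is a square integrable past
  variable. It serves both the residuals of the mode equation and the isometry for simple
  integrands.\<close>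

lemma orthogonal_sum:
  fixes D :: "nat \<Rightarrow> 'a \<Rightarrow> complex"
  assumes \<tau>: "0 \<le> \<tau> 0" "\<And>i. i < n \<Longrightarrow> \<tau> i \<le> \<tau> (Suc i)"
    and ad: "\<And>i. i < n \<Longrightarrow> D i \<in> borel_measurable (F (\<tau> (Suc i)))"
    and sq: "\<And>i. i < n \<Longrightarrow> integrable M (\<lambda>\<omega>. (cmod (D i \<omega>))\<^sup>2)"
    and mart: "\<And>i Y. i < n \<Longrightarrow> Y \<in> borel_measurable (F (\<tau> i)) \<Longrightarrow> integrable M (\<lambda>\<omega>. (cmod (Y \<omega>))\<^sup>2) \<Longrightarrow>
      (LINT \<omega>|M. D i \<omega> * Y \<omega>) = 0"
  shows "0 \<le> \<tau> n \<and> (\<lambda>\<omega>. \<Sum>i<n. D i \<omega>) \<in> borel_measurable (F (\<tau> n)) \<and>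
    integrable M (\<lambda>\<omega>. (cmod (\<Sum>i<n. D i \<omega>))\<^sup>2) \<and>
    (LINT \<omega>|M. (cmod (\<Sum>i<n. D i \<omega>))\<^sup>2) = (\<Sum>i<n. LINT \<omega>|M. (cmod (D i \<omega>))\<^sup>2)"
  using \<tau>(2) ad sq mart
proof (induction n)
  case 0
  then show ?case using \<tau>(1) by simp
next
  case (Suc n)
  let ?S = "\<lambda>\<omega>. \<Sum>i<n. D i \<omega>"
  have IH: "0 \<le> \<tau> n" "?S \<in> borel_measurable (F (\<tau> n))" "integrable M (\<lambda>\<omega>. (cmod (?S \<omega>))\<^sup>2)"
    "(LINT \<omega>|M. (cmod (?S \<omega>))\<^sup>2) = (\<Sum>i<n. LINT \<omega>|M. (cmod (D i \<omega>))\<^sup>2)"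
    using Suc.IH Suc.prems by (simp_all add: less_Suc_eq)
  have le: "\<tau> n \<le> \<tau> (Suc n)"
    using Suc.prems(1) by simp
  have D: "D n \<in> borel_measurable (F (\<tau> (Suc n)))" "integrable M (\<lambda>\<omega>. (cmod (D n \<omega>))\<^sup>2)"
    using Suc.prems by auto
  have [measurable]: "?S \<in> borel_measurable M" "D n \<in> borel_measurable M"
    using adapted_measurable[OF IH(2,1)] adapted_measurable[OF D(1)] IH(1) le by auto
  have cS: "(\<lambda>\<omega>. cnj (?S \<omega>)) \<in> borel_measurable (F (\<tau> n))" "integrable M (\<lambda>\<omega>. (cmod (cnj (?S \<omega>)))\<^sup>2)"
    using IH(2,3) by (auto simp del: cnj_sum)
  have zero: "(LINT \<omega>|M. D n \<omega> * cnj (?S \<omega>)) = 0"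
    by (rule Suc.prems(4)[OF _ cS]) simp
  have int: "integrable M (\<lambda>\<omega>. D n \<omega> * cnj (?S \<omega>))"
    using D cS(2) by (intro integrable_mult_squares) (auto simp del: cnj_sum)
  have eq: "(cmod (\<Sum>i<Suc n. D i \<omega>))\<^sup>2 = (cmod (?S \<omega>))\<^sup>2 + (cmod (D n \<omega>))\<^sup>2 + 2 * Re (D n \<omega> * cnj (?S \<omega>))" for \<omega>
    unfolding sum.lessThan_Suc by (rule cmod_add_square)
  note intR = integrable_Re[OF int]
  have "(LINT \<omega>|M. Re (D n \<omega> * cnj (?S \<omega>))) = 0"
    by (simp only: integral_Re[OF int] zero) simp
  moreover have "(LINT \<omega>|M. f \<omega> + g \<omega> + 2 * h \<omega>) = (LINT \<omega>|M. f \<omega>) + (LINT \<omega>|M. g \<omega>) + 2 * (LINT \<omega>|M. h \<omega>)"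
    if "integrable M f" "integrable M g" "integrable M h" for f g h :: "'a \<Rightarrow> real"
    using that by simp
  from this[OF IH(3) D(2) intR] have "(LINT \<omega>|M. (cmod (\<Sum>i<Suc n. D i \<omega>))\<^sup>2) =
      (LINT \<omega>|M. (cmod (?S \<omega>))\<^sup>2) + (LINT \<omega>|M. (cmod (D n \<omega>))\<^sup>2) + 2 * (LINT \<omega>|M. Re (D n \<omega> * cnj (?S \<omega>)))"
    unfolding eq .
  ultimately have "(LINT \<omega>|M. (cmod (\<Sum>i<Suc n. D i \<omega>))\<^sup>2) = (\<Sum>i<Suc n. LINT \<omega>|M. (cmod (D i \<omega>))\<^sup>2)"
    by (simp only: IH(4) sum.lessThan_Suc mult_zero_right add_0_right)
  moreover have "integrable M (\<lambda>\<omega>. (cmod (\<Sum>i<Suc n. D i \<omega>))\<^sup>2)"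
    unfolding eq by (intro Bochner_Integration.integrable_add integrable_mult_right IH(3) D(2) intR)
  moreover have "(\<lambda>\<omega>. \<Sum>i<Suc n. D i \<omega>) \<in> borel_measurable (F (\<tau> (Suc n)))"
    unfolding sum.lessThan_Suc by (intro borel_measurable_add D adapted_mono[OF IH(2) le])
  ultimately show ?case
    using IH(1) le by simp
qed

section \<open>The explicit solution of one mode: measurability, bounds, continuity\<close>

definition mode_lin :: "real \<Rightarrow> real \<Rightarrow> complex \<Rightarrow> complex \<Rightarrow> bool \<Rightarrow> real \<Rightarrow> 'a \<Rightarrow> complex" where
  "mode_lin \<sigma> \<xi> a b c t \<omega> = linear_sol (\<lambda>s. iexp (\<sigma> * \<xi> * W s \<omega>)) \<xi> a b c t"

definition mode_u :: "real \<Rightarrow> real \<Rightarrow> complex \<Rightarrow> complex \<Rightarrow> real \<Rightarrow> 'a \<Rightarrow> complex" where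
  "mode_u \<sigma> \<xi> a b t \<omega> = iexp (\<sigma> * \<xi> * W t \<omega>) * mode_lin \<sigma> \<xi> a b True t \<omega>"

lemma unimodular_W: "\<omega> \<in> space M \<Longrightarrow> unimodular (\<lambda>s. iexp (l * W s \<omega>))"
  by (rule unimodular_iexp[OF W_path_measurable])

lemma mode_lin_joint:
  assumes [measurable]: "a \<in> borel_measurable borel" "b \<in> borel_measurable borel"
  shows "(\<lambda>(t, \<omega>, \<xi>). mode_lin \<sigma> \<xi> (a \<xi>) (b \<xi>) c t \<omega>) \<in> borel_measurable (borel \<Otimes>\<^sub>M (M \<Otimes>\<^sub>M borel))"
proof -
  have [measurable]: "(\<lambda>p. W (fst p) (snd p)) \<in> borel_measurable (borel \<Otimes>\<^sub>M M)"
    using W_joint by (simp add: case_prod_beta')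
  have "(\<lambda>p. (fst p, fst (snd p))) \<in> measurable (borel \<Otimes>\<^sub>M (M \<Otimes>\<^sub>M (borel :: real measure))) (borel \<Otimes>\<^sub>M M)"
    by measurable
  from measurable_compose[OF this, of "\<lambda>p. W (fst p) (snd p)" borel]
  have [measurable]: "(\<lambda>p. W (fst p) (fst (snd p))) \<in> borel_measurable (borel \<Otimes>\<^sub>M (M \<Otimes>\<^sub>M (borel :: real measure)))"
    by simp
  have "(\<lambda>(t, x). linear_sol (\<lambda>s. iexp (\<sigma> * snd x * W s (fst x))) (snd x) (a (snd x)) (b (snd x)) c t)
      \<in> borel_measurable (borel \<Otimes>\<^sub>M (M \<Otimes>\<^sub>M borel))"
    by (rule linear_sol_joint) (unfold case_prod_beta', measurable)
  then show ?thesis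
    by (simp add: mode_lin_def case_prod_beta')
qed

text \<open>Stopping the driving path at t makes the whole coefficient known at time t, and by
  causality the solution up to t is unchanged.\<close>

lemma mode_lin_progressive:
  assumes t: "0 \<le> t" and [measurable]: "a \<in> borel_measurable borel" "b \<in> borel_measurable borel"
  shows "(\<lambda>(s, \<omega>, \<xi>). mode_lin \<sigma> \<xi> (a \<xi>) (b \<xi>) c (min s t) \<omega>) \<in> borel_measurable (borel \<Otimes>\<^sub>M (F t \<Otimes>\<^sub>M borel))"
proof -
  let ?N = "F t \<Otimes>\<^sub>M (borel :: real measure)"
  have [measurable]: "(\<lambda>p. W (min (fst p) t) (snd p)) \<in> borel_measurable (borel \<Otimes>\<^sub>M F t)"
    using W_progressive[OF t] by (simp add: case_prod_beta')
  have "(\<lambda>p. (fst p, fst (snd p))) \<in> measurable (borel \<Otimes>\<^sub>M ?N) (borel \<Otimes>\<^sub>M F t)"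
    by measurable
  from measurable_compose[OF this, of "\<lambda>p. W (min (fst p) t) (snd p)" borel]
  have [measurable]: "(\<lambda>p. W (min (fst p) t) (fst (snd p))) \<in> borel_measurable (borel \<Otimes>\<^sub>M ?N)"
    by simp
  have l: "(\<lambda>(s, x). linear_sol (\<lambda>s. iexp (\<sigma> * snd x * W (min s t) (fst x))) (snd x) (a (snd x)) (b (snd x)) c s)
      \<in> borel_measurable (borel \<Otimes>\<^sub>M ?N)"
    by (rule linear_sol_joint) (unfold case_prod_beta', measurable)
  have "(\<lambda>p. (min (fst p) t, snd p)) \<in> measurable (borel \<Otimes>\<^sub>M ?N) (borel \<Otimes>\<^sub>M ?N)"
    by measurable
  from measurable_compose[OF this l]
  have "(\<lambda>p. linear_sol (\<lambda>s. iexp (\<sigma> * snd (snd p) * W (min s t) (fst (snd p)))) (snd (snd p)) (a (snd (snd p))) (b (snd (snd p))) c (min (fst p) t))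
      \<in> borel_measurable (borel \<Otimes>\<^sub>M ?N)"
    by simp
  moreover have "linear_sol (\<lambda>s. iexp (\<sigma> * \<xi> * W (min s t) \<omega>)) \<xi> a' b' c (min s' t) = mode_lin \<sigma> \<xi> a' b' c (min s' t) \<omega>" for \<xi> \<omega> a' b' s'
    unfolding mode_lin_def by (rule linear_sol_cong[where T = t]) (auto simp: min_def)
  ultimately show ?thesis
    by (simp only: case_prod_beta')
qed

lemma mode_lin_adapted_joint:
  assumes "0 \<le> t" "a \<in> borel_measurable borel" "b \<in> borel_measurable borel"
  shows "(\<lambda>(\<omega>, \<xi>). mode_lin \<sigma> \<xi> (a \<xi>) (b \<xi>) c t \<omega>) \<in> borel_measurable (F t \<Otimes>\<^sub>M borel)"
proof -
  have "(\<lambda>p. (t, p)) \<in> measurable (F t \<Otimes>\<^sub>M borel) (borel \<Otimes>\<^sub>M (F t \<Otimes>\<^sub>M (borel :: real measure)))"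
    by measurable
  from measurable_compose[OF this mode_lin_progressive[OF assms]] show ?thesis
    by (simp add: case_prod_beta')
qed

lemma mode_lin_adapted:
  assumes "0 \<le> t"
  shows "mode_lin \<sigma> \<xi> a b c t \<in> borel_measurable (F t)"
  using measurable_compose[OF measurable_Pair2' mode_lin_adapted_joint[OF assms, of "\<lambda>_. a" "\<lambda>_. b"], of \<xi>]
  by simp

lemma mode_lin_progressive1:
  assumes "0 \<le> t"
  shows "(\<lambda>(s, \<omega>). mode_lin \<sigma> \<xi> a b c (min s t) \<omega>) \<in> borel_measurable (borel \<Otimes>\<^sub>M F t)"
proof -
  have "(\<lambda>p. (fst p, snd p, \<xi>)) \<in> measurable (borel \<Otimes>\<^sub>M F t) (borel \<Otimes>\<^sub>M (F t \<Otimes>\<^sub>M (borel :: real measure)))"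
    by measurable
  from measurable_compose[OF this mode_lin_progressive[OF assms, of "\<lambda>_. a" "\<lambda>_. b" \<sigma> c]] show ?thesis
    by (simp add: case_prod_beta')
qed

lemma mode_lin_joint1: "(\<lambda>(s, \<omega>). mode_lin \<sigma> \<xi> a b c s \<omega>) \<in> borel_measurable (borel \<Otimes>\<^sub>M M)"
proof -
  have "(\<lambda>p. (fst p, snd p, \<xi>)) \<in> measurable (borel \<Otimes>\<^sub>M M) (borel \<Otimes>\<^sub>M (M \<Otimes>\<^sub>M (borel :: real measure)))"
    by measurable
  from measurable_compose[OF this mode_lin_joint[of "\<lambda>_. a" "\<lambda>_. b" \<sigma> c]] show ?thesis
    by (simp add: case_prod_beta')
qed

lemma mode_lin_bound:
  assumes "\<omega> \<in> space M" "t \<in> {0..T}"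
  shows "cmod (mode_lin \<sigma> \<xi> a b c t \<omega>) \<le> (cmod a + cmod b) * exp ((1 + \<bar>\<xi>\<bar>) * T)"
  unfolding mode_lin_def using assms by (intro unimodular.linear_sol_bound_uniform[OF unimodular_W]) auto

lemma cmod_mode_u: "cmod (mode_u \<sigma> \<xi> a b t \<omega>) = cmod (mode_lin \<sigma> \<xi> a b True t \<omega>)"
  by (simp add: mode_u_def norm_mult del: of_real_mult)

lemma mode_u_joint1: "(\<lambda>(s, \<omega>). mode_u \<sigma> \<xi> a b s \<omega>) \<in> borel_measurable (borel \<Otimes>\<^sub>M M)"
  using W_joint mode_lin_joint1[of \<sigma> \<xi> a b True] unfolding mode_u_def case_prod_beta' by measurable

lemma mode_u_progressive1:
  "0 \<le> t \<Longrightarrow> (\<lambda>(s, \<omega>). mode_u \<sigma> \<xi> a b (min s t) \<omega>) \<in> borel_measurable (borel \<Otimes>\<^sub>M F t)"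
  using W_progressive[of t] mode_lin_progressive1[of t \<sigma> \<xi> a b True] unfolding mode_u_def case_prod_beta' by measurable

lemma mode_u_adapted: "0 \<le> t \<Longrightarrow> mode_u \<sigma> \<xi> a b t \<in> borel_measurable (F t)"
  using W_adapted[of t] mode_lin_adapted[of t \<sigma> \<xi> a b True] unfolding mode_u_def[abs_def] by measurable

lemma mode_lin_continuous:
  assumes "\<omega> \<in> space M"
  shows "continuous_on {0..T} (\<lambda>t. mode_lin \<sigma> \<xi> a b c t \<omega>)"
  unfolding mode_lin_def by (rule unimodular.linear_sol_continuous[OF unimodular_W[OF assms]])

lemma W_continuous: "AE \<omega> in M. continuous_on {0..} (\<lambda>t. W t \<omega>)"
  using BM_continuous W_eq_B
proof eventually_elim
  case (elim \<omega>)
  show ?case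
    by (rule continuous_on_eq[OF elim(1)]) (use elim(2) in auto)
qed

lemma mode_u_continuous: "AE \<omega> in M. continuous_on {0..T} (\<lambda>t. mode_u \<sigma> \<xi> a b t \<omega>)"
  using W_continuous AE_space
proof eventually_elim
  case (elim \<omega>)
  have "continuous_on {0..T} (\<lambda>t. W t \<omega>)"
    by (rule continuous_on_subset[OF elim(1)]) auto
  with elim(2) show ?case
    unfolding mode_u_def by (intro continuous_intros mode_lin_continuous)
qed

lemma mode_lin_increment:
  assumes "\<omega> \<in> space M" "0 \<le> s" "s \<le> r"
  shows "mode_lin \<sigma> \<xi> a b True r \<omega> = mode_lin \<sigma> \<xi> a b True s \<omega> +
      (LINT q:{s..r}|lborel. cnj (iexp (\<sigma> * \<xi> * W q \<omega>)) * mode_lin \<sigma> \<xi> a b False q \<omega>)"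
    and "mode_lin \<sigma> \<xi> a b False r \<omega> = mode_lin \<sigma> \<xi> a b False s \<omega> +
      (LINT q:{s..r}|lborel. of_real \<xi> * mode_u \<sigma> \<xi> a b q \<omega>)"
  using unimodular.linear_sol_increment[OF unimodular_W[OF assms(1)] assms(2,3), of "\<sigma> * \<xi>" \<xi> a b True]
    unimodular.linear_sol_increment[OF unimodular_W[OF assms(1)] assms(2,3), of "\<sigma> * \<xi>" \<xi> a b False]
  by (simp_all add: mode_lin_def mode_u_def coef_def mult.assoc)

section \<open>One-step residuals of the Ito equation of a mode\<close>

definition mode_drift :: "real \<Rightarrow> real \<Rightarrow> complex \<Rightarrow> complex \<Rightarrow> real \<Rightarrow> 'a \<Rightarrow> complex" where
  "mode_drift \<sigma> \<xi> a b t \<omega> = mode_lin \<sigma> \<xi> a b False t \<omega> - of_real (\<sigma>\<^sup>2 / 2 * \<xi>\<^sup>2) * mode_u \<sigma> \<xi> a b t \<omega>"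

lemma mode_drift_bound:
  assumes "\<omega> \<in> space M" "t \<in> {0..T}"
  shows "cmod (mode_drift \<sigma> \<xi> a b t \<omega>) \<le> (1 + \<sigma>\<^sup>2 / 2 * \<xi>\<^sup>2) * ((cmod a + cmod b) * exp ((1 + \<bar>\<xi>\<bar>) * T))"
proof -
  let ?K = "(cmod a + cmod b) * exp ((1 + \<bar>\<xi>\<bar>) * T)"
  have "cmod (mode_drift \<sigma> \<xi> a b t \<omega>) \<le> cmod (mode_lin \<sigma> \<xi> a b False t \<omega>) + cmod (of_real (\<sigma>\<^sup>2 / 2 * \<xi>\<^sup>2) * mode_u \<sigma> \<xi> a b t \<omega>)"
    unfolding mode_drift_def by (rule norm_triangle_ineq4)
  also have "cmod (of_real (\<sigma>\<^sup>2 / 2 * \<xi>\<^sup>2) * mode_u \<sigma> \<xi> a b t \<omega>) = (\<sigma>\<^sup>2 / 2 * \<xi>\<^sup>2) * cmod (mode_lin \<sigma> \<xi> a b True t \<omega>)"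
    by (simp only: norm_mult norm_of_real cmod_mode_u) simp
  also have "cmod (mode_lin \<sigma> \<xi> a b False t \<omega>) + (\<sigma>\<^sup>2 / 2 * \<xi>\<^sup>2) * cmod (mode_lin \<sigma> \<xi> a b True t \<omega>) \<le> ?K + (\<sigma>\<^sup>2 / 2 * \<xi>\<^sup>2) * ?K"
    using assms by (intro add_mono mult_left_mono mode_lin_bound) auto
  finally show ?thesis
    by (simp only: distrib_right mult_1)
qed

lemma mode_drift_joint: "(\<lambda>(s, \<omega>). mode_drift \<sigma> \<xi> a b s \<omega>) \<in> borel_measurable (borel \<Otimes>\<^sub>M M)"
  using mode_u_joint1[of \<sigma> \<xi> a b] mode_lin_joint1[of \<sigma> \<xi> a b False] unfolding mode_drift_def case_prod_beta' by measurable

lemma mode_drift_progressive: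
  "0 \<le> t \<Longrightarrow> (\<lambda>(s, \<omega>). mode_drift \<sigma> \<xi> a b (min s t) \<omega>) \<in> borel_measurable (borel \<Otimes>\<^sub>M F t)"
  using mode_u_progressive1[of t \<sigma> \<xi> a b] mode_lin_progressive1[of t \<sigma> \<xi> a b False] unfolding mode_drift_def case_prod_beta' by measurable

lemma mode_drift_integral_adapted:
  assumes "0 \<le> t"
  shows "(\<lambda>\<omega>. LINT q:{s..t}|lborel. mode_drift \<sigma> \<xi> a b q \<omega>) \<in> borel_measurable (F t)"
proof -
  have "(\<lambda>p. mode_drift \<sigma> \<xi> a b (min (fst p) t) (snd p)) \<in> borel_measurable (borel \<Otimes>\<^sub>M F t)"
    using mode_drift_progressive[OF assms] by (simp add: case_prod_beta')
  then have [measurable]: "(\<lambda>p. mode_drift \<sigma> \<xi> a b (min (fst p) t) (snd p)) \<in> borel_measurable (lborel \<Otimes>\<^sub>M F t)"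
    by (simp cong: measurable_cong_sets)
  have "(\<lambda>p. indicator {s..t} (fst p) *\<^sub>R mode_drift \<sigma> \<xi> a b (min (fst p) t) (snd p)) \<in> borel_measurable (lborel \<Otimes>\<^sub>M F t)"
    by measurable
  from measurable_pair_swap[OF this]
  have "(\<lambda>(\<omega>, q). indicator {s..t} q *\<^sub>R mode_drift \<sigma> \<xi> a b (min q t) \<omega>) \<in> borel_measurable (F t \<Otimes>\<^sub>M lborel)"
    by simp
  then have "(\<lambda>\<omega>. LINT q|lborel. indicator {s..t} q *\<^sub>R mode_drift \<sigma> \<xi> a b (min q t) \<omega>) \<in> borel_measurable (F t)"
    by (rule lborel.borel_measurable_lebesgue_integral)
  moreover have "indicator {s..t} q *\<^sub>R mode_drift \<sigma> \<xi> a b (min q t) \<omega> = indicator {s..t} q *\<^sub>R mode_drift \<sigma> \<xi> a b q \<omega>" for q \<omega>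
    by (auto simp: indicator_def min_def)
  ultimately show ?thesis
    by (simp only: set_lebesgue_integral_def)
qed

lemma mode_drift_integrable:
  assumes "\<omega> \<in> space M" "0 \<le> s"
  shows "set_integrable lborel {s..t} (\<lambda>q. mode_drift \<sigma> \<xi> a b q \<omega>)"
  unfolding set_integrable_def
proof (rule Bochner_Integration.integrable_bound[OF integrable_const_Icc])
  let ?K = "(1 + \<sigma>\<^sup>2 / 2 * \<xi>\<^sup>2) * ((cmod a + cmod b) * exp ((1 + \<bar>\<xi>\<bar>) * t))"
  show "AE q in lborel. norm (indicator {s..t} q *\<^sub>R mode_drift \<sigma> \<xi> a b q \<omega>) \<le> norm (?K * indicator {s..t} q)"
    using mode_drift_bound[OF assms(1)] assms(2)
    by (intro AE_I2) (auto simp: indicator_def intro!: order_trans[OF _ abs_ge_self])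
  have "(\<lambda>q. mode_drift \<sigma> \<xi> a b q \<omega>) \<in> borel_measurable borel"
    using measurable_compose[OF measurable_Pair2'[OF assms(1)] mode_drift_joint] by simp
  then show "(\<lambda>q. indicator {s..t} q *\<^sub>R mode_drift \<sigma> \<xi> a b q \<omega>) \<in> borel_measurable lborel"
    by simp
qed

text \<open>
  The error made on \<open>[s, r]\<close> by freezing the integrand of the Ito integral at time \<open>s\<close>.
\<close>

definition mode_error :: "real \<Rightarrow> real \<Rightarrow> complex \<Rightarrow> complex \<Rightarrow> real \<Rightarrow> real \<Rightarrow> 'a \<Rightarrow> complex" where
  "mode_error \<sigma> \<xi> a b s r \<omega> = mode_u \<sigma> \<xi> a b r \<omega> - mode_u \<sigma> \<xi> a b s \<omega>
     - (LINT q:{s..r}|lborel. mode_drift \<sigma> \<xi> a b q \<omega>)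
     - \<i> * of_real (\<sigma> * \<xi>) * mode_u \<sigma> \<xi> a b s \<omega> * of_real (B r \<omega> - B s \<omega>)"

lemma mode_error_adapted:
  assumes "0 \<le> s" "s \<le> r"
  shows "mode_error \<sigma> \<xi> a b s r \<in> borel_measurable (F r)"
proof -
  have [measurable]: "mode_u \<sigma> \<xi> a b r \<in> borel_measurable (F r)" "mode_u \<sigma> \<xi> a b s \<in> borel_measurable (F r)"
    "B r \<in> borel_measurable (F r)" "B s \<in> borel_measurable (F r)"
    "(\<lambda>\<omega>. LINT q:{s..r}|lborel. mode_drift \<sigma> \<xi> a b q \<omega>) \<in> borel_measurable (F r)"
    using assms adapted_mono[OF mode_u_adapted] by (auto intro: mode_u_adapted B_adapted mode_drift_integral_adapted)
  show ?thesis
    unfolding mode_error_def[abs_def] by measurable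
qed

lemma mode_error_orthogonal:
  assumes sr: "0 \<le> s" "s \<le> r"
    and Y: "Y \<in> borel_measurable (F s)" "integrable M Y"
  shows "(LINT \<omega>|M. mode_error \<sigma> \<xi> a b s r \<omega> * Y \<omega>) = 0"
proof -
  let ?K = "(cmod a + cmod b) * exp ((1 + \<bar>\<xi>\<bar>) * r)"
  let ?u = "mode_u \<sigma> \<xi> a b" and ?d = "mode_drift \<sigma> \<xi> a b" and ?v = "mode_lin \<sigma> \<xi> a b False"
  have u_bd: "cmod (?u q \<omega>) \<le> ?K" if "q \<in> {s..r}" "\<omega> \<in> space M" for q \<omega>
    unfolding cmod_mode_u using that sr by (intro mode_lin_bound) auto
  have v_bd: "cmod (?v q \<omega>) \<le> ?K" if "q \<in> {s..r}" "\<omega> \<in> space M" for q \<omega>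
    using that sr by (intro mode_lin_bound) auto
  have um: "?u q \<in> borel_measurable M" if "q \<in> {s..r}" for q
    using adapted_measurable[OF mode_u_adapted] that sr by auto
  have vm: "?v q \<in> borel_measurable M" if "q \<in> {s..r}" for q
    using adapted_measurable[OF mode_lin_adapted] that sr by auto
  have int_u: "integrable M (\<lambda>\<omega>. ?u q \<omega> * Y \<omega>)" if "q \<in> {s..r}" for q
    using that by (intro integrable_bounded_mult[OF um u_bd Y(2)])
  have int_v: "integrable M (\<lambda>\<omega>. ?v q \<omega> * Y \<omega>)" if "q \<in> {s..r}" for q
    using that by (intro integrable_bounded_mult[OF vm v_bd Y(2)])
  let ?I = "\<lambda>\<omega>. LINT q:{s..r}|lborel. ?d q \<omega>"
  have d_bd: "cmod (?d q \<omega>) \<le> (1 + \<sigma>\<^sup>2 / 2 * \<xi>\<^sup>2) * ?K" if "q \<in> {s..r}" "\<omega> \<in> space M" for q \<omega>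
    using that sr by (intro mode_drift_bound) auto
  have int_I: "integrable M (\<lambda>\<omega>. ?I \<omega> * Y \<omega>)"
  proof (rule integrable_bounded_mult[OF _ _ Y(2)])
    show "?I \<in> borel_measurable M"
      using adapted_measurable[OF mode_drift_integral_adapted] sr by auto
    show "cmod (?I \<omega>) \<le> (LINT q|lborel. (1 + \<sigma>\<^sup>2 / 2 * \<xi>\<^sup>2) * ?K * indicator {s..r} q)" if "\<omega> \<in> space M" for \<omega>
      unfolding set_lebesgue_integral_def
      by (rule order_trans[OF integral_norm_bound], rule integral_mono'[OF integrable_const_Icc])
        (use d_bd[OF _ that] order_trans[OF norm_ge_zero d_bd[OF _ that]] in \<open>auto simp: indicator_def\<close>)
  qed
  have "(\<lambda>\<omega>. ?u s \<omega> * Y \<omega>) \<in> borel_measurable (F s)"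
    using Y(1) sr mode_u_adapted by auto
  note inc = increment_mean_mult[OF sr this int_u]
  have "(LINT \<omega>|M. mode_error \<sigma> \<xi> a b s r \<omega> * Y \<omega>) = (LINT \<omega>|M. ?u r \<omega> * Y \<omega> - ?u s \<omega> * Y \<omega> - ?I \<omega> * Y \<omega>
     - \<i> * of_real (\<sigma> * \<xi>) * (?u s \<omega> * Y \<omega> * of_real (B r \<omega> - B s \<omega>)))"
    unfolding mode_error_def by (rule Bochner_Integration.integral_cong) (simp_all add: algebra_simps)
  moreover have "(LINT \<omega>|M. ?u r \<omega> * Y \<omega> - ?u s \<omega> * Y \<omega> - ?I \<omega> * Y \<omega>
     - \<i> * of_real (\<sigma> * \<xi>) * (?u s \<omega> * Y \<omega> * of_real (B r \<omega> - B s \<omega>)))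
     = (LINT \<omega>|M. ?u r \<omega> * Y \<omega>) - (LINT \<omega>|M. ?u s \<omega> * Y \<omega>) - (LINT \<omega>|M. ?I \<omega> * Y \<omega>)
     - \<i> * of_real (\<sigma> * \<xi>) * (LINT \<omega>|M. ?u s \<omega> * Y \<omega> * of_real (B r \<omega> - B s \<omega>))"
    using int_u int_I inc(1) sr
    by (simp only: Bochner_Integration.integral_diff Bochner_Integration.integrable_diff integrable_mult_right integral_mult_right_zero atLeastAtMost_iff order_refl simp_thms)
  moreover have "(LINT \<omega>|M. ?u s \<omega> * Y \<omega> * of_real (B r \<omega> - B s \<omega>)) = 0"
    using sr by (intro inc(2)) auto
  moreover have "(LINT \<omega>|M. ?u r \<omega> * Y \<omega>) - (LINT \<omega>|M. ?u s \<omega> * Y \<omega>) =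
     (LINT q:{s..r}|lborel. (LINT \<omega>|M. ?v q \<omega> * Y \<omega>) - of_real ((\<sigma> * \<xi>)\<^sup>2 / 2) * (LINT \<omega>|M. ?u q \<omega> * Y \<omega>))"
    unfolding mode_u_def
  proof (rule exp_evolution(1)[where T = r and K = ?K and K' = ?K])
    show "AE \<omega> in M. continuous_on {s..r} (\<lambda>q. ?v q \<omega>)"
      using sr by (intro AE_I2 continuous_on_subset[OF mode_lin_continuous[where T = r]]) auto
    show "AE \<omega> in M. \<forall>r'\<in>{s..r}. mode_lin \<sigma> \<xi> a b True r' \<omega> = mode_lin \<sigma> \<xi> a b True s \<omega> +
        (LINT q:{s..r'}|lborel. cnj (iexp (\<sigma> * \<xi> * W q \<omega>)) * ?v q \<omega>)"
      using sr by (intro AE_I2 ballI mode_lin_increment(1)) auto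
  qed (use sr Y v_bd in \<open>auto intro: mode_lin_adapted mode_lin_joint1 mode_lin_bound\<close>)
  moreover have "(LINT q:{s..r}|lborel. (LINT \<omega>|M. ?v q \<omega> * Y \<omega>) - of_real ((\<sigma> * \<xi>)\<^sup>2 / 2) * (LINT \<omega>|M. ?u q \<omega> * Y \<omega>))
    = (LINT q:{s..r}|lborel. (LINT \<omega>|M. ?d q \<omega> * Y \<omega>))"
  proof (rule set_lebesgue_integral_cong)
    show "\<forall>q. q \<in> {s..r} \<longrightarrow> (LINT \<omega>|M. ?v q \<omega> * Y \<omega>) - of_real ((\<sigma> * \<xi>)\<^sup>2 / 2) * (LINT \<omega>|M. ?u q \<omega> * Y \<omega>)
        = (LINT \<omega>|M. ?d q \<omega> * Y \<omega>)"
    proof (intro allI impI)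
      fix q assume q: "q \<in> {s..r}"
      have "(LINT \<omega>|M. ?d q \<omega> * Y \<omega>) = (LINT \<omega>|M. ?v q \<omega> * Y \<omega> - of_real ((\<sigma> * \<xi>)\<^sup>2 / 2) * (?u q \<omega> * Y \<omega>))"
        unfolding mode_drift_def by (rule Bochner_Integration.integral_cong) (simp_all add: algebra_simps power_mult_distrib)
      then show "(LINT \<omega>|M. ?v q \<omega> * Y \<omega>) - of_real ((\<sigma> * \<xi>)\<^sup>2 / 2) * (LINT \<omega>|M. ?u q \<omega> * Y \<omega>) = (LINT \<omega>|M. ?d q \<omega> * Y \<omega>)"
        by (simp only: Bochner_Integration.integral_diff[OF int_v[OF q] integrable_mult_right[OF int_u[OF q]]] integral_mult_right_zero)
    qed
  qed simp
  moreover have "(LINT q:{s..r}|lborel. (LINT \<omega>|M. ?d q \<omega> * Y \<omega>)) = (LINT \<omega>|M. ?I \<omega> * Y \<omega>)"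
    by (rule expectation_time_integral(1)[OF mode_drift_joint d_bd Y(2), symmetric])
  ultimately show ?thesis
    by (simp only: diff_self mult_zero_right)
qed

text \<open>The second moment is of order (r - s)^2, one power better than for an increment of u.
  With D the increment of B, the phase enters only through exp (i l D) - 1 - i l D, which is O(D^2),
  and E D^4 = 3 (r - s)^2 explains the 3. In 2 + m, one unit comes from the integral of v and 1 + m
  from the drift. The outer 2 comes from squaring a sum of two terms.\<close>

lemma mode_error_square:
  assumes sr: "0 \<le> s" "s \<le> r" "r \<le> T" and m: "m = \<sigma>\<^sup>2 / 2 * \<xi>\<^sup>2" and K: "K = (cmod a + cmod b) * exp ((1 + \<bar>\<xi>\<bar>) * T)"
  shows "integrable M (\<lambda>\<omega>. (cmod (mode_error \<sigma> \<xi> a b s r \<omega>))\<^sup>2)"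
    and "(LINT \<omega>|M. (cmod (mode_error \<sigma> \<xi> a b s r \<omega>))\<^sup>2) \<le> 2 * K\<^sup>2 * (3 * m\<^sup>2 + (2 + m)\<^sup>2) * (r - s)\<^sup>2"
proof -
  let ?u = "mode_u \<sigma> \<xi> a b" and ?d = "mode_drift \<sigma> \<xi> a b" and ?v = "mode_lin \<sigma> \<xi> a b False"
  let ?D = "\<lambda>\<omega>. B r \<omega> - B s \<omega>" and ?l = "\<sigma> * \<xi>"
  let ?b = "\<lambda>\<omega>. 2 * K\<^sup>2 * (m\<^sup>2 * (?D \<omega>) ^ 4 + (2 + m)\<^sup>2 * (r - s)\<^sup>2)"
  have m0: "0 \<le> m" and K0: "0 \<le> K"
    by (simp_all add: m K)
  have "AE \<omega> in M. cmod (mode_error \<sigma> \<xi> a b s r \<omega>) \<le> K * (m * (?D \<omega>)\<^sup>2) + K * ((2 + m) * (r - s))"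
    using W_eq_B AE_space
  proof eventually_elim
    case (elim \<omega>)
    let ?e = "\<lambda>q. iexp (?l * W q \<omega>)" and ?p = "\<lambda>q. mode_lin \<sigma> \<xi> a b True q \<omega>"
    let ?J = "LINT q:{s..r}|lborel. cnj (?e q) * ?v q \<omega>"
    have J: "cmod ?J \<le> K * (r - s)"
    proof -
      have "cmod ?J \<le> (LINT q|lborel. K * indicator {s..r} q)"
        unfolding set_lebesgue_integral_def
      proof (rule order_trans[OF integral_norm_bound], rule integral_mono'[OF integrable_const_Icc])
        show "cmod (indicator {s..r} q *\<^sub>R (cnj (?e q) * ?v q \<omega>)) \<le> K * indicator {s..r} q" for q
          using mode_lin_bound[OF elim(2), of q T \<sigma> \<xi> a b False] sr
          by (auto simp: indicator_def norm_mult K simp del: of_real_mult)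
      qed (use K0 in auto)
      then show ?thesis
        using sr by simp
    qed
    have dI: "cmod (LINT q:{s..r}|lborel. ?d q \<omega>) \<le> (1 + m) * K * (r - s)"
    proof -
      have "cmod (LINT q:{s..r}|lborel. ?d q \<omega>) \<le> (LINT q|lborel. (1 + m) * K * indicator {s..r} q)"
        unfolding set_lebesgue_integral_def
      proof (rule order_trans[OF integral_norm_bound], rule integral_mono'[OF integrable_const_Icc])
        show "cmod (indicator {s..r} q *\<^sub>R ?d q \<omega>) \<le> (1 + m) * K * indicator {s..r} q" for q
          using mode_drift_bound[OF elim(2), of q T \<sigma> \<xi> a b] sr
          by (auto simp: indicator_def K m mult.assoc)
      qed (use K0 m0 in auto)
      then show ?thesis
        using sr by simp
    qed
    have W: "W r \<omega> = B r \<omega>" "W s \<omega> = B s \<omega>"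
      using elim sr by auto
    have ee: "?e r = ?e s * iexp (?l * ?D \<omega>)"
      by (simp add: W algebra_simps flip: exp_add)
    have "?u r \<omega> = ?e r * ?p s + ?e r * ?J"
      unfolding mode_u_def mode_lin_increment(1)[OF elim(2) sr(1,2)] by (rule distrib_left)
    also have "?e r * ?p s = iexp (?l * ?D \<omega>) * ?u s \<omega>"
      unfolding ee mode_u_def by (simp only: ac_simps)
    finally have "mode_error \<sigma> \<xi> a b s r \<omega> = (iexp (?l * ?D \<omega>) - 1 - \<i> * of_real (?l * ?D \<omega>)) * ?u s \<omega> + ?e r * ?J - (LINT q:{s..r}|lborel. ?d q \<omega>)"
      unfolding mode_error_def by (simp add: algebra_simps)
    moreover have "cmod (x * y + z * j - k) \<le> cmod x * cmod y + cmod j + cmod k" if "cmod z = 1" for x y z j k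
      using norm_triangle_ineq4[of "x * y + z * j" k] norm_triangle_ineq[of "x * y" "z * j"] that
      by (simp add: norm_mult)
    ultimately have "cmod (mode_error \<sigma> \<xi> a b s r \<omega>) \<le>
      cmod (iexp (?l * ?D \<omega>) - 1 - \<i> * of_real (?l * ?D \<omega>)) * cmod (?u s \<omega>) + cmod ?J + cmod (LINT q:{s..r}|lborel. ?d q \<omega>)"
      by (simp only: norm_exp_i_times)
    also have "\<dots> \<le> (?l * ?D \<omega>)\<^sup>2 / 2 * K + K * (r - s) + (1 + m) * K * (r - s)"
      using mode_lin_bound[OF elim(2), of s T \<sigma> \<xi> a b True] sr
      by (intro add_mono mult_mono cmod_exp_minus_linear J dI) (auto simp: cmod_mode_u K)
    also have "\<dots> = K * (m * (?D \<omega>)\<^sup>2) + K * ((2 + m) * (r - s))"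
      unfolding m power_mult_distrib by (simp add: algebra_simps)
    finally show ?case .
  qed
  then have le: "AE \<omega> in M. (cmod (mode_error \<sigma> \<xi> a b s r \<omega>))\<^sup>2 \<le> ?b \<omega>"
  proof eventually_elim
    case (elim \<omega>)
    have "(cmod (mode_error \<sigma> \<xi> a b s r \<omega>))\<^sup>2 \<le> (K * (m * (?D \<omega>)\<^sup>2) + K * ((2 + m) * (r - s)))\<^sup>2"
      using elim by (intro power_mono) auto
    also have "\<dots> \<le> 2 * (K * (m * (?D \<omega>)\<^sup>2))\<^sup>2 + 2 * (K * ((2 + m) * (r - s)))\<^sup>2"
      using sum_squares_bound[of "K * (m * (?D \<omega>)\<^sup>2)" "K * ((2 + m) * (r - s))"] by (simp add: power2_sum)
    also have "\<dots> = ?b \<omega>"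
    proof -
      have "((?D \<omega>)\<^sup>2)\<^sup>2 = (?D \<omega>) ^ 4"
        by simp
      then show ?thesis
        unfolding power_mult_distrib by (simp only: distrib_left mult.assoc)
    qed
    finally show ?case .
  qed
  have bi: "integrable M ?b"
    using sr by (intro integrable_mult_right Bochner_Integration.integrable_add increment_moments(1)) auto
  have em: "mode_error \<sigma> \<xi> a b s r \<in> borel_measurable M"
    using adapted_measurable[OF mode_error_adapted] sr by auto
  show i: "integrable M (\<lambda>\<omega>. (cmod (mode_error \<sigma> \<xi> a b s r \<omega>))\<^sup>2)"
    by (rule Bochner_Integration.integrable_bound[OF bi])
      (use em le in \<open>auto elim!: eventually_mono intro: order_trans[OF _ abs_ge_self]\<close>)
  have "(LINT \<omega>|M. (cmod (mode_error \<sigma> \<xi> a b s r \<omega>))\<^sup>2) \<le> (LINT \<omega>|M. ?b \<omega>)"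
    by (rule integral_mono_AE[OF i bi le])
  also have "\<dots> = 2 * K\<^sup>2 * (3 * m\<^sup>2 + (2 + m)\<^sup>2) * (r - s)\<^sup>2"
  proof -
    have "(LINT \<omega>|M. ?b \<omega>) = 2 * K\<^sup>2 * (m\<^sup>2 * (LINT \<omega>|M. (?D \<omega>) ^ 4) + (2 + m)\<^sup>2 * (r - s)\<^sup>2)"
      using increment_moments(1)[OF sr(1,2), of 4] by (simp add: prob_space)
    then show ?thesis
      by (simp add: increment_moments(4)[OF sr(1,2)] algebra_simps)
  qed
  finally show "(LINT \<omega>|M. (cmod (mode_error \<sigma> \<xi> a b s r \<omega>))\<^sup>2) \<le> 2 * K\<^sup>2 * (3 * m\<^sup>2 + (2 + m)\<^sup>2) * (r - s)\<^sup>2" .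
qed

end

section \<open>Second moments of a mode: Gronwall's lemma, product rules, moment system\<close>

lemma gronwall:
  fixes f :: "real \<Rightarrow> real"
  assumes cont: "continuous_on {0..T} f" and C: "0 \<le> C"
    and le: "\<And>t. t \<in> {0..T} \<Longrightarrow> f t \<le> A + C * integral {0..t} f" and t: "t \<in> {0..T}"
  shows "f t \<le> A * exp (C * t)"
proof -
  define g where "g q = A + C * integral {0..q} f" for q
  have dg: "(g has_real_derivative C * f q) (at q within {0..T})" if "q \<in> {0..T}" for q
    unfolding g_def using integral_has_real_derivative[OF cont that]
    by (auto intro!: derivative_eq_intros)
  have cg: "continuous_on {0..T} g"
    unfolding continuous_on_eq_continuous_within using DERIV_continuous[OF dg] by blast
  \<comment> \<open>f need not be differentiable, but its integral majorant g is, and g q exp (- C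
    q) is nonincreasing because f is at most g.\<close>
  have "g t * exp (- C * t) \<le> g 0 * exp (- C * 0)"
  proof (rule DERIV_nonpos_imp_decreasing_open[where f = "\<lambda>q. g q * exp (- C * q)" and a = 0 and b = t])
    show "0 \<le> t" using t by simp
    fix x assume x: "0 < x" "x < t"
    then have "(g has_real_derivative C * f x) (at x)"
      using dg[of x] t at_within_Icc_at[of 0 x T] by auto
    then have "((\<lambda>q. g q * exp (- C * q)) has_real_derivative C * f x * exp (- C * x) + - C * exp (- C * x) * g x) (at x)"
      by (auto intro!: derivative_eq_intros)
    moreover have "C * f x * exp (- C * x) + - C * exp (- C * x) * g x = C * exp (- C * x) * (f x - g x)"
      by (simp add: algebra_simps)
    moreover have "C * exp (- C * x) * (f x - g x) \<le> 0"
      using le[of x] x t C by (intro mult_nonneg_nonpos) (auto simp: g_def)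
    ultimately show "\<exists>y. ((\<lambda>q. g q * exp (- C * q)) has_real_derivative y) (at x) \<and> y \<le> 0"
      by metis
  next
    show "continuous_on {0..t} (\<lambda>q. g q * exp (- C * q))"
      using t by (intro continuous_intros continuous_on_subset[OF cg]) auto
  qed
  then have "g t * exp (- C * t) * exp (C * t) \<le> A * exp (C * t)"
    by (intro mult_right_mono) (simp_all add: g_def)
  then have "g t \<le> A * exp (C * t)"
    by (simp add: mult.assoc flip: exp_add)
  then show ?thesis
    using le[OF t] by (simp add: g_def)
qed

lemma set_lebesgue_integral_continuous:
  fixes f :: "real \<Rightarrow> 'b::euclidean_space"
  assumes "continuous_on {s..r} f"
  shows "(LINT q:{s..r}|lborel. f q) = integral {s..r} f"
  by (intro set_borel_integral_eq_integral(2) borel_integrable_atLeastAtMost' assms)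

lemma lebesgue_fundamental_theorem:
  fixes f :: "real \<Rightarrow> complex"
  assumes d: "\<And>q. q \<in> {0..T} \<Longrightarrow> (f has_vector_derivative f' q) (at q within {0..T})"
    and c: "continuous_on {0..T} f'" and r: "r \<in> {0..T}"
  shows "f r = f 0 + (LINT q:{0..r}|lborel. f' q)"
proof -
  have "(f' has_integral f r - f 0) {0..r}"
    using r by (intro fundamental_theorem_of_calculus has_vector_derivative_within_subset[OF d]) auto
  moreover have "(LINT q:{0..r}|lborel. f' q) = integral {0..r} f'"
    using r by (intro set_lebesgue_integral_continuous continuous_on_subset[OF c]) auto
  ultimately show ?thesis
    by (simp add: integral_unique)
qed

lemma has_vector_derivative_cnj:
  "(f has_vector_derivative f') F \<Longrightarrow> ((\<lambda>x. cnj (f x)) has_vector_derivative cnj f') F"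
  by (rule bounded_linear.has_vector_derivative[OF bounded_linear_cnj])

context brownian_motion
begin

lemma mode_lin_derivative:
  assumes "\<omega> \<in> space M" "continuous_on {0..} (\<lambda>t. W t \<omega>)" "t \<in> {0..T}"
  shows "((\<lambda>t. mode_lin \<sigma> \<xi> a b True t \<omega>) has_vector_derivative
      cnj (iexp (\<sigma> * \<xi> * W t \<omega>)) * mode_lin \<sigma> \<xi> a b False t \<omega>) (at t within {0..T})"
    and "((\<lambda>t. mode_lin \<sigma> \<xi> a b False t \<omega>) has_vector_derivative
      of_real \<xi> * iexp (\<sigma> * \<xi> * W t \<omega>) * mode_lin \<sigma> \<xi> a b True t \<omega>) (at t within {0..T})"
proof -
  have "continuous_on {0..T} (\<lambda>t. W t \<omega>)"
    by (rule continuous_on_subset[OF assms(2)]) auto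
  then have "continuous_on {0..T} (\<lambda>t. iexp (\<sigma> * \<xi> * W t \<omega>))"
    by (intro continuous_intros)
  note d = unimodular.linear_sol_derivative[OF unimodular_W[OF assms(1)] this assms(3)]
  show "((\<lambda>t. mode_lin \<sigma> \<xi> a b True t \<omega>) has_vector_derivative
      cnj (iexp (\<sigma> * \<xi> * W t \<omega>)) * mode_lin \<sigma> \<xi> a b False t \<omega>) (at t within {0..T})"
    using d[of \<xi> a b True] unfolding mode_lin_def coef_def by (simp only: if_True not_True_eq_False)
  show "((\<lambda>t. mode_lin \<sigma> \<xi> a b False t \<omega>) has_vector_derivative
      of_real \<xi> * iexp (\<sigma> * \<xi> * W t \<omega>) * mode_lin \<sigma> \<xi> a b True t \<omega>) (at t within {0..T})"
    using d[of \<xi> a b False] unfolding mode_lin_def coef_def by (simp only: if_False not_False_eq_True)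
qed

text \<open>Since |e| = 1, |u| = |p| and u cnj v = e p cnj v, so these are the products whose means
  are the second moments of the mode. In the first identity the factor cnj (e q) stands in front of
  a noise-free expression, exactly the form that \<open>exp_evolution\<close> asks for.\<close>

lemma mode_products:
  fixes \<sigma> \<xi> a b
  defines "p \<equiv> mode_lin \<sigma> \<xi> a b True" and "v \<equiv> mode_lin \<sigma> \<xi> a b False"
    and "e \<equiv> \<lambda>q \<omega>. iexp (\<sigma> * \<xi> * W q \<omega>)"
  assumes \<omega>: "\<omega> \<in> space M" "continuous_on {0..} (\<lambda>t. W t \<omega>)" and r: "r \<in> {0..T}"
  shows "p r \<omega> * cnj (v r \<omega>) = a * cnj b +
      (LINT q:{0..r}|lborel. cnj (e q \<omega>) * (v q \<omega> * cnj (v q \<omega>) + of_real \<xi> * (p q \<omega> * cnj (p q \<omega>))))"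
    and "p r \<omega> * cnj (p r \<omega>) = a * cnj a + (LINT q:{0..r}|lborel. of_real (2 * Re (e q \<omega> * (p q \<omega> * cnj (v q \<omega>)))))"
    and "v r \<omega> * cnj (v r \<omega>) = b * cnj b + (LINT q:{0..r}|lborel. of_real (2 * \<xi> * Re (e q \<omega> * (p q \<omega> * cnj (v q \<omega>)))))"
proof -
  have dp: "((\<lambda>q. p q \<omega>) has_vector_derivative cnj (e q \<omega>) * v q \<omega>) (at q within {0..T})"
    and dv: "((\<lambda>q. v q \<omega>) has_vector_derivative of_real \<xi> * e q \<omega> * p q \<omega>) (at q within {0..T})"
    if "q \<in> {0..T}" for q
    unfolding p_def v_def e_def by (rule mode_lin_derivative[OF \<omega> that])+
  have "continuous_on {0..T} (\<lambda>t. W t \<omega>)"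
    by (rule continuous_on_subset[OF \<omega>(2)]) auto
  then have ce: "continuous_on {0..T} (\<lambda>q. e q \<omega>)"
    unfolding e_def by (intro continuous_intros)
  have cp: "continuous_on {0..T} (\<lambda>q. p q \<omega>)" and cv: "continuous_on {0..T} (\<lambda>q. v q \<omega>)"
    unfolding p_def v_def by (rule mode_lin_continuous[OF \<omega>(1)])+
  have 0: "p 0 \<omega> = a" "v 0 \<omega> = b"
    unfolding p_def v_def mode_lin_def unimodular.linear_sol_0[OF unimodular_W[OF \<omega>(1)]] by simp_all
  have ee: "cnj (x * (y * cnj z)) = cnj x * z * cnj y" for x y z
    by simp
  have re: "of_real (2 * Re z) = z + cnj z" for z
    by (simp add: complex_add_cnj)
  have "p r \<omega> * cnj (v r \<omega>) = p 0 \<omega> * cnj (v 0 \<omega>) +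
      (LINT q:{0..r}|lborel. cnj (e q \<omega>) * (v q \<omega> * cnj (v q \<omega>) + of_real \<xi> * (p q \<omega> * cnj (p q \<omega>))))"
  proof (rule lebesgue_fundamental_theorem[OF _ _ r])
    fix q assume "q \<in> {0..T}"
    from has_vector_derivative_mult[OF dp[OF this] has_vector_derivative_cnj[OF dv[OF this]]]
    show "((\<lambda>q. p q \<omega> * cnj (v q \<omega>)) has_vector_derivative
        cnj (e q \<omega>) * (v q \<omega> * cnj (v q \<omega>) + of_real \<xi> * (p q \<omega> * cnj (p q \<omega>)))) (at q within {0..T})"
      by (rule has_vector_derivative_eq_rhs) (simp add: algebra_simps)
  qed (intro continuous_intros ce cp cv)
  then show "p r \<omega> * cnj (v r \<omega>) = a * cnj b +
      (LINT q:{0..r}|lborel. cnj (e q \<omega>) * (v q \<omega> * cnj (v q \<omega>) + of_real \<xi> * (p q \<omega> * cnj (p q \<omega>))))"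
    unfolding 0 .
  have "p r \<omega> * cnj (p r \<omega>) = p 0 \<omega> * cnj (p 0 \<omega>) + (LINT q:{0..r}|lborel. of_real (2 * Re (e q \<omega> * (p q \<omega> * cnj (v q \<omega>)))))"
  proof (rule lebesgue_fundamental_theorem[OF _ _ r])
    fix q assume "q \<in> {0..T}"
    from has_vector_derivative_mult[OF dp[OF this] has_vector_derivative_cnj[OF dp[OF this]]]
    show "((\<lambda>q. p q \<omega> * cnj (p q \<omega>)) has_vector_derivative of_real (2 * Re (e q \<omega> * (p q \<omega> * cnj (v q \<omega>))))) (at q within {0..T})"
      by (rule has_vector_derivative_eq_rhs) (simp only: re ee, simp add: algebra_simps)
  qed (intro continuous_intros ce cp cv)
  then show "p r \<omega> * cnj (p r \<omega>) = a * cnj a + (LINT q:{0..r}|lborel. of_real (2 * Re (e q \<omega> * (p q \<omega> * cnj (v q \<omega>)))))"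
    unfolding 0 .
  have "v r \<omega> * cnj (v r \<omega>) = v 0 \<omega> * cnj (v 0 \<omega>) + (LINT q:{0..r}|lborel. of_real (2 * \<xi> * Re (e q \<omega> * (p q \<omega> * cnj (v q \<omega>)))))"
  proof (rule lebesgue_fundamental_theorem[OF _ _ r])
    fix q assume "q \<in> {0..T}"
    from has_vector_derivative_mult[OF dv[OF this] has_vector_derivative_cnj[OF dv[OF this]]]
    show "((\<lambda>q. v q \<omega> * cnj (v q \<omega>)) has_vector_derivative of_real (2 * \<xi> * Re (e q \<omega> * (p q \<omega> * cnj (v q \<omega>))))) (at q within {0..T})"
    proof (rule has_vector_derivative_eq_rhs)
      have "complex_of_real (2 * \<xi> * Re (e q \<omega> * (p q \<omega> * cnj (v q \<omega>)))) = of_real \<xi> * of_real (2 * Re (e q \<omega> * (p q \<omega> * cnj (v q \<omega>))))"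
        by (simp only: of_real_mult mult_ac)
      then show "v q \<omega> * cnj (of_real \<xi> * e q \<omega> * p q \<omega>) + of_real \<xi> * e q \<omega> * p q \<omega> * cnj (v q \<omega>) = of_real (2 * \<xi> * Re (e q \<omega> * (p q \<omega> * cnj (v q \<omega>))))"
        by (simp only: re ee) (simp add: algebra_simps)
    qed
  qed (intro continuous_intros ce cp cv)
  then show "v r \<omega> * cnj (v r \<omega>) = b * cnj b + (LINT q:{0..r}|lborel. of_real (2 * \<xi> * Re (e q \<omega> * (p q \<omega> * cnj (v q \<omega>)))))"
    unfolding 0 .
qed

end

lemma Re_set_integral_continuous:
  fixes f :: "real \<Rightarrow> complex"
  assumes "continuous_on {s..r} f"
  shows "Re (LINT q:{s..r}|lborel. f q) = integral {s..r} (\<lambda>q. Re (f q))"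
  unfolding set_lebesgue_integral_continuous[OF assms]
  using integral_linear[OF integrable_continuous_real[OF assms] bounded_linear_Re] by (simp add: o_def)

lemma (in prob_space) time_integral_measurable:
  fixes h :: "real \<Rightarrow> 'a \<Rightarrow> complex"
  assumes "(\<lambda>(q, \<omega>). h q \<omega>) \<in> borel_measurable (borel \<Otimes>\<^sub>M M)"
  shows "(\<lambda>\<omega>. LINT q:{s..r}|lborel. h q \<omega>) \<in> borel_measurable M"
proof -
  have [measurable]: "(\<lambda>p. h (fst p) (snd p)) \<in> borel_measurable (lborel \<Otimes>\<^sub>M M)"
    using assms by (simp add: case_prod_beta' cong: measurable_cong_sets)
  have "(\<lambda>p. indicator {s..r} (fst p) *\<^sub>R h (fst p) (snd p)) \<in> borel_measurable (lborel \<Otimes>\<^sub>M M)"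
    by measurable
  from measurable_pair_swap[OF this] show ?thesis
    unfolding set_lebesgue_integral_def by (intro lborel.borel_measurable_lebesgue_integral) simp
qed

context brownian_motion
begin

text \<open>
  The second moments solve a closed linear system. The Gaussian damping of \<open>E (u cnj v)\<close>, at
  rate \<open>(\<sigma> \<xi>)\<^sup>2 / 2\<close>, compensates the factor \<open>\<xi>\<close> in \<open>v' = \<xi> u\<close>, which by itself would produce a
  growth of order \<open>exp (sqrt \<bar>\<xi>\<bar> t)\<close>.
\<close>

lemma mode_energy:
  fixes \<sigma> \<xi> a b
  assumes \<sigma>: "0 < \<sigma>" and \<xi>: "1 \<le> \<bar>\<xi>\<bar>" and t: "t \<in> {0..T}"
  shows "\<bar>\<xi>\<bar> * (LINT \<omega>|M. (cmod (mode_lin \<sigma> \<xi> a b True t \<omega>))\<^sup>2) + (LINT \<omega>|M. (cmod (mode_lin \<sigma> \<xi> a b False t \<omega>))\<^sup>2)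
    \<le> (\<bar>\<xi>\<bar> * (cmod a)\<^sup>2 + (cmod b)\<^sup>2 + 16 / \<sigma>\<^sup>2 * (cmod a * cmod b)) * exp (16 / \<sigma>\<^sup>2 * t)"
proof -
  define p where "p = mode_lin \<sigma> \<xi> a b True"
  define v where "v = mode_lin \<sigma> \<xi> a b False"
  define e where "e q \<omega> = iexp (\<sigma> * \<xi> * W q \<omega>)" for q \<omega>
  define K where "K = (cmod a + cmod b) * exp ((1 + \<bar>\<xi>\<bar>) * T)"
  define m where "m = (\<sigma> * \<xi>)\<^sup>2 / 2"
  define G where "G q \<omega> = p q \<omega> * cnj (v q \<omega>)" for q \<omega>
  define h where "h q \<omega> = v q \<omega> * cnj (v q \<omega>) + of_real \<xi> * (p q \<omega> * cnj (p q \<omega>))" for q \<omega>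
  \<comment> \<open>In terms of the means E |u|^2, E |v|^2 and E (u cnj v) the system is X' = 2 Re
    Z, Y' = 2 \<xi> Re Z, Z' = Y + \<xi> X - m Z, with \<open>h\<close> the source of Z before
    averaging.\<close>
  define X where "X q = (LINT \<omega>|M. (cmod (p q \<omega>))\<^sup>2)" for q
  define Y where "Y q = (LINT \<omega>|M. (cmod (v q \<omega>))\<^sup>2)" for q
  define Z where "Z q = (LINT \<omega>|M. e q \<omega> * G q \<omega>)" for q
  \<comment> \<open>The weight |\<xi>| makes the source Y + \<xi> X of Z at most \<open>En\<close>
    and gives both moments the same growth 2 |\<xi>| |R|.\<close>
  define En where "En q = \<bar>\<xi>\<bar> * X q + Y q" for q
  have K0: "0 \<le> K"
    by (simp add: K_def)
  have bd: "cmod (p q \<omega>) \<le> K" "cmod (v q \<omega>) \<le> K" if "q \<in> {0..T}" "\<omega> \<in> space M" for q \<omega>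
    unfolding p_def v_def K_def using that by (auto intro: mode_lin_bound)
  have meas [measurable]: "p q \<in> borel_measurable M" "v q \<in> borel_measurable M" "e q \<in> borel_measurable M" if "0 \<le> q" for q
    using that adapted_measurable[OF mode_lin_adapted] unfolding p_def v_def e_def[abs_def] by auto
  have joint [measurable]: "(\<lambda>r. p (fst r) (snd r)) \<in> borel_measurable (borel \<Otimes>\<^sub>M M)" "(\<lambda>r. v (fst r) (snd r)) \<in> borel_measurable (borel \<Otimes>\<^sub>M M)"
    "(\<lambda>r. e (fst r) (snd r)) \<in> borel_measurable (borel \<Otimes>\<^sub>M M)"
    using mode_lin_joint1 W_joint unfolding p_def v_def e_def by (simp_all add: case_prod_beta')
  have prod_bd: "cmod (x * cnj y) \<le> K\<^sup>2" if "cmod x \<le> K" "cmod y \<le> K" for x y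
    using mult_mono[OF that] K0 by (simp add: norm_mult power2_eq_square)
  have G_bd: "cmod (G q \<omega>) \<le> K\<^sup>2" if "q \<in> {0..T}" "\<omega> \<in> space M" for q \<omega>
    unfolding G_def using that by (intro prod_bd bd)
  have h_bd: "cmod (h q \<omega>) \<le> (1 + \<bar>\<xi>\<bar>) * K\<^sup>2" if "q \<in> {0..T}" "\<omega> \<in> space M" for q \<omega>
  proof -
    have "cmod (h q \<omega>) \<le> cmod (v q \<omega> * cnj (v q \<omega>)) + \<bar>\<xi>\<bar> * cmod (p q \<omega> * cnj (p q \<omega>))"
      unfolding h_def by (rule order_trans[OF norm_triangle_ineq]) (simp add: norm_mult)
    also have "\<dots> \<le> K\<^sup>2 + \<bar>\<xi>\<bar> * K\<^sup>2"
      using that by (intro add_mono mult_left_mono prod_bd bd) auto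
    finally show ?thesis by (simp add: distrib_right)
  qed
  have int1: "integrable M (\<lambda>_. 1 :: complex)"
    by simp
  have int_eG: "integrable M (\<lambda>\<omega>. e q \<omega> * G q \<omega>)" if "q \<in> {0..T}" for q
  proof (rule integrable_const_bound[where B = "K\<^sup>2"])
    show "AE \<omega> in M. cmod (e q \<omega> * G q \<omega>) \<le> K\<^sup>2"
      using G_bd[OF that] by (intro AE_I2) (simp add: norm_mult e_def del: of_real_mult)
    show "(\<lambda>\<omega>. e q \<omega> * G q \<omega>) \<in> borel_measurable M"
      using meas[of q] that unfolding G_def by (auto intro!: borel_measurable_times borel_measurable_cnj)
  qed
  have int_sq: "integrable M (\<lambda>\<omega>. (cmod (p q \<omega>))\<^sup>2)" "integrable M (\<lambda>\<omega>. (cmod (v q \<omega>))\<^sup>2)" if "q \<in> {0..T}" for q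
    using that bd[OF that] by (auto intro!: integrable_const_bound[where B = "K\<^sup>2"] AE_I2 power_mono)
  have sq: "p q \<omega> * cnj (p q \<omega>) = of_real ((cmod (p q \<omega>))\<^sup>2)" "v q \<omega> * cnj (v q \<omega>) = of_real ((cmod (v q \<omega>))\<^sup>2)" for q \<omega>
    by (rule complex_norm_square[symmetric])+
  have cont_pv: "continuous_on {0..T} (\<lambda>q. p q \<omega>)" "continuous_on {0..T} (\<lambda>q. v q \<omega>)" if "\<omega> \<in> space M" for \<omega>
    unfolding p_def v_def using that by (auto intro: mode_lin_continuous)
  have Xc: "continuous_on {0..T} X" and Yc: "continuous_on {0..T} Y"
  proof -
    have "continuous_on {0..T} (\<lambda>q. LINT \<omega>|M. w q \<omega> * cnj (w q \<omega>) * 1)"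
      if "\<And>q. q \<in> {0..T} \<Longrightarrow> w q \<in> borel_measurable M" "\<And>q \<omega>. q \<in> {0..T} \<Longrightarrow> \<omega> \<in> space M \<Longrightarrow> cmod (w q \<omega>) \<le> K"
        "\<And>\<omega>. \<omega> \<in> space M \<Longrightarrow> continuous_on {0..T} (\<lambda>q. w q \<omega>)" for w
    proof (rule continuous_on_expectation[where K = "K\<^sup>2"])
      show "cmod (w q \<omega> * cnj (w q \<omega>)) \<le> K\<^sup>2" if "q \<in> {0..T}" "\<omega> \<in> space M" for q \<omega>
        using \<open>\<And>q \<omega>. q \<in> {0..T} \<Longrightarrow> \<omega> \<in> space M \<Longrightarrow> cmod (w q \<omega>) \<le> K\<close> that by (intro prod_bd)
      show "AE \<omega> in M. continuous_on {0..T} (\<lambda>q. w q \<omega> * cnj (w q \<omega>))"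
        using that(3) by (intro AE_I2 continuous_intros)
    qed (use that(1) in auto)
    from this[of p] this[of v] have "continuous_on {0..T} (\<lambda>q. LINT \<omega>|M. p q \<omega> * cnj (p q \<omega>) * 1)" "continuous_on {0..T} (\<lambda>q. LINT \<omega>|M. v q \<omega> * cnj (v q \<omega>) * 1)"
      using bd cont_pv meas by auto
    then have "continuous_on {0..T} (\<lambda>q. complex_of_real (X q))" "continuous_on {0..T} (\<lambda>q. complex_of_real (Y q))"
      unfolding X_def Y_def sq mult_1_right integral_complex_of_real .
    from this[THEN continuous_on_Re] show "continuous_on {0..T} X" "continuous_on {0..T} Y"
      by simp_all
  qed
  have Enc: "continuous_on {0..T} En"
    unfolding En_def by (intro continuous_intros Xc Yc)
  have X0: "0 \<le> X q" "0 \<le> Y q" for q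
    by (simp_all add: X_def Y_def)
  have H: "(LINT \<omega>|M. h q \<omega>) = of_real (Y q + \<xi> * X q)" if "q \<in> {0..T}" for q
  proof -
    have "h q \<omega> = of_real ((cmod (v q \<omega>))\<^sup>2 + \<xi> * (cmod (p q \<omega>))\<^sup>2)" for \<omega>
      unfolding h_def sq by simp
    then show ?thesis
      using int_sq[OF that] by (simp only: integral_complex_of_real) (simp add: X_def Y_def)
  qed
  have G0: "G 0 \<omega> = a * cnj b" if "\<omega> \<in> space M" for \<omega>
    unfolding G_def p_def v_def mode_lin_def unimodular.linear_sol_0[OF unimodular_W[OF that]] by simp
  have ev: "Z r - Z 0 = (LINT q:{0..r}|lborel. of_real (Y q + \<xi> * X q) - of_real m * Z q)"
    "Z r = of_real (exp (- m * (r - 0))) * Z 0 + (LINT q:{0..r}|lborel. of_real (exp (- m * (r - q))) * of_real (Y q + \<xi> * X q))"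
    "continuous_on {0..T} Z" if r: "r \<in> {0..T}" for r
  proof -
    have w_joint: "(\<lambda>(q, \<omega>). h q \<omega>) \<in> borel_measurable (borel \<Otimes>\<^sub>M M)"
      unfolding h_def case_prod_beta' by measurable
    have hG_ad: "h q \<in> borel_measurable (F q)" "G q \<in> borel_measurable (F q)" if "0 \<le> q" for q
      using that mode_lin_adapted[of q] unfolding h_def[abs_def] G_def[abs_def] p_def v_def
      by (auto intro!: borel_measurable_add borel_measurable_times borel_measurable_cnj)
    have w_cont: "AE \<omega> in M. continuous_on {0..T} (\<lambda>q. h q \<omega>)"
      using cont_pv unfolding h_def by (intro AE_I2 continuous_intros) auto
    have p_eq: "AE \<omega> in M. \<forall>r\<in>{0..T}. G r \<omega> = G 0 \<omega> + (LINT q:{0..r}|lborel. cnj (iexp (\<sigma> * \<xi> * W q \<omega>)) * h q \<omega>)"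
      using W_continuous AE_space
    proof eventually_elim
      case (elim \<omega>)
      show ?case
        unfolding G0[OF elim(2)] using mode_products(1)[OF elim(2,1), of _ T \<sigma> \<xi> a b]
        by (auto simp: G_def h_def p_def v_def)
    qed
    have w_ad: "h q \<in> borel_measurable (F q)" and p_ad: "G q \<in> borel_measurable (F q)" if "q \<in> {0..T}" for q
      using hG_ad that by auto
    have p_bd: "cmod (G 0 \<omega>) \<le> K\<^sup>2" if "\<omega> \<in> space M" for \<omega>
      using G_bd[OF _ that, of 0] t by auto
    note E = exp_evolution[of 0 r T h "(1 + \<bar>\<xi>\<bar>) * K\<^sup>2" G "K\<^sup>2" "\<sigma> * \<xi>" "\<lambda>_. 1",
        OF order_refl r w_joint w_ad h_bd w_cont p_ad p_bd p_eq borel_measurable_const int1]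
    have E': "Z r - Z 0 = (LINT q:{0..r}|lborel. (LINT \<omega>|M. h q \<omega>) - of_real m * Z q)"
      using E(1) unfolding Z_def e_def m_def mult_1_right .
    have E'': "Z r = of_real (exp (- m * (r - 0))) * Z 0 + (LINT q:{0..r}|lborel. of_real (exp (- m * (r - q))) * (LINT \<omega>|M. h q \<omega>))"
      using E(2) unfolding Z_def e_def m_def mult_1_right .
    have cong: "(LINT q:{0..r}|lborel. f q (LINT \<omega>|M. h q \<omega>)) = (LINT q:{0..r}|lborel. f q (of_real (Y q + \<xi> * X q)))"
      for f :: "real \<Rightarrow> complex \<Rightarrow> complex"
      using H r by (intro set_lebesgue_integral_cong) auto
    show "Z r - Z 0 = (LINT q:{0..r}|lborel. of_real (Y q + \<xi> * X q) - of_real m * Z q)"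
      unfolding E' by (rule cong)
    show "Z r = of_real (exp (- m * (r - 0))) * Z 0 + (LINT q:{0..r}|lborel. of_real (exp (- m * (r - q))) * of_real (Y q + \<xi> * X q))"
      using E'' cong[of "\<lambda>q x. of_real (exp (- m * (r - q))) * x"] by (simp only:)
    show "continuous_on {0..T} Z"
      using E(3) unfolding Z_def[abs_def] e_def mult_1_right .
  qed
  note Zc = ev(3)[OF t]
  define R where "R r = integral {0..r} (\<lambda>q. Re (Z q))" for r
  \<comment> \<open>One argument for both moments: k is 1 for X and \<xi> for Y, and c is the
    corresponding initial value.\<close>
  have growth: "LINT_sq r = (cmod c)\<^sup>2 + 2 * k * R r"
    if r: "r \<in> {0..T}" and LS: "LINT_sq r = (LINT \<omega>|M. (cmod (w r \<omega>))\<^sup>2)" and wm: "w r \<in> borel_measurable M"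
      and wb: "\<And>\<omega>. \<omega> \<in> space M \<Longrightarrow> cmod (w r \<omega>) \<le> K"
      and w: "AE \<omega> in M. w r \<omega> * cnj (w r \<omega>) = c * cnj c + (LINT q:{0..r}|lborel. of_real (2 * k * Re (e q \<omega> * G q \<omega>)))"
    for r LINT_sq w c k
  proof -
    have j: "(\<lambda>(q, \<omega>). complex_of_real (2 * k * Re (e q \<omega> * G q \<omega>))) \<in> borel_measurable (borel \<Otimes>\<^sub>M M)"
      unfolding G_def case_prod_beta' by measurable
    have jb: "cmod (complex_of_real (2 * k * Re (e q \<omega> * G q \<omega>))) \<le> 2 * \<bar>k\<bar> * K\<^sup>2" if "q \<in> {0..r}" "\<omega> \<in> space M" for q \<omega>
    proof -
      have "\<bar>Re (e q \<omega> * G q \<omega>)\<bar> \<le> cmod (e q \<omega> * G q \<omega>)"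
        by (rule abs_Re_le_cmod)
      also have "\<dots> \<le> K\<^sup>2"
        using G_bd[of q \<omega>] that r by (simp add: norm_mult e_def del: of_real_mult)
      finally show ?thesis
        by (simp only: norm_of_real abs_mult) (intro mult_mono, auto)
    qed
    have "complex_of_real (LINT_sq r) - c * cnj c = (LINT \<omega>|M. w r \<omega> * cnj (w r \<omega>) - c * cnj c)"
    proof -
      have "integrable M (\<lambda>\<omega>. w r \<omega> * cnj (w r \<omega>))"
        using wb wm by (auto intro!: integrable_const_bound[where B = "K\<^sup>2"] AE_I2 prod_bd)
      then have "(LINT \<omega>|M. w r \<omega> * cnj (w r \<omega>) - c * cnj c) = (LINT \<omega>|M. w r \<omega> * cnj (w r \<omega>)) - c * cnj c"
        by (simp add: prob_space)
      also have "(LINT \<omega>|M. w r \<omega> * cnj (w r \<omega>)) = of_real (LINT_sq r)"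
        unfolding LS complex_norm_square[symmetric] by (rule integral_complex_of_real)
      finally show ?thesis by simp
    qed
    also have "\<dots> = (LINT \<omega>|M. (LINT q:{0..r}|lborel. of_real (2 * k * Re (e q \<omega> * G q \<omega>))) * 1)"
    proof (rule integral_cong_AE)
      show "AE \<omega> in M. w r \<omega> * cnj (w r \<omega>) - c * cnj c = (LINT q:{0..r}|lborel. of_real (2 * k * Re (e q \<omega> * G q \<omega>))) * 1"
        using w by eventually_elim (simp only: add_diff_cancel_left' mult_1_right)
      show "(\<lambda>\<omega>. (LINT q:{0..r}|lborel. complex_of_real (2 * k * Re (e q \<omega> * G q \<omega>))) * 1) \<in> borel_measurable M"
        using time_integral_measurable[OF j] by simp
    qed (use wm in measurable)
    also have "\<dots> = (LINT q:{0..r}|lborel. (LINT \<omega>|M. of_real (2 * k * Re (e q \<omega> * G q \<omega>)) * 1))"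
      by (rule expectation_time_integral(1)[OF j jb int1])
    also have "\<dots> = (LINT q:{0..r}|lborel. of_real (2 * k * Re (Z q)))"
    proof (rule set_lebesgue_integral_cong)
      show "\<forall>q. q \<in> {0..r} \<longrightarrow> (LINT \<omega>|M. of_real (2 * k * Re (e q \<omega> * G q \<omega>)) * 1) = complex_of_real (2 * k * Re (Z q))"
      proof (intro allI impI)
        fix q assume "q \<in> {0..r}"
        then have "integrable M (\<lambda>\<omega>. e q \<omega> * G q \<omega>)"
          using r by (intro int_eG) auto
        then have "(LINT \<omega>|M. Re (e q \<omega> * G q \<omega>)) = Re (Z q)"
          unfolding Z_def by (rule integral_Re)
        then show "(LINT \<omega>|M. of_real (2 * k * Re (e q \<omega> * G q \<omega>)) * 1) = complex_of_real (2 * k * Re (Z q))"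
          by (simp only: mult_1_right integral_complex_of_real integral_mult_right_zero)
      qed
    qed simp
    also have "\<dots> = of_real (integral {0..r} (\<lambda>q. 2 * k * Re (Z q)))"
      unfolding set_integral_complex_of_real using r
      by (intro arg_cong[where f = of_real] set_lebesgue_integral_continuous continuous_intros continuous_on_subset[OF Zc]) auto
    also have "integral {0..r} (\<lambda>q. 2 * k * Re (Z q)) = 2 * k * R r"
      unfolding R_def by (rule integral_mult_right)
    finally have "complex_of_real (LINT_sq r) = of_real ((cmod c)\<^sup>2) + of_real (2 * k * R r)"
      unfolding complex_norm_square by (simp only: diff_eq_eq add.commute)
    then show ?thesis
      by (simp only: of_real_add[symmetric] of_real_eq_iff)
  qed
  have XR: "X r = (cmod a)\<^sup>2 + 2 * 1 * R r" if r: "r \<in> {0..T}" for r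
  proof (rule growth[of r X p a 1, OF r])
    show "AE \<omega> in M. p r \<omega> * cnj (p r \<omega>) = a * cnj a + (LINT q:{0..r}|lborel. of_real (2 * 1 * Re (e q \<omega> * G q \<omega>)))"
      using W_continuous AE_space
    proof eventually_elim
      case (elim \<omega>)
      show ?case
        using mode_products(2)[OF elim(2,1) r, of \<sigma> \<xi> a b] unfolding G_def p_def v_def e_def by (simp only: mult_1_right)
    qed
  qed (use r bd in \<open>auto simp: X_def\<close>)
  have YR: "Y r = (cmod b)\<^sup>2 + 2 * \<xi> * R r" if r: "r \<in> {0..T}" for r
  proof (rule growth[of r Y v b \<xi>, OF r])
    show "AE \<omega> in M. v r \<omega> * cnj (v r \<omega>) = b * cnj b + (LINT q:{0..r}|lborel. of_real (2 * \<xi> * Re (e q \<omega> * G q \<omega>)))"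
      using W_continuous AE_space
    proof eventually_elim
      case (elim \<omega>)
      show ?case
        using mode_products(3)[OF elim(2,1) r, of \<sigma> \<xi> a b] unfolding G_def p_def v_def e_def .
    qed
  qed (use r bd in \<open>auto simp: Y_def\<close>)
  \<comment> \<open>B starts at 0 only almost surely, but |e 0| = 1 is enough.\<close>
  have Z0: "cmod (Z 0) \<le> cmod a * cmod b"
  proof -
    have "cmod (Z 0) \<le> (LINT \<omega>|M. cmod (e 0 \<omega> * G 0 \<omega>))"
      unfolding Z_def by (rule integral_norm_bound)
    also have "\<dots> = (LINT \<omega>|M. cmod a * cmod b)"
      by (rule Bochner_Integration.integral_cong) (simp_all add: G0 norm_mult e_def del: of_real_mult)
    finally show ?thesis
      by (simp add: prob_space)
  qed
  have HEn: "\<bar>Y q + \<xi> * X q\<bar> \<le> En q" for q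
    using X0[of q] abs_triangle_ineq[of "Y q" "\<xi> * X q"] by (simp add: En_def abs_mult)
  have le: "En r \<le> (\<bar>\<xi>\<bar> * (cmod a)\<^sup>2 + (cmod b)\<^sup>2 + 16 / \<sigma>\<^sup>2 * (cmod a * cmod b)) + 16 / \<sigma>\<^sup>2 * integral {0..r} En"
    if r: "r \<in> {0..T}" for r
  proof -
    let ?I = "integral {0..r} En" and ?ab = "cmod a * cmod b"
    have sub: "continuous_on {0..r} X" "continuous_on {0..r} Y" "continuous_on {0..r} Z" "continuous_on {0..r} En"
      using r continuous_on_subset[OF Xc] continuous_on_subset[OF Yc] continuous_on_subset[OF Zc] continuous_on_subset[OF Enc] by auto
    have m0: "0 < m"
      using \<sigma> \<xi> by (auto simp: m_def)
    have iEn: "En integrable_on {0..r}"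
      by (rule integrable_continuous_real[OF sub(4)])
    \<comment> \<open>The gain: the equation for Z is solved for m times the integral R of Re Z. The
      other terms are bounded by the energy and the data with constants free of \<xi>, so division
      by m, of order \<xi>^2, more than pays for the factor |\<xi>| in the growth of
      \<open>En\<close>.\<close>
    have "Re (Z r) - Re (Z 0) = integral {0..r} (\<lambda>q. Re (of_real (Y q + \<xi> * X q) - of_real m * Z q))"
      using ev(1)[OF r] sub by (subst Re_set_integral_continuous[symmetric]) (auto intro!: continuous_intros simp flip: minus_complex.sel)
    also have "\<dots> = integral {0..r} (\<lambda>q. (Y q + \<xi> * X q) - m * Re (Z q))"
      by simp
    also have "\<dots> = integral {0..r} (\<lambda>q. Y q + \<xi> * X q) - m * R r"
      unfolding R_def integral_mult_right[symmetric] using sub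
      by (intro Henstock_Kurzweil_Integration.integral_diff integrable_continuous_real continuous_intros)
    finally have mR: "m * R r = integral {0..r} (\<lambda>q. Y q + \<xi> * X q) - (Re (Z r) - Re (Z 0))"
      by simp
    have "\<bar>integral {0..r} (\<lambda>q. Y q + \<xi> * X q)\<bar> \<le> ?I"
      using HEn sub by (intro integral_norm_bound_integral[where 'a = real, simplified] iEn integrable_continuous_real continuous_intros) auto
    \<comment> \<open>From the Duhamel form of Z, whose kernel is at most 1. The integrated form
      would need a bound on R, which is what is sought.\<close>
    have "cmod (Z r) \<le> ?ab + ?I"
    proof -
      have "cmod (LINT q:{0..r}|lborel. of_real (exp (- m * (r - q))) * of_real (Y q + \<xi> * X q)) \<le> ?I"
      proof (subst set_lebesgue_integral_continuous)
        show c: "continuous_on {0..r} (\<lambda>q. complex_of_real (exp (- m * (r - q))) * of_real (Y q + \<xi> * X q))"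
          using sub by (intro continuous_intros)
        show "cmod (integral {0..r} (\<lambda>q. complex_of_real (exp (- m * (r - q))) * of_real (Y q + \<xi> * X q))) \<le> ?I"
        proof (rule integral_norm_bound_integral[OF integrable_continuous_real[OF c] iEn])
          fix q assume "q \<in> {0..r}"
          then have "exp (- m * (r - q)) \<le> 1"
            using m0 by simp
          then have "exp (- m * (r - q)) * \<bar>Y q + \<xi> * X q\<bar> \<le> 1 * En q"
            using HEn by (intro mult_mono) auto
          then show "cmod (complex_of_real (exp (- m * (r - q))) * of_real (Y q + \<xi> * X q)) \<le> En q"
            by (simp only: norm_mult norm_of_real abs_exp_cancel mult_1)
        qed
      qed
      moreover have "cmod (of_real (exp (- m * (r - 0))) * Z 0) \<le> ?ab"
      proof -
        have "exp (- m * (r - 0)) \<le> 1"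
          using m0 r by simp
        then have "exp (- m * (r - 0)) * cmod (Z 0) \<le> 1 * ?ab"
          using Z0 by (intro mult_mono) auto
        then show ?thesis
          by (simp only: norm_mult norm_of_real abs_exp_cancel mult_1)
      qed
      ultimately show ?thesis
        unfolding ev(2)[OF r] by (rule norm_triangle_mono[rotated])
    qed
    have mR': "m * \<bar>R r\<bar> \<le> 2 * ?I + 2 * ?ab"
    proof -
      have "\<bar>m * R r\<bar> \<le> 2 * ?I + 2 * ?ab"
        using \<open>\<bar>integral {0..r} (\<lambda>q. Y q + \<xi> * X q)\<bar> \<le> ?I\<close> \<open>cmod (Z r) \<le> ?ab + ?I\<close> mR Z0
          abs_Re_le_cmod[of "Z r"] abs_Re_le_cmod[of "Z 0"] by linarith
      then show ?thesis
        using m0 by (simp add: abs_mult)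
    qed
    have nonneg: "0 \<le> 2 * ?I + 2 * ?ab"
      using mR' m0 by (meson abs_ge_zero less_imp_le mult_nonneg_nonneg order_trans)
    \<comment> \<open>4 |\<xi>| / m = 8 / (\<sigma>^2 |\<xi>|), at most 8 / \<sigma>^2 because
      |\<xi>| \<ge> 1; doubled, this is the rate 16 / \<sigma>^2 of the energy bound.\<close>
    have "4 * \<bar>\<xi>\<bar> * \<bar>R r\<bar> = (4 * \<bar>\<xi>\<bar> / m) * (m * \<bar>R r\<bar>)"
      using m0 by simp
    also have "\<dots> \<le> (8 / \<sigma>\<^sup>2) * (2 * ?I + 2 * ?ab)"
    proof (rule mult_mono[OF _ mR'])
      have m_abs: "m = \<sigma>\<^sup>2 * (\<bar>\<xi>\<bar> * \<bar>\<xi>\<bar>) / 2"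
        by (simp add: m_def power_mult_distrib power2_eq_square)
      have "4 * x / (s * (x * x) / 2) = 8 / (s * x)" if "0 < x" for x s :: real
        using that by simp
      from this[of "\<bar>\<xi>\<bar>" "\<sigma>\<^sup>2"] have "4 * \<bar>\<xi>\<bar> / m = 8 / (\<sigma>\<^sup>2 * \<bar>\<xi>\<bar>)"
        unfolding m_abs using \<xi> by linarith
      also have "\<dots> \<le> 8 / \<sigma>\<^sup>2"
        using \<xi> \<sigma> by (intro divide_left_mono) (auto intro!: mult_pos_pos)
      finally show "4 * \<bar>\<xi>\<bar> / m \<le> 8 / \<sigma>\<^sup>2" .
    qed (use m0 in auto)
    finally have "4 * \<bar>\<xi>\<bar> * \<bar>R r\<bar> \<le> (8 / \<sigma>\<^sup>2) * (2 * ?I + 2 * ?ab)" .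
    moreover have "(8 / \<sigma>\<^sup>2) * (2 * x + 2 * y) = 16 / \<sigma>\<^sup>2 * x + 16 / \<sigma>\<^sup>2 * y" for x y
      by (simp add: distrib_left)
    moreover have "En r \<le> \<bar>\<xi>\<bar> * (cmod a)\<^sup>2 + (cmod b)\<^sup>2 + 4 * \<bar>\<xi>\<bar> * \<bar>R r\<bar>"
    proof -
      have "\<xi> * R r \<le> \<bar>\<xi>\<bar> * \<bar>R r\<bar>" "\<bar>\<xi>\<bar> * R r \<le> \<bar>\<xi>\<bar> * \<bar>R r\<bar>"
        using abs_ge_self[of "\<xi> * R r"] by (auto simp: abs_mult intro!: mult_left_mono)
      then show ?thesis
        unfolding En_def XR[OF r] YR[OF r] distrib_left by linarith
    qed
    ultimately show ?thesis
      by (simp only:)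
  qed
  have "En t \<le> (\<bar>\<xi>\<bar> * (cmod a)\<^sup>2 + (cmod b)\<^sup>2 + 16 / \<sigma>\<^sup>2 * (cmod a * cmod b)) * exp (16 / \<sigma>\<^sup>2 * t)"
    by (rule gronwall[OF Enc _ le t]) auto
  then show ?thesis
    by (simp only: En_def X_def Y_def p_def v_def)
qed

text \<open>For |\<xi>| < 1 the damping is too weak to help, but the pathwise bound has exponent at
  most 2 T there (constant \<open>?C2\<close>). For |\<xi>| \<ge> 1 the energy bound applies
  (constant \<open>?C1\<close>), and 1 + \<xi>^2 absorbs its weight |\<xi>|. The constant must not
  depend on \<xi> for the later integration over frequencies.\<close>

lemma mode_moment:
  assumes \<sigma>: "0 < \<sigma>" and T: "0 < T"
  obtains C where "0 \<le> C" "\<And>\<xi> a b c t. t \<in> {0..T} \<Longrightarrow>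
      (LINT \<omega>|M. (cmod (mode_lin \<sigma> \<xi> a b c t \<omega>))\<^sup>2) \<le> C * (1 + \<xi>\<^sup>2) * ((cmod a)\<^sup>2 + (cmod b)\<^sup>2)"
proof
  let ?k = "16 / \<sigma>\<^sup>2"
  let ?C1 = "(1 + ?k) * exp (?k * T)" and ?C2 = "2 * (exp (2 * T))\<^sup>2"
  show "0 \<le> ?C1 + ?C2"
    by simp
  fix \<xi> a b c t assume t: "t \<in> {0..T}"
  let ?S = "(cmod a)\<^sup>2 + (cmod b)\<^sup>2"
  let ?L = "\<lambda>c. LINT \<omega>|M. (cmod (mode_lin \<sigma> \<xi> a b c t \<omega>))\<^sup>2"
  have ab: "cmod a * cmod b \<le> ?S"
    using cmod_mult_le_squares[of a b] by (simp add: norm_mult)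
  have x1: "\<bar>\<xi>\<bar> \<le> 1 + \<xi>\<^sup>2"
    using zero_le_power2[of "\<bar>\<xi>\<bar> - 1"] by (simp add: power2_eq_square algebra_simps)
  have L0: "0 \<le> ?L c" for c
    by simp
  show "?L c \<le> (?C1 + ?C2) * (1 + \<xi>\<^sup>2) * ?S"
  proof (cases "1 \<le> \<bar>\<xi>\<bar>")
    case True
    have gen: "(x * A + x * B + k * (x * (A + B))) * y = (1 + k) * y * x * (A + B)" for x A B k y :: real
      by (simp add: algebra_simps)
    have "?L c \<le> \<bar>\<xi>\<bar> * ?L True + ?L False"
    proof (cases c)
      case True
      then show ?thesis
        using mult_right_mono[OF \<open>1 \<le> \<bar>\<xi>\<bar>\<close> L0[of True]] L0[of False] by (simp only: mult_1)
    next
      case False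
      then show ?thesis
        using mult_nonneg_nonneg[OF abs_ge_zero[of \<xi>] L0[of True]] by (simp only:)
    qed
    also have "\<dots> \<le> (\<bar>\<xi>\<bar> * (cmod a)\<^sup>2 + (cmod b)\<^sup>2 + ?k * (cmod a * cmod b)) * exp (?k * t)"
      by (rule mode_energy[OF \<sigma> True t])
    also have "\<dots> \<le> ((1 + \<xi>\<^sup>2) * (cmod a)\<^sup>2 + (1 + \<xi>\<^sup>2) * (cmod b)\<^sup>2 + ?k * ((1 + \<xi>\<^sup>2) * ?S)) * exp (?k * T)"
    proof (rule mult_mono)
      have "1 * (cmod b)\<^sup>2 \<le> (1 + \<xi>\<^sup>2) * (cmod b)\<^sup>2" "1 * ?S \<le> (1 + \<xi>\<^sup>2) * ?S"
        by (intro mult_right_mono; simp)+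
      then show "\<bar>\<xi>\<bar> * (cmod a)\<^sup>2 + (cmod b)\<^sup>2 + ?k * (cmod a * cmod b) \<le> (1 + \<xi>\<^sup>2) * (cmod a)\<^sup>2 + (1 + \<xi>\<^sup>2) * (cmod b)\<^sup>2 + ?k * ((1 + \<xi>\<^sup>2) * ?S)"
        using x1 ab by (intro add_mono mult_left_mono mult_right_mono) auto
      show "exp (?k * t) \<le> exp (?k * T)"
        using t by (auto intro!: mult_left_mono divide_right_mono)
    qed auto
    also have "\<dots> = ?C1 * (1 + \<xi>\<^sup>2) * ?S"
      by (rule gen)
    also have "\<dots> \<le> (?C1 + ?C2) * (1 + \<xi>\<^sup>2) * ?S"
      by (intro mult_right_mono) auto
    finally show ?thesis .
  next
    case False
    have "?L c \<le> (LINT \<omega>|M. ?C2 * ?S)"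
    proof (rule integral_mono')
      fix \<omega> assume \<omega>: "\<omega> \<in> space M"
      have "cmod (mode_lin \<sigma> \<xi> a b c t \<omega>) \<le> (cmod a + cmod b) * exp ((1 + \<bar>\<xi>\<bar>) * T)"
        by (rule mode_lin_bound[OF \<omega> t])
      also have "\<dots> \<le> (cmod a + cmod b) * exp (2 * T)"
        using False T by (intro mult_left_mono) auto
      finally have "(cmod (mode_lin \<sigma> \<xi> a b c t \<omega>))\<^sup>2 \<le> ((cmod a + cmod b) * exp (2 * T))\<^sup>2"
        by (intro power_mono) auto
      also have "\<dots> = (cmod a + cmod b)\<^sup>2 * (exp (2 * T))\<^sup>2"
        by (rule power_mult_distrib)
      also have "\<dots> \<le> (2 * ?S) * (exp (2 * T))\<^sup>2"
        using sum_squares_bound[of "cmod a" "cmod b"] by (intro mult_right_mono) (auto simp: power2_sum)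
      finally show "(cmod (mode_lin \<sigma> \<xi> a b c t \<omega>))\<^sup>2 \<le> ?C2 * ?S"
        by (simp only: mult_ac)
    qed auto
    also have "\<dots> = ?C2 * 1 * ?S"
      by (simp add: prob_space)
    also have "\<dots> \<le> (?C1 + ?C2) * (1 + \<xi>\<^sup>2) * ?S"
      by (intro mult_right_mono mult_mono) auto
    finally show ?thesis .
  qed
qed

end

section \<open>Existence for a single mode\<close>

context prob_space
begin

lemma null_in_probability_AE:
  assumes [measurable]: "\<And>n. Z n \<in> borel_measurable M"
    and lim: "AE \<omega> in M. (\<lambda>n. Z n \<omega>) \<longlonglongrightarrow> 0"
  shows "null_in_probability M Z"
  unfolding null_in_probability_def
proof (intro allI impI)
  fix \<epsilon> :: ennreal assume \<epsilon>: "0 < \<epsilon>"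
  let ?A = "\<lambda>n. {\<omega> \<in> space M. Z n \<omega> > \<epsilon>}"
  have "(\<lambda>n. LINT \<omega>|M. indicator (?A n) \<omega> :: real) \<longlonglongrightarrow> (LINT \<omega>|M. 0)"
  proof (rule integral_dominated_convergence[where w = "\<lambda>_. 1"])
    show "AE \<omega> in M. (\<lambda>n. indicator (?A n) \<omega> :: real) \<longlonglongrightarrow> 0"
      using lim
    proof eventually_elim
      case (elim \<omega>)
      then have "\<forall>\<^sub>F n in sequentially. Z n \<omega> < \<epsilon>"
        using \<epsilon> by (rule order_tendstoD)
      then show ?case
        by (intro tendsto_eventually) (auto elim!: eventually_mono simp: indicator_def)
    qed
  qed (auto simp: indicator_def)
  then show "(\<lambda>n. measure M (?A n)) \<longlonglongrightarrow> 0"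
    by simp
qed

text \<open>Chebyshev's inequality; for an infinite threshold the event is empty.\<close>

lemma null_in_probability_mean_square:
  fixes X :: "nat \<Rightarrow> 'a \<Rightarrow> complex"
  assumes X [measurable]: "\<And>n. X n \<in> borel_measurable M"
    and int: "\<And>n. integrable M (\<lambda>\<omega>. (cmod (X n \<omega>))\<^sup>2)"
    and lim: "(\<lambda>n. LINT \<omega>|M. (cmod (X n \<omega>))\<^sup>2) \<longlonglongrightarrow> 0"
  shows "null_in_probability M (\<lambda>n \<omega>. ennreal (cmod (X n \<omega>)))"
  unfolding null_in_probability_def
proof (intro allI impI)
  fix \<epsilon> :: ennreal assume \<epsilon>: "0 < \<epsilon>"
  show "(\<lambda>n. measure M {\<omega> \<in> space M. ennreal (cmod (X n \<omega>)) > \<epsilon>}) \<longlonglongrightarrow> 0"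
  proof (cases \<epsilon>)
    case (real e)
    with \<epsilon> have e: "0 < e" by simp
    show ?thesis
    proof (rule tendsto_sandwich[OF _ _ tendsto_const])
      show "\<forall>\<^sub>F n in sequentially. measure M {\<omega> \<in> space M. ennreal (cmod (X n \<omega>)) > \<epsilon>} \<le> (LINT \<omega>|M. (cmod (X n \<omega>))\<^sup>2) / e\<^sup>2"
      proof (rule always_eventually, rule allI)
        fix n
        have "measure M {\<omega> \<in> space M. ennreal (cmod (X n \<omega>)) > \<epsilon>} \<le> measure M {\<omega> \<in> space M. (cmod (X n \<omega>))\<^sup>2 \<ge> e\<^sup>2}"
          using real by (intro finite_measure_mono) (auto intro!: power_mono simp: ennreal_less_iff)
        also have "\<dots> \<le> (LINT \<omega>|M. (cmod (X n \<omega>))\<^sup>2) / e\<^sup>2"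
          using e int by (intro integral_Markov_inequality_measure[where A = "{}"]) auto
        finally show "measure M {\<omega> \<in> space M. ennreal (cmod (X n \<omega>)) > \<epsilon>} \<le> (LINT \<omega>|M. (cmod (X n \<omega>))\<^sup>2) / e\<^sup>2" .
      qed
      show "(\<lambda>n. (LINT \<omega>|M. (cmod (X n \<omega>))\<^sup>2) / e\<^sup>2) \<longlonglongrightarrow> 0"
        using tendsto_divide[OF lim tendsto_const[of "e\<^sup>2"]] e by simp
    qed simp
  qed (use \<epsilon> in auto)
qed

end

lemma measurable_restrict_fst:
  assumes "f \<in> measurable (L \<Otimes>\<^sub>M N) K"
  shows "f \<in> measurable (restrict_space L A \<Otimes>\<^sub>M N) K"
proof -
  have [measurable]: "(\<lambda>x. x) \<in> measurable (restrict_space L A) L"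
    by (rule measurable_restrict_space1[OF measurable_ident_sets]) simp
  have "(\<lambda>p. (fst p, snd p)) \<in> measurable (restrict_space L A \<Otimes>\<^sub>M N) (L \<Otimes>\<^sub>M N)"
    by (intro measurable_Pair measurable_snd measurable_compose[OF measurable_fst]) measurable
  from measurable_compose[OF this assms] show ?thesis
    by simp
qed

lemma partition_mono:
  fixes \<tau> :: "nat \<Rightarrow> real"
  assumes "\<And>i. i < N \<Longrightarrow> \<tau> i \<le> \<tau> (Suc i)" "i \<le> j" "j \<le> N"
  shows "\<tau> i \<le> \<tau> j"
  using assms(2,3)
proof (induction j rule: dec_induct)
  case (step n)
  then show ?case using assms(1)[of n] by simp
qed simp

lemma partition_covers:
  fixes \<tau> :: "nat \<Rightarrow> real"
  assumes "\<tau> 0 < s" "s \<le> \<tau> N"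
  obtains i where "i < N" "\<tau> i < s" "s \<le> \<tau> (Suc i)"
  using assms(2)
proof (induction N arbitrary: thesis)
  case 0
  then show ?case using assms(1) by simp
next
  case (Suc N)
  show ?case
  proof (cases "s \<le> \<tau> N")
    case True
    show ?thesis
      by (rule Suc.IH[OF Suc.prems(1)]) (use True in auto)
  next
    case False
    then show ?thesis
      using Suc.prems(1)[of N] Suc.prems(2) by simp
  qed
qed

lemma simple_value_eq:
  assumes \<tau>: "\<And>i. i < N \<Longrightarrow> \<tau> i \<le> \<tau> (Suc i)" and i: "i < N" "\<tau> i < s" "s \<le> \<tau> (Suc i)"
  shows "simple_value N \<tau> c s \<omega> = c i \<omega>"
proof -
  have "indicator {\<tau> j <.. \<tau> (Suc j)} s * c j \<omega> = (if j = i then c i \<omega> else 0)" if "j < N" for j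
  proof (cases j i rule: linorder_cases)
    case less
    then have "\<tau> (Suc j) \<le> \<tau> i"
      using i by (intro partition_mono[of N \<tau>, OF \<tau>]) auto
    then show ?thesis
      using less i by auto
  next
    case greater
    then have "\<tau> (Suc i) \<le> \<tau> j"
      using that by (intro partition_mono[of N \<tau>, OF \<tau>]) auto
    then show ?thesis
      using greater i by auto
  qed (use i in auto)
  then show ?thesis
    using i(1) by (simp add: simple_value_def)
qed

lemma simple_value_joint:
  assumes [measurable]: "\<And>i. i < N \<Longrightarrow> c i \<in> borel_measurable M"
  shows "(\<lambda>p. simple_value N \<tau> c (snd p) (fst p)) \<in> borel_measurable (M \<Otimes>\<^sub>M lborel)"
proof -
  have "(\<lambda>p. indicator {\<tau> i <.. \<tau> (Suc i)} (snd p) * c i (fst p)) \<in> borel_measurable (M \<Otimes>\<^sub>M lborel)" if "i < N" for i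
  proof -
    have [measurable]: "c i \<in> borel_measurable M"
      using that by simp
    show ?thesis by measurable
  qed
  then show ?thesis
    unfolding simple_value_def by (intro borel_measurable_sum) auto
qed

context brownian_motion
begin

lemma mode_drift_telescope:
  assumes \<omega>: "\<omega> \<in> space M" and \<tau>: "\<tau> 0 = 0" "\<And>i. i < N \<Longrightarrow> \<tau> i \<le> \<tau> (Suc i)"
  shows "0 \<le> \<tau> N \<and> (\<Sum>i<N. LINT q:{\<tau> i..\<tau> (Suc i)}|lborel. mode_drift \<sigma> \<xi> a b q \<omega>) = (LINT q:{0..\<tau> N}|lborel. mode_drift \<sigma> \<xi> a b q \<omega>)"
  using \<tau>(2)
proof (induction N)
  case 0
  show ?case
    using \<tau>(1) set_borel_integral_eq_integral(2)[OF mode_drift_integrable[OF \<omega>, of 0 0]] by simp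
next
  case (Suc N)
  let ?d = "\<lambda>q. mode_drift \<sigma> \<xi> a b q \<omega>"
  have IH: "0 \<le> \<tau> N" "(\<Sum>i<N. LINT q:{\<tau> i..\<tau> (Suc i)}|lborel. ?d q) = (LINT q:{0..\<tau> N}|lborel. ?d q)"
    and le: "\<tau> N \<le> \<tau> (Suc N)"
    using Suc by auto
  note i = set_borel_integral_eq_integral[OF mode_drift_integrable[OF \<omega>]]
  have "integral {0..\<tau> N} ?d + integral {\<tau> N..\<tau> (Suc N)} ?d = integral {0..\<tau> (Suc N)} ?d"
    using IH(1) le by (intro Henstock_Kurzweil_Integration.integral_combine i(1)) auto
  then show ?case
    using IH le by (simp add: i(2))
qed

text \<open>What the stochastic integral has to be if u satisfies the equation. Defined this way the
  equation is immediate, and the content lies in showing that it is the Ito integral of i \<sigma>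
  \<xi> u.\<close>

definition mode_mart :: "real \<Rightarrow> real \<Rightarrow> complex \<Rightarrow> complex \<Rightarrow> real \<Rightarrow> 'a \<Rightarrow> complex" where
  "mode_mart \<sigma> \<xi> a b t \<omega> = mode_u \<sigma> \<xi> a b t \<omega> - mode_u \<sigma> \<xi> a b 0 \<omega> - (LINT q:{0..t}|lborel. mode_drift \<sigma> \<xi> a b q \<omega>)"

text \<open>With all partition points capped at t, the first two terms of the residuals telescope
  and the stochastic terms form the Ito sum. For an interval beginning after t the capped increment
  of B is 0, so freezing u at the uncapped time makes no difference.\<close>

lemma mode_ito_error:
  assumes \<omega>: "\<omega> \<in> space M" and t: "t \<in> {0..T}"
    and \<tau>: "\<tau> 0 = 0" "\<tau> N = T" "\<And>i. i < N \<Longrightarrow> \<tau> i \<le> \<tau> (Suc i)"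
  shows "simple_ito B N \<tau> (\<lambda>i \<omega>. \<i> * of_real (\<sigma> * \<xi>) * mode_u \<sigma> \<xi> a b (\<tau> i) \<omega>) t \<omega> - mode_mart \<sigma> \<xi> a b t \<omega>
    = - (\<Sum>i<N. mode_error \<sigma> \<xi> a b (min t (\<tau> i)) (min t (\<tau> (Suc i))) \<omega>)"
proof -
  let ?s = "\<lambda>i. min t (\<tau> i)" and ?u = "\<lambda>t. mode_u \<sigma> \<xi> a b t \<omega>" and ?l = "\<i> * of_real (\<sigma> * \<xi>)"
  let ?d = "\<lambda>q. mode_drift \<sigma> \<xi> a b q \<omega>"
  have s: "?s 0 = 0" "?s N = t" "\<And>i. i < N \<Longrightarrow> ?s i \<le> ?s (Suc i)"
    using \<tau>(1,2) t min.mono[OF order_refl \<tau>(3)] by auto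
  have c: "?l * ?u (\<tau> i) * of_real (B (?s (Suc i)) \<omega> - B (?s i) \<omega>) = ?l * ?u (?s i) * of_real (B (?s (Suc i)) \<omega> - B (?s i) \<omega>)" if "i < N" for i
  proof (cases "\<tau> i \<le> t")
    case False
    then have "?s i = t" "?s (Suc i) = t"
      using \<tau>(3)[OF that] by auto
    then show ?thesis by simp
  qed simp
  have "(\<Sum>i<N. mode_error \<sigma> \<xi> a b (?s i) (?s (Suc i)) \<omega>) =
      (\<Sum>i<N. ?u (?s (Suc i)) - ?u (?s i)) - (\<Sum>i<N. LINT q:{?s i..?s (Suc i)}|lborel. ?d q)
      - (\<Sum>i<N. ?l * ?u (?s i) * of_real (B (?s (Suc i)) \<omega> - B (?s i) \<omega>))"
    unfolding mode_error_def by (simp only: sum_subtractf)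
  also have "(\<Sum>i<N. ?u (?s (Suc i)) - ?u (?s i)) = ?u t - ?u 0"
    using sum_lessThan_telescope[of "\<lambda>i. ?u (?s i)" N] s by simp
  also have "(\<Sum>i<N. LINT q:{?s i..?s (Suc i)}|lborel. ?d q) = (LINT q:{0..t}|lborel. ?d q)"
    using mode_drift_telescope[OF \<omega>, of ?s N] s by auto
  also have "(\<Sum>i<N. ?l * ?u (?s i) * of_real (B (?s (Suc i)) \<omega> - B (?s i) \<omega>)) = simple_ito B N \<tau> (\<lambda>i \<omega>. ?l * mode_u \<sigma> \<xi> a b (\<tau> i) \<omega>) t \<omega>"
    unfolding simple_ito_def by (rule sum.cong[OF refl], rule c[symmetric]) simp
  finally show ?thesis
    by (simp add: mode_mart_def)
qed

text \<open>Uniform partitions, with the integrand frozen at left end points. The integrands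
  converge by bounded convergence along continuous paths. The error of the sums is an orthogonal sum
  of about n terms of size C (T / n)^2, hence of order 1 / n.\<close>

lemma mode_has_ito_integral:
  assumes T: "0 < T"
  shows "has_ito_integral M F B T (\<lambda>s \<omega>. \<i> * of_real (\<sigma> * \<xi>) * mode_u \<sigma> \<xi> a b s \<omega>) (mode_mart \<sigma> \<xi> a b)"
proof -
  define K where "K = (cmod a + cmod b) * exp ((1 + \<bar>\<xi>\<bar>) * T)"
  define \<kappa> where "\<kappa> = \<bar>\<sigma> * \<xi>\<bar> * K"
  define m where "m = \<sigma>\<^sup>2 / 2 * \<xi>\<^sup>2"
  define C where "C = 2 * K\<^sup>2 * (3 * m\<^sup>2 + (2 + m)\<^sup>2)"
  define H where "H s \<omega> = \<i> * of_real (\<sigma> * \<xi>) * mode_u \<sigma> \<xi> a b s \<omega>" for s \<omega>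
  define \<tau> where "\<tau> n i = T * real i / real (Suc n)" for n i
  define c where "c n i \<omega> = H (\<tau> n i) \<omega>" for n i \<omega>
  have K0: "0 \<le> K" and \<kappa>0: "0 \<le> \<kappa>" and C0: "0 \<le> C"
    by (simp_all add: K_def \<kappa>_def C_def)
  have \<tau>0: "\<tau> n 0 = 0" and \<tau>N: "\<tau> n (Suc n) = T" and \<tau>_mono: "\<tau> n i \<le> \<tau> n (Suc i)" and \<tau>_nonneg: "0 \<le> \<tau> n i" for n i
    using T by (auto simp: \<tau>_def divide_right_mono mult_left_mono simp del: of_nat_Suc)
  have \<tau>_step: "\<tau> n (Suc i) - \<tau> n i = T * inverse (real (Suc n))" for n i
    unfolding \<tau>_def diff_divide_distrib[symmetric] right_diff_distrib[symmetric] by (simp add: divide_inverse)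
  have \<tau>_le: "\<tau> n i \<le> T" if "i \<le> Suc n" for n i
    using partition_mono[of "Suc n" "\<tau> n" i "Suc n"] \<tau>_mono \<tau>N that by simp
  have H_bd: "cmod (H s \<omega>) \<le> \<kappa>" if "s \<in> {0..T}" "\<omega> \<in> space M" for s \<omega>
    using mult_left_mono[OF mode_lin_bound[OF that(2,1), of \<sigma> \<xi> a b True], of "\<bar>\<sigma> * \<xi>\<bar>"]
    unfolding H_def \<kappa>_def K_def by (simp only: norm_mult norm_ii norm_of_real cmod_mode_u mult_1)
  have H_joint: "(\<lambda>p. H (fst p) (snd p)) \<in> borel_measurable (borel \<Otimes>\<^sub>M M)"
    using mode_u_joint1[of \<sigma> \<xi> a b] unfolding H_def case_prod_beta' by measurable
  have H_ad: "H s \<in> borel_measurable (F s)" if "0 \<le> s" for s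
    using mode_u_adapted[OF that, of \<sigma> \<xi> a b] unfolding H_def[abs_def] by measurable
  have H_meas: "H s \<in> borel_measurable M" if "0 \<le> s" for s
    using adapted_measurable[OF H_ad] that by auto
  have H_sec: "(\<lambda>s. H s \<omega>) \<in> borel_measurable borel" if "\<omega> \<in> space M" for \<omega>
    using measurable_compose[OF measurable_Pair2'[OF that] H_joint] by simp
  have H_cont: "AE \<omega> in M. continuous_on {0..T} (\<lambda>s. H s \<omega>)"
    using mode_u_continuous unfolding H_def by eventually_elim (intro continuous_intros)
  let ?S = "\<lambda>n s \<omega>. simple_value (Suc n) (\<tau> n) (c n) s \<omega>"
  have S_bd: "cmod (?S n s \<omega>) \<le> \<kappa>" if "s \<in> {0..T}" "\<omega> \<in> space M" for n s \<omega>
  \<comment> \<open>The cells are open on the left, so the simple process vanishes at time 0 instead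
    of being frozen there.\<close>
  proof (cases "s = 0")
    case True
    have "?S n s \<omega> = 0"
      unfolding simple_value_def using True \<tau>_nonneg[of n] by (intro sum.neutral) (auto simp: indicator_def not_less)
    then show ?thesis using \<kappa>0 by simp
  next
    case False
    then have "\<tau> n 0 < s" "s \<le> \<tau> n (Suc n)"
      using \<tau>0[of n] \<tau>N[of n] that by auto
    then obtain i where "i < Suc n" "\<tau> n i < s" "s \<le> \<tau> n (Suc i)"
      by (rule partition_covers)
    then have "?S n s \<omega> = c n i \<omega>"
      by (intro simple_value_eq \<tau>_mono)
    then show ?thesis
      using H_bd[of "\<tau> n i" \<omega>] \<tau>_nonneg \<tau>_le[of i n] \<open>i < Suc n\<close> that by (simp add: c_def)
  qed
  have S_lim: "(\<lambda>n. ?S n s \<omega>) \<longlonglongrightarrow> H s \<omega>" if s: "s \<in> {0<..T}" and cont: "continuous_on {0..T} (\<lambda>s. H s \<omega>)" for s \<omega>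
  proof -
    have "\<exists>i. i < Suc n \<and> \<tau> n i < s \<and> s \<le> \<tau> n (Suc i)" for n
    proof -
      have "\<tau> n 0 < s" "s \<le> \<tau> n (Suc n)"
        using \<tau>0[of n] \<tau>N[of n] s by auto
      then show ?thesis
        by (rule partition_covers) blast
    qed
    then obtain i where i: "\<And>n. i n < Suc n" "\<And>n. \<tau> n (i n) < s" "\<And>n. s \<le> \<tau> n (Suc (i n))"
      by metis
    have "(\<lambda>n. \<tau> n (i n)) \<longlonglongrightarrow> s"
    proof (rule tendsto_sandwich)
      show "\<forall>\<^sub>F n in sequentially. s - T * inverse (real (Suc n)) \<le> \<tau> n (i n)"
      proof (rule always_eventually, rule allI)
        fix n show "s - T * inverse (real (Suc n)) \<le> \<tau> n (i n)"
          using i(3)[of n] \<tau>_step[of n "i n"] by linarith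
      qed
      show "\<forall>\<^sub>F n in sequentially. \<tau> n (i n) \<le> s"
        by (intro always_eventually allI less_imp_le i(2))
      show "(\<lambda>n. s - T * inverse (real (Suc n))) \<longlonglongrightarrow> s"
        using tendsto_diff[OF tendsto_const[of s] tendsto_mult[OF tendsto_const[of T] LIMSEQ_inverse_real_of_nat]] by simp
    qed simp
    then have "(\<lambda>n. H (\<tau> n (i n)) \<omega>) \<longlonglongrightarrow> H s \<omega>"
      by (rule continuous_on_tendsto_compose[OF cont]) (use s \<tau>_nonneg \<tau>_le i(1) in \<open>auto simp: less_imp_le\<close>)
    moreover have "?S n s \<omega> = H (\<tau> n (i n)) \<omega>" for n
      using simple_value_eq[of "Suc n" "\<tau> n" "i n" s "c n" \<omega>] \<tau>_mono i by (simp add: c_def)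
    ultimately show ?thesis by simp
  qed
  have simple: "simple_process M F T (Suc n) (\<tau> n) (c n)" for n
    unfolding simple_process_def
  proof (intro conjI allI impI)
    show "\<exists>K. \<forall>i<Suc n. \<forall>\<omega>\<in>space M. cmod (c n i \<omega>) \<le> K"
      unfolding c_def using H_bd \<tau>_nonneg \<tau>_le by (intro exI[of _ \<kappa>]) auto
  qed (use \<tau>0 \<tau>N \<tau>_mono \<tau>_nonneg H_ad in \<open>auto simp: c_def[abs_def]\<close>)
  have null1: "null_in_probability M (\<lambda>n \<omega>. \<integral>\<^sup>+s\<in>{0..T}. ennreal ((cmod (?S n s \<omega> - H s \<omega>))\<^sup>2) \<partial>lborel)"
  proof (rule null_in_probability_AE)
    fix n
    have [measurable]: "(\<lambda>p. ?S n (snd p) (fst p)) \<in> borel_measurable (M \<Otimes>\<^sub>M lborel)"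
      using H_meas \<tau>_nonneg by (intro simple_value_joint) (simp add: c_def[abs_def])
    have "(\<lambda>p. H (fst p) (snd p)) \<in> borel_measurable (lborel \<Otimes>\<^sub>M M)"
      using H_joint by (simp cong: measurable_cong_sets)
    from measurable_pair_swap[OF this] have [measurable]: "(\<lambda>p. H (snd p) (fst p)) \<in> borel_measurable (M \<Otimes>\<^sub>M lborel)"
      by (simp add: case_prod_beta')
    show "(\<lambda>\<omega>. \<integral>\<^sup>+s\<in>{0..T}. ennreal ((cmod (?S n s \<omega> - H s \<omega>))\<^sup>2) \<partial>lborel) \<in> borel_measurable M"
      by (intro lborel.borel_measurable_nn_integral) (unfold case_prod_beta', measurable)
  next
    show "AE \<omega> in M. (\<lambda>n. \<integral>\<^sup>+s\<in>{0..T}. ennreal ((cmod (?S n s \<omega> - H s \<omega>))\<^sup>2) \<partial>lborel) \<longlonglongrightarrow> 0"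
      using H_cont AE_space
    proof eventually_elim
      case (elim \<omega>)
      have [measurable]: "(\<lambda>s. H s \<omega>) \<in> borel_measurable borel"
        by (rule H_sec[OF elim(2)])
      have "(\<lambda>n. \<integral>\<^sup>+s\<in>{0..T}. ennreal ((cmod (?S n s \<omega> - H s \<omega>))\<^sup>2) \<partial>lborel) \<longlonglongrightarrow> (\<integral>\<^sup>+s. 0 \<partial>(lborel :: real measure))"
      proof (rule nn_integral_dominated_convergence[where w = "\<lambda>s. ennreal ((2 * \<kappa>)\<^sup>2) * indicator {0..T} s"])
        show "(\<lambda>s. ennreal ((cmod (?S n s \<omega> - H s \<omega>))\<^sup>2) * indicator {0..T} s) \<in> borel_measurable lborel" for n
          unfolding simple_value_def by measurable
        show "AE s in lborel. ennreal ((cmod (?S n s \<omega> - H s \<omega>))\<^sup>2) * indicator {0..T} s \<le> ennreal ((2 * \<kappa>)\<^sup>2) * indicator {0..T} s" for n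
        proof (rule AE_I2)
          fix s :: real
          show "ennreal ((cmod (?S n s \<omega> - H s \<omega>))\<^sup>2) * indicator {0..T} s \<le> ennreal ((2 * \<kappa>)\<^sup>2) * indicator {0..T} s"
          proof (cases "s \<in> {0..T}")
            case True
            have "cmod (?S n s \<omega> - H s \<omega>) \<le> 2 * \<kappa>"
              using norm_triangle_ineq4[of "?S n s \<omega>" "H s \<omega>"] S_bd[OF True elim(2), of n] H_bd[OF True elim(2)] by linarith
            then have "(cmod (?S n s \<omega> - H s \<omega>))\<^sup>2 \<le> (2 * \<kappa>)\<^sup>2"
              by (intro power_mono) auto
            then show ?thesis
              by (intro mult_right_mono ennreal_leI) auto
          qed simp
        qed
        show "(\<integral>\<^sup>+s. ennreal ((2 * \<kappa>)\<^sup>2) * indicator {0..T} s \<partial>lborel) < \<infinity>"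
          using T by (subst nn_integral_cmult) (auto simp: ennreal_mult_less_top)
        show "AE s in lborel. (\<lambda>n. ennreal ((cmod (?S n s \<omega> - H s \<omega>))\<^sup>2) * indicator {0..T} s) \<longlonglongrightarrow> 0"
          \<comment> \<open>Time 0 is excluded: there the simple processes are 0 and need not
            converge to H.\<close>
          using AE_lborel_singleton[of "0::real"]
        proof eventually_elim
          case s: (elim s)
          show ?case
          proof (cases "s \<in> {0..T}")
            case True
            with s have "s \<in> {0<..T}" by auto
            from tendsto_power[OF tendsto_norm[OF tendsto_diff[OF S_lim[OF this elim(1)] tendsto_const[of "H s \<omega>"]]], of 2]
            have "(\<lambda>n. (cmod (?S n s \<omega> - H s \<omega>))\<^sup>2) \<longlonglongrightarrow> 0"
              by simp
            from tendsto_ennrealI[OF this] show ?thesis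
              using True by simp
          qed simp
        qed
      qed auto
      then show ?case
        by simp
    qed
  qed
  have null2: "null_in_probability M (\<lambda>n \<omega>. ennreal (cmod (simple_ito B (Suc n) (\<tau> n) (c n) t \<omega> - mode_mart \<sigma> \<xi> a b t \<omega>)))"
    if t: "t \<in> {0..T}" for t
  proof -
    let ?s = "\<lambda>n i. min t (\<tau> n i)"
    let ?E = "\<lambda>n i. mode_error \<sigma> \<xi> a b (?s n i) (?s n (Suc i))"
    have s: "0 \<le> ?s n i" "?s n i \<le> ?s n (Suc i)" "?s n i \<le> T" for n i
      using t \<tau>_nonneg min.mono[OF order_refl \<tau>_mono] by auto
    have sq: "integrable M (\<lambda>\<omega>. (cmod (?E n i \<omega>))\<^sup>2)" "(LINT \<omega>|M. (cmod (?E n i \<omega>))\<^sup>2) \<le> C * (?s n (Suc i) - ?s n i)\<^sup>2" for n i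
      using mode_error_square[OF s(1,2) s(3)[of n "Suc i"] m_def K_def] by (simp_all add: C_def)
    have O: "0 \<le> ?s n (Suc n) \<and> (\<lambda>\<omega>. \<Sum>i<Suc n. ?E n i \<omega>) \<in> borel_measurable (F (?s n (Suc n))) \<and>
      integrable M (\<lambda>\<omega>. (cmod (\<Sum>i<Suc n. ?E n i \<omega>))\<^sup>2) \<and>
      (LINT \<omega>|M. (cmod (\<Sum>i<Suc n. ?E n i \<omega>))\<^sup>2) = (\<Sum>i<Suc n. LINT \<omega>|M. (cmod (?E n i \<omega>))\<^sup>2)" for n
    proof (rule orthogonal_sum[of "?s n" "Suc n" "?E n"])
      show "0 \<le> ?s n 0" "\<And>i. i < Suc n \<Longrightarrow> ?s n i \<le> ?s n (Suc i)"
        by (rule s)+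
      show "?E n i \<in> borel_measurable (F (?s n (Suc i)))" "integrable M (\<lambda>\<omega>. (cmod (?E n i \<omega>))\<^sup>2)" for i
        by (rule mode_error_adapted[OF s(1,2)], rule sq)
      fix i and Y :: "'a \<Rightarrow> complex"
      assume Y: "Y \<in> borel_measurable (F (?s n i))" "integrable M (\<lambda>\<omega>. (cmod (Y \<omega>))\<^sup>2)"
      show "(LINT \<omega>|M. ?E n i \<omega> * Y \<omega>) = 0"
        by (rule mode_error_orthogonal[OF s(1,2) Y(1) integrable_of_square[OF adapted_measurable[OF Y(1) s(1)] Y(2)]])
    qed
    have "null_in_probability M (\<lambda>n \<omega>. ennreal (cmod (\<Sum>i<Suc n. ?E n i \<omega>)))"
    proof (rule null_in_probability_mean_square)
      show "(\<lambda>\<omega>. \<Sum>i<Suc n. ?E n i \<omega>) \<in> borel_measurable M" for n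
        using O[of n] adapted_measurable[of "\<lambda>\<omega>. \<Sum>i<Suc n. ?E n i \<omega>" "?s n (Suc n)"] by blast
      show "integrable M (\<lambda>\<omega>. (cmod (\<Sum>i<Suc n. ?E n i \<omega>))\<^sup>2)" for n
        using O[of n] by blast
      show "(\<lambda>n. LINT \<omega>|M. (cmod (\<Sum>i<Suc n. ?E n i \<omega>))\<^sup>2) \<longlonglongrightarrow> 0"
      proof (rule tendsto_sandwich[OF _ _ tendsto_const])
        show "\<forall>\<^sub>F n in sequentially. (LINT \<omega>|M. (cmod (\<Sum>i<Suc n. ?E n i \<omega>))\<^sup>2) \<le> C * T * t * inverse (real (Suc n))"
        proof (rule always_eventually, rule allI)
          fix n
          have "(LINT \<omega>|M. (cmod (\<Sum>i<Suc n. ?E n i \<omega>))\<^sup>2) = (\<Sum>i<Suc n. LINT \<omega>|M. (cmod (?E n i \<omega>))\<^sup>2)"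
            using O[of n] by blast
          also have "\<dots> \<le> (\<Sum>i<Suc n. C * (T * inverse (real (Suc n))) * (?s n (Suc i) - ?s n i))"
          proof (rule sum_mono)
            fix i
            have "?s n (Suc i) - ?s n i \<le> T * inverse (real (Suc n))"
              using \<tau>_step[of n i] \<tau>_mono[of n i] by linarith
            \<comment> \<open>One factor of the squared step is estimated by the mesh; the other is
              kept and telescopes to t.\<close>
            then have "C * ((?s n (Suc i) - ?s n i) * (?s n (Suc i) - ?s n i)) \<le> C * ((T * inverse (real (Suc n))) * (?s n (Suc i) - ?s n i))"
              using s(2)[of n i] C0 by (intro mult_left_mono mult_right_mono) auto
            then show "(LINT \<omega>|M. (cmod (?E n i \<omega>))\<^sup>2) \<le> C * (T * inverse (real (Suc n))) * (?s n (Suc i) - ?s n i)"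
              using sq(2)[of n i] by (simp only: power2_eq_square mult.assoc)
          qed
          also have "\<dots> = C * (T * inverse (real (Suc n))) * (?s n (Suc n) - ?s n 0)"
            unfolding sum_distrib_left[symmetric] sum_lessThan_telescope[of "?s n" "Suc n"] ..
          also have "\<dots> = C * T * t * inverse (real (Suc n))"
            using t \<tau>0[of n] \<tau>N[of n] by simp
          finally show "(LINT \<omega>|M. (cmod (\<Sum>i<Suc n. ?E n i \<omega>))\<^sup>2) \<le> C * T * t * inverse (real (Suc n))" .
        qed
        show "(\<lambda>n. C * T * t * inverse (real (Suc n))) \<longlonglongrightarrow> 0"
          by (intro tendsto_mult_right_zero LIMSEQ_inverse_real_of_nat)
      qed simp
    qed
    moreover have "cmod (simple_ito B (Suc n) (\<tau> n) (c n) t \<omega> - mode_mart \<sigma> \<xi> a b t \<omega>) = cmod (\<Sum>i<Suc n. ?E n i \<omega>)" if "\<omega> \<in> space M" for n \<omega>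
      using mode_ito_error[OF that t \<tau>0[of n] \<tau>N[of n] \<tau>_mono, of \<sigma> \<xi> a b]
      unfolding c_def H_def by (simp only: norm_minus_cancel)
    then have "{\<omega> \<in> space M. ennreal (cmod (simple_ito B (Suc n) (\<tau> n) (c n) t \<omega> - mode_mart \<sigma> \<xi> a b t \<omega>)) > \<epsilon>}
       = {\<omega> \<in> space M. ennreal (cmod (\<Sum>i<Suc n. ?E n i \<omega>)) > \<epsilon>}" for n \<epsilon>
      by (intro Collect_cong conj_cong refl) (simp only:)
    ultimately show ?thesis
      unfolding null_in_probability_def by (simp only:)
  qed
  show ?thesis
    unfolding has_ito_integral_def H_def[symmetric]
  proof (intro conjI ballI)
    show "(\<lambda>(t, \<omega>). H t \<omega>) \<in> borel_measurable (restrict_space borel {0..T} \<Otimes>\<^sub>M M)"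
      using measurable_restrict_fst[OF H_joint] by (simp add: case_prod_beta')
    show "AE \<omega> in M. (\<integral>\<^sup>+s\<in>{0..T}. ennreal ((cmod (H s \<omega>))\<^sup>2) \<partial>lborel) < \<infinity>"
    proof (rule AE_I2)
      fix \<omega> assume \<omega>: "\<omega> \<in> space M"
      have "(\<integral>\<^sup>+s\<in>{0..T}. ennreal ((cmod (H s \<omega>))\<^sup>2) \<partial>lborel) \<le> (\<integral>\<^sup>+s. ennreal (\<kappa>\<^sup>2) * indicator {0..T} s \<partial>lborel)"
        using H_bd[OF _ \<omega>] by (intro nn_integral_mono) (auto simp: indicator_def intro!: ennreal_leI power_mono)
      also have "\<dots> < \<infinity>"
        using T by (subst nn_integral_cmult) (auto simp: ennreal_mult_less_top)
      finally show "(\<integral>\<^sup>+s\<in>{0..T}. ennreal ((cmod (H s \<omega>))\<^sup>2) \<partial>lborel) < \<infinity>" .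
    qed
    show "mode_mart \<sigma> \<xi> a b t \<in> borel_measurable M" if "t \<in> {0..T}" for t
      unfolding mode_mart_def[abs_def] using that adapted_measurable[OF mode_u_adapted] adapted_measurable[OF mode_drift_integral_adapted]
      by (intro borel_measurable_diff) auto
    show "AE \<omega> in M. continuous_on {0..T} (\<lambda>t. mode_mart \<sigma> \<xi> a b t \<omega>)"
      using mode_u_continuous[of T \<sigma> \<xi> a b] AE_space
    proof eventually_elim
      case (elim \<omega>)
      note i = set_borel_integral_eq_integral[OF mode_drift_integrable[OF elim(2) order_refl]]
      show ?case
        unfolding mode_mart_def i(2)
        by (intro continuous_on_diff elim(1) continuous_on_const indefinite_integral_continuous_1 i(1))
    qed
    show "\<exists>N \<tau> c. (\<forall>n. simple_process M F T (N n) (\<tau> n) (c n)) \<and>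
        null_in_probability M (\<lambda>n \<omega>. \<integral>\<^sup>+s\<in>{0..T}.
           ennreal ((cmod (simple_value (N n) (\<tau> n) (c n) s \<omega> - H s \<omega>))\<^sup>2) \<partial>lborel) \<and>
        (\<forall>t\<in>{0..T}. null_in_probability M (\<lambda>n \<omega>.
           ennreal (cmod (simple_ito B (N n) (\<tau> n) (c n) t \<omega> - mode_mart \<sigma> \<xi> a b t \<omega>))))"
      using simple null1 null2 by (intro exI[of _ Suc] exI[of _ \<tau>] exI[of _ c]) auto
  qed (use H_ad in auto)
qed

lemma mode_solution_exists:
  assumes T: "0 < T"
  shows "mode_solution M F B \<sigma> T \<xi> a b (mode_u \<sigma> \<xi> a b) (mode_lin \<sigma> \<xi> a b False)"
  unfolding mode_solution_def
proof (intro conjI ballI exI[of _ "mode_mart \<sigma> \<xi> a b"] mode_has_ito_integral[OF T])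
  show "AE \<omega> in M. continuous_on {0..T} (\<lambda>t. mode_u \<sigma> \<xi> a b t \<omega>) \<and> continuous_on {0..T} (\<lambda>t. mode_lin \<sigma> \<xi> a b False t \<omega>)"
    using mode_u_continuous[of T \<sigma> \<xi> a b] AE_space by eventually_elim (simp add: mode_lin_continuous)
  show "AE \<omega> in M. \<forall>t\<in>{0..T}. mode_u \<sigma> \<xi> a b t \<omega> = a + integral {0..t}
      (\<lambda>s. mode_lin \<sigma> \<xi> a b False s \<omega> - of_real (\<sigma>\<^sup>2 / 2 * \<xi>\<^sup>2) * mode_u \<sigma> \<xi> a b s \<omega>) + mode_mart \<sigma> \<xi> a b t \<omega>"
    using W_eq_B BM_zero AE_space
  proof eventually_elim
    case (elim \<omega>)
    have "W 0 \<omega> = 0"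
      using elim by simp
    then have "mode_u \<sigma> \<xi> a b 0 \<omega> = a"
      unfolding mode_u_def mode_lin_def unimodular.linear_sol_0[OF unimodular_W[OF elim(3)]] by simp
    then show ?case
      using set_borel_integral_eq_integral(2)[OF mode_drift_integrable[OF elim(3) order_refl], of _ \<sigma> \<xi> a b]
      by (simp add: mode_mart_def mode_drift_def)
  qed
  show "AE \<omega> in M. \<forall>t\<in>{0..T}. mode_lin \<sigma> \<xi> a b False t \<omega> = b + integral {0..t} (\<lambda>s. of_real \<xi> * mode_u \<sigma> \<xi> a b s \<omega>)"
  proof (intro AE_I2 ballI)
    fix \<omega> t assume "\<omega> \<in> space M" "t \<in> {0..T}"
    then show "mode_lin \<sigma> \<xi> a b False t \<omega> = b + integral {0..t} (\<lambda>s. of_real \<xi> * mode_u \<sigma> \<xi> a b s \<omega>)"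
      using unimodular.linear_sol_integral(2)[OF unimodular_W, of \<omega> t "\<sigma> * \<xi>" \<xi> a b False]
      by (simp add: mode_lin_def mode_u_def coef_def mult.assoc)
  qed
qed (use mode_u_adapted mode_lin_adapted in auto)

end

section \<open>An inequality for Ito integrals\<close>

lemma cmod_diff_square: "(cmod (x - y))\<^sup>2 \<le> 2 * (cmod x)\<^sup>2 + 2 * (cmod y)\<^sup>2"
proof -
  have "(cmod (x - y))\<^sup>2 \<le> (cmod x + cmod y)\<^sup>2"
    by (intro power_mono norm_triangle_ineq4) simp
  also have "\<dots> \<le> 2 * (cmod x)\<^sup>2 + 2 * (cmod y)\<^sup>2"
    using sum_squares_bound[of "cmod x" "cmod y"] by (simp add: power2_sum)
  finally show ?thesis .
qed

text \<open>Borel-Cantelli with the summable thresholds (1/2)^k, used both as size of the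
  exceptional event and as size of the deviation.\<close>

lemma (in prob_space) null_in_probability_subseq:
  assumes [measurable]: "\<And>n. Z n \<in> borel_measurable M" and Z: "null_in_probability M Z"
  obtains r where "strict_mono r" "AE \<omega> in M. (\<lambda>n. Z (r n) \<omega>) \<longlonglongrightarrow> 0"
proof -
  define e where "e k = (1 / 2 :: real) ^ k" for k :: nat
  have e: "0 < e k" for k
    by (simp add: e_def)
  have "\<exists>N. \<forall>n\<ge>N. measure M {\<omega> \<in> space M. Z n \<omega> > ennreal (e k)} < e k" for k
  proof -
    have "(\<lambda>n. measure M {\<omega> \<in> space M. Z n \<omega> > ennreal (e k)}) \<longlonglongrightarrow> 0"
      using Z e[of k] by (simp add: null_in_probability_def)
    from order_tendstoD(2)[OF this e[of k]] show ?thesis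
      by (simp add: eventually_sequentially)
  qed
  then obtain N where N: "\<And>k n. N k \<le> n \<Longrightarrow> measure M {\<omega> \<in> space M. Z n \<omega> > ennreal (e k)} < e k"
    by metis
  \<comment> \<open>Summation makes r strictly increasing while keeping r k \<ge> N k.\<close>
  define r where "r k = (\<Sum>j\<le>k. Suc (N j))" for k
  have mono: "strict_mono r"
    by (rule strict_monoI_Suc) (simp add: r_def)
  have rN: "N k \<le> r k" for k
  proof -
    have "Suc (N k) \<le> r k"
      unfolding r_def by (rule member_le_sum) auto
    then show ?thesis by simp
  qed
  let ?A = "\<lambda>k. {\<omega> \<in> space M. Z (r k) \<omega> > ennreal (e k)}"
  have "AE \<omega> in M. \<forall>\<^sub>F k in sequentially. \<omega> \<in> space M - ?A k"
  proof (rule borel_cantelli_AE1)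
    show "summable (\<lambda>k. measure M (?A k))"
    proof (rule summable_comparison_test)
      show "\<exists>K. \<forall>k\<ge>K. norm (measure M (?A k)) \<le> e k"
        using N[OF rN] by (intro exI[of _ 0]) (auto intro: less_imp_le)
      show "summable e"
        unfolding e_def by (rule summable_geometric) simp
    qed
  qed (auto simp: less_top[symmetric])
  then have "AE \<omega> in M. (\<lambda>n. Z (r n) \<omega>) \<longlonglongrightarrow> 0"
  proof eventually_elim
    case (elim \<omega>)
    show ?case
    proof (rule tendsto_sandwich[OF _ _ tendsto_const])
      show "\<forall>\<^sub>F n in sequentially. Z (r n) \<omega> \<le> ennreal (e n)"
        using elim by eventually_elim (auto simp: not_less)
      have "e \<longlonglongrightarrow> 0"
        unfolding e_def by (rule LIMSEQ_power_zero) simp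
      from tendsto_ennrealI[OF this] show "(\<lambda>n. ennreal (e n)) \<longlonglongrightarrow> 0"
        by simp
    qed simp
  qed
  with mono show thesis
    by (rule that)
qed

lemma null_in_probability_compose:
  "null_in_probability M Z \<Longrightarrow> strict_mono r \<Longrightarrow> null_in_probability M (\<lambda>n. Z (r n))"
  unfolding null_in_probability_def using LIMSEQ_subseq_LIMSEQ[of _ 0 r] by (auto simp: o_def)

section \<open>Simple processes: quadratic variation and truncation\<close>

lemma simple_value_square:
  assumes \<tau>: "\<And>i. i < N \<Longrightarrow> \<tau> i \<le> \<tau> (Suc i)"
  shows "(cmod (simple_value N \<tau> c s \<omega>))\<^sup>2 = (\<Sum>i<N. indicator {\<tau> i <.. \<tau> (Suc i)} s * (cmod (c i \<omega>))\<^sup>2)"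
proof -
  have eq: "complex_of_real (\<Sum>i<N. indicator {\<tau> i <.. \<tau> (Suc i)} s * (cmod (c i \<omega>))\<^sup>2)
      = simple_value N \<tau> (\<lambda>i \<omega>. of_real ((cmod (c i \<omega>))\<^sup>2)) s \<omega>"
    unfolding simple_value_def of_real_sum by (intro sum.cong) (auto simp: indicator_def)
  show ?thesis
  proof (cases "\<exists>i<N. s \<in> {\<tau> i <.. \<tau> (Suc i)}")
    case True
    then obtain i where i: "i < N" "\<tau> i < s" "s \<le> \<tau> (Suc i)"
      by auto
    have "complex_of_real (\<Sum>i<N. indicator {\<tau> i <.. \<tau> (Suc i)} s * (cmod (c i \<omega>))\<^sup>2) = of_real ((cmod (c i \<omega>))\<^sup>2)"
      unfolding eq by (rule simple_value_eq[of N \<tau>, OF \<tau> i])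
    moreover have "simple_value N \<tau> c s \<omega> = c i \<omega>"
      by (rule simple_value_eq[of N \<tau>, OF \<tau> i])
    ultimately show ?thesis
      by (simp only: of_real_eq_iff)
  next
    case False
    then have "indicator {\<tau> i <.. \<tau> (Suc i)} s = (0::real)" "indicator {\<tau> i <.. \<tau> (Suc i)} s = (0::complex)" if "i < N" for i
      using that by (auto simp: indicator_def)
    then show ?thesis
      by (simp add: simple_value_def)
  qed
qed

text \<open>The integral over [0, t] of the squared modulus of the simple process, as a finite sum;
  \<open>simple_value_nn_integral\<close> confirms it when the partition is ordered and starts at a
  nonnegative time.\<close>

definition quad :: "nat \<Rightarrow> (nat \<Rightarrow> real) \<Rightarrow> (nat \<Rightarrow> 'a \<Rightarrow> complex) \<Rightarrow> real \<Rightarrow> 'a \<Rightarrow> real" where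
  "quad N \<tau> c t \<omega> = (\<Sum>i<N. (cmod (c i \<omega>))\<^sup>2 * (min t (\<tau> (Suc i)) - min t (\<tau> i)))"

lemma simple_value_nn_integral:
  assumes \<tau>: "\<And>i. i < N \<Longrightarrow> \<tau> i \<le> \<tau> (Suc i)" "0 \<le> \<tau> 0" and t: "0 \<le> t"
  shows "(\<integral>\<^sup>+s\<in>{0..t}. ennreal ((cmod (simple_value N \<tau> c s \<omega>))\<^sup>2) \<partial>lborel) = ennreal (quad N \<tau> c t \<omega>)"
proof -
  have \<tau>0: "0 \<le> \<tau> i" if "i \<le> N" for i
    using partition_mono[of N \<tau> 0 i, OF \<tau>(1)] \<tau>(2) that by simp
  have "(\<integral>\<^sup>+s\<in>{0..t}. ennreal ((cmod (simple_value N \<tau> c s \<omega>))\<^sup>2) \<partial>lborel)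
      = (\<integral>\<^sup>+s. (\<Sum>i<N. ennreal ((cmod (c i \<omega>))\<^sup>2) * indicator {min t (\<tau> i) <.. min t (\<tau> (Suc i))} s) \<partial>lborel)"
  proof (rule nn_integral_cong)
    fix s :: real
    have "ennreal ((cmod (simple_value N \<tau> c s \<omega>))\<^sup>2) * indicator {0..t} s
       = (\<Sum>i<N. ennreal (indicator {\<tau> i <.. \<tau> (Suc i)} s * (cmod (c i \<omega>))\<^sup>2) * indicator {0..t} s)"
    proof -
      have "(cmod (simple_value N \<tau> c s \<omega>))\<^sup>2 = (\<Sum>i<N. indicator {\<tau> i <.. \<tau> (Suc i)} s * (cmod (c i \<omega>))\<^sup>2)"
        by (rule simple_value_square) (rule \<tau>(1))
      then show ?thesis
        unfolding sum_distrib_right[symmetric] by (simp only:) (subst sum_ennreal, auto)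
    qed
    also have "\<dots> = (\<Sum>i<N. ennreal ((cmod (c i \<omega>))\<^sup>2) * indicator {min t (\<tau> i) <.. min t (\<tau> (Suc i))} s)"
    proof (rule sum.cong[OF refl])
      fix i assume "i \<in> {..<N}"
      then show "ennreal (indicator {\<tau> i <.. \<tau> (Suc i)} s * (cmod (c i \<omega>))\<^sup>2) * indicator {0..t} s
         = ennreal ((cmod (c i \<omega>))\<^sup>2) * indicator {min t (\<tau> i) <.. min t (\<tau> (Suc i))} s"
        using \<tau>0[of i] t by (auto simp: indicator_def min_def split: if_splits)
    qed
    finally show "ennreal ((cmod (simple_value N \<tau> c s \<omega>))\<^sup>2) * indicator {0..t} s
       = (\<Sum>i<N. ennreal ((cmod (c i \<omega>))\<^sup>2) * indicator {min t (\<tau> i) <.. min t (\<tau> (Suc i))} s)" .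
  qed
  also have "\<dots> = (\<Sum>i<N. ennreal ((cmod (c i \<omega>))\<^sup>2) * emeasure lborel {min t (\<tau> i) <.. min t (\<tau> (Suc i))})"
    by (subst nn_integral_sum) (auto simp: nn_integral_cmult_indicator)
  also have "\<dots> = (\<Sum>i<N. ennreal ((cmod (c i \<omega>))\<^sup>2 * (min t (\<tau> (Suc i)) - min t (\<tau> i))))"
    using min.mono[OF order_refl \<tau>(1)] by (intro sum.cong refl) (simp add: ennreal_mult)
  also have "\<dots> = ennreal (quad N \<tau> c t \<omega>)"
    unfolding quad_def using min.mono[OF order_refl \<tau>(1)] by (intro sum_ennreal) simp
  finally show ?thesis .
qed

text \<open>Stopping when the integrated square would exceed K. The test includes step i itself, so
  the bound K is never overshot; yet it involves only c 0, ..., c i and deterministic times, so it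
  is known at the start of that step.\<close>

definition truncate_at :: "real \<Rightarrow> (nat \<Rightarrow> real) \<Rightarrow> (nat \<Rightarrow> 'a \<Rightarrow> complex) \<Rightarrow> real \<Rightarrow> nat \<Rightarrow> 'a \<Rightarrow> complex" where
  "truncate_at t \<tau> c K i \<omega> = (if quad (Suc i) \<tau> c t \<omega> \<le> K then c i \<omega> else 0)"

lemma quad_Suc: "quad (Suc N) \<tau> c t \<omega> = quad N \<tau> c t \<omega> + (cmod (c N \<omega>))\<^sup>2 * (min t (\<tau> (Suc N)) - min t (\<tau> N))"
  by (simp add: quad_def)

lemma quad_nonneg:
  assumes "\<And>i. i < N \<Longrightarrow> \<tau> i \<le> \<tau> (Suc i)"
  shows "0 \<le> quad N \<tau> c t \<omega>"
  unfolding quad_def using min.mono[OF order_refl assms] by (intro sum_nonneg) simp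

lemma quad_mono:
  assumes \<tau>: "\<And>i. i < N \<Longrightarrow> \<tau> i \<le> \<tau> (Suc i)" and "i \<le> N"
  shows "quad i \<tau> c t \<omega> \<le> quad N \<tau> c t \<omega>"
  unfolding quad_def using min.mono[OF order_refl \<tau>] assms(2) by (intro sum_mono2) auto

lemma quad_truncate:
  assumes \<tau>: "\<And>i. i < N \<Longrightarrow> \<tau> i \<le> \<tau> (Suc i)" and K: "0 \<le> K"
  shows "quad N \<tau> (truncate_at t \<tau> c K) t \<omega> \<le> quad N \<tau> c t \<omega>"
    and "quad N \<tau> (truncate_at t \<tau> c K) t \<omega> \<le> K"
proof -
  show le: "quad N \<tau> (truncate_at t \<tau> c K) t \<omega> \<le> quad N \<tau> c t \<omega>"
    unfolding quad_def using min.mono[OF order_refl \<tau>] by (intro sum_mono mult_right_mono) (auto simp: truncate_at_def)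
  show "quad N \<tau> (truncate_at t \<tau> c K) t \<omega> \<le> K"
    using \<tau>
  proof (induction N)
    case 0
    then show ?case using K by (simp add: quad_def)
  next
    case (Suc N)
    show ?case
    proof (cases "quad (Suc N) \<tau> c t \<omega> \<le> K")
      case True
      have "quad (Suc N) \<tau> (truncate_at t \<tau> c K) t \<omega> \<le> quad (Suc N) \<tau> c t \<omega>"
        unfolding quad_def using min.mono[OF order_refl Suc.prems] by (intro sum_mono mult_right_mono) (auto simp: truncate_at_def)
      then show ?thesis using True by simp
    next
      case False
      then have "quad (Suc N) \<tau> (truncate_at t \<tau> c K) t \<omega> = quad N \<tau> (truncate_at t \<tau> c K) t \<omega>"
        by (simp add: quad_Suc truncate_at_def)
      then show ?thesis using Suc by simp
    qed
  qed
qed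

lemma simple_ito_truncate:
  assumes \<tau>: "\<And>i. i < N \<Longrightarrow> \<tau> i \<le> \<tau> (Suc i)" and "quad N \<tau> c t \<omega> \<le> K"
  shows "simple_ito B N \<tau> (truncate_at t \<tau> c K) t \<omega> = simple_ito B N \<tau> c t \<omega>"
  unfolding simple_ito_def
proof (rule sum.cong[OF refl])
  fix i assume "i \<in> {..<N}"
  then have "quad (Suc i) \<tau> c t \<omega> \<le> K"
    using quad_mono[of N \<tau> "Suc i" c t \<omega>, OF \<tau>] assms(2) by simp
  then show "truncate_at t \<tau> c K i \<omega> * of_real (B (min t (\<tau> (Suc i))) \<omega> - B (min t (\<tau> i)) \<omega>)
    = c i \<omega> * of_real (B (min t (\<tau> (Suc i))) \<omega> - B (min t (\<tau> i)) \<omega>)"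
    by (simp add: truncate_at_def)
qed

context brownian_motion
begin

lemma simple_processD:
  assumes "simple_process M F T N \<tau> c"
  shows "\<And>i. i < N \<Longrightarrow> \<tau> i \<le> \<tau> (Suc i)" "\<And>i. i \<le> N \<Longrightarrow> 0 \<le> \<tau> i" "\<And>i. i \<le> N \<Longrightarrow> \<tau> i \<le> T"
    "\<And>i. i < N \<Longrightarrow> c i \<in> borel_measurable (F (\<tau> i))" "\<And>i. i < N \<Longrightarrow> c i \<in> borel_measurable M"
proof -
  show \<tau>: "\<And>i. i < N \<Longrightarrow> \<tau> i \<le> \<tau> (Suc i)" and c: "\<And>i. i < N \<Longrightarrow> c i \<in> borel_measurable (F (\<tau> i))"
    using assms by (auto simp: simple_process_def)
  show \<tau>0: "0 \<le> \<tau> i" if "i \<le> N" for i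
    using partition_mono[of N \<tau> 0 i, OF \<tau>] that assms by (simp add: simple_process_def)
  show "\<tau> i \<le> T" if "i \<le> N" for i
    using partition_mono[of N \<tau> i N, OF \<tau>] that assms by (simp add: simple_process_def)
  show "c i \<in> borel_measurable M" if "i < N" for i
    using adapted_measurable[OF c[OF that] \<tau>0] that by simp
qed

lemma simple_process_truncate:
  assumes s: "simple_process M F T N \<tau> c"
  shows "simple_process M F T N \<tau> (truncate_at t \<tau> c K)"
proof -
  note sD = simple_processD[OF s]
  obtain C where C: "\<And>i \<omega>. i < N \<Longrightarrow> \<omega> \<in> space M \<Longrightarrow> cmod (c i \<omega>) \<le> C"
    using s unfolding simple_process_def by blast
  have "truncate_at t \<tau> c K i \<in> borel_measurable (F (\<tau> i))" if i: "i < N" for i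
  proof -
    have cj: "c j \<in> borel_measurable (F (\<tau> i))" if "j \<le> i" for j
      using that i partition_mono[of N \<tau> j i, OF sD(1)] by (intro adapted_mono[OF sD(4)]) auto
    then have "quad (Suc i) \<tau> c t \<in> borel_measurable (F (\<tau> i))"
      unfolding quad_def[abs_def] by (intro borel_measurable_sum borel_measurable_times) auto
    then have [measurable]: "Measurable.pred (F (\<tau> i)) (\<lambda>\<omega>. quad (Suc i) \<tau> c t \<omega> \<le> K)"
      by measurable
    show ?thesis
      unfolding truncate_at_def[abs_def] using cj[of i] by measurable
  qed
  moreover have "cmod (truncate_at t \<tau> c K i \<omega>) \<le> \<bar>C\<bar>" if "i < N" "\<omega> \<in> space M" for i \<omega>
    using C[OF that] by (auto simp: truncate_at_def)
  ultimately show ?thesis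
    using s by (auto simp: simple_process_def)
qed

text \<open>The summands are martingale differences, so only the diagonal terms remain. The right
  side is stated through \<open>quad\<close> because that is the quantity controlled by
  truncation.\<close>

lemma simple_isometry:
  assumes s: "simple_process M F T N \<tau> c" and t: "0 \<le> t"
  shows "simple_ito B N \<tau> c t \<in> borel_measurable M"
    and "(\<integral>\<^sup>+\<omega>. ennreal ((cmod (simple_ito B N \<tau> c t \<omega>))\<^sup>2) \<partial>M) = (\<integral>\<^sup>+\<omega>. ennreal (quad N \<tau> c t \<omega>) \<partial>M)"
proof -
  note sD = simple_processD[OF s]
  obtain C where C: "\<And>i \<omega>. i < N \<Longrightarrow> \<omega> \<in> space M \<Longrightarrow> cmod (c i \<omega>) \<le> C"
    using s unfolding simple_process_def by blast
  let ?a = "\<lambda>i. min t (\<tau> i)" and ?D = "\<lambda>i \<omega>. c i \<omega> * of_real (B (min t (\<tau> (Suc i))) \<omega> - B (min t (\<tau> i)) \<omega>)"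
  have a: "0 \<le> ?a i" "?a i \<le> ?a (Suc i)" if "i < N" for i
    using sD(2)[of i] that t min.mono[OF order_refl sD(1)[OF that]] by auto
  have csq: "integrable M (\<lambda>\<omega>. (cmod (c i \<omega>))\<^sup>2)" if "i < N" for i
    using sD(5)[OF that] C[OF that] by (intro integrable_const_bound[where B = "C\<^sup>2"]) (auto intro!: AE_I2 power_mono)
  \<comment> \<open>An interval beginning after t contributes nothing. It is treated apart since its
    coefficient is known only at \<tau> i, later than the capped time t.\<close>
  have zero: "?D i = (\<lambda>\<omega>. 0)" if "i < N" "\<not> \<tau> i \<le> t" for i
  proof -
    have "?a i = t" "?a (Suc i) = t"
      using that sD(1)[OF that(1)] by auto
    then show ?thesis by auto
  qed
  have cad: "c i \<in> borel_measurable (F (?a i))" if "i < N" "\<tau> i \<le> t" for i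
    using sD(4)[OF that(1)] that(2) by (simp add: min_def)
  have Dad: "?D i \<in> borel_measurable (F (?a (Suc i)))" if i: "i < N" for i
  proof (cases "\<tau> i \<le> t")
    case True
    then show ?thesis
    proof -
      have [measurable]: "c i \<in> borel_measurable (F (?a (Suc i)))" "B (?a (Suc i)) \<in> borel_measurable (F (?a (Suc i)))"
        "B (?a i) \<in> borel_measurable (F (?a (Suc i)))"
        using a[OF i] adapted_mono[OF cad[OF i True] a(2)[OF i]] B_adapted[of "?a i" "?a (Suc i)"] B_adapted[of "?a (Suc i)" "?a (Suc i)"]
        by auto
      show ?thesis
        by measurable
    qed
  qed (use zero[OF i] in simp)
  have Dsq: "integrable M (\<lambda>\<omega>. (cmod (?D i \<omega>))\<^sup>2) \<and> (LINT \<omega>|M. (cmod (?D i \<omega>))\<^sup>2) = (LINT \<omega>|M. (cmod (c i \<omega>))\<^sup>2 * (?a (Suc i) - ?a i))"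
    if i: "i < N" for i
  proof (cases "\<tau> i \<le> t")
    case True
    show ?thesis
      using increment_square_mult[OF a[OF i] cad[OF i True] csq[OF i]] by (simp add: mult.commute)
  next
    case False
    then have "?a i = t" "?a (Suc i) = t"
      using sD(1)[OF i] by auto
    then show ?thesis
      using zero[OF i False] by simp
  qed
  have mart: "(LINT \<omega>|M. ?D i \<omega> * Y \<omega>) = 0"
    if i: "i < N" and Y: "Y \<in> borel_measurable (F (?a i))" "integrable M (\<lambda>\<omega>. (cmod (Y \<omega>))\<^sup>2)" for i Y
  proof (cases "\<tau> i \<le> t")
    case True
    have Yi: "integrable M Y"
      using integrable_of_square[OF adapted_measurable[OF Y(1)] Y(2)] a[OF i] by simp
    have "(\<lambda>\<omega>. c i \<omega> * Y \<omega>) \<in> borel_measurable (F (?a i))"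
      by (intro borel_measurable_times cad i True Y)
    moreover have "integrable M (\<lambda>\<omega>. c i \<omega> * Y \<omega>)"
      by (rule integrable_bounded_mult[OF sD(5)[OF i] C[OF i] Yi])
    ultimately have "(LINT \<omega>|M. (c i \<omega> * Y \<omega>) * of_real (B (?a (Suc i)) \<omega> - B (?a i) \<omega>)) = 0"
      by (rule increment_mean_mult(2)[OF a[OF i]])
    moreover have "(\<lambda>\<omega>. ?D i \<omega> * Y \<omega>) = (\<lambda>\<omega>. (c i \<omega> * Y \<omega>) * of_real (B (?a (Suc i)) \<omega> - B (?a i) \<omega>))"
      by (rule ext) (simp only: mult_ac)
    ultimately show ?thesis
      by (simp only:)
  next
    case False
    show ?thesis
      using fun_cong[OF zero[OF i False]] by (simp only: mult_zero_left Bochner_Integration.integral_zero)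
  qed
  have a0: "0 \<le> ?a 0"
    using sD(2)[of 0] t by simp
  have O: "0 \<le> ?a N \<and> (\<lambda>\<omega>. \<Sum>i<N. ?D i \<omega>) \<in> borel_measurable (F (?a N)) \<and>
    integrable M (\<lambda>\<omega>. (cmod (\<Sum>i<N. ?D i \<omega>))\<^sup>2) \<and>
    (LINT \<omega>|M. (cmod (\<Sum>i<N. ?D i \<omega>))\<^sup>2) = (\<Sum>i<N. LINT \<omega>|M. (cmod (?D i \<omega>))\<^sup>2)"
    using Dsq by (intro orthogonal_sum[of ?a N ?D, OF a0 a(2) Dad _ mart]) auto
  have ito: "simple_ito B N \<tau> c t = (\<lambda>\<omega>. \<Sum>i<N. ?D i \<omega>)"
    by (simp add: simple_ito_def[abs_def])
  show "simple_ito B N \<tau> c t \<in> borel_measurable M"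
    unfolding ito using O adapted_measurable by blast
  have "(\<integral>\<^sup>+\<omega>. ennreal ((cmod (simple_ito B N \<tau> c t \<omega>))\<^sup>2) \<partial>M) = ennreal (LINT \<omega>|M. (cmod (simple_ito B N \<tau> c t \<omega>))\<^sup>2)"
    unfolding ito using O by (intro nn_integral_eq_integral) auto
  also have "(LINT \<omega>|M. (cmod (simple_ito B N \<tau> c t \<omega>))\<^sup>2) = (LINT \<omega>|M. quad N \<tau> c t \<omega>)"
    unfolding quad_def using csq Dsq O by (simp add: ito)
  also have "ennreal \<dots> = (\<integral>\<^sup>+\<omega>. ennreal (quad N \<tau> c t \<omega>) \<partial>M)"
  proof (rule nn_integral_eq_integral[symmetric])
    show "integrable M (quad N \<tau> c t)"
      using csq by (auto simp: quad_def[abs_def])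
    show "AE \<omega> in M. 0 \<le> quad N \<tau> c t \<omega>"
      by (intro AE_I2 quad_nonneg) (rule sD(1))
  qed
  finally show "(\<integral>\<^sup>+\<omega>. ennreal ((cmod (simple_ito B N \<tau> c t \<omega>))\<^sup>2) \<partial>M) = (\<integral>\<^sup>+\<omega>. ennreal (quad N \<tau> c t \<omega>) \<partial>M)" .
qed

text \<open>
  Truncating the simple processes once their quadratic variation exceeds \<open>K\<close> does not change
  them on an event of almost full probability, and makes the isometry available in the limit.
\<close>

lemma ito_inequality_AE:
  assumes s: "\<And>n. simple_process M F T (N n) (\<tau> n) (c n)" and t: "t \<in> {0..T}"
    and H: "(\<lambda>p. H (snd p) (fst p)) \<in> borel_measurable (M \<Otimes>\<^sub>M lborel)"
    and J: "J \<in> borel_measurable M"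
    and lim_H: "AE \<omega> in M. (\<lambda>n. \<integral>\<^sup>+s\<in>{0..T}. ennreal ((cmod (simple_value (N n) (\<tau> n) (c n) s \<omega> - H s \<omega>))\<^sup>2) \<partial>lborel) \<longlonglongrightarrow> 0"
    and lim_J: "AE \<omega> in M. (\<lambda>n. simple_ito B (N n) (\<tau> n) (c n) t \<omega>) \<longlonglongrightarrow> J \<omega>"
  shows "(\<integral>\<^sup>+\<omega>. ennreal ((cmod (J \<omega>))\<^sup>2) \<partial>M) \<le> 2 * (\<integral>\<^sup>+\<omega>. (\<integral>\<^sup>+s\<in>{0..t}. ennreal ((cmod (H s \<omega>))\<^sup>2) \<partial>lborel) \<partial>M)"
proof -
  note [measurable] = H J
  note sD = simple_processD[OF s]
  have t0: "0 \<le> t" using t by simp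
  define X where "X \<omega> = (\<integral>\<^sup>+s\<in>{0..t}. ennreal ((cmod (H s \<omega>))\<^sup>2) \<partial>lborel)" for \<omega>
  define Z where "Z n \<omega> = (\<integral>\<^sup>+s\<in>{0..T}. ennreal ((cmod (simple_value (N n) (\<tau> n) (c n) s \<omega> - H s \<omega>))\<^sup>2) \<partial>lborel)" for n \<omega>
  have S_joint [measurable]: "(\<lambda>p. simple_value (N n) (\<tau> n) (c n) (snd p) (fst p)) \<in> borel_measurable (M \<Otimes>\<^sub>M lborel)" for n
    by (rule simple_value_joint[OF sD(5)])
  have Xm [measurable]: "X \<in> borel_measurable M"
    unfolding X_def[abs_def] by (intro lborel.borel_measurable_nn_integral) (unfold case_prod_beta', measurable)
  have Zm [measurable]: "Z n \<in> borel_measurable M" for n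
    unfolding Z_def[abs_def] by (intro lborel.borel_measurable_nn_integral) (unfold case_prod_beta', measurable)
  have section_m: "(\<lambda>s. H s \<omega>) \<in> borel_measurable lborel" if "\<omega> \<in> space M" for \<omega>
    using measurable_compose[OF measurable_Pair1'[OF that] H] by simp
  \<comment> \<open>Squaring S = H + (S - H) costs the factor 2 of the final inequality. An
    inequality with a constant suffices for Gronwall, so no sharp isometry is pursued.\<close>
  have quad_le: "ennreal (quad (N n) (\<tau> n) (c n) t \<omega>) \<le> 2 * X \<omega> + 2 * Z n \<omega>" if \<omega>: "\<omega> \<in> space M" for n \<omega>
  proof -
    let ?S = "\<lambda>s. simple_value (N n) (\<tau> n) (c n) s \<omega>"
    have [measurable]: "(\<lambda>s. H s \<omega>) \<in> borel_measurable borel"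
      using section_m[OF \<omega>] by simp
    have Sm [measurable]: "?S \<in> borel_measurable borel"
      unfolding simple_value_def[abs_def] by measurable
    have "ennreal (quad (N n) (\<tau> n) (c n) t \<omega>) = (\<integral>\<^sup>+s\<in>{0..t}. ennreal ((cmod (?S s))\<^sup>2) \<partial>lborel)"
      by (rule simple_value_nn_integral[symmetric]) (use sD t0 in auto)
    also have "\<dots> \<le> (\<integral>\<^sup>+s. 2 * (ennreal ((cmod (H s \<omega>))\<^sup>2) * indicator {0..t} s) + 2 * (ennreal ((cmod (?S s - H s \<omega>))\<^sup>2) * indicator {0..T} s) \<partial>lborel)"
    proof (rule nn_integral_mono)
      fix s :: real
      have "(cmod (?S s))\<^sup>2 \<le> 2 * (cmod (H s \<omega>))\<^sup>2 + 2 * (cmod (?S s - H s \<omega>))\<^sup>2"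
        using cmod_diff_square[of "H s \<omega>" "H s \<omega> - ?S s"] by (simp add: norm_minus_commute)
      then have "ennreal ((cmod (?S s))\<^sup>2) \<le> 2 * ennreal ((cmod (H s \<omega>))\<^sup>2) + 2 * ennreal ((cmod (?S s - H s \<omega>))\<^sup>2)"
        by (simp add: ennreal_leI flip: ennreal_numeral ennreal_mult ennreal_plus)
      then show "ennreal ((cmod (?S s))\<^sup>2) * indicator {0..t} s
         \<le> 2 * (ennreal ((cmod (H s \<omega>))\<^sup>2) * indicator {0..t} s) + 2 * (ennreal ((cmod (?S s - H s \<omega>))\<^sup>2) * indicator {0..T} s)"
        using t by (auto simp: indicator_def)
    qed
    also have "\<dots> = 2 * X \<omega> + 2 * Z n \<omega>"
      unfolding X_def Z_def by (subst nn_integral_add) (auto simp: nn_integral_cmult)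
    finally show ?thesis .
  qed
  show ?thesis
  proof (cases "(\<integral>\<^sup>+\<omega>. X \<omega> \<partial>M) = \<infinity>")
    case True
    then show ?thesis
      by (simp add: X_def ennreal_mult_top)
  next
    case False
    have fin: "AE \<omega> in M. X \<omega> \<noteq> \<infinity>"
      using nn_integral_PInf_AE[OF Xm] False by simp
    \<comment> \<open>Where 2 X < K the integrated squares fall below K from some index on, so the
      truncated integrals eventually coincide with the original ones and converge to J. Fatou's
      lemma transfers the isometry of the truncated integrals to J on that event.\<close>
    have bound: "(\<integral>\<^sup>+\<omega>. ennreal ((cmod (J \<omega>))\<^sup>2) * indicator {\<omega>. 2 * X \<omega> < ennreal (real K)} \<omega> \<partial>M) \<le> 2 * (\<integral>\<^sup>+\<omega>. X \<omega> \<partial>M)" for K :: nat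
    proof -
      define d where "d n = truncate_at t (\<tau> n) (c n) (real K)" for n
      define G where "G n \<omega> = ennreal ((cmod (simple_ito B (N n) (\<tau> n) (d n) t \<omega>))\<^sup>2)" for n \<omega>
      have sd: "simple_process M F T (N n) (\<tau> n) (d n)" for n
        unfolding d_def by (rule simple_process_truncate[OF s])
      have Gm [measurable]: "G n \<in> borel_measurable M" for n
        unfolding G_def[abs_def] using simple_isometry(1)[OF sd t0, of n] by measurable
      \<comment> \<open>Z n tends to 0 almost surely but perhaps not in mean. The minimum with K,
        available because of the truncation, supplies a constant majorant.\<close>
      have "(\<lambda>n. \<integral>\<^sup>+\<omega>. min (2 * X \<omega> + 2 * Z n \<omega>) (ennreal (real K)) \<partial>M) \<longlonglongrightarrow> (\<integral>\<^sup>+\<omega>. min (2 * X \<omega>) (ennreal (real K)) \<partial>M)"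
      proof (rule nn_integral_dominated_convergence[where w = "\<lambda>_. ennreal (real K)"])
        show "AE \<omega> in M. (\<lambda>n. min (2 * X \<omega> + 2 * Z n \<omega>) (ennreal (real K))) \<longlonglongrightarrow> min (2 * X \<omega>) (ennreal (real K))"
          using lim_H
        proof eventually_elim
          case (elim \<omega>)
          then have "(\<lambda>n. 2 * X \<omega> + 2 * Z n \<omega>) \<longlonglongrightarrow> 2 * X \<omega> + 2 * 0"
            unfolding Z_def by (intro tendsto_add tendsto_const ennreal_tendsto_cmult) auto
          then show ?case
            by (intro tendsto_min tendsto_const) simp
        qed
      qed (auto simp: emeasure_space_1)
      moreover have "(\<integral>\<^sup>+\<omega>. G n \<omega> \<partial>M) \<le> (\<integral>\<^sup>+\<omega>. min (2 * X \<omega> + 2 * Z n \<omega>) (ennreal (real K)) \<partial>M)" for n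
      proof -
        have "(\<integral>\<^sup>+\<omega>. G n \<omega> \<partial>M) = (\<integral>\<^sup>+\<omega>. ennreal (quad (N n) (\<tau> n) (d n) t \<omega>) \<partial>M)"
          unfolding G_def by (rule simple_isometry(2)[OF sd t0])
        also have "\<dots> \<le> (\<integral>\<^sup>+\<omega>. min (2 * X \<omega> + 2 * Z n \<omega>) (ennreal (real K)) \<partial>M)"
        proof (rule nn_integral_mono)
          fix \<omega> assume \<omega>: "\<omega> \<in> space M"
          have "ennreal (quad (N n) (\<tau> n) (d n) t \<omega>) \<le> ennreal (quad (N n) (\<tau> n) (c n) t \<omega>)"
            "ennreal (quad (N n) (\<tau> n) (d n) t \<omega>) \<le> ennreal (real K)"
            unfolding d_def by (intro ennreal_leI quad_truncate sD(1); simp)+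
          then show "ennreal (quad (N n) (\<tau> n) (d n) t \<omega>) \<le> min (2 * X \<omega> + 2 * Z n \<omega>) (ennreal (real K))"
            using quad_le[OF \<omega>, of n] by (auto intro: order_trans)
        qed
        finally show ?thesis .
      qed
      ultimately have lim: "liminf (\<lambda>n. \<integral>\<^sup>+\<omega>. G n \<omega> \<partial>M) \<le> (\<integral>\<^sup>+\<omega>. min (2 * X \<omega>) (ennreal (real K)) \<partial>M)"
        by (metis (no_types, lifting) Liminf_mono always_eventually lim_imp_Liminf sequentially_bot)
      have "(\<integral>\<^sup>+\<omega>. ennreal ((cmod (J \<omega>))\<^sup>2) * indicator {\<omega>. 2 * X \<omega> < ennreal (real K)} \<omega> \<partial>M) \<le> (\<integral>\<^sup>+\<omega>. liminf (\<lambda>n. G n \<omega>) \<partial>M)"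
      proof (rule nn_integral_mono_AE)
        show "AE \<omega> in M. ennreal ((cmod (J \<omega>))\<^sup>2) * indicator {\<omega>. 2 * X \<omega> < ennreal (real K)} \<omega> \<le> liminf (\<lambda>n. G n \<omega>)"
          using lim_H lim_J AE_space
        proof eventually_elim
          case (elim \<omega>)
          show ?case
          proof (cases "2 * X \<omega> < ennreal (real K)")
            case True
            have "(\<lambda>n. 2 * X \<omega> + 2 * Z n \<omega>) \<longlonglongrightarrow> 2 * X \<omega> + 2 * 0"
              using elim(1) unfolding Z_def by (intro tendsto_add tendsto_const ennreal_tendsto_cmult) auto
            then have "\<forall>\<^sub>F n in sequentially. 2 * X \<omega> + 2 * Z n \<omega> < ennreal (real K)"
              using True by (intro order_tendstoD) auto
            then have ev: "\<forall>\<^sub>F n in sequentially. G n \<omega> = ennreal ((cmod (simple_ito B (N n) (\<tau> n) (c n) t \<omega>))\<^sup>2)"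
            proof eventually_elim
              case (elim n)
              have "ennreal (quad (N n) (\<tau> n) (c n) t \<omega>) \<le> ennreal (real K)"
                using order.strict_implies_order[OF le_less_trans[OF quad_le[OF \<open>\<omega> \<in> space M\<close>, of n] elim]] .
              then have "quad (N n) (\<tau> n) (c n) t \<omega> \<le> real K"
                by (simp add: ennreal_le_iff)
              then show ?case
                unfolding G_def d_def by (subst simple_ito_truncate) (auto intro: sD(1))
            qed
            have "(\<lambda>n. ennreal ((cmod (simple_ito B (N n) (\<tau> n) (c n) t \<omega>))\<^sup>2)) \<longlonglongrightarrow> ennreal ((cmod (J \<omega>))\<^sup>2)"
              by (intro tendsto_ennrealI tendsto_power tendsto_norm elim(2))
            then have "(\<lambda>n. G n \<omega>) \<longlonglongrightarrow> ennreal ((cmod (J \<omega>))\<^sup>2)"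
              using tendsto_cong[OF ev] by simp
            then have "liminf (\<lambda>n. G n \<omega>) = ennreal ((cmod (J \<omega>))\<^sup>2)"
              by (intro lim_imp_Liminf) auto
            then show ?thesis
              using True by simp
          qed simp
        qed
      qed
      also have "\<dots> \<le> liminf (\<lambda>n. \<integral>\<^sup>+\<omega>. G n \<omega> \<partial>M)"
        by (rule nn_integral_liminf) simp
      also note lim
      also have "(\<integral>\<^sup>+\<omega>. min (2 * X \<omega>) (ennreal (real K)) \<partial>M) \<le> (\<integral>\<^sup>+\<omega>. 2 * X \<omega> \<partial>M)"
        by (rule nn_integral_mono) simp
      also have "\<dots> = 2 * (\<integral>\<^sup>+\<omega>. X \<omega> \<partial>M)"
        by (rule nn_integral_cmult) simp
      finally show ?thesis .
    qed
    \<comment> \<open>Removing the truncation: X is finite almost surely, so every sample point lies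
      in the event 2 X < K for large K, up to a null set, and Fatou's lemma applies once
      more.\<close>
    have "(\<integral>\<^sup>+\<omega>. ennreal ((cmod (J \<omega>))\<^sup>2) \<partial>M) \<le> (\<integral>\<^sup>+\<omega>. liminf (\<lambda>K. ennreal ((cmod (J \<omega>))\<^sup>2) * indicator {\<omega>. 2 * X \<omega> < ennreal (real K)} \<omega>) \<partial>M)"
    proof (rule nn_integral_mono_AE)
      show "AE \<omega> in M. ennreal ((cmod (J \<omega>))\<^sup>2) \<le> liminf (\<lambda>K. ennreal ((cmod (J \<omega>))\<^sup>2) * indicator {\<omega>. 2 * X \<omega> < ennreal (real K)} \<omega>)"
        using fin
      proof eventually_elim
        case (elim \<omega>)
        then have "2 * X \<omega> < \<infinity>"
          by (simp add: ennreal_mult_less_top less_top)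
        then obtain K where K: "2 * X \<omega> < ennreal (real K)"
        proof -
          obtain x where x: "2 * X \<omega> = ennreal x" "0 \<le> x"
            using \<open>2 * X \<omega> < \<infinity>\<close> by (cases "2 * X \<omega>") auto
          obtain K :: nat where "x < real K"
            using reals_Archimedean2 by blast
          then show thesis
            using x by (intro that[of K]) (simp add: ennreal_less_iff)
        qed
        then have "\<forall>\<^sub>F k in sequentially. 2 * X \<omega> < ennreal (real k)"
          by (intro eventually_mono[OF eventually_ge_at_top[of K]] less_le_trans[OF K] ennreal_leI) simp
        then have "\<forall>\<^sub>F k in sequentially. ennreal ((cmod (J \<omega>))\<^sup>2) * indicator {\<omega>. 2 * X \<omega> < ennreal (real k)} \<omega> = ennreal ((cmod (J \<omega>))\<^sup>2)"
          by eventually_elim simp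
        from lim_imp_Liminf[OF sequentially_bot tendsto_eventually[OF this]] show ?case
          by simp
      qed
    qed
    also have "\<dots> \<le> liminf (\<lambda>K. \<integral>\<^sup>+\<omega>. ennreal ((cmod (J \<omega>))\<^sup>2) * indicator {\<omega>. 2 * X \<omega> < ennreal (real K)} \<omega> \<partial>M)"
      by (rule nn_integral_liminf) measurable
    also have "\<dots> \<le> liminf (\<lambda>K::nat. 2 * (\<integral>\<^sup>+\<omega>. X \<omega> \<partial>M))"
      by (rule Liminf_mono[OF always_eventually]) (use bound in auto)
    also have "\<dots> = 2 * (\<integral>\<^sup>+\<omega>. X \<omega> \<partial>M)"
      by (rule Liminf_const) simp
    finally show ?thesis
      by (simp only: X_def)
  qed
qed

end

section \<open>Uniqueness for a single mode\<close>

lemma sorted_nth_less_iff: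
  fixes P :: "real list"
  assumes "sorted P" "distinct P" "j < length P" "l < length P"
  shows "P ! j < P ! l \<longleftrightarrow> j < l"
proof (cases "j < l")
  case True
  have "sorted_wrt (<) P"
    using assms by (simp add: strict_sorted_iff)
  from sorted_wrt_nth_less[OF this True assms(4)] True show ?thesis
    by simp
next
  case False
  then have "P ! l \<le> P ! j"
    using assms by (intro sorted_nth_mono) auto
  with False show ?thesis
    by auto
qed

lemma sorted_consecutive:
  fixes P :: "real list"
  assumes P: "sorted P" "distinct P" and i: "Suc i < length P" and x: "x \<in> set P"
  shows "x < P ! Suc i \<longleftrightarrow> x \<le> P ! i" and "P ! Suc i \<le> x \<longleftrightarrow> P ! i < x"
proof -
  obtain k where k: "k < length P" "x = P ! k"
    using x by (auto simp: in_set_conv_nth)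
  have lt: "P ! j < P ! l \<longleftrightarrow> j < l" if "j < length P" "l < length P" for j l
    by (rule sorted_nth_less_iff[OF P that])
  have le: "P ! j \<le> P ! l \<longleftrightarrow> j \<le> l" if "j < length P" "l < length P" for j l
    using lt[OF that(2,1)] by (auto simp: not_less[symmetric])
  show "x < P ! Suc i \<longleftrightarrow> x \<le> P ! i"
    using k i lt[of k "Suc i"] le[of k i] by auto
  show "P ! Suc i \<le> x \<longleftrightarrow> P ! i < x"
    using k i lt[of i k] le[of "Suc i" k] by auto
qed

lemma sorted_telescope:
  fixes P :: "real list" and b :: "real \<Rightarrow> 'b::ab_group_add"
  assumes P: "sorted P" "distinct P" and xy: "x \<in> set P" "y \<in> set P" "x \<le> y"
  shows "(\<Sum>i<length P - 1. if x < P ! Suc i \<and> P ! Suc i \<le> y then b (P ! Suc i) - b (P ! i) else 0) = b y - b x"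
proof -
  obtain k l where k: "k < length P" "x = P ! k" and l: "l < length P" "y = P ! l"
    using xy by (auto simp: in_set_conv_nth)
  have lt: "P ! j < P ! m \<longleftrightarrow> j < m" if "j < length P" "m < length P" for j m
    by (rule sorted_nth_less_iff[OF P that])
  have kl: "k \<le> l"
    using lt[OF l(1) k(1)] xy(3) k l by (auto simp: not_less[symmetric])
  have "(\<Sum>i<length P - 1. if x < P ! Suc i \<and> P ! Suc i \<le> y then b (P ! Suc i) - b (P ! i) else 0)
      = (\<Sum>i\<in>{..<length P - 1}. if i \<in> {k..<l} then b (P ! Suc i) - b (P ! i) else 0)"
  proof (rule sum.cong[OF refl])
    fix i assume "i \<in> {..<length P - 1}"
    then have "Suc i < length P" by auto
    then have "x < P ! Suc i \<longleftrightarrow> k < Suc i" "P ! Suc i \<le> y \<longleftrightarrow> \<not> l < Suc i"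
      using lt[OF k(1), of "Suc i"] lt[OF l(1), of "Suc i"] k l by (auto simp: not_less[symmetric])
    then show "(if x < P ! Suc i \<and> P ! Suc i \<le> y then b (P ! Suc i) - b (P ! i) else 0) = (if i \<in> {k..<l} then b (P ! Suc i) - b (P ! i) else 0)"
      by auto
  qed
  also have "\<dots> = (\<Sum>i\<in>{..<length P - 1} \<inter> {k..<l}. b (P ! Suc i) - b (P ! i))"
    by (simp add: sum.inter_restrict)
  also have "{..<length P - 1} \<inter> {k..<l} = {k..<l}"
    using l by auto
  also have "(\<Sum>i\<in>{k..<l}. b (P ! Suc i) - b (P ! i)) = b (P ! l) - b (P ! k)"
    using sum_Suc_diff'[OF kl, of "\<lambda>i. b (P ! i)"] .
  finally show ?thesis
    by (simp add: k l)
qed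

context
  fixes N :: nat and \<tau> :: "nat \<Rightarrow> real" and P :: "real list"
  assumes \<tau>: "\<And>i. i < N \<Longrightarrow> \<tau> i \<le> \<tau> (Suc i)" and P: "sorted P" "distinct P" and sub: "\<tau> ` {..N} \<subseteq> set P"
begin

lemma refine_point: "i \<le> N \<Longrightarrow> \<tau> i \<in> set P"
  using sub by auto

lemma sorted_step: "i < length P - 1 \<Longrightarrow> P ! i \<le> P ! Suc i"
  using P by (intro sorted_nth_mono) auto

text \<open>No point of \<tau> lies strictly inside a cell of P, so the process is constant there.
  Cells are open on the left and closed on the right, hence the right end point represents the
  cell.\<close>

lemma refine_value:
  assumes i: "Suc i < length P" and s: "P ! i < s" "s \<le> P ! Suc i"
  shows "simple_value N \<tau> c s \<omega> = simple_value N \<tau> c (P ! Suc i) \<omega>"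
  unfolding simple_value_def
proof (rule sum.cong[OF refl])
  fix j assume "j \<in> {..<N}"
  then have "\<tau> j \<in> set P" "\<tau> (Suc j) \<in> set P"
    using refine_point by auto
  then have "s \<in> {\<tau> j <.. \<tau> (Suc j)} \<longleftrightarrow> P ! Suc i \<in> {\<tau> j <.. \<tau> (Suc j)}"
    using sorted_consecutive[OF P i] s by fastforce
  then show "indicator {\<tau> j <.. \<tau> (Suc j)} s * c j \<omega> = indicator {\<tau> j <.. \<tau> (Suc j)} (P ! Suc i) * c j \<omega>"
    by (simp add: indicator_def)
qed

lemma refine_value_eq:
  "simple_value (length P - 1) ((!) P) (\<lambda>i. simple_value N \<tau> c (P ! Suc i)) s \<omega> = simple_value N \<tau> c s \<omega>"
proof (cases "\<exists>i<length P - 1. P ! i < s \<and> s \<le> P ! Suc i")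
  case True
  then obtain i where i: "i < length P - 1" "P ! i < s" "s \<le> P ! Suc i"
    by blast
  have "simple_value (length P - 1) ((!) P) (\<lambda>i. simple_value N \<tau> c (P ! Suc i)) s \<omega> = simple_value N \<tau> c (P ! Suc i) \<omega>"
    by (rule simple_value_eq[OF sorted_step i])
  also have "\<dots> = simple_value N \<tau> c s \<omega>"
    using i by (intro refine_value[symmetric]) auto
  finally show ?thesis .
next
  case False
  then have "simple_value (length P - 1) ((!) P) (\<lambda>i. simple_value N \<tau> c (P ! Suc i)) s \<omega> = 0"
    unfolding simple_value_def by (intro sum.neutral) (auto simp: indicator_def)
  moreover have "simple_value N \<tau> c s \<omega> = 0"
    unfolding simple_value_def
  proof (intro sum.neutral ballI)
    fix j assume j: "j \<in> {..<N}"
    have "s \<notin> {\<tau> j <.. \<tau> (Suc j)}"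
    proof
      assume s: "s \<in> {\<tau> j <.. \<tau> (Suc j)}"
      obtain k l where k: "k < length P" "\<tau> j = P ! k" and l: "l < length P" "\<tau> (Suc j) = P ! l"
        using refine_point[of j] refine_point[of "Suc j"] j by (auto simp: in_set_conv_nth)
      have "P ! 0 < s"
        using s k sorted_nth_mono[OF P(1), of 0 k] by auto
      moreover have "P ! l \<le> P ! (length P - 1)"
        by (rule sorted_nth_mono[OF P(1)]) (use l in auto)
      then have "s \<le> P ! (length P - 1)"
        using s l by auto
      ultimately obtain i where "i < length P - 1" "P ! i < s" "s \<le> P ! Suc i"
        by (rule partition_covers)
      with False show False by blast
    qed
    then show "indicator {\<tau> j <.. \<tau> (Suc j)} s * c j \<omega> = 0"
      by simp
  qed
  ultimately show ?thesis by simp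
qed

text \<open>After exchanging the two sums, the increments over those cells of P that make up one
  interval of \<tau> telescope.\<close>

lemma refine_ito:
  "simple_ito B (length P - 1) ((!) P) (\<lambda>i. simple_value N \<tau> c (P ! Suc i)) t \<omega> = simple_ito B N \<tau> c t \<omega>"
proof -
  let ?b = "\<lambda>x. complex_of_real (B (min t x) \<omega>)"
  have "simple_ito B (length P - 1) ((!) P) (\<lambda>i. simple_value N \<tau> c (P ! Suc i)) t \<omega>
    = (\<Sum>i<length P - 1. \<Sum>j<N. c j \<omega> * (if \<tau> j < P ! Suc i \<and> P ! Suc i \<le> \<tau> (Suc j) then ?b (P ! Suc i) - ?b (P ! i) else 0))"
    unfolding simple_ito_def simple_value_def sum_distrib_right
    by (intro sum.cong refl) (auto simp: indicator_def)
  also have "\<dots> = (\<Sum>j<N. c j \<omega> * (\<Sum>i<length P - 1. if \<tau> j < P ! Suc i \<and> P ! Suc i \<le> \<tau> (Suc j) then ?b (P ! Suc i) - ?b (P ! i) else 0))"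
    by (subst sum.swap) (simp only: sum_distrib_left)
  also have "\<dots> = (\<Sum>j<N. c j \<omega> * (?b (\<tau> (Suc j)) - ?b (\<tau> j)))"
    using refine_point \<tau> by (intro sum.cong refl arg_cong2[where f = "(*)"] sorted_telescope P) auto
  finally show ?thesis
    by (simp add: simple_ito_def)
qed

end

lemma simple_value_diff:
  "simple_value N \<tau> (\<lambda>i \<omega>. c i \<omega> - d i \<omega>) s \<omega> = simple_value N \<tau> c s \<omega> - simple_value N \<tau> d s \<omega>"
  by (simp add: simple_value_def right_diff_distrib sum_subtractf)

lemma simple_ito_diff:
  "simple_ito B N \<tau> (\<lambda>i \<omega>. c i \<omega> - d i \<omega>) t \<omega> = simple_ito B N \<tau> c t \<omega> - simple_ito B N \<tau> d t \<omega>"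
  by (simp add: simple_ito_def left_diff_distrib sum_subtractf)

context brownian_motion
begin

text \<open>The coefficient is read off at the right end of the cell but is already known at the
  left end: a cell inside the interval that begins at \<tau> j starts no earlier than \<tau>
  j.\<close>

lemma refine_adapted:
  assumes s: "simple_process M F T N \<tau> c" and P: "sorted P" "distinct P" "\<tau> ` {..N} \<subseteq> set P" and i: "i < length P - 1"
  shows "simple_value N \<tau> c (P ! Suc i) \<in> borel_measurable (F (P ! i))"
  unfolding simple_value_def[abs_def]
proof (rule borel_measurable_sum)
  fix j assume j: "j \<in> {..<N}"
  then have "\<tau> j \<in> set P"
    using P(3) by auto
  then have *: "\<tau> j < P ! Suc i \<longleftrightarrow> \<tau> j \<le> P ! i"
    using i by (intro sorted_consecutive(1) P) auto
  show "(\<lambda>\<omega>. indicator {\<tau> j <.. \<tau> (Suc j)} (P ! Suc i) * c j \<omega>) \<in> borel_measurable (F (P ! i))"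
  proof (cases "\<tau> j \<le> P ! i")
    case True
    then show ?thesis
      using adapted_mono[OF simple_processD(4)[OF s, of j]] j by auto
  next
    case False
    then have "P ! Suc i \<notin> {\<tau> j <.. \<tau> (Suc j)}"
      using * by auto
    then show ?thesis by simp
  qed
qed

text \<open>Two approximating sequences come with unrelated partitions. Their difference is again
  simple on the sorted union of the partition points, so an estimate for one Ito integral applies to
  a difference of two.\<close>

lemma simple_process_diff:
  assumes s1: "simple_process M F T N1 \<tau>1 c1" and s2: "simple_process M F T N2 \<tau>2 c2"
  obtains N \<tau> c where "simple_process M F T N \<tau> c"
    and "\<And>s \<omega>. simple_value N \<tau> c s \<omega> = simple_value N1 \<tau>1 c1 s \<omega> - simple_value N2 \<tau>2 c2 s \<omega>"
    and "\<And>t \<omega>. simple_ito B N \<tau> c t \<omega> = simple_ito B N1 \<tau>1 c1 t \<omega> - simple_ito B N2 \<tau>2 c2 t \<omega>"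
proof
  define P where "P = sorted_list_of_set (\<tau>1 ` {..N1} \<union> \<tau>2 ` {..N2})"
  have P: "sorted P" "distinct P" and setP: "set P = \<tau>1 ` {..N1} \<union> \<tau>2 ` {..N2}"
    by (simp_all add: P_def)
  then have sub: "\<tau>1 ` {..N1} \<subseteq> set P" "\<tau>2 ` {..N2} \<subseteq> set P"
    by auto
  define d1 where "d1 i = simple_value N1 \<tau>1 c1 (P ! Suc i)" for i
  define d2 where "d2 i = simple_value N2 \<tau>2 c2 (P ! Suc i)" for i
  let ?c = "\<lambda>i \<omega>. d1 i \<omega> - d2 i \<omega>"
  note D1 = simple_processD[OF s1] and D2 = simple_processD[OF s2]
  have len: "0 < length P"
    using setP by (auto simp: length_pos_if_in_set)
  have P_bd: "0 \<le> x \<and> x \<le> T" if "x \<in> set P" for x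
    using that D1(2,3) D2(2,3) by (auto simp: setP)
  have bd: "\<exists>K. \<forall>s. \<forall>\<omega>\<in>space M. cmod (simple_value N \<tau> c s \<omega>) \<le> K" if "simple_process M F T N \<tau> c" for N \<tau> c
  proof -
    obtain K where K: "\<And>i \<omega>. i < N \<Longrightarrow> \<omega> \<in> space M \<Longrightarrow> cmod (c i \<omega>) \<le> K"
      using \<open>simple_process M F T N \<tau> c\<close> unfolding simple_process_def by blast
    have "cmod (simple_value N \<tau> c s \<omega>) \<le> (\<Sum>i<N. K)" if "\<omega> \<in> space M" for s \<omega>
      unfolding simple_value_def using K[OF _ that] order_trans[OF norm_ge_zero K[OF _ that]]
      by (intro order_trans[OF norm_sum] sum_mono) (auto simp: indicator_def)
    then show ?thesis by blast
  qed
  show "simple_process M F T (length P - 1) ((!) P) ?c"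
    unfolding simple_process_def
  proof (intro conjI allI impI)
    show "0 \<le> P ! 0" "P ! (length P - 1) \<le> T"
      using P_bd len by simp_all
    show "P ! i \<le> P ! Suc i" if "i < length P - 1" for i
      using that P(1) by (intro sorted_nth_mono) auto
    show "?c i \<in> borel_measurable (F (P ! i))" if "i < length P - 1" for i
      unfolding d1_def d2_def using that sub P by (intro borel_measurable_diff refine_adapted[OF s1] refine_adapted[OF s2]) auto
    obtain K1 K2 where "\<And>s \<omega>. \<omega> \<in> space M \<Longrightarrow> cmod (simple_value N1 \<tau>1 c1 s \<omega>) \<le> K1" "\<And>s \<omega>. \<omega> \<in> space M \<Longrightarrow> cmod (simple_value N2 \<tau>2 c2 s \<omega>) \<le> K2"
      using bd[OF s1] bd[OF s2] by blast
    then have "cmod (?c i \<omega>) \<le> K1 + K2" if "\<omega> \<in> space M" for i \<omega>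
      unfolding d1_def d2_def using that by (intro order_trans[OF norm_triangle_ineq4] add_mono) auto
    then show "\<exists>K. \<forall>i<length P - 1. \<forall>\<omega>\<in>space M. cmod (?c i \<omega>) \<le> K"
      by blast
  qed
  show "simple_value (length P - 1) ((!) P) ?c s \<omega> = simple_value N1 \<tau>1 c1 s \<omega> - simple_value N2 \<tau>2 c2 s \<omega>" for s \<omega>
    unfolding simple_value_diff d1_def d2_def
    by (intro arg_cong2[where f = "(-)"] refine_value_eq D1(1) D2(1) P sub)
  show "simple_ito B (length P - 1) ((!) P) ?c t \<omega> = simple_ito B N1 \<tau>1 c1 t \<omega> - simple_ito B N2 \<tau>2 c2 t \<omega>" for t \<omega>
    unfolding simple_ito_diff d1_def d2_def
    by (intro arg_cong2[where f = "(-)"] refine_ito D1(1) D2(1) P sub)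
qed

text \<open>Integrands are measurable only on [0, T]. Composition with the projection of the line
  onto [0, T] extends them measurably and changes no integral over subsets of [0, T].\<close>

lemma clamp_joint:
  fixes H :: "real \<Rightarrow> 'a \<Rightarrow> 'c"
  assumes "(\<lambda>(t, \<omega>). H t \<omega>) \<in> measurable (restrict_space borel {0..T} \<Otimes>\<^sub>M M) K" and "0 \<le> T"
  shows "(\<lambda>p. H (max 0 (min T (snd p))) (fst p)) \<in> measurable (M \<Otimes>\<^sub>M lborel) K"
proof -
  have 1: "(\<lambda>s::real. max 0 (min T s)) \<in> measurable borel (restrict_space borel {0..T})"
    using assms(2) by (intro measurable_restrict_space2) auto
  have "(\<lambda>p. (max 0 (min T (snd p)), fst p)) \<in> measurable (M \<Otimes>\<^sub>M lborel) (restrict_space borel {0..T} \<Otimes>\<^sub>M M)"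
  proof (rule measurable_Pair)
    have "snd \<in> measurable (M \<Otimes>\<^sub>M lborel) (borel :: real measure)"
      using measurable_snd[of M lborel] by simp
    from measurable_compose[OF this 1]
    show "(\<lambda>p. max 0 (min T (snd p))) \<in> measurable (M \<Otimes>\<^sub>M lborel) (restrict_space borel {0..T})"
      by simp
  qed measurable
  from measurable_compose[OF this assms(1)] show ?thesis
    by simp
qed

text \<open>Two successive subsequences turn both convergences in probability into almost sure ones.
  The second depends on t, which is why t is fixed in advance.\<close>

lemma has_ito_integral_subseq:
  assumes I: "has_ito_integral M F B T H J" and T: "0 \<le> T" and t: "t \<in> {0..T}"
  obtains N :: "nat \<Rightarrow> nat" and \<tau> :: "nat \<Rightarrow> nat \<Rightarrow> real" and c :: "nat \<Rightarrow> nat \<Rightarrow> 'a \<Rightarrow> complex"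
  where "\<And>n. simple_process M F T (N n) (\<tau> n) (c n)"
    and "AE \<omega> in M. (\<lambda>n. \<integral>\<^sup>+s\<in>{0..T}. ennreal ((cmod (simple_value (N n) (\<tau> n) (c n) s \<omega> - H s \<omega>))\<^sup>2) \<partial>lborel) \<longlonglongrightarrow> 0"
    and "AE \<omega> in M. (\<lambda>n. simple_ito B (N n) (\<tau> n) (c n) t \<omega>) \<longlonglongrightarrow> J t \<omega>"
proof -
  from I obtain N :: "nat \<Rightarrow> nat" and \<tau> :: "nat \<Rightarrow> nat \<Rightarrow> real" and c :: "nat \<Rightarrow> nat \<Rightarrow> 'a \<Rightarrow> complex"
    where s: "\<And>n. simple_process M F T (N n) (\<tau> n) (c n)"
    and n1: "null_in_probability M (\<lambda>n \<omega>. \<integral>\<^sup>+s\<in>{0..T}. ennreal ((cmod (simple_value (N n) (\<tau> n) (c n) s \<omega> - H s \<omega>))\<^sup>2) \<partial>lborel)"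
    and n2: "null_in_probability M (\<lambda>n \<omega>. ennreal (cmod (simple_ito B (N n) (\<tau> n) (c n) t \<omega> - J t \<omega>)))"
    and Hm: "(\<lambda>(t, \<omega>). H t \<omega>) \<in> borel_measurable (restrict_space borel {0..T} \<Otimes>\<^sub>M M)" and [measurable]: "J t \<in> borel_measurable M"
    using t unfolding has_ito_integral_def by blast
  let ?Z = "\<lambda>n \<omega>. \<integral>\<^sup>+s\<in>{0..T}. ennreal ((cmod (simple_value (N n) (\<tau> n) (c n) s \<omega> - H s \<omega>))\<^sup>2) \<partial>lborel"
  let ?Y = "\<lambda>n \<omega>. ennreal (cmod (simple_ito B (N n) (\<tau> n) (c n) t \<omega> - J t \<omega>))"
  have Zm: "?Z n \<in> borel_measurable M" for n
  proof -
    note [measurable] = clamp_joint[OF Hm T] simple_value_joint[of "N n" "c n" M "\<tau> n", OF simple_processD(5)[OF s[of n]]]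
    have "(\<lambda>\<omega>. \<integral>\<^sup>+s\<in>{0..T}. ennreal ((cmod (simple_value (N n) (\<tau> n) (c n) s \<omega> - H (max 0 (min T s)) \<omega>))\<^sup>2) \<partial>lborel) \<in> borel_measurable M"
      by (intro lborel.borel_measurable_nn_integral) (unfold case_prod_beta', measurable)
    moreover have "(\<integral>\<^sup>+s\<in>{0..T}. ennreal ((cmod (simple_value (N n) (\<tau> n) (c n) s \<omega> - H (max 0 (min T s)) \<omega>))\<^sup>2) \<partial>lborel) = ?Z n \<omega>" for \<omega>
      by (rule nn_integral_cong) (auto simp: indicator_def)
    ultimately show ?thesis
      by simp
  qed
  have Ym: "?Y n \<in> borel_measurable M" for n
    using simple_isometry(1)[OF s, of t n] t by auto
  obtain r1 where r1: "strict_mono r1" "AE \<omega> in M. (\<lambda>n. ?Z (r1 n) \<omega>) \<longlonglongrightarrow> 0"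
    using null_in_probability_subseq[OF Zm n1] .
  obtain r2 where r2: "strict_mono r2" "AE \<omega> in M. (\<lambda>n. ?Y (r1 (r2 n)) \<omega>) \<longlonglongrightarrow> 0"
    using null_in_probability_subseq[OF Ym null_in_probability_compose[OF n2 r1(1)]] .
  show thesis
  proof (rule that[of "\<lambda>n. N (r1 (r2 n))" "\<lambda>n. \<tau> (r1 (r2 n))" "\<lambda>n. c (r1 (r2 n))"])
    show "simple_process M F T (N (r1 (r2 n))) (\<tau> (r1 (r2 n))) (c (r1 (r2 n)))" for n
      by (rule s)
    show "AE \<omega> in M. (\<lambda>n. ?Z (r1 (r2 n)) \<omega>) \<longlonglongrightarrow> 0"
      using r1(2)
    proof eventually_elim
      case (elim \<omega>)
      from LIMSEQ_subseq_LIMSEQ[OF elim r2(1)] show ?case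
        by (simp add: o_def)
    qed
    show "AE \<omega> in M. (\<lambda>n. simple_ito B (N (r1 (r2 n))) (\<tau> (r1 (r2 n))) (c (r1 (r2 n))) t \<omega>) \<longlonglongrightarrow> J t \<omega>"
      using r2(2)
    proof eventually_elim
      case (elim \<omega>)
      then have "(\<lambda>n. ?Y (r1 (r2 n)) \<omega>) \<longlonglongrightarrow> ennreal 0"
        by simp
      then have "(\<lambda>n. cmod (simple_ito B (N (r1 (r2 n))) (\<tau> (r1 (r2 n))) (c (r1 (r2 n))) t \<omega> - J t \<omega>)) \<longlonglongrightarrow> 0"
        by (subst (asm) tendsto_ennreal_iff) auto
      then show ?case
        by (simp add: tendsto_norm_zero_iff LIM_zero_iff)
    qed
  qed
qed

text \<open>No moments are assumed, as an Ito integrand is only pathwise square integrable; if the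
  right side is infinite there is nothing to prove. The refined differences of the two approximating
  sequences approximate the difference of the integrands, again with a factor 2 from the square of a
  sum.\<close>

lemma ito_inequality:
  assumes I1: "has_ito_integral M F B T H1 J1" and I2: "has_ito_integral M F B T H2 J2"
    and T: "0 \<le> T" and t: "t \<in> {0..T}"
  shows "(\<integral>\<^sup>+\<omega>. ennreal ((cmod (J1 t \<omega> - J2 t \<omega>))\<^sup>2) \<partial>M)
    \<le> 2 * (\<integral>\<^sup>+\<omega>. (\<integral>\<^sup>+s\<in>{0..t}. ennreal ((cmod (H1 s \<omega> - H2 s \<omega>))\<^sup>2) \<partial>lborel) \<partial>M)"
proof -
  obtain N1 \<tau>1 c1 where s1: "\<And>n. simple_process M F T (N1 n) (\<tau>1 n) (c1 n)"
    and l1: "AE \<omega> in M. (\<lambda>n. \<integral>\<^sup>+s\<in>{0..T}. ennreal ((cmod (simple_value (N1 n) (\<tau>1 n) (c1 n) s \<omega> - H1 s \<omega>))\<^sup>2) \<partial>lborel) \<longlonglongrightarrow> 0"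
    and j1: "AE \<omega> in M. (\<lambda>n. simple_ito B (N1 n) (\<tau>1 n) (c1 n) t \<omega>) \<longlonglongrightarrow> J1 t \<omega>"
    by (rule has_ito_integral_subseq[OF I1 T t]) (rule that)
  obtain N2 \<tau>2 c2 where s2: "\<And>n. simple_process M F T (N2 n) (\<tau>2 n) (c2 n)"
    and l2: "AE \<omega> in M. (\<lambda>n. \<integral>\<^sup>+s\<in>{0..T}. ennreal ((cmod (simple_value (N2 n) (\<tau>2 n) (c2 n) s \<omega> - H2 s \<omega>))\<^sup>2) \<partial>lborel) \<longlonglongrightarrow> 0"
    and j2: "AE \<omega> in M. (\<lambda>n. simple_ito B (N2 n) (\<tau>2 n) (c2 n) t \<omega>) \<longlonglongrightarrow> J2 t \<omega>"
    by (rule has_ito_integral_subseq[OF I2 T t]) (rule that)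
  have "\<exists>N \<tau> c. simple_process M F T N \<tau> c \<and>
      (\<forall>s \<omega>. simple_value N \<tau> c s \<omega> = simple_value (N1 n) (\<tau>1 n) (c1 n) s \<omega> - simple_value (N2 n) (\<tau>2 n) (c2 n) s \<omega>) \<and>
      (\<forall>t \<omega>. simple_ito B N \<tau> c t \<omega> = simple_ito B (N1 n) (\<tau>1 n) (c1 n) t \<omega> - simple_ito B (N2 n) (\<tau>2 n) (c2 n) t \<omega>)" for n
    by (rule simple_process_diff[OF s1[of n] s2[of n]]) blast
  from choice[OF allI[OF this]] obtain N where
    "\<forall>n. \<exists>\<tau> c. simple_process M F T (N n) \<tau> c \<and>
      (\<forall>s \<omega>. simple_value (N n) \<tau> c s \<omega> = simple_value (N1 n) (\<tau>1 n) (c1 n) s \<omega> - simple_value (N2 n) (\<tau>2 n) (c2 n) s \<omega>) \<and>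
      (\<forall>t \<omega>. simple_ito B (N n) \<tau> c t \<omega> = simple_ito B (N1 n) (\<tau>1 n) (c1 n) t \<omega> - simple_ito B (N2 n) (\<tau>2 n) (c2 n) t \<omega>)" ..
  from choice[OF this] obtain \<tau> where
    "\<forall>n. \<exists>c. simple_process M F T (N n) (\<tau> n) c \<and>
      (\<forall>s \<omega>. simple_value (N n) (\<tau> n) c s \<omega> = simple_value (N1 n) (\<tau>1 n) (c1 n) s \<omega> - simple_value (N2 n) (\<tau>2 n) (c2 n) s \<omega>) \<and>
      (\<forall>t \<omega>. simple_ito B (N n) (\<tau> n) c t \<omega> = simple_ito B (N1 n) (\<tau>1 n) (c1 n) t \<omega> - simple_ito B (N2 n) (\<tau>2 n) (c2 n) t \<omega>)" ..
  from choice[OF this] obtain c where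
    "\<forall>n. simple_process M F T (N n) (\<tau> n) (c n) \<and>
      (\<forall>s \<omega>. simple_value (N n) (\<tau> n) (c n) s \<omega> = simple_value (N1 n) (\<tau>1 n) (c1 n) s \<omega> - simple_value (N2 n) (\<tau>2 n) (c2 n) s \<omega>) \<and>
      (\<forall>t \<omega>. simple_ito B (N n) (\<tau> n) (c n) t \<omega> = simple_ito B (N1 n) (\<tau>1 n) (c1 n) t \<omega> - simple_ito B (N2 n) (\<tau>2 n) (c2 n) t \<omega>)" ..
  then have s: "\<And>n. simple_process M F T (N n) (\<tau> n) (c n)"
    and v: "\<And>n s \<omega>. simple_value (N n) (\<tau> n) (c n) s \<omega> = simple_value (N1 n) (\<tau>1 n) (c1 n) s \<omega> - simple_value (N2 n) (\<tau>2 n) (c2 n) s \<omega>"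
    and i: "\<And>n t \<omega>. simple_ito B (N n) (\<tau> n) (c n) t \<omega> = simple_ito B (N1 n) (\<tau>1 n) (c1 n) t \<omega> - simple_ito B (N2 n) (\<tau>2 n) (c2 n) t \<omega>"
    by auto
  have Hm: "(\<lambda>(t, \<omega>). H1 t \<omega>) \<in> borel_measurable (restrict_space borel {0..T} \<Otimes>\<^sub>M M)" "(\<lambda>(t, \<omega>). H2 t \<omega>) \<in> borel_measurable (restrict_space borel {0..T} \<Otimes>\<^sub>M M)"
    using I1 I2 unfolding has_ito_integral_def by blast+
  note [measurable] = clamp_joint[OF Hm(1) T] clamp_joint[OF Hm(2) T]
  define H where "H s \<omega> = H1 (max 0 (min T s)) \<omega> - H2 (max 0 (min T s)) \<omega>" for s \<omega>
  have H_eq: "H s \<omega> = H1 s \<omega> - H2 s \<omega>" if "s \<in> {0..T}" for s \<omega>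
    using that by (simp add: H_def)
  have "(\<integral>\<^sup>+\<omega>. ennreal ((cmod (J1 t \<omega> - J2 t \<omega>))\<^sup>2) \<partial>M) \<le> 2 * (\<integral>\<^sup>+\<omega>. (\<integral>\<^sup>+s\<in>{0..t}. ennreal ((cmod (H s \<omega>))\<^sup>2) \<partial>lborel) \<partial>M)"
  proof (rule ito_inequality_AE[OF s t])
    show "(\<lambda>p. H (snd p) (fst p)) \<in> borel_measurable (M \<Otimes>\<^sub>M lborel)"
      unfolding H_def by measurable
    show "(\<lambda>\<omega>. J1 t \<omega> - J2 t \<omega>) \<in> borel_measurable M"
      using I1 I2 t unfolding has_ito_integral_def by (intro borel_measurable_diff) blast+
    show "AE \<omega> in M. (\<lambda>n. simple_ito B (N n) (\<tau> n) (c n) t \<omega>) \<longlonglongrightarrow> J1 t \<omega> - J2 t \<omega>"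
      using j1 j2 unfolding i by eventually_elim (rule tendsto_diff)
    show "AE \<omega> in M. (\<lambda>n. \<integral>\<^sup>+s\<in>{0..T}. ennreal ((cmod (simple_value (N n) (\<tau> n) (c n) s \<omega> - H s \<omega>))\<^sup>2) \<partial>lborel) \<longlonglongrightarrow> 0"
      using l1 l2 AE_space
    proof eventually_elim
      case (elim \<omega>)
      let ?Z1 = "\<lambda>n. \<integral>\<^sup>+s\<in>{0..T}. ennreal ((cmod (simple_value (N1 n) (\<tau>1 n) (c1 n) s \<omega> - H1 s \<omega>))\<^sup>2) \<partial>lborel"
      let ?Z2 = "\<lambda>n. \<integral>\<^sup>+s\<in>{0..T}. ennreal ((cmod (simple_value (N2 n) (\<tau>2 n) (c2 n) s \<omega> - H2 s \<omega>))\<^sup>2) \<partial>lborel"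
      have h1 [measurable]: "(\<lambda>s. H1 (max 0 (min T s)) \<omega>) \<in> borel_measurable borel"
        using measurable_compose[OF measurable_Pair1'[OF elim(3)] clamp_joint[OF Hm(1) T]] by simp
      have h2 [measurable]: "(\<lambda>s. H2 (max 0 (min T s)) \<omega>) \<in> borel_measurable borel"
        using measurable_compose[OF measurable_Pair1'[OF elim(3)] clamp_joint[OF Hm(2) T]] by simp
      have [measurable]: "(\<lambda>s. simple_value (N1 n) (\<tau>1 n) (c1 n) s \<omega>) \<in> borel_measurable borel" "(\<lambda>s. simple_value (N2 n) (\<tau>2 n) (c2 n) s \<omega>) \<in> borel_measurable borel" for n
        unfolding simple_value_def[abs_def] by measurable
      have le: "(\<integral>\<^sup>+s\<in>{0..T}. ennreal ((cmod (simple_value (N n) (\<tau> n) (c n) s \<omega> - H s \<omega>))\<^sup>2) \<partial>lborel) \<le> 2 * ?Z1 n + 2 * ?Z2 n" for n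
      proof -
        let ?x = "\<lambda>s. simple_value (N1 n) (\<tau>1 n) (c1 n) s \<omega> - H1 (max 0 (min T s)) \<omega>"
        let ?y = "\<lambda>s. simple_value (N2 n) (\<tau>2 n) (c2 n) s \<omega> - H2 (max 0 (min T s)) \<omega>"
        have "(\<integral>\<^sup>+s\<in>{0..T}. ennreal ((cmod (simple_value (N n) (\<tau> n) (c n) s \<omega> - H s \<omega>))\<^sup>2) \<partial>lborel)
          \<le> (\<integral>\<^sup>+s. 2 * (ennreal ((cmod (?x s))\<^sup>2) * indicator {0..T} s) + 2 * (ennreal ((cmod (?y s))\<^sup>2) * indicator {0..T} s) \<partial>lborel)"
        proof (rule nn_integral_mono)
          fix s :: real
          have "simple_value (N n) (\<tau> n) (c n) s \<omega> - H s \<omega> = ?x s - ?y s"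
            by (simp add: v H_def)
          then have "ennreal ((cmod (simple_value (N n) (\<tau> n) (c n) s \<omega> - H s \<omega>))\<^sup>2) \<le> 2 * ennreal ((cmod (?x s))\<^sup>2) + 2 * ennreal ((cmod (?y s))\<^sup>2)"
            using cmod_diff_square[of "?x s" "?y s"] by (simp add: ennreal_leI flip: ennreal_numeral ennreal_mult ennreal_plus)
          then show "ennreal ((cmod (simple_value (N n) (\<tau> n) (c n) s \<omega> - H s \<omega>))\<^sup>2) * indicator {0..T} s
            \<le> 2 * (ennreal ((cmod (?x s))\<^sup>2) * indicator {0..T} s) + 2 * (ennreal ((cmod (?y s))\<^sup>2) * indicator {0..T} s)"
            by (auto simp: indicator_def)
        qed
        also have "\<dots> = 2 * (\<integral>\<^sup>+s\<in>{0..T}. ennreal ((cmod (?x s))\<^sup>2) \<partial>lborel) + 2 * (\<integral>\<^sup>+s\<in>{0..T}. ennreal ((cmod (?y s))\<^sup>2) \<partial>lborel)"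
          by (subst nn_integral_add) (auto simp: nn_integral_cmult)
        also have "(\<integral>\<^sup>+s\<in>{0..T}. ennreal ((cmod (?x s))\<^sup>2) \<partial>lborel) = ?Z1 n"
          by (rule nn_integral_cong) (auto simp: indicator_def)
        also have "(\<integral>\<^sup>+s\<in>{0..T}. ennreal ((cmod (?y s))\<^sup>2) \<partial>lborel) = ?Z2 n"
          by (rule nn_integral_cong) (auto simp: indicator_def)
        finally show ?thesis .
      qed
      have "(\<lambda>n. 2 * ?Z1 n + 2 * ?Z2 n) \<longlonglongrightarrow> 2 * 0 + 2 * 0"
        using elim(1,2) by (intro tendsto_add ennreal_tendsto_cmult) auto
      then have z: "(\<lambda>n. 2 * ?Z1 n + 2 * ?Z2 n) \<longlonglongrightarrow> 0"
        by simp
      show ?case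
        by (rule tendsto_sandwich[OF _ _ tendsto_const z]) (use le in auto)
    qed
  qed
  moreover have "(\<integral>\<^sup>+s\<in>{0..t}. ennreal ((cmod (H s \<omega>))\<^sup>2) \<partial>lborel) = (\<integral>\<^sup>+s\<in>{0..t}. ennreal ((cmod (H1 s \<omega> - H2 s \<omega>))\<^sup>2) \<partial>lborel)" for \<omega>
    using t by (intro nn_integral_cong) (auto simp: H_eq indicator_def)
  ultimately show ?thesis
    by simp
qed

end

section \<open>Gronwall argument for the difference of two solutions of a mode\<close>

lemma nn_integral_power_Icc:
  assumes "0 \<le> t" "0 \<le> k"
  shows "(\<integral>\<^sup>+s\<in>{0..t}. ennreal (k * s ^ n) \<partial>lborel) = ennreal (k * (t ^ Suc n / Suc n))"
proof -
  have "(\<integral>\<^sup>+s\<in>{0..t}. ennreal (k * s ^ n) \<partial>lborel) = (\<integral>\<^sup>+s. ennreal (k * (s ^ n * indicator {0..t} s)) \<partial>lborel)"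
    by (rule nn_integral_cong) (auto simp: indicator_def)
  also have "\<dots> = ennreal (LINT s|lborel. k * (s ^ n * indicator {0..t} s))"
    using borel_integrable_atLeastAtMost[of 0 t "\<lambda>s. s ^ n"] assms
    by (intro nn_integral_eq_integral integrable_mult_right) (auto simp: indicator_def)
  also have "(LINT s|lborel. k * (s ^ n * indicator {0..t} s)) = k * (t ^ Suc n / Suc n)"
    by (simp only: integral_mult_right_zero integral_power[OF assms(1)]) simp
  finally show ?thesis .
qed

text \<open>A version for a merely measurable f, as neither finiteness at each time nor continuity
  of the second moment is known beforehand. Only the time integral A is assumed finite; iteration
  improves the bound to C A (C t)^n / n!, which tends to 0.\<close>

lemma gronwall_ennreal:
  fixes f :: "real \<Rightarrow> ennreal"
  assumes C: "0 \<le> C" and fin: "(\<integral>\<^sup>+s\<in>{0..T}. f s \<partial>lborel) < \<infinity>"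
    and f [measurable]: "f \<in> borel_measurable borel"
    and le: "\<And>t. t \<in> {0..T} \<Longrightarrow> f t \<le> ennreal C * (\<integral>\<^sup>+s\<in>{0..t}. f s \<partial>lborel)" and t: "t \<in> {0..T}"
  shows "f t = 0"
proof -
  obtain A where A: "(\<integral>\<^sup>+s\<in>{0..T}. f s \<partial>lborel) = ennreal A" "0 \<le> A"
    using fin by (cases "\<integral>\<^sup>+s\<in>{0..T}. f s \<partial>lborel") auto
  have bound: "f t \<le> ennreal (C * A * ((C * t) ^ n / fact n))" if "t \<in> {0..T}" for n t
    using that
  proof (induction n arbitrary: t)
    case 0
    have "f t \<le> ennreal C * (\<integral>\<^sup>+s\<in>{0..t}. f s \<partial>lborel)"
      by (rule le[OF 0])
    also have "\<dots> \<le> ennreal C * (\<integral>\<^sup>+s\<in>{0..T}. f s \<partial>lborel)"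
      using 0 by (intro mult_left_mono nn_integral_mono) (auto simp: indicator_def)
    also have "\<dots> = ennreal (C * A)"
      using A C by (simp add: ennreal_mult)
    finally show ?case by simp
  next
    case (Suc n)
    let ?k = "C * A * (C ^ n / fact n)"
    have k: "0 \<le> ?k"
      using A C by simp
    have "f t \<le> ennreal C * (\<integral>\<^sup>+s\<in>{0..t}. f s \<partial>lborel)"
      by (rule le[OF Suc.prems])
    also have "\<dots> \<le> ennreal C * (\<integral>\<^sup>+s\<in>{0..t}. ennreal (?k * s ^ n) \<partial>lborel)"
    proof (intro mult_left_mono nn_integral_mono)
      fix s :: real
      have "C * A * ((C * s) ^ n / fact n) = ?k * s ^ n"
        by (simp add: power_mult_distrib)
      then have "f s \<le> ennreal (?k * s ^ n)" if "s \<in> {0..t}"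
        using Suc.IH[of s] Suc.prems that by (simp only:) simp
      then show "f s * indicator {0..t} s \<le> ennreal (?k * s ^ n) * indicator {0..t} s"
        by (simp add: indicator_def)
    qed simp
    also have "\<dots> = ennreal (C * (?k * (t ^ Suc n / Suc n)))"
      using Suc.prems k C by (subst nn_integral_power_Icc) (auto simp del: power_Suc of_nat_Suc times_divide_eq_right simp flip: ennreal_mult')
    also have "C * (?k * (t ^ Suc n / Suc n)) = C * A * ((C * t) ^ Suc n / fact (Suc n))"
      by (simp add: power_mult_distrib field_simps)
    finally show ?case .
  qed
  have "(\<lambda>n. C * A * ((C * t) ^ n / fact n)) \<longlonglongrightarrow> C * A * 0"
    using summable_LIMSEQ_zero[OF summable_exp[of "C * t"]]
    by (intro tendsto_mult tendsto_const) (simp add: inverse_eq_divide)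
  from tendsto_ennrealI[OF this] have "(\<lambda>n. ennreal (C * A * ((C * t) ^ n / fact n))) \<longlonglongrightarrow> 0"
    by simp
  then have "f t \<le> 0"
    by (rule LIMSEQ_le_const) (use bound[OF t] in auto)
  then show ?thesis by simp
qed

text \<open>The Cauchy-Schwarz inequality, read off from the nonnegative integral of the squared
  deviation of |g| from its mean c.\<close>

lemma integral_square_bound:
  fixes g :: "real \<Rightarrow> complex"
  assumes g: "continuous_on {0..s} g" and s: "0 \<le> s"
  shows "(cmod (integral {0..s} g))\<^sup>2 \<le> s * integral {0..s} (\<lambda>q. (cmod (g q))\<^sup>2)"
proof (cases "s = 0")
  case False
  with s have s: "0 < s" by simp
  let ?I = "integral {0..s} (\<lambda>q. cmod (g q))" and ?Q = "integral {0..s} (\<lambda>q. (cmod (g q))\<^sup>2)"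
  define c where "c = ?I / s"
  have i1: "(\<lambda>q. cmod (g q)) integrable_on {0..s}"
    by (rule integrable_continuous_real) (intro continuous_intros g)
  have i2: "(\<lambda>q. (cmod (g q))\<^sup>2) integrable_on {0..s}"
    by (rule integrable_continuous_real) (intro continuous_intros g)
  have "0 \<le> integral {0..s} (\<lambda>q. (cmod (g q) - c)\<^sup>2)"
    using g by (intro integral_nonneg integrable_continuous_real continuous_intros) auto
  also have "(\<lambda>q. (cmod (g q) - c)\<^sup>2) = (\<lambda>q. (cmod (g q))\<^sup>2 - 2 * c * cmod (g q) + c\<^sup>2)"
    by (rule ext) (simp add: power2_eq_square algebra_simps)
  also have "integral {0..s} \<dots> = ?Q - 2 * c * ?I + c\<^sup>2 * s"
  proof -
    have "integral {0..s} (\<lambda>q. (cmod (g q))\<^sup>2 - 2 * c * cmod (g q) + c\<^sup>2)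
        = integral {0..s} (\<lambda>q. (cmod (g q))\<^sup>2 - 2 * c * cmod (g q)) + integral {0..s} (\<lambda>q. c\<^sup>2)"
      using i1 i2 by (intro Henstock_Kurzweil_Integration.integral_add integrable_diff integrable_on_mult_right) auto
    also have "integral {0..s} (\<lambda>q. (cmod (g q))\<^sup>2 - 2 * c * cmod (g q)) = ?Q - integral {0..s} (\<lambda>q. 2 * c * cmod (g q))"
      using i1 i2 by (intro Henstock_Kurzweil_Integration.integral_diff integrable_on_mult_right) auto
    finally show ?thesis using s by simp
  qed
  also have "\<dots> = ?Q - ?I\<^sup>2 / s"
    using s by (simp add: c_def power2_eq_square field_simps)
  finally have "?I\<^sup>2 \<le> s * ?Q"
    using s by (simp add: field_simps)
  moreover have "cmod (integral {0..s} g) \<le> ?I"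
    by (rule integral_norm_bound_integral[OF integrable_continuous_real[OF g] i1]) simp
  then have "(cmod (integral {0..s} g))\<^sup>2 \<le> ?I\<^sup>2"
    by (intro power_mono) auto
  ultimately show ?thesis by simp
qed simp

lemma nn_integral_continuous_Icc:
  fixes g :: "real \<Rightarrow> real"
  assumes g: "continuous_on {0..s} g" and nonneg: "\<And>q. 0 \<le> g q"
  shows "(\<integral>\<^sup>+q\<in>{0..s}. ennreal (g q) \<partial>lborel) = ennreal (integral {0..s} g)"
proof -
  have i: "set_integrable lborel {0..s} g"
    by (rule borel_integrable_atLeastAtMost'[OF g])
  have "(\<integral>\<^sup>+q\<in>{0..s}. ennreal (g q) \<partial>lborel) = (\<integral>\<^sup>+q. ennreal (indicator {0..s} q *\<^sub>R g q) \<partial>lborel)"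
    by (rule nn_integral_cong) (auto simp: indicator_def)
  also have "\<dots> = ennreal (LINT q:{0..s}|lborel. g q)"
    using i nonneg unfolding set_integrable_def set_lebesgue_integral_def by (intro nn_integral_eq_integral) auto
  finally show ?thesis
    by (simp add: set_borel_integral_eq_integral(2)[OF i])
qed

context brownian_motion
begin

text \<open>For w = u1 - u2 the equation of v expresses v1 - v2 through w, the drift is handled by
  Cauchy-Schwarz along the path and the stochastic part by \<open>ito_inequality\<close>, giving E
  |w|^2 \<le> const times its time integral. The finiteness assumptions \<open>f1\<close> and
  \<open>f2\<close> are what allows Gronwall to conclude 0 and not infinity.\<close>

lemma mode_unique:
  assumes S1: "mode_solution M F B \<sigma> T \<xi> a b u1 v1" and S2: "mode_solution M F B \<sigma> T \<xi> a b u2 v2"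
    and T: "0 < T"
    and m1: "(\<lambda>(t, \<omega>). u1 t \<omega>) \<in> borel_measurable (restrict_space borel {0..T} \<Otimes>\<^sub>M M)"
    and m2: "(\<lambda>(t, \<omega>). u2 t \<omega>) \<in> borel_measurable (restrict_space borel {0..T} \<Otimes>\<^sub>M M)"
    and f1: "(\<integral>\<^sup>+s\<in>{0..T}. (\<integral>\<^sup>+\<omega>. ennreal ((cmod (u1 s \<omega>))\<^sup>2) \<partial>M) \<partial>lborel) < \<infinity>"
    and f2: "(\<integral>\<^sup>+s\<in>{0..T}. (\<integral>\<^sup>+\<omega>. ennreal ((cmod (u2 s \<omega>))\<^sup>2) \<partial>M) \<partial>lborel) < \<infinity>"
    and t: "t \<in> {0..T}"
  shows "AE \<omega> in M. u1 t \<omega> = u2 t \<omega> \<and> v1 t \<omega> = v2 t \<omega>"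
proof -
  interpret P: pair_sigma_finite M lborel ..
  have T0: "0 \<le> T" using T by simp
  define m where "m = \<sigma>\<^sup>2 / 2 * \<xi>\<^sup>2"
  \<comment> \<open>Clamping time to [0, T] makes the measurability of the fields usable on the
    whole line.\<close>
  define cl where "cl s = max 0 (min T s)" for s
  have cl: "cl s = s" if "s \<in> {0..T}" for s
    using that by (simp add: cl_def)
  have cl_in: "cl s \<in> {0..T}" for s
    using T by (simp add: cl_def)
  define w where "w s \<omega> = u1 (cl s) \<omega> - u2 (cl s) \<omega>" for s \<omega>
  define f where "f s = (\<integral>\<^sup>+\<omega>. ennreal ((cmod (w s \<omega>))\<^sup>2) \<partial>M)" for s
  have c1 [measurable]: "(\<lambda>p. u1 (cl (snd p)) (fst p)) \<in> borel_measurable (M \<Otimes>\<^sub>M lborel)"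
    and c2 [measurable]: "(\<lambda>p. u2 (cl (snd p)) (fst p)) \<in> borel_measurable (M \<Otimes>\<^sub>M lborel)"
    unfolding cl_def by (rule clamp_joint[OF m1 T0], rule clamp_joint[OF m2 T0])
  have wm [measurable]: "(\<lambda>p. w (snd p) (fst p)) \<in> borel_measurable (M \<Otimes>\<^sub>M lborel)"
    unfolding w_def by measurable
  have sw: "(\<lambda>(s, \<omega>). ennreal ((cmod (h s \<omega>))\<^sup>2)) \<in> borel_measurable (lborel \<Otimes>\<^sub>M M)"
    if "(\<lambda>p. h (snd p) (fst p)) \<in> borel_measurable (M \<Otimes>\<^sub>M lborel)" for h :: "real \<Rightarrow> 'a \<Rightarrow> complex"
  proof -
    have "(\<lambda>p. ennreal ((cmod (h (snd p) (fst p)))\<^sup>2)) \<in> borel_measurable (M \<Otimes>\<^sub>M lborel)"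
      using that by measurable
    from measurable_pair_swap[OF this] show ?thesis
      by simp
  qed
  have fm_l: "f \<in> borel_measurable lborel"
    unfolding f_def[abs_def] by (rule borel_measurable_nn_integral[OF sw[OF wm]])
  then have fm: "f \<in> borel_measurable borel"
    by simp
  have w_t [measurable]: "w s \<in> borel_measurable M" for s
    using measurable_compose[OF measurable_Pair2'[of s lborel M] wm] by simp
  have swap: "(\<integral>\<^sup>+\<omega>. (\<integral>\<^sup>+q\<in>{0..s}. ennreal ((cmod (w q \<omega>))\<^sup>2) \<partial>lborel) \<partial>M) = (\<integral>\<^sup>+q\<in>{0..s}. f q \<partial>lborel)" for s
  proof -
    have "(\<lambda>(\<omega>, q). ennreal ((cmod (w q \<omega>))\<^sup>2) * indicator {0..s} q) \<in> borel_measurable (M \<Otimes>\<^sub>M lborel)"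
      unfolding case_prod_beta' by measurable
    from P.Fubini'[OF this]
    have "(\<integral>\<^sup>+\<omega>. (\<integral>\<^sup>+q\<in>{0..s}. ennreal ((cmod (w q \<omega>))\<^sup>2) \<partial>lborel) \<partial>M) = (\<integral>\<^sup>+q. (\<integral>\<^sup>+\<omega>. ennreal ((cmod (w q \<omega>))\<^sup>2) * indicator {0..s} q \<partial>M) \<partial>lborel)"
      by simp
    also have "\<dots> = (\<integral>\<^sup>+q\<in>{0..s}. f q \<partial>lborel)"
      unfolding f_def by (intro nn_integral_cong nn_integral_multc) measurable
    finally show ?thesis .
  qed
  obtain J1 where I1: "has_ito_integral M F B T (\<lambda>s \<omega>. \<i> * of_real (\<sigma> * \<xi>) * u1 s \<omega>) J1"
    and e1: "AE \<omega> in M. \<forall>t\<in>{0..T}. u1 t \<omega> = a + integral {0..t} (\<lambda>s. v1 s \<omega> - of_real (\<sigma>\<^sup>2 / 2 * \<xi>\<^sup>2) * u1 s \<omega>) + J1 t \<omega>"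
    using S1 unfolding mode_solution_def by blast
  obtain J2 where I2: "has_ito_integral M F B T (\<lambda>s \<omega>. \<i> * of_real (\<sigma> * \<xi>) * u2 s \<omega>) J2"
    and e2: "AE \<omega> in M. \<forall>t\<in>{0..T}. u2 t \<omega> = a + integral {0..t} (\<lambda>s. v2 s \<omega> - of_real (\<sigma>\<^sup>2 / 2 * \<xi>\<^sup>2) * u2 s \<omega>) + J2 t \<omega>"
    using S2 unfolding mode_solution_def by blast
  have c: "AE \<omega> in M. continuous_on {0..T} (\<lambda>t. u1 t \<omega>) \<and> continuous_on {0..T} (\<lambda>t. v1 t \<omega>)"
    "AE \<omega> in M. continuous_on {0..T} (\<lambda>t. u2 t \<omega>) \<and> continuous_on {0..T} (\<lambda>t. v2 t \<omega>)"
    and ev: "AE \<omega> in M. \<forall>t\<in>{0..T}. v1 t \<omega> = b + integral {0..t} (\<lambda>s. of_real \<xi> * u1 s \<omega>)"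
    "AE \<omega> in M. \<forall>t\<in>{0..T}. v2 t \<omega> = b + integral {0..t} (\<lambda>s. of_real \<xi> * u2 s \<omega>)"
    using S1 S2 unfolding mode_solution_def by blast+
  \<comment> \<open>With Q the time integral of |w|^2: |v1 - v2|^2 is at most T \<xi>^2 Q, and |v1 -
    v2 - m w|^2 at most twice the sum of the squares. Integrating, applying Cauchy-Schwarz with
    factor T, and a last factor 2 for separating the stochastic part give k.\<close>
  define k where "k = 2 * (T * (2 * (T * (T * \<xi>\<^sup>2)) + 2 * m\<^sup>2))"
  have k0: "0 \<le> k"
    using T by (simp add: k_def)
  have path: "AE \<omega> in M. \<forall>s\<in>{0..T}.
      ennreal ((cmod (v1 s \<omega> - v2 s \<omega>))\<^sup>2) \<le> ennreal (T * \<xi>\<^sup>2) * (\<integral>\<^sup>+q\<in>{0..s}. ennreal ((cmod (w q \<omega>))\<^sup>2) \<partial>lborel) \<and>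
      ennreal ((cmod (w s \<omega>))\<^sup>2) \<le> ennreal k * (\<integral>\<^sup>+q\<in>{0..s}. ennreal ((cmod (w q \<omega>))\<^sup>2) \<partial>lborel) + 2 * ennreal ((cmod (J1 s \<omega> - J2 s \<omega>))\<^sup>2)"
    using e1 e2 c ev
  proof eventually_elim
    case (elim \<omega>)
    let ?w = "\<lambda>q. u1 q \<omega> - u2 q \<omega>" and ?z = "\<lambda>q. v1 q \<omega> - v2 q \<omega>"
    have cw: "continuous_on {0..T} ?w" and cz: "continuous_on {0..T} ?z"
      using elim by (auto intro!: continuous_intros)
    have sub: "continuous_on {0..s} g" if "continuous_on {0..T} g" "s \<in> {0..T}" for g :: "real \<Rightarrow> complex" and s
      using that by (auto intro: continuous_on_subset)
    have sub1: "continuous_on {0..s} (\<lambda>t. u1 t \<omega>)" "continuous_on {0..s} (\<lambda>t. u2 t \<omega>)"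
      "continuous_on {0..s} (\<lambda>t. v1 t \<omega>)" "continuous_on {0..s} (\<lambda>t. v2 t \<omega>)" if "s \<in> {0..T}" for s
      using elim that by (auto intro!: sub)
    define Q where "Q s = integral {0..s} (\<lambda>q. (cmod (?w q))\<^sup>2)" for s
    have Q: "(\<integral>\<^sup>+q\<in>{0..s}. ennreal ((cmod (w q \<omega>))\<^sup>2) \<partial>lborel) = ennreal (Q s)" if s: "s \<in> {0..T}" for s
    proof -
      have "(\<integral>\<^sup>+q\<in>{0..s}. ennreal ((cmod (w q \<omega>))\<^sup>2) \<partial>lborel) = (\<integral>\<^sup>+q\<in>{0..s}. ennreal ((cmod (?w q))\<^sup>2) \<partial>lborel)"
        using s by (intro nn_integral_cong) (auto simp: w_def cl indicator_def)
      also have "\<dots> = ennreal (Q s)"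
        unfolding Q_def using sub1[OF s] by (intro nn_integral_continuous_Icc continuous_intros) auto
      finally show ?thesis .
    qed
    have Q0: "0 \<le> Q s" if "s \<in> {0..T}" for s
      unfolding Q_def using sub1[OF that] by (intro integral_nonneg integrable_continuous_real continuous_intros) auto
    have Qmono: "Q q \<le> Q s" if "q \<in> {0..s}" "s \<in> {0..T}" for q s
      unfolding Q_def using that sub1[OF that(2)] sub1[of q]
      by (intro integral_subset_le integrable_continuous_real continuous_intros) auto
    have z: "(cmod (?z s))\<^sup>2 \<le> T * \<xi>\<^sup>2 * Q s" if s: "s \<in> {0..T}" for s
    proof -
      have "?z s = integral {0..s} (\<lambda>q. of_real \<xi> * ?w q)"
        using elim(5,6) s sub1[OF s]
        by (simp add: right_diff_distrib Henstock_Kurzweil_Integration.integral_diff integrable_continuous_real continuous_intros)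
      then have "(cmod (?z s))\<^sup>2 \<le> s * integral {0..s} (\<lambda>q. (cmod (of_real \<xi> * ?w q))\<^sup>2)"
        using integral_square_bound[of s "\<lambda>q. of_real \<xi> * ?w q"] sub1[OF s] s by (simp add: continuous_intros)
      also have "integral {0..s} (\<lambda>q. (cmod (of_real \<xi> * ?w q))\<^sup>2) = \<xi>\<^sup>2 * Q s"
        unfolding Q_def integral_mult_right[symmetric] by (simp add: norm_mult power_mult_distrib)
      also have "s * (\<xi>\<^sup>2 * Q s) \<le> T * (\<xi>\<^sup>2 * Q s)"
        using s Q0[OF s] by (intro mult_right_mono) auto
      finally show ?thesis by (simp add: mult.assoc)
    qed
    show ?case
    proof (intro ballI conjI)
      fix s assume s: "s \<in> {0..T}"
      show "ennreal ((cmod (?z s))\<^sup>2) \<le> ennreal (T * \<xi>\<^sup>2) * (\<integral>\<^sup>+q\<in>{0..s}. ennreal ((cmod (w q \<omega>))\<^sup>2) \<partial>lborel)"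
        unfolding Q[OF s] using z[OF s] Q0[OF s] T by (simp add: ennreal_leI flip: ennreal_mult)
      let ?g = "\<lambda>q. ?z q - of_real m * ?w q"
      have cg: "continuous_on {0..s} ?g"
        using sub1[OF s] by (intro continuous_intros)
      have ci: "(\<lambda>q. v1 q \<omega> - of_real m * u1 q \<omega>) integrable_on {0..s}" "(\<lambda>q. v2 q \<omega> - of_real m * u2 q \<omega>) integrable_on {0..s}"
        using sub1[OF s] by (auto intro!: integrable_continuous_real continuous_intros)
      have "integral {0..s} ?g = integral {0..s} (\<lambda>q. (v1 q \<omega> - of_real m * u1 q \<omega>) - (v2 q \<omega> - of_real m * u2 q \<omega>))"
        by (rule Henstock_Kurzweil_Integration.integral_cong) (simp add: algebra_simps)
      also have "\<dots> = integral {0..s} (\<lambda>q. v1 q \<omega> - of_real m * u1 q \<omega>) - integral {0..s} (\<lambda>q. v2 q \<omega> - of_real m * u2 q \<omega>)"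
        by (rule Henstock_Kurzweil_Integration.integral_diff[OF ci])
      finally have "?w s = integral {0..s} ?g - (- (J1 s \<omega> - J2 s \<omega>))"
        using elim(1,2) s by (simp add: m_def)
      then have "(cmod (?w s))\<^sup>2 \<le> 2 * (cmod (integral {0..s} ?g))\<^sup>2 + 2 * (cmod (J1 s \<omega> - J2 s \<omega>))\<^sup>2"
        using cmod_diff_square[of "integral {0..s} ?g" "- (J1 s \<omega> - J2 s \<omega>)"] by (simp only: norm_minus_cancel)
      moreover have "(cmod (integral {0..s} ?g))\<^sup>2 \<le> T * (2 * (T * (T * \<xi>\<^sup>2)) + 2 * m\<^sup>2) * Q s"
      proof -
        have cI: "continuous_on {0..s} (\<lambda>q. 2 * (T * \<xi>\<^sup>2 * Q s) + 2 * m\<^sup>2 * (cmod (?w q))\<^sup>2)"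
          using sub1[OF s] by (intro continuous_intros)
        have "integral {0..s} (\<lambda>q. (cmod (?g q))\<^sup>2) \<le> integral {0..s} (\<lambda>q. 2 * (T * \<xi>\<^sup>2 * Q s) + 2 * m\<^sup>2 * (cmod (?w q))\<^sup>2)"
        proof (rule integral_le)
          show "(\<lambda>q. (cmod (?g q))\<^sup>2) integrable_on {0..s}"
            using sub1[OF s] by (intro integrable_continuous_real continuous_intros)
          show "(\<lambda>q. 2 * (T * \<xi>\<^sup>2 * Q s) + 2 * m\<^sup>2 * (cmod (?w q))\<^sup>2) integrable_on {0..s}"
            by (rule integrable_continuous_real[OF cI])
          fix q assume q: "q \<in> {0..s}"
          have "(cmod (?g q))\<^sup>2 \<le> 2 * (cmod (?z q))\<^sup>2 + 2 * (cmod (of_real m * ?w q))\<^sup>2"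
            by (rule cmod_diff_square)
          also have "(cmod (of_real m * ?w q))\<^sup>2 = m\<^sup>2 * (cmod (?w q))\<^sup>2"
            by (simp add: norm_mult power_mult_distrib)
          also have "(cmod (?z q))\<^sup>2 \<le> T * \<xi>\<^sup>2 * Q s"
            using z[of q] Qmono[OF q s] q s T by (auto intro: order_trans[OF _ mult_left_mono])
          finally show "(cmod (?g q))\<^sup>2 \<le> 2 * (T * \<xi>\<^sup>2 * Q s) + 2 * m\<^sup>2 * (cmod (?w q))\<^sup>2"
            by simp
        qed
        also have "\<dots> = 2 * (T * \<xi>\<^sup>2 * Q s) * s + 2 * m\<^sup>2 * Q s"
        proof -
          have iw: "(\<lambda>q. 2 * m\<^sup>2 * (cmod (?w q))\<^sup>2) integrable_on {0..s}"
            using sub1[OF s] by (intro integrable_continuous_real continuous_intros)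
          show ?thesis
            unfolding Q_def[of s] integral_mult_right[symmetric]
            using s by (subst Henstock_Kurzweil_Integration.integral_add[OF _ iw]) auto
        qed
        also have "\<dots> \<le> 2 * (T * \<xi>\<^sup>2 * Q s) * T + 2 * m\<^sup>2 * Q s"
          using s Q0[OF s] T by (intro add_right_mono mult_left_mono) auto
        finally have le: "integral {0..s} (\<lambda>q. (cmod (?g q))\<^sup>2) \<le> 2 * (T * \<xi>\<^sup>2 * Q s) * T + 2 * m\<^sup>2 * Q s" .
        have "(cmod (integral {0..s} ?g))\<^sup>2 \<le> s * integral {0..s} (\<lambda>q. (cmod (?g q))\<^sup>2)"
          using s by (intro integral_square_bound cg) auto
        also have "\<dots> \<le> T * (2 * (T * \<xi>\<^sup>2 * Q s) * T + 2 * m\<^sup>2 * Q s)"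
          using s le sub1[OF s] by (intro mult_mono integral_nonneg integrable_continuous_real continuous_intros) auto
        also have "\<dots> = T * (2 * (T * (T * \<xi>\<^sup>2)) + 2 * m\<^sup>2) * Q s"
          by (simp add: algebra_simps)
        finally show ?thesis .
      qed
      ultimately have "(cmod (?w s))\<^sup>2 \<le> k * Q s + 2 * (cmod (J1 s \<omega> - J2 s \<omega>))\<^sup>2"
        unfolding k_def by (simp only: mult.assoc)
      then have "ennreal ((cmod (?w s))\<^sup>2) \<le> ennreal k * ennreal (Q s) + 2 * ennreal ((cmod (J1 s \<omega> - J2 s \<omega>))\<^sup>2)"
        using k0 Q0[OF s] by (simp add: ennreal_leI flip: ennreal_numeral ennreal_mult ennreal_plus)
      then show "ennreal ((cmod (w s \<omega>))\<^sup>2) \<le> ennreal k * (\<integral>\<^sup>+q\<in>{0..s}. ennreal ((cmod (w q \<omega>))\<^sup>2) \<partial>lborel) + 2 * ennreal ((cmod (J1 s \<omega> - J2 s \<omega>))\<^sup>2)"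
        unfolding Q[OF s] using cl[OF s] by (simp add: w_def)
    qed
  qed
  let ?l = "(\<sigma> * \<xi>)\<^sup>2"
  have Im: "(\<lambda>\<omega>. \<integral>\<^sup>+q\<in>{0..s}. ennreal ((cmod (w q \<omega>))\<^sup>2) \<partial>lborel) \<in> borel_measurable M" for s
    by (intro lborel.borel_measurable_nn_integral) (unfold case_prod_beta', measurable)
  \<comment> \<open>The 4 is the 2 in front of the stochastic part times the 2 of
    \<open>ito_inequality\<close>.\<close>
  have f_le: "f s \<le> ennreal (k + 4 * ?l) * (\<integral>\<^sup>+q\<in>{0..s}. f q \<partial>lborel)" if s: "s \<in> {0..T}" for s
  proof -
    have Jm [measurable]: "J1 s \<in> borel_measurable M" "J2 s \<in> borel_measurable M"
      using I1 I2 s unfolding has_ito_integral_def by blast+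
    note [measurable] = Im[of s]
    have "f s \<le> (\<integral>\<^sup>+\<omega>. ennreal k * (\<integral>\<^sup>+q\<in>{0..s}. ennreal ((cmod (w q \<omega>))\<^sup>2) \<partial>lborel) + 2 * ennreal ((cmod (J1 s \<omega> - J2 s \<omega>))\<^sup>2) \<partial>M)"
      unfolding f_def using path by (intro nn_integral_mono_AE) (use s in \<open>auto elim!: eventually_mono\<close>)
    also have "\<dots> = ennreal k * (\<integral>\<^sup>+q\<in>{0..s}. f q \<partial>lborel) + 2 * (\<integral>\<^sup>+\<omega>. ennreal ((cmod (J1 s \<omega> - J2 s \<omega>))\<^sup>2) \<partial>M)"
      by (simp add: nn_integral_add nn_integral_cmult swap)
    also have "(\<integral>\<^sup>+\<omega>. ennreal ((cmod (J1 s \<omega> - J2 s \<omega>))\<^sup>2) \<partial>M) \<le> 2 * (ennreal ?l * (\<integral>\<^sup>+q\<in>{0..s}. f q \<partial>lborel))"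
    proof -
      have "(\<integral>\<^sup>+\<omega>. ennreal ((cmod (J1 s \<omega> - J2 s \<omega>))\<^sup>2) \<partial>M) \<le> 2 * (\<integral>\<^sup>+\<omega>. (\<integral>\<^sup>+q\<in>{0..s}.
          ennreal ((cmod (\<i> * of_real (\<sigma> * \<xi>) * u1 q \<omega> - \<i> * of_real (\<sigma> * \<xi>) * u2 q \<omega>))\<^sup>2) \<partial>lborel) \<partial>M)"
        by (rule ito_inequality[OF I1 I2 T0 s])
      also have "(\<integral>\<^sup>+\<omega>. (\<integral>\<^sup>+q\<in>{0..s}. ennreal ((cmod (\<i> * of_real (\<sigma> * \<xi>) * u1 q \<omega> - \<i> * of_real (\<sigma> * \<xi>) * u2 q \<omega>))\<^sup>2) \<partial>lborel) \<partial>M)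
        = (\<integral>\<^sup>+\<omega>. ennreal ?l * (\<integral>\<^sup>+q\<in>{0..s}. ennreal ((cmod (w q \<omega>))\<^sup>2) \<partial>lborel) \<partial>M)"
      proof (rule nn_integral_cong)
        fix \<omega> assume \<omega>: "\<omega> \<in> space M"
        have [measurable]: "(\<lambda>q. w q \<omega>) \<in> borel_measurable borel"
          using measurable_compose[OF measurable_Pair1'[OF \<omega>] wm] by simp
        have "(\<integral>\<^sup>+q\<in>{0..s}. ennreal ((cmod (\<i> * of_real (\<sigma> * \<xi>) * u1 q \<omega> - \<i> * of_real (\<sigma> * \<xi>) * u2 q \<omega>))\<^sup>2) \<partial>lborel)
          = (\<integral>\<^sup>+q. ennreal ?l * (ennreal ((cmod (w q \<omega>))\<^sup>2) * indicator {0..s} q) \<partial>lborel)"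
        proof (rule nn_integral_cong)
          fix q :: real
          have "\<i> * of_real (\<sigma> * \<xi>) * x - \<i> * of_real (\<sigma> * \<xi>) * y = \<i> * of_real (\<sigma> * \<xi>) * (x - y)" for x y
            by (simp add: right_diff_distrib)
          moreover have "(cmod (\<i> * of_real (\<sigma> * \<xi>) * x))\<^sup>2 = ?l * (cmod x)\<^sup>2" for x
            by (simp only: norm_mult norm_ii norm_of_real mult_1 power_mult_distrib power2_abs)
          ultimately show "ennreal ((cmod (\<i> * of_real (\<sigma> * \<xi>) * u1 q \<omega> - \<i> * of_real (\<sigma> * \<xi>) * u2 q \<omega>))\<^sup>2) * indicator {0..s} q
            = ennreal ?l * (ennreal ((cmod (w q \<omega>))\<^sup>2) * indicator {0..s} q)"
            using s by (auto simp: indicator_def w_def cl ennreal_mult simp del: of_real_mult)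
        qed
        also have "\<dots> = ennreal ?l * (\<integral>\<^sup>+q\<in>{0..s}. ennreal ((cmod (w q \<omega>))\<^sup>2) \<partial>lborel)"
          by (rule nn_integral_cmult) simp
        finally show "(\<integral>\<^sup>+q\<in>{0..s}. ennreal ((cmod (\<i> * of_real (\<sigma> * \<xi>) * u1 q \<omega> - \<i> * of_real (\<sigma> * \<xi>) * u2 q \<omega>))\<^sup>2) \<partial>lborel)
          = ennreal ?l * (\<integral>\<^sup>+q\<in>{0..s}. ennreal ((cmod (w q \<omega>))\<^sup>2) \<partial>lborel)" .
      qed
      also have "\<dots> = ennreal ?l * (\<integral>\<^sup>+q\<in>{0..s}. f q \<partial>lborel)"
        by (simp add: nn_integral_cmult swap)
      finally show ?thesis .
    qed
    finally have "f s \<le> ennreal k * (\<integral>\<^sup>+q\<in>{0..s}. f q \<partial>lborel) + 2 * (2 * (ennreal ?l * (\<integral>\<^sup>+q\<in>{0..s}. f q \<partial>lborel)))"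
      by (simp add: add_left_mono mult_left_mono)
    also have "\<dots> = (ennreal k + 2 * (2 * ennreal ?l)) * (\<integral>\<^sup>+q\<in>{0..s}. f q \<partial>lborel)"
      by (simp add: distrib_right mult.assoc)
    also have "ennreal k + 2 * (2 * ennreal ?l) = ennreal (k + 4 * ?l)"
      using k0 by (simp add: ennreal_plus ennreal_mult flip: ennreal_numeral) (simp flip: ennreal_mult)
    finally show ?thesis .
  qed
  have f_fin: "(\<integral>\<^sup>+s\<in>{0..T}. f s \<partial>lborel) < \<infinity>"
  proof -
    let ?g1 = "\<lambda>s. \<integral>\<^sup>+\<omega>. ennreal ((cmod (u1 (cl s) \<omega>))\<^sup>2) \<partial>M" and ?g2 = "\<lambda>s. \<integral>\<^sup>+\<omega>. ennreal ((cmod (u2 (cl s) \<omega>))\<^sup>2) \<partial>M"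
    have gm [measurable]: "?g1 \<in> borel_measurable borel" "?g2 \<in> borel_measurable borel"
      using borel_measurable_nn_integral[OF sw[OF c1]] borel_measurable_nn_integral[OF sw[OF c2]] by simp_all
    have um: "(\<lambda>\<omega>. u1 (cl s) \<omega>) \<in> borel_measurable M" "(\<lambda>\<omega>. u2 (cl s) \<omega>) \<in> borel_measurable M" for s
      using measurable_compose[OF measurable_Pair2'[of s lborel M] c1] measurable_compose[OF measurable_Pair2'[of s lborel M] c2] by simp_all
    have "f s \<le> 2 * ?g1 s + 2 * ?g2 s" for s
    proof -
      have "f s \<le> (\<integral>\<^sup>+\<omega>. 2 * ennreal ((cmod (u1 (cl s) \<omega>))\<^sup>2) + 2 * ennreal ((cmod (u2 (cl s) \<omega>))\<^sup>2) \<partial>M)"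
        unfolding f_def w_def
        by (intro nn_integral_mono) (simp add: cmod_diff_square ennreal_leI flip: ennreal_numeral ennreal_mult ennreal_plus)
      also have "\<dots> = 2 * ?g1 s + 2 * ?g2 s"
        using um by (simp add: nn_integral_add nn_integral_cmult)
      finally show ?thesis .
    qed
    then have "(\<integral>\<^sup>+s\<in>{0..T}. f s \<partial>lborel) \<le> (\<integral>\<^sup>+s. 2 * (?g1 s * indicator {0..T} s) + 2 * (?g2 s * indicator {0..T} s) \<partial>lborel)"
      by (intro nn_integral_mono) (auto simp: indicator_def)
    also have "\<dots> = 2 * (\<integral>\<^sup>+s\<in>{0..T}. ?g1 s \<partial>lborel) + 2 * (\<integral>\<^sup>+s\<in>{0..T}. ?g2 s \<partial>lborel)"
      by (subst nn_integral_add) (auto simp: nn_integral_cmult)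
    also have "(\<integral>\<^sup>+s\<in>{0..T}. ?g1 s \<partial>lborel) = (\<integral>\<^sup>+s\<in>{0..T}. (\<integral>\<^sup>+\<omega>. ennreal ((cmod (u1 s \<omega>))\<^sup>2) \<partial>M) \<partial>lborel)"
      by (rule nn_integral_cong) (auto simp: cl indicator_def)
    also have "(\<integral>\<^sup>+s\<in>{0..T}. ?g2 s \<partial>lborel) = (\<integral>\<^sup>+s\<in>{0..T}. (\<integral>\<^sup>+\<omega>. ennreal ((cmod (u2 s \<omega>))\<^sup>2) \<partial>M) \<partial>lborel)"
      by (rule nn_integral_cong) (auto simp: cl indicator_def)
    also have "2 * (\<integral>\<^sup>+s\<in>{0..T}. (\<integral>\<^sup>+\<omega>. ennreal ((cmod (u1 s \<omega>))\<^sup>2) \<partial>M) \<partial>lborel) +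
        2 * (\<integral>\<^sup>+s\<in>{0..T}. (\<integral>\<^sup>+\<omega>. ennreal ((cmod (u2 s \<omega>))\<^sup>2) \<partial>M) \<partial>lborel) < \<infinity>"
      using f1 f2 by (simp add: ennreal_mult_less_top)
    finally show ?thesis .
  qed
  have f0: "f s = 0" if "s \<in> {0..T}" for s
    by (rule gronwall_ennreal[OF _ f_fin fm f_le that]) (use k0 in auto)
  \<comment> \<open>The difference of the v components at time t depends on w over the whole of
    [0, t]; the vanishing of w at time t alone would not settle it.\<close>
  have F0: "(\<integral>\<^sup>+q\<in>{0..t}. f q \<partial>lborel) = 0"
  proof -
    have "(\<integral>\<^sup>+q\<in>{0..t}. f q \<partial>lborel) = (\<integral>\<^sup>+q. 0 \<partial>(lborel :: real measure))"
      using t f0 by (intro nn_integral_cong) (auto simp: indicator_def)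
    then show ?thesis by simp
  qed
  have "AE \<omega> in M. ennreal ((cmod (w t \<omega>))\<^sup>2) = 0"
    using f0[OF t] unfolding f_def by (subst (asm) nn_integral_0_iff_AE) auto
  moreover have "AE \<omega> in M. (\<integral>\<^sup>+q\<in>{0..t}. ennreal ((cmod (w q \<omega>))\<^sup>2) \<partial>lborel) = 0"
    using F0 unfolding swap[symmetric] by (subst (asm) nn_integral_0_iff_AE[OF Im])
  ultimately show ?thesis
    using path
  proof eventually_elim
    case (elim \<omega>)
    have "ennreal ((cmod (v1 t \<omega> - v2 t \<omega>))\<^sup>2)
        \<le> ennreal (T * \<xi>\<^sup>2) * (\<integral>\<^sup>+q\<in>{0..t}. ennreal ((cmod (w q \<omega>))\<^sup>2) \<partial>lborel)"
      using elim(3) t by blast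
    then have "ennreal ((cmod (v1 t \<omega> - v2 t \<omega>))\<^sup>2) \<le> 0"
      unfolding elim(2) by simp
    then show ?case
      using elim(1) cl[OF t] by (simp add: w_def ennreal_eq_0_iff)
  qed
qed

end

section \<open>Sobolev-valued random variables and random fields of modes\<close>

abbreviation mode_weight :: "real \<Rightarrow> real \<Rightarrow> real" where
  "mode_weight s \<xi> \<equiv> (1 + \<xi>\<^sup>2) powr s"

definition weighted_energy :: "real \<Rightarrow> (real \<Rightarrow> complex) \<Rightarrow> ennreal" where
  "weighted_energy s g = (\<integral>\<^sup>+\<xi>. ennreal (mode_weight s \<xi> * (cmod (g \<xi>))\<^sup>2) \<partial>lborel)"

text \<open>The second moment of the Sobolev norm of order s for a random field of transforms. As an
  extended nonnegative integral over the product it can be split in either order without prior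
  integrability.\<close>

definition field_energy :: "'a measure \<Rightarrow> real \<Rightarrow> ('a \<Rightarrow> real \<Rightarrow> complex) \<Rightarrow> ennreal" where
  "field_energy M s G = (\<integral>\<^sup>+z. ennreal (mode_weight s (snd z) * (cmod (G (fst z) (snd z)))\<^sup>2) \<partial>(M \<Otimes>\<^sub>M lborel))"

abbreviation joint_field :: "'a measure \<Rightarrow> ('a \<Rightarrow> real \<Rightarrow> complex) \<Rightarrow> bool" where
  "joint_field M G \<equiv> (\<lambda>z. G (fst z) (snd z)) \<in> borel_measurable (M \<Otimes>\<^sub>M lborel)"

lemma joint_field_iff:
  "joint_field M G \<longleftrightarrow> (\<lambda>(\<omega>, \<xi>). G \<omega> \<xi>) \<in> borel_measurable (M \<Otimes>\<^sub>M borel)"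
proof -
  have "sets (M \<Otimes>\<^sub>M lborel) = sets (M \<Otimes>\<^sub>M (borel :: real measure))"
    by (intro sets_pair_measure_cong) auto
  then show ?thesis
    unfolding case_prod_beta' by (simp cong: measurable_cong_sets)
qed

lemma joint_field_section:
  assumes "joint_field M G" "\<omega> \<in> space M"
  shows "G \<omega> \<in> borel_measurable borel"
  using measurable_compose[OF measurable_Pair1'[OF assms(2)] assms(1)] by simp

lemma field_energy_iterated:
  assumes [measurable]: "joint_field M G"
  shows "field_energy M s G = (\<integral>\<^sup>+\<omega>. weighted_energy s (G \<omega>) \<partial>M)"
proof -
  have "(\<lambda>z. ennreal (mode_weight s (snd z) * (cmod (G (fst z) (snd z)))\<^sup>2)) \<in> borel_measurable (M \<Otimes>\<^sub>M lborel)"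
    by measurable
  from lborel.nn_integral_fst[OF this] show ?thesis
    by (simp add: field_energy_def weighted_energy_def)
qed

lemma weighted_energy_joint [measurable]:
  assumes [measurable]: "joint_field M G"
  shows "(\<lambda>\<omega>. weighted_energy s (G \<omega>)) \<in> borel_measurable M"
proof -
  have "(\<lambda>z. ennreal (mode_weight s (snd z) * (cmod (G (fst z) (snd z)))\<^sup>2)) \<in> borel_measurable (M \<Otimes>\<^sub>M lborel)"
    by measurable
  from lborel.borel_measurable_nn_integral_fst[OF this] show ?thesis
    by (simp add: weighted_energy_def)
qed

lemma weighted_square_add:
  assumes "0 \<le> (c::real)"
  shows "ennreal (c * (cmod (x + y))\<^sup>2) \<le> 2 * ennreal (c * (cmod x)\<^sup>2) + 2 * ennreal (c * (cmod y)\<^sup>2)"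
proof -
  have "c * (cmod (x + y))\<^sup>2 \<le> c * (2 * (cmod x)\<^sup>2 + 2 * (cmod y)\<^sup>2)"
    using cmod_diff_square[of x "- y"] assms by (intro mult_left_mono) auto
  then have "ennreal (c * (cmod (x + y))\<^sup>2) \<le> ennreal (2 * (c * (cmod x)\<^sup>2) + 2 * (c * (cmod y)\<^sup>2))"
    by (intro ennreal_leI) (simp add: algebra_simps)
  then show ?thesis
    using assms by (simp add: ennreal_plus ennreal_mult)
qed

lemma weighted_energy_add:
  assumes [measurable]: "g \<in> borel_measurable borel" "h \<in> borel_measurable borel"
  shows "weighted_energy s (\<lambda>\<xi>. g \<xi> + h \<xi>) \<le> 2 * weighted_energy s g + 2 * weighted_energy s h"
proof -
  have "weighted_energy s (\<lambda>\<xi>. g \<xi> + h \<xi>) \<le> (\<integral>\<^sup>+\<xi>. 2 * ennreal (mode_weight s \<xi> * (cmod (g \<xi>))\<^sup>2) + 2 * ennreal (mode_weight s \<xi> * (cmod (h \<xi>))\<^sup>2) \<partial>lborel)"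
    unfolding weighted_energy_def by (intro nn_integral_mono weighted_square_add) simp
  also have "\<dots> = 2 * weighted_energy s g + 2 * weighted_energy s h"
    unfolding weighted_energy_def by (simp add: nn_integral_add nn_integral_cmult)
  finally show ?thesis .
qed

lemma weighted_energy_minus: "weighted_energy s (\<lambda>\<xi>. - g \<xi>) = weighted_energy s g"
  by (simp add: weighted_energy_def)

lemma field_energy_add:
  assumes [measurable]: "joint_field M G" "joint_field M H"
  shows "field_energy M s (\<lambda>\<omega> \<xi>. G \<omega> \<xi> + H \<omega> \<xi>) \<le> 2 * field_energy M s G + 2 * field_energy M s H"
proof -
  have "field_energy M s (\<lambda>\<omega> \<xi>. G \<omega> \<xi> + H \<omega> \<xi>) \<le> (\<integral>\<^sup>+z. 2 * ennreal (mode_weight s (snd z) * (cmod (G (fst z) (snd z)))\<^sup>2)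
      + 2 * ennreal (mode_weight s (snd z) * (cmod (H (fst z) (snd z)))\<^sup>2) \<partial>(M \<Otimes>\<^sub>M lborel))"
    unfolding field_energy_def by (intro nn_integral_mono weighted_square_add) simp
  also have "\<dots> = 2 * field_energy M s G + 2 * field_energy M s H"
    unfolding field_energy_def by (simp add: nn_integral_add nn_integral_cmult)
  finally show ?thesis .
qed

lemma mode_weight_0: "mode_weight 0 \<xi> = 1"
  by (simp add: add_nonneg_eq_0_iff)

lemma square_integrable_iff:
  "square_integrable g \<longleftrightarrow> g \<in> borel_measurable borel \<and> weighted_energy 0 g < \<infinity>"
  unfolding square_integrable_def weighted_energy_def mode_weight_0 by (auto simp: integrable_iff_bounded)

lemma integrable_weight_iff:
  assumes [measurable]: "g \<in> borel_measurable borel"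
  shows "integrable lborel (\<lambda>\<xi>. mode_weight s \<xi> * (cmod (g \<xi>))\<^sup>2) \<longleftrightarrow> weighted_energy s g < \<infinity>"
  unfolding weighted_energy_def by (auto simp: integrable_iff_bounded)

lemma sobolev_iff_energy:
  assumes "has_fourier u g"
  shows "u \<in> sobolev s \<longleftrightarrow> weighted_energy s g < \<infinity>"
  using sobolev_iff[OF assms] integrable_weight_iff[OF has_fourierD(1)[OF assms]] by simp

lemma sobolev_norm_energy:
  assumes "has_fourier u g" and "u \<in> sobolev s"
  shows "ennreal ((sobolev_norm s u)\<^sup>2) = weighted_energy s g"
proof -
  have "integrable lborel (\<lambda>\<xi>. mode_weight s \<xi> * (cmod (g \<xi>))\<^sup>2)"
    using sobolev_iff[OF assms(1)] assms(2) by simp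
  then show ?thesis
    unfolding weighted_energy_def by (simp add: sobolev_norm_eq[OF assms(1)] nn_integral_eq_integral integral_nonneg_AE)
qed

text \<open>Equality may fail outside \<open>sobolev s\<close>, where the Bochner integral defining
  the norm takes the value 0 while the energy is infinite; the inequality survives.\<close>

lemma sobolev_norm_le_energy:
  assumes "has_fourier u g"
  shows "ennreal ((sobolev_norm s u)\<^sup>2) \<le> weighted_energy s g"
  using sobolev_norm_energy[OF assms] sobolev_iff_energy[OF assms, of s] by (cases "u \<in> sobolev s") (auto simp: less_top[symmetric])

text \<open>The value 0 outside the square integrable functions keeps the construction adapted.\<close>

definition dist_of :: "(real \<Rightarrow> complex) \<Rightarrow> tempered" where
  "dist_of g = (if square_integrable g then tempered_of g else 0)"

lemma has_fourier_dist_of: "square_integrable g \<Longrightarrow> has_fourier (dist_of g) g"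
  by (simp add: dist_of_def has_fourier_tempered_of)

text \<open>N is kept general in order to take N = F t: whether the section has finite energy is
  then an event known at time t, so switching to the default respects the filtration.\<close>

lemma pairing_dist_of_measurable:
  assumes G [measurable]: "joint_field N G" and \<phi>: "schwartz \<phi>"
  shows "(\<lambda>\<omega>. pairing (dist_of (G \<omega>)) \<phi>) \<in> borel_measurable N"
proof -
  have [measurable]: "fourier \<phi> \<in> borel_measurable borel"
    by (rule schwartz_borel[OF schwartz_fourier[OF \<phi>]])
  have "(\<lambda>z. G (fst z) (snd z) * fourier \<phi> (- snd z)) \<in> borel_measurable (N \<Otimes>\<^sub>M lborel)"
    by measurable
  then have [measurable]: "(\<lambda>\<omega>. LINT \<xi>|lborel. G \<omega> \<xi> * fourier \<phi> (- \<xi>)) \<in> borel_measurable N"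
    by (intro lborel.borel_measurable_lebesgue_integral) (simp add: case_prod_beta')
  have "(\<lambda>\<omega>. if weighted_energy 0 (G \<omega>) < \<infinity> then of_real (1 / (2 * pi)) * (LINT \<xi>|lborel. G \<omega> \<xi> * fourier \<phi> (- \<xi>)) else 0) \<in> borel_measurable N"
    by measurable
  also have "?this \<longleftrightarrow> ?thesis"
    using joint_field_section[OF G]
    by (intro measurable_cong) (auto simp: dist_of_def square_integrable_iff pairing_tempered_of \<phi> zero_tempered.rep_eq)
  finally show ?thesis .
qed


text \<open>
  Approximable fields contain the rectangles and are closed under sums and dominated limits, so
  a Dynkin argument applies. A simple field takes finitely many values, as functions of \<open>\<xi>\<close>.
\<close>

definition simple_field :: "'a measure \<Rightarrow> real \<Rightarrow> ('a \<Rightarrow> real \<Rightarrow> complex) \<Rightarrow> bool" where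
  "simple_field M s S \<longleftrightarrow> simple_function M S \<and> joint_field M S \<and>
     (\<forall>\<omega>\<in>space M. weighted_energy 0 (S \<omega>) < \<infinity> \<and> weighted_energy s (S \<omega>) < \<infinity>)"

definition approximable_field :: "'a measure \<Rightarrow> real \<Rightarrow> ('a \<Rightarrow> real \<Rightarrow> complex) \<Rightarrow> bool" where
  "approximable_field M s G \<longleftrightarrow> joint_field M G \<and>
     (\<forall>\<epsilon>>0. \<exists>S. simple_field M s S \<and> field_energy M s (\<lambda>\<omega> \<xi>. S \<omega> \<xi> - G \<omega> \<xi>) < \<epsilon>)"

lemma simple_field_approximable: "simple_field M s S \<Longrightarrow> approximable_field M s S"
  unfolding approximable_field_def by (auto simp: simple_field_def field_energy_def intro!: exI[of _ S])

lemma simple_field_add: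
  assumes S: "simple_field M s S" and R: "simple_field M s R"
  shows "simple_field M s (\<lambda>\<omega> \<xi>. S \<omega> \<xi> + R \<omega> \<xi>)"
  unfolding simple_field_def
proof (intro conjI ballI)
  have [measurable]: "joint_field M S" "joint_field M R"
    using S R by (auto simp: simple_field_def)
  show "simple_function M (\<lambda>\<omega> \<xi>. S \<omega> \<xi> + R \<omega> \<xi>)"
    using simple_function_compose2[of M S R "\<lambda>g h \<xi>. g \<xi> + h \<xi>"] S R by (simp add: simple_field_def)
  show "joint_field M (\<lambda>\<omega> \<xi>. S \<omega> \<xi> + R \<omega> \<xi>)"
    by measurable
  fix \<omega> assume \<omega>: "\<omega> \<in> space M"
  have "weighted_energy p (\<lambda>\<xi>. S \<omega> \<xi> + R \<omega> \<xi>) < \<infinity>" if "weighted_energy p (S \<omega>) < \<infinity>" "weighted_energy p (R \<omega>) < \<infinity>" for p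
  proof -
    have "weighted_energy p (\<lambda>\<xi>. S \<omega> \<xi> + R \<omega> \<xi>) \<le> 2 * weighted_energy p (S \<omega>) + 2 * weighted_energy p (R \<omega>)"
      by (intro weighted_energy_add joint_field_section[OF _ \<omega>]) measurable
    also have "\<dots> < \<infinity>"
      using that by (simp add: ennreal_mult_less_top)
    finally show ?thesis .
  qed
  then show "weighted_energy 0 (\<lambda>\<xi>. S \<omega> \<xi> + R \<omega> \<xi>) < \<infinity>" "weighted_energy s (\<lambda>\<xi>. S \<omega> \<xi> + R \<omega> \<xi>) < \<infinity>"
    using S R \<omega> by (auto simp: simple_field_def)
qed

text \<open>The \<epsilon>/4 argument, matched to the two factors 2 of
  \<open>field_energy_add\<close>; \<epsilon> may be infinite.\<close>

lemma ennreal_quarter: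
  assumes "0 < (\<epsilon> :: ennreal)"
  shows "\<exists>\<delta>>0. \<forall>x y. x < \<delta> \<longrightarrow> y < \<delta> \<longrightarrow> 2 * x + 2 * y < \<epsilon>"
proof -
  obtain e :: real where e: "0 < e" "ennreal e < \<epsilon>"
  proof (cases "\<epsilon> = \<top>")
    case True
    then show ?thesis by (intro that[of 1]) auto
  next
    case False
    then obtain r where "\<epsilon> = ennreal r" "0 < r"
      using assms by (cases \<epsilon>) auto
    then show ?thesis by (intro that[of "r / 2"]) (auto simp: ennreal_less_iff)
  qed
  show ?thesis
  proof (intro exI[of _ "ennreal (e / 4)"] conjI allI impI)
    show "0 < ennreal (e / 4)" using e by simp
    fix x y assume "x < ennreal (e / 4)" "y < ennreal (e / 4)"
    then have "2 * x + 2 * y \<le> 2 * ennreal (e / 4) + 2 * ennreal (e / 4)"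
      by (intro add_mono mult_left_mono) auto
    also have "\<dots> = ennreal e"
      using e by (simp flip: ennreal_numeral ennreal_mult ennreal_plus)
    finally show "2 * x + 2 * y < \<epsilon>" using e by simp
  qed
qed

lemma approximable_field_add:
  assumes G: "approximable_field M s G" and H: "approximable_field M s H"
  shows "approximable_field M s (\<lambda>\<omega> \<xi>. G \<omega> \<xi> + H \<omega> \<xi>)"
  unfolding approximable_field_def
proof (intro conjI allI impI)
  have jG [measurable]: "joint_field M G" and jH [measurable]: "joint_field M H"
    using G H by (auto simp: approximable_field_def)
  show "joint_field M (\<lambda>\<omega> \<xi>. G \<omega> \<xi> + H \<omega> \<xi>)"
    by measurable
  fix \<epsilon> :: ennreal assume "0 < \<epsilon>"
  then obtain \<delta> where \<delta>: "0 < \<delta>" "\<And>x y. x < \<delta> \<Longrightarrow> y < \<delta> \<Longrightarrow> 2 * x + 2 * y < \<epsilon>"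
    using ennreal_quarter by blast
  obtain S where S: "simple_field M s S" "field_energy M s (\<lambda>\<omega> \<xi>. S \<omega> \<xi> - G \<omega> \<xi>) < \<delta>"
    using G \<delta>(1) by (auto simp: approximable_field_def)
  obtain R where R: "simple_field M s R" "field_energy M s (\<lambda>\<omega> \<xi>. R \<omega> \<xi> - H \<omega> \<xi>) < \<delta>"
    using H \<delta>(1) by (auto simp: approximable_field_def)
  have [measurable]: "joint_field M S" "joint_field M R"
    using S R by (auto simp: simple_field_def)
  have "field_energy M s (\<lambda>\<omega> \<xi>. (S \<omega> \<xi> + R \<omega> \<xi>) - (G \<omega> \<xi> + H \<omega> \<xi>)) = field_energy M s (\<lambda>\<omega> \<xi>. (S \<omega> \<xi> - G \<omega> \<xi>) + (R \<omega> \<xi> - H \<omega> \<xi>))"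
    by (simp add: algebra_simps)
  also have "\<dots> \<le> 2 * field_energy M s (\<lambda>\<omega> \<xi>. S \<omega> \<xi> - G \<omega> \<xi>) + 2 * field_energy M s (\<lambda>\<omega> \<xi>. R \<omega> \<xi> - H \<omega> \<xi>)"
    by (intro field_energy_add) measurable
  also have "\<dots> < \<epsilon>"
    by (rule \<delta>(2)[OF S(2) R(2)])
  finally show "\<exists>S. simple_field M s S \<and> field_energy M s (\<lambda>\<omega> \<xi>. S \<omega> \<xi> - (G \<omega> \<xi> + H \<omega> \<xi>)) < \<epsilon>"
    using simple_field_add[OF S(1) R(1)] by blast
qed

lemma approximable_field_sum:
  assumes "finite I" "\<And>i. i \<in> I \<Longrightarrow> approximable_field M s (G i)"
  shows "approximable_field M s (\<lambda>\<omega> \<xi>. \<Sum>i\<in>I. G i \<omega> \<xi>)"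
  using assms
proof (induction I rule: finite_induct)
  case empty
  have "simple_field M s (\<lambda>\<omega> \<xi>. 0)"
    by (simp add: simple_field_def weighted_energy_def)
  then show ?case
    by (simp add: simple_field_approximable)
next
  case (insert i I)
  then show ?case
    by (simp add: approximable_field_add)
qed

lemma approximable_field_limit:
  fixes M :: "'a measure"
  assumes G: "\<And>n. approximable_field M s (G n)" and H: "joint_field M H"
    and lim: "\<And>\<omega> \<xi>. \<omega> \<in> space M \<Longrightarrow> (\<lambda>n. G n \<omega> \<xi>) \<longlonglongrightarrow> H \<omega> \<xi>"
    and D: "joint_field M D" "field_energy M s D < \<infinity>"
    and le: "\<And>n \<omega> \<xi>. \<omega> \<in> space M \<Longrightarrow> cmod (G n \<omega> \<xi>) \<le> cmod (D \<omega> \<xi>)"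
  shows "approximable_field M s H"
  unfolding approximable_field_def
proof (intro conjI allI impI)
  note [measurable] = H D(1)
  have jG [measurable]: "joint_field M (G n)" for n
    using G[of n] by (simp add: approximable_field_def)
  show "joint_field M H"
    by measurable
  have leH: "cmod (H \<omega> \<xi>) \<le> cmod (D \<omega> \<xi>)" if "\<omega> \<in> space M" for \<omega> \<xi>
    by (rule LIMSEQ_le_const2[OF tendsto_norm[OF lim[OF that]]]) (use le[OF that] in auto)
  let ?w = "\<lambda>z :: 'a \<times> real. mode_weight s (snd z)"
  have "(\<lambda>n. field_energy M s (\<lambda>\<omega> \<xi>. G n \<omega> \<xi> - H \<omega> \<xi>)) \<longlonglongrightarrow> (\<integral>\<^sup>+z. 0 \<partial>(M \<Otimes>\<^sub>M (lborel :: real measure)))"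
    unfolding field_energy_def
  \<comment> \<open>4 = 2 + 2 from the square of a difference, since D bounds both G n and the limit
    H.\<close>
  proof (rule nn_integral_dominated_convergence[where w = "\<lambda>z. 4 * ennreal (?w z * (cmod (D (fst z) (snd z)))\<^sup>2)"])
    have "(\<integral>\<^sup>+z. 4 * ennreal (?w z * (cmod (D (fst z) (snd z)))\<^sup>2) \<partial>(M \<Otimes>\<^sub>M lborel)) = 4 * field_energy M s D"
      unfolding field_energy_def by (rule nn_integral_cmult) measurable
    then show "(\<integral>\<^sup>+z. 4 * ennreal (?w z * (cmod (D (fst z) (snd z)))\<^sup>2) \<partial>(M \<Otimes>\<^sub>M lborel)) < \<infinity>"
      using D(2) by (simp add: ennreal_mult_less_top)
    show "AE z in M \<Otimes>\<^sub>M lborel. (\<lambda>n. ennreal (?w z * (cmod (G n (fst z) (snd z) - H (fst z) (snd z)))\<^sup>2)) \<longlonglongrightarrow> 0"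
    proof (rule AE_I2)
      fix z :: "'a \<times> real" assume "z \<in> space (M \<Otimes>\<^sub>M lborel)"
      then have "fst z \<in> space M" by (auto simp: space_pair_measure)
      from tendsto_diff[OF lim[OF this, of "snd z"] tendsto_const[of "H (fst z) (snd z)"]]
      have "(\<lambda>n. G n (fst z) (snd z) - H (fst z) (snd z)) \<longlonglongrightarrow> 0" by simp
      then have "(\<lambda>n. ?w z * (cmod (G n (fst z) (snd z) - H (fst z) (snd z)))\<^sup>2) \<longlonglongrightarrow> ?w z * (cmod 0)\<^sup>2"
        by (intro tendsto_intros)
      then show "(\<lambda>n. ennreal (?w z * (cmod (G n (fst z) (snd z) - H (fst z) (snd z)))\<^sup>2)) \<longlonglongrightarrow> 0"
        using tendsto_ennrealI by fastforce
    qed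
    show "AE z in M \<Otimes>\<^sub>M lborel. ennreal (?w z * (cmod (G n (fst z) (snd z) - H (fst z) (snd z)))\<^sup>2) \<le> 4 * ennreal (?w z * (cmod (D (fst z) (snd z)))\<^sup>2)" for n
    proof (rule AE_I2)
      fix z :: "'a \<times> real" assume "z \<in> space (M \<Otimes>\<^sub>M lborel)"
      then have z: "fst z \<in> space M" by (auto simp: space_pair_measure)
      let ?d = "(cmod (D (fst z) (snd z)))\<^sup>2"
      have "(cmod (G n (fst z) (snd z) - H (fst z) (snd z)))\<^sup>2 \<le> 2 * ?d + 2 * ?d"
        by (rule order_trans[OF cmod_diff_square]) (intro add_mono mult_left_mono power_mono le[OF z] leH[OF z]; simp)
      then have "?w z * (cmod (G n (fst z) (snd z) - H (fst z) (snd z)))\<^sup>2 \<le> ?w z * (4 * ?d)"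
        by (intro mult_left_mono) auto
      then have "ennreal (?w z * (cmod (G n (fst z) (snd z) - H (fst z) (snd z)))\<^sup>2) \<le> ennreal (4 * (?w z * ?d))"
        by (intro ennreal_leI) simp
      also have "\<dots> = 4 * ennreal (?w z * ?d)"
        by (subst ennreal_mult) auto
      finally show "ennreal (?w z * (cmod (G n (fst z) (snd z) - H (fst z) (snd z)))\<^sup>2) \<le> 4 * ennreal (?w z * ?d)" .
    qed
  qed measurable
  then have lim0: "(\<lambda>n. field_energy M s (\<lambda>\<omega> \<xi>. G n \<omega> \<xi> - H \<omega> \<xi>)) \<longlonglongrightarrow> 0"
    by simp
  fix \<epsilon> :: ennreal assume "0 < \<epsilon>"
  then obtain \<delta> where \<delta>: "0 < \<delta>" "\<And>x y. x < \<delta> \<Longrightarrow> y < \<delta> \<Longrightarrow> 2 * x + 2 * y < \<epsilon>"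
    using ennreal_quarter by blast
  from order_tendstoD(2)[OF lim0 \<delta>(1)] obtain n where n: "field_energy M s (\<lambda>\<omega> \<xi>. G n \<omega> \<xi> - H \<omega> \<xi>) < \<delta>"
    by (auto simp: eventually_sequentially)
  obtain S where S: "simple_field M s S" "field_energy M s (\<lambda>\<omega> \<xi>. S \<omega> \<xi> - G n \<omega> \<xi>) < \<delta>"
    using G[of n] \<delta>(1) by (auto simp: approximable_field_def)
  have [measurable]: "joint_field M S"
    using S by (auto simp: simple_field_def)
  have "field_energy M s (\<lambda>\<omega> \<xi>. S \<omega> \<xi> - H \<omega> \<xi>) = field_energy M s (\<lambda>\<omega> \<xi>. (S \<omega> \<xi> - G n \<omega> \<xi>) + (G n \<omega> \<xi> - H \<omega> \<xi>))"
    by simp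
  also have "\<dots> \<le> 2 * field_energy M s (\<lambda>\<omega> \<xi>. S \<omega> \<xi> - G n \<omega> \<xi>) + 2 * field_energy M s (\<lambda>\<omega> \<xi>. G n \<omega> \<xi> - H \<omega> \<xi>)"
    by (intro field_energy_add) measurable
  also have "\<dots> < \<epsilon>"
    by (rule \<delta>(2)[OF S(2) n])
  finally show "\<exists>S. simple_field M s S \<and> field_energy M s (\<lambda>\<omega> \<xi>. S \<omega> \<xi> - H \<omega> \<xi>) < \<epsilon>"
    using S(1) by blast
qed

text \<open>Dynkin's argument in E. A measurable rectangle gives a simple field outright, with at
  most two values. The window [- m, m] keeps all energies finite, since the whole line may have
  infinite weighted measure, and its indicator serves as dominating field for complements and
  countable unions.\<close>

lemma approximable_field_rectangle:
  assumes E: "E \<in> sets (M \<Otimes>\<^sub>M borel)" and M: "finite_measure M"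
  shows "approximable_field M s (\<lambda>\<omega> \<xi>. c * indicator {-m..m} \<xi> * indicator E (\<omega>, \<xi>))"
proof -
  interpret finite_measure M by (rule M)
  have joint: "joint_field M (\<lambda>\<omega> \<xi>. c * indicator {-m..m} \<xi> * indicator E (\<omega>, \<xi>))"
    if [measurable]: "E \<in> sets (M \<Otimes>\<^sub>M borel)" for c E
    unfolding joint_field_iff by measurable
  have finite_Icc: "weighted_energy p (\<lambda>\<xi>. c * indicator {-m..m} \<xi>) < \<infinity>" for p c
  proof -
    have "continuous_on {-m..m} (\<lambda>\<xi>. mode_weight p \<xi> * (cmod c)\<^sup>2)"
      by (intro continuous_intros) (auto simp: add_nonneg_eq_0_iff)
    then have "integrable lborel (\<lambda>\<xi>. indicator {-m..m} \<xi> *\<^sub>R (mode_weight p \<xi> * (cmod c)\<^sup>2))"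
      using borel_integrable_atLeastAtMost' unfolding set_integrable_def by blast
    also have "(\<lambda>\<xi>. indicator {-m..m} \<xi> *\<^sub>R (mode_weight p \<xi> * (cmod c)\<^sup>2)) = (\<lambda>\<xi>. mode_weight p \<xi> * (cmod (c * indicator {-m..m} \<xi>))\<^sup>2)"
      by (rule ext) (simp add: norm_mult power_mult_distrib indicator_def)
    finally show ?thesis
      by (subst integrable_weight_iff[symmetric]) simp_all
  qed
  have finite_rect: "field_energy M p (\<lambda>\<omega> \<xi>. c * indicator {-m..m} \<xi>) < \<infinity>" for p c
  proof -
    have "field_energy M p (\<lambda>\<omega> \<xi>. c * indicator {-m..m} \<xi>) = weighted_energy p (\<lambda>\<xi>. c * indicator {-m..m} \<xi>) * emeasure M (space M)"
      by (subst field_energy_iterated) simp_all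
    then show ?thesis
      using finite_Icc emeasure_finite[of "space M"] by (simp add: ennreal_mult_eq_top_iff less_top[symmetric])
  qed
  have full: "approximable_field M s (\<lambda>\<omega> \<xi>. c * indicator {-m..m} \<xi>)" for c
    using finite_Icc by (intro simple_field_approximable) (simp add: simple_field_def)
  \<comment> \<open>The coefficient c is quantified inside because a complement is handled as c
    times the window minus c times the set, that is, with coefficient - c.\<close>
  let ?P = "\<lambda>E. \<forall>c. approximable_field M s (\<lambda>\<omega> \<xi>. c * indicator {-m..m} \<xi> * indicator E (\<omega>, \<xi>))"
  have "E \<in> sigma_sets (space M \<times> space borel) {a \<times> b | a b. a \<in> sets M \<and> b \<in> sets borel}"
    using E by (simp add: sets_pair_measure)
  then have "?P E"
  proof (induction rule: sigma_sets_induct_disjoint[OF Int_stable_pair_measure_generator pair_measure_closed, consumes 1, case_names basic empty compl union])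
    case (basic E)
    then obtain A C where E: "E = A \<times> C" and [measurable]: "A \<in> sets M" "C \<in> sets borel"
      by blast
    show ?case
    proof (intro allI simple_field_approximable)
      fix c :: complex
      let ?f = "\<lambda>x :: real. \<lambda>\<xi>. c * indicator {-m..m} \<xi> * (of_real x * indicator C \<xi>)"
      have eq: "(\<lambda>\<omega> \<xi>. c * indicator {-m..m} \<xi> * indicator E (\<omega>, \<xi>)) = (\<lambda>\<omega>. ?f (indicator A \<omega>))"
        unfolding E by (intro ext) (simp add: indicator_def)
      have "simple_function M (\<lambda>\<omega>. ?f (indicator A \<omega>))"
        by (rule simple_function_compose1[of M "indicator A" ?f]) simp
      moreover have "weighted_energy p (\<lambda>\<xi>. c * indicator {-m..m} \<xi> * indicator E (\<omega>, \<xi>)) < \<infinity>" for p \<omega>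
      proof -
        have "weighted_energy p (\<lambda>\<xi>. c * indicator {-m..m} \<xi> * indicator E (\<omega>, \<xi>)) \<le> weighted_energy p (\<lambda>\<xi>. c * indicator {-m..m} \<xi>)"
          unfolding weighted_energy_def by (intro nn_integral_mono ennreal_leI) (auto simp: indicator_def)
        then show ?thesis using finite_Icc[of p c] by (rule le_less_trans)
      qed
      ultimately show "simple_field M s (\<lambda>\<omega> \<xi>. c * indicator {-m..m} \<xi> * indicator E (\<omega>, \<xi>))"
        unfolding simple_field_def using joint[of E c] by (auto simp: eq[symmetric] E)
    qed
  next
    case empty
    show ?case using full[of 0] by simp
  next
    case (compl E)
    show ?case
    proof
      fix c :: complex
      have Em [measurable]: "E \<in> sets (M \<Otimes>\<^sub>M borel)"
        using compl(1) by (simp add: sets_pair_measure)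
      let ?G = "\<lambda>\<omega> \<xi>. c * indicator {-m..m} \<xi> + (- c) * indicator {-m..m} \<xi> * indicator E (\<omega>, \<xi>)"
      show "approximable_field M s (\<lambda>\<omega> \<xi>. c * indicator {-m..m} \<xi> * indicator (space M \<times> space borel - E) (\<omega>, \<xi>))"
      \<comment> \<open>The limit of a constant sequence acts as a congruence on
        \<open>space M\<close>: outside it the two fields may differ.\<close>
      proof (rule approximable_field_limit[where G = "\<lambda>_. ?G"])
        show "approximable_field M s ?G"
          using compl(2) by (intro approximable_field_add full) blast
        show "joint_field M (\<lambda>\<omega> \<xi>. c * indicator {-m..m} \<xi> * indicator (space M \<times> space borel - E) (\<omega>, \<xi>))"
          unfolding space_pair_measure[symmetric] by (rule joint) measurable
        show "joint_field M (\<lambda>\<omega> \<xi>. c * indicator {-m..m} \<xi>)" by measurable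
        show "field_energy M s (\<lambda>\<omega> \<xi>. c * indicator {-m..m} \<xi>) < \<infinity>" by (rule finite_rect)
        show "(\<lambda>_. ?G \<omega> \<xi>) \<longlonglongrightarrow> c * indicator {-m..m} \<xi> * indicator (space M \<times> space borel - E) (\<omega>, \<xi>)"
          if "\<omega> \<in> space M" for \<omega> \<xi>
          using that by (intro tendsto_eq_intros) (auto simp: indicator_def)
        show "cmod (?G \<omega> \<xi>) \<le> cmod (c * indicator {-m..m} \<xi>)" for \<omega> \<xi>
          by (auto simp: indicator_def)
      qed
    qed
  next
    case (union E)
    have Em [measurable]: "E i \<in> sets (M \<Otimes>\<^sub>M borel)" for i
      using union(2) by (auto simp: sets_pair_measure)
    show ?case
    proof
      fix c :: complex
      show "approximable_field M s (\<lambda>\<omega> \<xi>. c * indicator {-m..m} \<xi> * indicator (\<Union>i. E i) (\<omega>, \<xi>))"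
      proof (rule approximable_field_limit)
        show "approximable_field M s (\<lambda>\<omega> \<xi>. \<Sum>i<n. c * indicator {-m..m} \<xi> * indicator (E i) (\<omega>, \<xi>))" for n
          using union(3) by (intro approximable_field_sum) auto
        show "joint_field M (\<lambda>\<omega> \<xi>. c * indicator {-m..m} \<xi> * indicator (\<Union>i. E i) (\<omega>, \<xi>))"
          by (rule joint) measurable
        show "joint_field M (\<lambda>\<omega> \<xi>. c * indicator {-m..m} \<xi>)" by measurable
        show "field_energy M s (\<lambda>\<omega> \<xi>. c * indicator {-m..m} \<xi>) < \<infinity>" by (rule finite_rect)
        have sum: "(\<Sum>i<n. indicator (E i) z :: complex) = indicator (\<Union>i<n. E i) z" for n z
          using disjoint_family_on_mono[OF _ union(1), of "{..<n}"] by (simp add: indicator_UN_disjoint)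
        show "(\<lambda>n. \<Sum>i<n. c * indicator {-m..m} \<xi> * indicator (E i) (\<omega>, \<xi>)) \<longlonglongrightarrow> c * indicator {-m..m} \<xi> * indicator (\<Union>i. E i) (\<omega>, \<xi>)" for \<omega> \<xi>
          unfolding sum_distrib_left[symmetric] sum
          by (intro tendsto_intros LIMSEQ_indicator_UN)
        show "cmod (\<Sum>i<n. c * indicator {-m..m} \<xi> * indicator (E i) (\<omega>, \<xi>)) \<le> cmod (c * indicator {-m..m} \<xi>)" for n \<omega> \<xi>
          unfolding sum_distrib_left[symmetric] sum by (auto simp: indicator_def norm_mult)
      qed
    qed
  qed
  then show ?thesis by blast
qed

text \<open>Simple functions on the product space converge pointwise to G with norm at most 2 |G|,
  which is why 2 G dominates. Cut off to growing windows, they are finite sums of the fields of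
  \<open>approximable_field_rectangle\<close>, one for each value.\<close>

lemma approximable_field_finite_energy:
  assumes G: "joint_field M G" "field_energy M s G < \<infinity>" and M: "finite_measure M"
  shows "approximable_field M s G"
proof -
  have Gm: "(\<lambda>z. G (fst z) (snd z)) \<in> borel_measurable (M \<Otimes>\<^sub>M borel)"
    using G(1) unfolding joint_field_iff case_prod_beta' .
  obtain S where S: "\<And>i. simple_function (M \<Otimes>\<^sub>M borel) (S i)"
    and lim: "\<And>z. z \<in> space (M \<Otimes>\<^sub>M borel) \<Longrightarrow> (\<lambda>i. S i z) \<longlonglongrightarrow> G (fst z) (snd z)"
    and le: "\<And>i z. z \<in> space (M \<Otimes>\<^sub>M borel) \<Longrightarrow> dist (S i z) 0 \<le> 2 * dist (G (fst z) (snd z)) 0"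
    using borel_measurable_implies_sequence_metric[OF Gm, of 0] by blast
  let ?S = "\<lambda>n \<omega> \<xi>. \<Sum>y\<in>S n ` space (M \<Otimes>\<^sub>M borel). y * indicator {-real n..real n} \<xi> * indicator (S n -` {y} \<inter> space (M \<Otimes>\<^sub>M borel)) (\<omega>, \<xi>)"
  show ?thesis
  proof (rule approximable_field_limit[where G = ?S
        and D = "\<lambda>\<omega> \<xi>. 2 * G \<omega> \<xi>"])
    show "approximable_field M s (?S n)" for n
      using S[of n] by (intro approximable_field_sum approximable_field_rectangle M) (auto dest: simple_functionD)
    show "joint_field M (\<lambda>\<omega> \<xi>. 2 * G \<omega> \<xi>)"
      using G(1) by measurable
    have "field_energy M s (\<lambda>\<omega> \<xi>. 2 * G \<omega> \<xi>) \<le> 2 * field_energy M s G + 2 * field_energy M s G"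
      using field_energy_add[OF G(1) G(1), of s] by simp
    also have "\<dots> < \<infinity>"
      using G(2) by (simp add: ennreal_mult_less_top)
    finally show "field_energy M s (\<lambda>\<omega> \<xi>. 2 * G \<omega> \<xi>) < \<infinity>" .
    fix \<omega> and \<xi> :: real assume "\<omega> \<in> space M"
    then have z: "(\<omega>, \<xi>) \<in> space (M \<Otimes>\<^sub>M borel)"
      by (simp add: space_pair_measure)
    have eq: "(?S n \<omega> \<xi>)
        = indicator {-real n..real n} \<xi> * S n (\<omega>, \<xi>)" for n
    proof -
      have "(?S n \<omega> \<xi>)
        = (\<Sum>y\<in>S n ` space (M \<Otimes>\<^sub>M borel). if S n (\<omega>, \<xi>) = y then indicator {-real n..real n} \<xi> * y else 0)"
        using z by (intro sum.cong) (auto simp: indicator_def)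
      then show ?thesis
        using z simple_functionD(1)[OF S[of n]] by (simp add: sum.delta')
    qed
    show "(\<lambda>n. ?S n \<omega> \<xi>) \<longlonglongrightarrow> G \<omega> \<xi>"
      unfolding eq
    proof (rule Lim_transform_eventually)
      show "(\<lambda>n. S n (\<omega>, \<xi>)) \<longlonglongrightarrow> G \<omega> \<xi>"
        using lim[OF z] by simp
      show "\<forall>\<^sub>F n in sequentially. S n (\<omega>, \<xi>) = indicator {-real n..real n} \<xi> * S n (\<omega>, \<xi>)"
        using eventually_ge_at_top[of "nat \<lceil>\<bar>\<xi>\<bar>\<rceil>"]
      proof eventually_elim
        case (elim n)
        then have "\<bar>\<xi>\<bar> \<le> real n" by linarith
        then show ?case by (auto simp: indicator_def)
      qed
    qed
    show "cmod (?S n \<omega> \<xi>) \<le> cmod (2 * G \<omega> \<xi>)" for n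
      unfolding eq using le[OF z, of n] by (auto simp: indicator_def norm_mult)
  qed (rule G(1))
qed

text \<open>Simple fields with error energy below (1/2)^n have summable errors in mean, so their
  error energies tend to 0 almost surely. The energy of order 0 is required besides that of order s
  because s may be negative and \<open>dist_of\<close> yields the intended distribution only for
  square integrable sections.\<close>

lemma strongly_measurable_field:
  fixes G :: "'a \<Rightarrow> real \<Rightarrow> complex"
  assumes G [measurable]: "joint_field M G" and E: "field_energy M s G < \<infinity>" "field_energy M 0 G < \<infinity>"
    and M: "finite_measure M"
  shows "strongly_measurable M s (\<lambda>\<omega>. dist_of (G \<omega>))"
proof -
  have "\<exists>S. simple_field M s S \<and> field_energy M s (\<lambda>\<omega> \<xi>. S \<omega> \<xi> - G \<omega> \<xi>) < ennreal ((1 / 2) ^ n)" for n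
    using approximable_field_finite_energy[OF G E(1) M] unfolding approximable_field_def by simp
  then obtain S where S: "\<And>n. simple_field M s (S n)"
    and le: "\<And>n. field_energy M s (\<lambda>\<omega> \<xi>. S n \<omega> \<xi> - G \<omega> \<xi>) < ennreal ((1 / 2) ^ n)"
    by metis
  have [measurable]: "joint_field M (S n)" for n
    using S[of n] by (simp add: simple_field_def)
  define e where "e n \<omega> = weighted_energy s (\<lambda>\<xi>. S n \<omega> \<xi> - G \<omega> \<xi>)" for n \<omega>
  have em [measurable]: "e n \<in> borel_measurable M" for n
    unfolding e_def by measurable
  have "(\<integral>\<^sup>+\<omega>. (\<Sum>n. e n \<omega>) \<partial>M) = (\<Sum>n. \<integral>\<^sup>+\<omega>. e n \<omega> \<partial>M)"
    by (rule nn_integral_suminf) measurable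
  also have "\<dots> = (\<Sum>n. field_energy M s (\<lambda>\<omega> \<xi>. S n \<omega> \<xi> - G \<omega> \<xi>))"
    unfolding e_def by (intro suminf_cong field_energy_iterated[symmetric]) measurable
  also have "\<dots> \<le> (\<Sum>n. ennreal ((1 / 2) ^ n))"
    using le by (intro suminf_le) (auto intro: less_imp_le)
  also have "\<dots> = ennreal (\<Sum>n. (1 / 2) ^ n)"
    by (intro suminf_ennreal2) auto
  also have "\<dots> < \<infinity>"
    by simp
  finally have "AE \<omega> in M. (\<Sum>n. e n \<omega>) \<noteq> \<infinity>"
    by (intro nn_integral_noteq_infinite) auto
  then have lim: "AE \<omega> in M. (\<lambda>n. e n \<omega>) \<longlonglongrightarrow> 0"
  proof eventually_elim
    case (elim \<omega>)
    then have fin: "e n \<omega> \<noteq> \<top>" for n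
      using ennreal_suminf_lessD[of "\<lambda>n. e n \<omega>" \<top>] by (metis infinity_ennreal_def less_top)
    have "summable (\<lambda>n. enn2real (e n \<omega>))"
      using elim fin by (intro summable_suminf_not_top) (auto simp: ennreal_enn2real_if)
    from tendsto_ennrealI[OF summable_LIMSEQ_zero[OF this]] show ?case
      using fin by (simp add: ennreal_enn2real_if)
  qed
  have AE_fin: "AE \<omega> in M. weighted_energy p (G \<omega>) \<noteq> \<infinity>" if "field_energy M p G < \<infinity>" for p
    using that unfolding field_energy_iterated[OF G] by (intro nn_integral_noteq_infinite) auto
  have SF: "has_fourier (dist_of (S n \<omega>)) (S n \<omega>)" if "\<omega> \<in> space M" for n \<omega>
    using S[of n] that joint_field_section[of "S n" M \<omega>]
    by (intro has_fourier_dist_of) (auto simp: square_integrable_iff simple_field_def)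
  show ?thesis
    unfolding strongly_measurable_def
  proof (intro exI[of _ "\<lambda>n \<omega>. dist_of (S n \<omega>)"] conjI allI)
    fix n
    show "simple_function M (\<lambda>\<omega>. dist_of (S n \<omega>))"
      using S[of n] by (intro simple_function_compose1[of M "S n" dist_of]) (simp add: simple_field_def)
    show "(\<lambda>\<omega>. dist_of (S n \<omega>)) ` space M \<subseteq> sobolev s"
      using S[of n] SF[THEN sobolev_iff_energy] by (auto simp: simple_field_def)
  next
    show "AE \<omega> in M. dist_of (G \<omega>) \<in> sobolev s \<and> (\<lambda>n. sobolev_norm s (dist_of (S n \<omega>) - dist_of (G \<omega>))) \<longlonglongrightarrow> 0"
      using lim AE_fin[OF E(1)] AE_fin[OF E(2)] AE_space
    proof eventually_elim
      case (elim \<omega>)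
      have GF: "has_fourier (dist_of (G \<omega>)) (G \<omega>)"
        using elim joint_field_section[OF G] by (intro has_fourier_dist_of) (auto simp: square_integrable_iff less_top)
      have "(\<lambda>n. ennreal ((sobolev_norm s (dist_of (S n \<omega>) - dist_of (G \<omega>)))\<^sup>2)) \<longlonglongrightarrow> 0"
      proof (rule tendsto_sandwich[OF _ _ tendsto_const elim(1)])
        show "\<forall>\<^sub>F n in sequentially. ennreal ((sobolev_norm s (dist_of (S n \<omega>) - dist_of (G \<omega>)))\<^sup>2) \<le> e n \<omega>"
          unfolding e_def by (intro always_eventually allI sobolev_norm_le_energy has_fourier_diff SF[OF elim(4)] GF)
      qed auto
      then have "(\<lambda>n. (sobolev_norm s (dist_of (S n \<omega>) - dist_of (G \<omega>)))\<^sup>2) \<longlonglongrightarrow> 0"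
        by (simp add: ennreal_tendsto_0_iff)
      from tendsto_real_sqrt[OF this] have "(\<lambda>n. sobolev_norm s (dist_of (S n \<omega>) - dist_of (G \<omega>))) \<longlonglongrightarrow> 0"
        by (simp add: tendsto_rabs_zero_iff)
      moreover have "dist_of (G \<omega>) \<in> sobolev s"
        using elim(2) by (simp add: sobolev_iff_energy[OF GF] less_top)
      ultimately show ?case by simp
    qed
  qed
qed

lemma L2_sobolev_field:
  fixes G :: "'a \<Rightarrow> real \<Rightarrow> complex"
  assumes G [measurable]: "joint_field M G" and E: "field_energy M s G < \<infinity>" "field_energy M 0 G < \<infinity>"
    and M: "finite_measure M"
  shows "(\<lambda>\<omega>. dist_of (G \<omega>)) \<in> L2_sobolev M s"
    and "AE \<omega> in M. has_fourier (dist_of (G \<omega>)) (G \<omega>)"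
proof -
  have "AE \<omega> in M. weighted_energy 0 (G \<omega>) \<noteq> \<infinity>"
    using E(2) unfolding field_energy_iterated[OF G] by (intro nn_integral_noteq_infinite) auto
  then show F: "AE \<omega> in M. has_fourier (dist_of (G \<omega>)) (G \<omega>)"
    using AE_space
  proof eventually_elim
    case (elim \<omega>)
    then show ?case
      using joint_field_section[OF G] by (intro has_fourier_dist_of) (auto simp: square_integrable_iff less_top)
  qed
  then have "(\<integral>\<^sup>+\<omega>. ennreal ((sobolev_norm s (dist_of (G \<omega>)))\<^sup>2) \<partial>M) \<le> field_energy M s G"
    unfolding field_energy_iterated[OF G] by (intro nn_integral_mono_AE) (auto elim!: eventually_mono intro: sobolev_norm_le_energy)
  also note E(1)
  finally show "(\<lambda>\<omega>. dist_of (G \<omega>)) \<in> L2_sobolev M s"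
    using strongly_measurable_field[OF G E M] by (simp add: L2_sobolev_def)
qed

section \<open>Well-posedness\<close>

lemma joint_field_diff:
  assumes [measurable]: "joint_field M G" "joint_field M H"
  shows "joint_field M (\<lambda>\<omega> \<xi>. G \<omega> \<xi> - H \<omega> \<xi>)"
  by measurable

text \<open>The order with the frequency outside, which is the one that accepts moment bounds given
  mode by mode; \<open>field_energy_iterated\<close> has chance outside.\<close>

lemma field_energy_swap:
  assumes M: "sigma_finite_measure M" and [measurable]: "joint_field M G"
  shows "field_energy M s G = (\<integral>\<^sup>+\<xi>. ennreal (mode_weight s \<xi>) * (\<integral>\<^sup>+\<omega>. ennreal ((cmod (G \<omega> \<xi>))\<^sup>2) \<partial>M) \<partial>lborel)"
proof -
  interpret M: sigma_finite_measure M by (rule M)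
  interpret P: pair_sigma_finite M "lborel :: real measure" ..
  have "(\<lambda>(\<omega>, \<xi>). ennreal (mode_weight s \<xi> * (cmod (G \<omega> \<xi>))\<^sup>2)) \<in> borel_measurable (M \<Otimes>\<^sub>M lborel)"
    unfolding case_prod_beta' by measurable
  from P.nn_integral_snd[OF this]
  have "field_energy M s G = (\<integral>\<^sup>+\<xi>. (\<integral>\<^sup>+\<omega>. ennreal (mode_weight s \<xi> * (cmod (G \<omega> \<xi>))\<^sup>2) \<partial>M) \<partial>lborel)"
    by (simp add: field_energy_def case_prod_beta')
  also have "\<dots> = (\<integral>\<^sup>+\<xi>. ennreal (mode_weight s \<xi>) * (\<integral>\<^sup>+\<omega>. ennreal ((cmod (G \<omega> \<xi>))\<^sup>2) \<partial>M) \<partial>lborel)"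
  proof (rule nn_integral_cong)
    fix \<xi> :: real
    have [measurable]: "(\<lambda>\<omega>. G \<omega> \<xi>) \<in> borel_measurable M"
      using measurable_compose[OF measurable_Pair2'[of \<xi> lborel M] assms(2)] by simp
    show "(\<integral>\<^sup>+\<omega>. ennreal (mode_weight s \<xi> * (cmod (G \<omega> \<xi>))\<^sup>2) \<partial>M) = ennreal (mode_weight s \<xi>) * (\<integral>\<^sup>+\<omega>. ennreal ((cmod (G \<omega> \<xi>))\<^sup>2) \<partial>M)"
      by (simp add: ennreal_mult nn_integral_cmult)
  qed
  finally show ?thesis .
qed

lemma weighted_energy_mono:
  assumes "p \<le> q"
  shows "weighted_energy p g \<le> weighted_energy q g"
  unfolding weighted_energy_def using assms
  by (intro nn_integral_mono ennreal_leI mult_right_mono powr_mono) auto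

text \<open>One representative, chosen at order 0, serves all orders, since membership in any
  Sobolev space can be decided by any representative; negative orders follow by
  monotonicity.\<close>

lemma sobolev_inf_fourier:
  assumes "\<phi> \<in> sobolev_inf"
  obtains a where "has_fourier \<phi> a" "\<And>p. weighted_energy p a < \<infinity>"
proof -
  have S: "\<phi> \<in> sobolev k" if "0 \<le> k" for k
    using assms that by (auto simp: sobolev_inf_def)
  obtain a where a: "has_fourier \<phi> a"
    using S[of 0] by (auto simp: sobolev_def)
  have "weighted_energy p a < \<infinity>" for p
  proof -
    have "weighted_energy p a \<le> weighted_energy (max p 0) a"
      by (intro weighted_energy_mono) simp
    also have "\<dots> < \<infinity>"
      using sobolev_iff_energy[OF a, of "max p 0"] S[of "max p 0"] by simp
    finally show ?thesis .
  qed
  with a show ?thesis by (rule that)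
qed

lemma L2_sobolev_AE: "X \<in> L2_sobolev M s \<Longrightarrow> AE \<omega> in M. X \<omega> \<in> sobolev s"
  unfolding L2_sobolev_def strongly_measurable_def by (auto elim!: eventually_mono)

section \<open>The field of all modes as a process in the Sobolev spaces\<close>

context brownian_motion
begin

definition mode_field :: "real \<Rightarrow> (real \<Rightarrow> complex) \<Rightarrow> (real \<Rightarrow> complex) \<Rightarrow> bool \<Rightarrow> real \<Rightarrow> 'a \<Rightarrow> real \<Rightarrow> complex" where
  "mode_field \<sigma> a b c t \<omega> \<xi> = (if c then mode_u \<sigma> \<xi> (a \<xi>) (b \<xi>) t \<omega> else mode_lin \<sigma> \<xi> (a \<xi>) (b \<xi>) False t \<omega>)"

lemma cmod_mode_field: "cmod (mode_field \<sigma> a b c t \<omega> \<xi>) = cmod (mode_lin \<sigma> \<xi> (a \<xi>) (b \<xi>) c t \<omega>)"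
  by (simp add: mode_field_def cmod_mode_u)

lemma mode_field_joint:
  assumes "a \<in> borel_measurable borel" "b \<in> borel_measurable borel"
  shows "(\<lambda>(t, \<omega>, \<xi>). mode_field \<sigma> a b c t \<omega> \<xi>) \<in> borel_measurable (borel \<Otimes>\<^sub>M (M \<Otimes>\<^sub>M borel))"
proof -
  note [measurable] = mode_lin_joint[OF assms, of \<sigma>, unfolded case_prod_beta']
  have "(\<lambda>p. (fst p, fst (snd p))) \<in> borel \<Otimes>\<^sub>M (M \<Otimes>\<^sub>M borel) \<rightarrow>\<^sub>M borel \<Otimes>\<^sub>M M"
    by measurable
  from measurable_compose[OF this W_joint]
  have [measurable]: "(\<lambda>p. W (fst p) (fst (snd p))) \<in> borel_measurable (borel \<Otimes>\<^sub>M (M \<Otimes>\<^sub>M (borel :: real measure)))"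
    by simp
  show ?thesis
    unfolding mode_field_def mode_u_def case_prod_beta' by (cases c) (simp_all, measurable)
qed

lemma mode_field_adapted:
  assumes t: "0 \<le> t" and ab: "a \<in> borel_measurable borel" "b \<in> borel_measurable borel"
  shows "joint_field (F t) (mode_field \<sigma> a b c t)"
proof -
  note [measurable] = mode_lin_adapted_joint[OF t ab, of \<sigma>, unfolded case_prod_beta'] W_adapted[OF t]
  show ?thesis
    unfolding joint_field_iff mode_field_def mode_u_def case_prod_beta' by (cases c) (simp_all, measurable)
qed

lemma mode_field_joint_field:
  assumes "0 \<le> t" and "a \<in> borel_measurable borel" "b \<in> borel_measurable borel"
  shows "joint_field M (mode_field \<sigma> a b c t)"
  using measurable_compose[OF measurable_Pair1'[of t borel] mode_field_joint[OF assms(2,3)]]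
  unfolding joint_field_iff by (simp add: case_prod_beta')

lemma mode_field_continuous: "AE \<omega> in M. continuous_on {0..T} (\<lambda>t. mode_field \<sigma> a b c t \<omega> \<xi>)"
proof (cases c)
  case True
  then show ?thesis
    using mode_u_continuous[of T \<sigma> \<xi> "a \<xi>" "b \<xi>"] by (simp add: mode_field_def)
next
  case False
  then show ?thesis
    using mode_lin_continuous by (intro AE_I2) (simp add: mode_field_def)
qed

lemma mode_field_moment:
  assumes "0 < \<sigma>" "0 < T"
  obtains C where "0 \<le> C" "\<And>a b c t \<xi>. t \<in> {0..T} \<Longrightarrow>
    (\<integral>\<^sup>+\<omega>. ennreal ((cmod (mode_field \<sigma> a b c t \<omega> \<xi>))\<^sup>2) \<partial>M) \<le> ennreal (C * (1 + \<xi>\<^sup>2) * ((cmod (a \<xi>))\<^sup>2 + (cmod (b \<xi>))\<^sup>2))"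
proof -
  obtain C where C: "0 \<le> C" "\<And>\<xi> a b c t. t \<in> {0..T} \<Longrightarrow>
      (LINT \<omega>|M. (cmod (mode_lin \<sigma> \<xi> a b c t \<omega>))\<^sup>2) \<le> C * (1 + \<xi>\<^sup>2) * ((cmod a)\<^sup>2 + (cmod b)\<^sup>2)"
    by (rule mode_moment[OF assms]) (rule that)
  show ?thesis
  proof (rule that[OF C(1)])
    fix a b :: "real \<Rightarrow> complex" and c t \<xi> assume t: "t \<in> {0..T}"
    let ?K = "(cmod (a \<xi>) + cmod (b \<xi>)) * exp ((1 + \<bar>\<xi>\<bar>) * T)"
    have [measurable]: "mode_lin \<sigma> \<xi> (a \<xi>) (b \<xi>) c t \<in> borel_measurable M"
      using adapted_measurable[OF mode_lin_adapted] t by auto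
    have "integrable M (\<lambda>\<omega>. (cmod (mode_lin \<sigma> \<xi> (a \<xi>) (b \<xi>) c t \<omega>))\<^sup>2)"
    proof (rule integrable_const_bound[where B = "?K\<^sup>2"])
      show "AE \<omega> in M. norm ((cmod (mode_lin \<sigma> \<xi> (a \<xi>) (b \<xi>) c t \<omega>))\<^sup>2) \<le> ?K\<^sup>2"
        using mode_lin_bound t by (intro AE_I2) (simp add: power_mono)
    qed measurable
    then have "(\<integral>\<^sup>+\<omega>. ennreal ((cmod (mode_field \<sigma> a b c t \<omega> \<xi>))\<^sup>2) \<partial>M) = ennreal (LINT \<omega>|M. (cmod (mode_lin \<sigma> \<xi> (a \<xi>) (b \<xi>) c t \<omega>))\<^sup>2)"
      unfolding cmod_mode_field by (intro nn_integral_eq_integral) auto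
    also have "\<dots> \<le> ennreal (C * (1 + \<xi>\<^sup>2) * ((cmod (a \<xi>))\<^sup>2 + (cmod (b \<xi>))\<^sup>2))"
      by (intro ennreal_leI C t)
    finally show "(\<integral>\<^sup>+\<omega>. ennreal ((cmod (mode_field \<sigma> a b c t \<omega> \<xi>))\<^sup>2) \<partial>M) \<le> ennreal (C * (1 + \<xi>\<^sup>2) * ((cmod (a \<xi>))\<^sup>2 + (cmod (b \<xi>))\<^sup>2))" .
  qed
qed

text \<open>The factor 1 + \<xi>^2 in the moment bound raises the index from s to s + 1. This loss
  of one derivative is absorbed because the data lie in every Sobolev space.\<close>

lemma weighted_moment_integral:
  fixes a b :: "real \<Rightarrow> complex"
  assumes [measurable]: "a \<in> borel_measurable borel" "b \<in> borel_measurable borel" and C: "0 \<le> C"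
  shows "(\<integral>\<^sup>+\<xi>. ennreal (mode_weight s \<xi>) * ennreal (C * (1 + \<xi>\<^sup>2) * ((cmod (a \<xi>))\<^sup>2 + (cmod (b \<xi>))\<^sup>2)) \<partial>lborel)
    = ennreal C * (weighted_energy (s + 1) a + weighted_energy (s + 1) b)"
proof -
  have "ennreal (mode_weight s \<xi>) * ennreal (C * (1 + \<xi>\<^sup>2) * ((cmod (a \<xi>))\<^sup>2 + (cmod (b \<xi>))\<^sup>2))
      = ennreal C * (ennreal (mode_weight (s + 1) \<xi> * (cmod (a \<xi>))\<^sup>2) + ennreal (mode_weight (s + 1) \<xi> * (cmod (b \<xi>))\<^sup>2))" for \<xi>
  proof -
    have p: "mode_weight (s + 1) \<xi> = mode_weight s \<xi> * (1 + \<xi>\<^sup>2)"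
      by (simp add: powr_add)
    have "ennreal (mode_weight s \<xi>) * ennreal (C * (1 + \<xi>\<^sup>2) * ((cmod (a \<xi>))\<^sup>2 + (cmod (b \<xi>))\<^sup>2))
        = ennreal (C * (mode_weight (s + 1) \<xi> * (cmod (a \<xi>))\<^sup>2 + mode_weight (s + 1) \<xi> * (cmod (b \<xi>))\<^sup>2))"
      using C unfolding p by (subst ennreal_mult[symmetric]) (auto simp: algebra_simps)
    then show ?thesis
      using C by (simp add: ennreal_mult ennreal_plus)
  qed
  then show ?thesis
    unfolding weighted_energy_def by (simp add: nn_integral_cmult nn_integral_add)
qed

lemma mode_field_energy_finite:
  assumes \<sigma>: "0 < \<sigma>" and T: "0 < T" and ab: "a \<in> borel_measurable borel" "b \<in> borel_measurable borel"
    and fin: "\<And>p. weighted_energy p a < \<infinity>" "\<And>p. weighted_energy p b < \<infinity>" and t: "t \<in> {0..T}"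
  shows "field_energy M s (mode_field \<sigma> a b c t) < \<infinity>"
proof -
  obtain C where C: "0 \<le> C" "\<And>a b c t \<xi>. t \<in> {0..T} \<Longrightarrow>
    (\<integral>\<^sup>+\<omega>. ennreal ((cmod (mode_field \<sigma> a b c t \<omega> \<xi>))\<^sup>2) \<partial>M) \<le> ennreal (C * (1 + \<xi>\<^sup>2) * ((cmod (a \<xi>))\<^sup>2 + (cmod (b \<xi>))\<^sup>2))"
    using mode_field_moment[OF \<sigma> T] by blast
  have "field_energy M s (mode_field \<sigma> a b c t) \<le> ennreal C * (weighted_energy (s + 1) a + weighted_energy (s + 1) b)"
    unfolding weighted_moment_integral[OF ab C(1), symmetric]
    using t by (subst field_energy_swap[OF sigma_finite_measure_axioms mode_field_joint_field[OF _ ab]])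
      (auto intro!: nn_integral_mono mult_left_mono C(2))
  also have "\<dots> < \<infinity>"
    using fin by (simp add: ennreal_mult_less_top)
  finally show ?thesis .
qed

text \<open>Dominated convergence at two levels. At fixed \<xi>, convergence in chance follows from
  continuous paths and the pathwise bound, whose exponential growth in \<xi> is harmless there. For
  the integral over \<xi> that bound would be useless, and the polynomial moment bound serves as
  majorant.\<close>

lemma mode_field_energy_continuous:
  assumes \<sigma>: "0 < \<sigma>" and T: "0 < T" and ab: "a \<in> borel_measurable borel" "b \<in> borel_measurable borel"
    and fin: "\<And>p. weighted_energy p a < \<infinity>" "\<And>p. weighted_energy p b < \<infinity>" and r: "r \<in> {0..T}"
  shows "((\<lambda>t. field_energy M s (\<lambda>\<omega> \<xi>. mode_field \<sigma> a b c t \<omega> \<xi> - mode_field \<sigma> a b c r \<omega> \<xi>)) \<longlongrightarrow> 0) (at r within {0..T})"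
  unfolding tendsto_at_iff_sequentially o_def
proof (intro allI impI)
  fix X :: "nat \<Rightarrow> real" assume "\<forall>i. X i \<in> {0..T} - {r}" and lim: "X \<longlonglongrightarrow> r"
  then have X: "X n \<in> {0..T}" for n by blast
  let ?G = "mode_field \<sigma> a b c"
  obtain C where C: "0 \<le> C" "\<And>a b c t \<xi>. t \<in> {0..T} \<Longrightarrow>
    (\<integral>\<^sup>+\<omega>. ennreal ((cmod (mode_field \<sigma> a b c t \<omega> \<xi>))\<^sup>2) \<partial>M) \<le> ennreal (C * (1 + \<xi>\<^sup>2) * ((cmod (a \<xi>))\<^sup>2 + (cmod (b \<xi>))\<^sup>2))"
    using mode_field_moment[OF \<sigma> T] by blast
  have jG [measurable]: "joint_field M (?G t)" if "t \<in> {0..T}" for t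
    using that by (intro mode_field_joint_field ab) auto
  have sG: "(\<lambda>\<omega>. ?G t \<omega> \<xi>) \<in> borel_measurable M" if "t \<in> {0..T}" for t \<xi>
    using measurable_compose[OF measurable_Pair2'[of \<xi> lborel M] jG[OF that]] by simp
  have sX: "(\<lambda>\<omega>. ?G (X n) \<omega> \<xi>) \<in> borel_measurable M" and sr: "(\<lambda>\<omega>. ?G r \<omega> \<xi>) \<in> borel_measurable M" for n \<xi>
    by (rule sG[OF X]) (rule sG[OF r])
  note jX = joint_field_diff[OF jG[OF X] jG[OF r]]
  define h where "h n \<xi> = (\<integral>\<^sup>+\<omega>. ennreal ((cmod (?G (X n) \<omega> \<xi> - ?G r \<omega> \<xi>))\<^sup>2) \<partial>M)" for n \<xi>
  let ?b = "\<lambda>\<xi>. ennreal (C * (1 + \<xi>\<^sup>2) * ((cmod (a \<xi>))\<^sup>2 + (cmod (b \<xi>))\<^sup>2))"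
  have h_le: "h n \<xi> \<le> 4 * ?b \<xi>" for n \<xi>
  proof -
    note [measurable] = sX sr
    have "h n \<xi> \<le> (\<integral>\<^sup>+\<omega>. 2 * ennreal ((cmod (?G (X n) \<omega> \<xi>))\<^sup>2) + 2 * ennreal ((cmod (?G r \<omega> \<xi>))\<^sup>2) \<partial>M)"
      unfolding h_def by (intro nn_integral_mono) (simp add: cmod_diff_square ennreal_leI flip: ennreal_numeral ennreal_mult ennreal_plus)
    also have "\<dots> = 2 * (\<integral>\<^sup>+\<omega>. ennreal ((cmod (?G (X n) \<omega> \<xi>))\<^sup>2) \<partial>M) + 2 * (\<integral>\<^sup>+\<omega>. ennreal ((cmod (?G r \<omega> \<xi>))\<^sup>2) \<partial>M)"
      by (simp add: nn_integral_add nn_integral_cmult)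
    also have "\<dots> \<le> 2 * ?b \<xi> + 2 * ?b \<xi>"
      by (intro add_mono mult_left_mono C(2) X r) auto
    finally show ?thesis
      by (simp add: mult_2[symmetric] mult.assoc[symmetric])
  qed
  have h_lim: "(\<lambda>n. h n \<xi>) \<longlonglongrightarrow> 0" for \<xi>
  proof -
    let ?K = "(cmod (a \<xi>) + cmod (b \<xi>)) * exp ((1 + \<bar>\<xi>\<bar>) * T)"
    note [measurable] = sX sr
    have "(\<lambda>n. h n \<xi>) \<longlonglongrightarrow> (\<integral>\<^sup>+\<omega>. 0 \<partial>M)"
      unfolding h_def
    proof (rule nn_integral_dominated_convergence[where w = "\<lambda>_. ennreal (4 * ?K\<^sup>2)"])
      show "AE \<omega> in M. ennreal ((cmod (?G (X n) \<omega> \<xi> - ?G r \<omega> \<xi>))\<^sup>2) \<le> ennreal (4 * ?K\<^sup>2)" for n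
      proof (intro AE_I2 ennreal_leI)
        fix \<omega> assume \<omega>: "\<omega> \<in> space M"
        have "(cmod (?G (X n) \<omega> \<xi> - ?G r \<omega> \<xi>))\<^sup>2 \<le> 2 * ?K\<^sup>2 + 2 * ?K\<^sup>2"
          by (rule order_trans[OF cmod_diff_square])
            (intro add_mono mult_left_mono power_mono; simp add: cmod_mode_field mode_lin_bound[OF \<omega> X] mode_lin_bound[OF \<omega> r])
        then show "(cmod (?G (X n) \<omega> \<xi> - ?G r \<omega> \<xi>))\<^sup>2 \<le> 4 * ?K\<^sup>2" by simp
      qed
      show "AE \<omega> in M. (\<lambda>n. ennreal ((cmod (?G (X n) \<omega> \<xi> - ?G r \<omega> \<xi>))\<^sup>2)) \<longlonglongrightarrow> 0"
        using mode_field_continuous[of T \<sigma> a b c \<xi>]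
      proof eventually_elim
        case (elim \<omega>)
        have "(\<lambda>n. ?G (X n) \<omega> \<xi>) \<longlonglongrightarrow> ?G r \<omega> \<xi>"
          using continuous_on_tendsto_compose[OF elim lim r] X by simp
        from tendsto_diff[OF this tendsto_const[of "?G r \<omega> \<xi>"]]
        have "(\<lambda>n. ?G (X n) \<omega> \<xi> - ?G r \<omega> \<xi>) \<longlonglongrightarrow> 0" by simp
        from tendsto_ennrealI[OF tendsto_power[OF tendsto_norm[OF this], of 2]] show ?case
          by simp
      qed
    qed (simp_all add: ennreal_mult_less_top emeasure_space_1, measurable)
    then show ?thesis by simp
  qed
  have hm: "h n \<in> borel_measurable lborel" for n
  proof -
    interpret P: pair_sigma_finite M "lborel :: real measure" ..
    have "(\<lambda>z. ennreal ((cmod (?G (X n) (fst z) (snd z) - ?G r (fst z) (snd z)))\<^sup>2)) \<in> borel_measurable (M \<Otimes>\<^sub>M lborel)"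
      using jX[of n] by measurable
    from borel_measurable_nn_integral_fst[OF measurable_pair_swap[OF this]] show ?thesis
      by (simp add: h_def[abs_def])
  qed
  note [measurable] = hm ab
  have "(\<lambda>n. \<integral>\<^sup>+\<xi>. ennreal (mode_weight s \<xi>) * h n \<xi> \<partial>lborel) \<longlonglongrightarrow> (\<integral>\<^sup>+\<xi>. 0 \<partial>(lborel :: real measure))"
  proof (rule nn_integral_dominated_convergence[where w = "\<lambda>\<xi>. 4 * (ennreal (mode_weight s \<xi>) * ?b \<xi>)"])
    have "(\<integral>\<^sup>+\<xi>. 4 * (ennreal (mode_weight s \<xi>) * ?b \<xi>) \<partial>lborel) = 4 * (ennreal C * (weighted_energy (s + 1) a + weighted_energy (s + 1) b))"
      unfolding weighted_moment_integral[OF ab C(1), symmetric] by (rule nn_integral_cmult) measurable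
    also have "\<dots> < \<infinity>"
      using fin by (simp add: ennreal_mult_less_top)
    finally show "(\<integral>\<^sup>+\<xi>. 4 * (ennreal (mode_weight s \<xi>) * ?b \<xi>) \<partial>lborel) < \<infinity>" .
    show "AE \<xi> in lborel. ennreal (mode_weight s \<xi>) * h n \<xi> \<le> 4 * (ennreal (mode_weight s \<xi>) * ?b \<xi>)" for n
    proof (rule AE_I2)
      fix \<xi> :: real
      have "ennreal (mode_weight s \<xi>) * h n \<xi> \<le> ennreal (mode_weight s \<xi>) * (4 * ?b \<xi>)"
        by (rule mult_left_mono[OF h_le]) simp
      then show "ennreal (mode_weight s \<xi>) * h n \<xi> \<le> 4 * (ennreal (mode_weight s \<xi>) * ?b \<xi>)"
        by (simp only: mult.left_commute)
    qed
    show "AE \<xi> in lborel. (\<lambda>n. ennreal (mode_weight s \<xi>) * h n \<xi>) \<longlonglongrightarrow> 0"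
      using ennreal_tendsto_cmult[OF _ h_lim] by (intro AE_I2) fastforce
  qed measurable
  then show "(\<lambda>n. field_energy M s (\<lambda>\<omega> \<xi>. ?G (X n) \<omega> \<xi> - ?G r \<omega> \<xi>)) \<longlonglongrightarrow> 0"
    by (simp add: field_energy_swap[OF sigma_finite_measure_axioms jX] h_def)
qed

lemma mode_field_continuous_L2:
  assumes \<sigma>: "0 < \<sigma>" and T: "0 < T" and ab: "a \<in> borel_measurable borel" "b \<in> borel_measurable borel"
    and fin: "\<And>p. weighted_energy p a < \<infinity>" "\<And>p. weighted_energy p b < \<infinity>"
  shows "continuous_L2_sobolev M T s (\<lambda>t \<omega>. dist_of (mode_field \<sigma> a b c t \<omega>))"
    and "t \<in> {0..T} \<Longrightarrow> AE \<omega> in M. has_fourier (dist_of (mode_field \<sigma> a b c t \<omega>)) (mode_field \<sigma> a b c t \<omega>)"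
proof -
  let ?G = "mode_field \<sigma> a b c"
  have jG: "joint_field M (?G t)" if "t \<in> {0..T}" for t
    using that by (intro mode_field_joint_field ab) auto
  note L2 = L2_sobolev_field[OF jG mode_field_energy_finite[OF \<sigma> T ab fin] mode_field_energy_finite[OF \<sigma> T ab fin] finite_measure_axioms]
  show F: "AE \<omega> in M. has_fourier (dist_of (?G t \<omega>)) (?G t \<omega>)" if "t \<in> {0..T}" for t
    using L2(2) that by blast
  show "continuous_L2_sobolev M T s (\<lambda>t \<omega>. dist_of (?G t \<omega>))"
    unfolding continuous_L2_sobolev_def
  proof (intro conjI ballI)
    show "(\<lambda>\<omega>. dist_of (?G t \<omega>)) \<in> L2_sobolev M s" if "t \<in> {0..T}" for t
      using L2(1) that by blast
    fix r assume r: "r \<in> {0..T}"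
    have le: "(\<integral>\<^sup>+\<omega>. ennreal ((sobolev_norm s (dist_of (?G t \<omega>) - dist_of (?G r \<omega>)))\<^sup>2) \<partial>M)
        \<le> field_energy M s (\<lambda>\<omega> \<xi>. ?G t \<omega> \<xi> - ?G r \<omega> \<xi>)" if t: "t \<in> {0..T}" for t
      unfolding field_energy_iterated[OF joint_field_diff[OF jG[OF t] jG[OF r]]]
    proof (rule nn_integral_mono_AE)
      show "AE \<omega> in M. ennreal ((sobolev_norm s (dist_of (?G t \<omega>) - dist_of (?G r \<omega>)))\<^sup>2) \<le> weighted_energy s (\<lambda>\<xi>. ?G t \<omega> \<xi> - ?G r \<omega> \<xi>)"
        using F[OF t] F[OF r] by eventually_elim (intro sobolev_norm_le_energy has_fourier_diff)
    qed
    show "((\<lambda>t. \<integral>\<^sup>+\<omega>. ennreal ((sobolev_norm s (dist_of (?G t \<omega>) - dist_of (?G r \<omega>)))\<^sup>2) \<partial>M) \<longlongrightarrow> 0) (at r within {0..T})"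
    proof (rule tendsto_sandwich[OF _ _ tendsto_const mode_field_energy_continuous[OF \<sigma> T ab fin r]])
      show "\<forall>\<^sub>F t in at r within {0..T}. (\<integral>\<^sup>+\<omega>. ennreal ((sobolev_norm s (dist_of (?G t \<omega>) - dist_of (?G r \<omega>)))\<^sup>2) \<partial>M)
          \<le> field_energy M s (\<lambda>\<omega> \<xi>. ?G t \<omega> \<xi> - ?G r \<omega> \<xi>)"
        using le by (auto simp: eventually_at_filter)
    qed auto
  qed
qed

lemma cauchy_solution_exists:
  assumes \<sigma>: "0 < \<sigma>" and T: "0 < T" and a: "has_fourier \<phi>0 a0" and b: "has_fourier \<phi>1 b0"
    and fin: "\<And>p. weighted_energy p a0 < \<infinity>" "\<And>p. weighted_energy p b0 < \<infinity>"
  shows "cauchy_solution M F B \<sigma> T \<phi>0 \<phi>1 (\<lambda>t \<omega>. dist_of (mode_field \<sigma> a0 b0 True t \<omega>)) (\<lambda>t \<omega>. dist_of (mode_field \<sigma> a0 b0 False t \<omega>))"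
  unfolding cauchy_solution_def
proof (intro conjI)
  have ab: "a0 \<in> borel_measurable borel" "b0 \<in> borel_measurable borel"
    using a b by (auto simp: has_fourier_def)
  have ad: "adapted_process F T (\<lambda>t \<omega>. dist_of (mode_field \<sigma> a0 b0 c t \<omega>))" for c
    unfolding adapted_process_def using mode_field_adapted[OF _ ab] by (auto intro!: pairing_dist_of_measurable)
  show "adapted_process F T (\<lambda>t \<omega>. dist_of (mode_field \<sigma> a0 b0 True t \<omega>))" "adapted_process F T (\<lambda>t \<omega>. dist_of (mode_field \<sigma> a0 b0 False t \<omega>))"
    by (rule ad)+
  have J: "(\<lambda>(t, \<omega>, \<xi>). mode_field \<sigma> a0 b0 c t \<omega> \<xi>) \<in> borel_measurable (restrict_space borel {0..T} \<Otimes>\<^sub>M M \<Otimes>\<^sub>M borel)" for c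
    by (rule measurable_restrict_fst[OF mode_field_joint[OF ab]])
  have S: "mode_solution M F B \<sigma> T \<xi> (a0 \<xi>) (b0 \<xi>) (\<lambda>t \<omega>. mode_field \<sigma> a0 b0 True t \<omega> \<xi>) (\<lambda>t \<omega>. mode_field \<sigma> a0 b0 False t \<omega> \<xi>)" for \<xi>
    using mode_solution_exists[OF T] by (simp add: mode_field_def)
  show "\<exists>(u :: real \<Rightarrow> 'a \<Rightarrow> real \<Rightarrow> complex) (v :: real \<Rightarrow> 'a \<Rightarrow> real \<Rightarrow> complex) a b. has_fourier \<phi>0 a \<and> has_fourier \<phi>1 b \<and>
      (\<lambda>(t, \<omega>, \<xi>). u t \<omega> \<xi>) \<in> borel_measurable (restrict_space borel {0..T} \<Otimes>\<^sub>M M \<Otimes>\<^sub>M borel) \<and>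
      (\<lambda>(t, \<omega>, \<xi>). v t \<omega> \<xi>) \<in> borel_measurable (restrict_space borel {0..T} \<Otimes>\<^sub>M M \<Otimes>\<^sub>M borel) \<and>
      (AE \<xi> in lborel. mode_solution M F B \<sigma> T \<xi> (a \<xi>) (b \<xi>) (\<lambda>t \<omega>. u t \<omega> \<xi>) (\<lambda>t \<omega>. v t \<omega> \<xi>)) \<and>
      (\<forall>t\<in>{0..T}. AE \<omega> in M. has_fourier (dist_of (mode_field \<sigma> a0 b0 True t \<omega>)) (u t \<omega>) \<and> has_fourier (dist_of (mode_field \<sigma> a0 b0 False t \<omega>)) (v t \<omega>))"
    by (rule exI[of _ "mode_field \<sigma> a0 b0 True"], rule exI[of _ "mode_field \<sigma> a0 b0 False"], rule exI[of _ a0], rule exI[of _ b0])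
      (use a b J S mode_field_continuous_L2(2)[OF \<sigma> T ab fin] in auto)
qed

section \<open>Uniqueness of the solution process\<close>

lemma time_slice_joint_field:
  fixes u :: "real \<Rightarrow> 'a \<Rightarrow> real \<Rightarrow> complex"
  assumes u: "(\<lambda>(t, \<omega>, \<xi>). u t \<omega> \<xi>) \<in> borel_measurable (restrict_space borel {0..T} \<Otimes>\<^sub>M M \<Otimes>\<^sub>M borel)" and t: "t \<in> {0..T}"
  shows "joint_field M (u t)"
proof -
  have "t \<in> space (restrict_space borel {0..T})"
    using t by (simp add: space_restrict_space)
  from measurable_compose[OF measurable_Pair1'[OF this] u] show ?thesis
    unfolding joint_field_iff by (simp add: case_prod_beta')
qed

lemma sobolev_energy_AE:
  assumes "AE \<omega> in M. has_fourier (X \<omega>) (G \<omega>)" and "AE \<omega> in M. X \<omega> \<in> sobolev s" and G: "joint_field M G"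
  shows "field_energy M s G = (\<integral>\<^sup>+\<omega>. ennreal ((sobolev_norm s (X \<omega>))\<^sup>2) \<partial>M)"
  unfolding field_energy_iterated[OF G] using assms(1,2)
  by (intro nn_integral_cong_AE, eventually_elim) (simp add: sobolev_norm_energy)

text \<open>Continuity in mean square bounds the energy near each time, and bisection of [0, T]
  makes the bound global. Uniformity in t is what permits integrating the energy over time
  afterwards.\<close>

lemma energy_bounded:
  fixes U :: "real \<Rightarrow> 'a \<Rightarrow> tempered" and u :: "real \<Rightarrow> 'a \<Rightarrow> real \<Rightarrow> complex"
  assumes u: "(\<lambda>(t, \<omega>, \<xi>). u t \<omega> \<xi>) \<in> borel_measurable (restrict_space borel {0..T} \<Otimes>\<^sub>M M \<Otimes>\<^sub>M borel)"
    and U: "\<And>t. t \<in> {0..T} \<Longrightarrow> AE \<omega> in M. has_fourier (U t \<omega>) (u t \<omega>)"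
    and L2: "continuous_L2_sobolev M T s U" and T: "0 \<le> T"
  obtains K :: real where "\<And>t. t \<in> {0..T} \<Longrightarrow> field_energy M s (u t) \<le> ennreal K"
proof -
  note ju = time_slice_joint_field[OF u]
  have S: "AE \<omega> in M. U t \<omega> \<in> sobolev s" if "t \<in> {0..T}" for t
    using L2 that by (intro L2_sobolev_AE) (auto simp: continuous_L2_sobolev_def)
  have fin: "field_energy M s (u t) < \<infinity>" if t: "t \<in> {0..T}" for t
    using L2 t unfolding sobolev_energy_AE[OF U[OF t] S[OF t] ju[OF t]] by (auto simp: continuous_L2_sobolev_def L2_sobolev_def)
  have diff: "field_energy M s (\<lambda>\<omega> \<xi>. u t \<omega> \<xi> - u r \<omega> \<xi>) = (\<integral>\<^sup>+\<omega>. ennreal ((sobolev_norm s (U t \<omega> - U r \<omega>))\<^sup>2) \<partial>M)"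
    if t: "t \<in> {0..T}" and r: "r \<in> {0..T}" for t r
  proof (rule sobolev_energy_AE)
    show "AE \<omega> in M. has_fourier (U t \<omega> - U r \<omega>) (\<lambda>\<xi>. u t \<omega> \<xi> - u r \<omega> \<xi>)"
      using U[OF t] U[OF r] by eventually_elim (rule has_fourier_diff)
    show "AE \<omega> in M. U t \<omega> - U r \<omega> \<in> sobolev s"
      using U[OF t] U[OF r] S[OF t] S[OF r]
    proof eventually_elim
      case (elim \<omega>)
      have "weighted_energy s (\<lambda>\<xi>. u t \<omega> \<xi> + - u r \<omega> \<xi>) \<le> 2 * weighted_energy s (u t \<omega>) + 2 * weighted_energy s (\<lambda>\<xi>. - u r \<omega> \<xi>)"
        using has_fourierD(1)[OF elim(1)] has_fourierD(1)[OF elim(2)] by (intro weighted_energy_add) auto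
      also have "\<dots> < \<infinity>"
        using elim(3,4) sobolev_iff_energy[OF elim(1)] sobolev_iff_energy[OF elim(2)]
        by (simp add: weighted_energy_minus ennreal_mult_less_top)
      finally show ?case
        by (simp add: sobolev_iff_energy[OF has_fourier_diff[OF elim(1,2)]])
    qed
    show "joint_field M (\<lambda>\<omega> \<xi>. u t \<omega> \<xi> - u r \<omega> \<xi>)"
      by (intro joint_field_diff ju t r)
  qed
  define P where "P a b \<longleftrightarrow> (\<exists>K. \<forall>t\<in>{a..b} \<inter> {0..T}. field_energy M s (u t) \<le> ennreal K)" for a b
  have "P 0 T"
    using T
  proof (induction rule: Bolzano)
    case (trans a b c)
    from trans(1) obtain K1 where K1: "\<And>t. t \<in> {a..b} \<inter> {0..T} \<Longrightarrow> field_energy M s (u t) \<le> ennreal K1"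
      unfolding P_def by blast
    from trans(2) obtain K2 where K2: "\<And>t. t \<in> {b..c} \<inter> {0..T} \<Longrightarrow> field_energy M s (u t) \<le> ennreal K2"
      unfolding P_def by blast
    have "field_energy M s (u t) \<le> ennreal (max K1 K2)" if t: "t \<in> {a..c} \<inter> {0..T}" for t
    proof (cases "t \<le> b")
      case True
      then have "field_energy M s (u t) \<le> ennreal K1" using t by (intro K1) auto
      also have "\<dots> \<le> ennreal (max K1 K2)" by (intro ennreal_leI) simp
      finally show ?thesis .
    next
      case False
      then have "field_energy M s (u t) \<le> ennreal K2" using t by (intro K2) auto
      also have "\<dots> \<le> ennreal (max K1 K2)" by (intro ennreal_leI) simp
      finally show ?thesis .
    qed
    then show ?case unfolding P_def by blast
  next
    case (local r)
    then have r: "r \<in> {0..T}" by simp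
    obtain k where k: "field_energy M s (u r) = ennreal k" "0 \<le> k"
      using fin[OF r] by (cases "field_energy M s (u r)") auto
    have "((\<lambda>t. \<integral>\<^sup>+\<omega>. ennreal ((sobolev_norm s (U t \<omega> - U r \<omega>))\<^sup>2) \<partial>M) \<longlongrightarrow> 0) (at r within {0..T})"
      using L2 r by (auto simp: continuous_L2_sobolev_def)
    from order_tendstoD(2)[OF this, of 1]
    obtain d where d: "0 < d" "\<And>t. t \<in> {0..T} \<Longrightarrow> t \<noteq> r \<Longrightarrow> dist t r < d \<Longrightarrow> (\<integral>\<^sup>+\<omega>. ennreal ((sobolev_norm s (U t \<omega> - U r \<omega>))\<^sup>2) \<partial>M) < 1"
      unfolding eventually_at by auto
    \<comment> \<open>2 k + 2 comes from u t = u r + (u t - u r), with the energy of the difference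
      below 1 near r.\<close>
    have le: "field_energy M s (u t) \<le> ennreal (2 * k + 2)" if t: "t \<in> {0..T}" "dist t r < d" for t
    proof (cases "t = r")
      case False
      have "field_energy M s (\<lambda>\<omega> \<xi>. u r \<omega> \<xi> + (u t \<omega> \<xi> - u r \<omega> \<xi>)) \<le> 2 * field_energy M s (u r) + 2 * field_energy M s (\<lambda>\<omega> \<xi>. u t \<omega> \<xi> - u r \<omega> \<xi>)"
        by (intro field_energy_add joint_field_diff ju t r)
      also have "\<dots> \<le> 2 * ennreal k + 2 * 1"
        unfolding k diff[OF t(1) r] using d(2)[OF t(1) False t(2)] by (intro add_left_mono mult_left_mono) auto
      also have "\<dots> = ennreal (2 * k + 2)"
        using k by (simp add: ennreal_plus ennreal_mult)
      finally show ?thesis by simp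
    qed (use k in \<open>simp add: ennreal_leI del: ennreal_plus\<close>)
    show ?case
      unfolding P_def
    proof (rule exI[of _ d], intro conjI allI impI, rule d(1), rule exI[of _ "2 * k + 2"], intro ballI)
      fix a b t assume "a \<le> r \<and> r \<le> b \<and> b - a < d" "t \<in> {a..b} \<inter> {0..T}"
      then show "field_energy M s (u t) \<le> ennreal (2 * k + 2)"
        by (intro le) (auto simp: dist_real_def)
    qed
  qed
  then show ?thesis using that unfolding P_def by blast
qed

text \<open>By Tonelli the energy of order 0 integrated over [0, T] is the integral over \<xi> of
  the quantities in question, so these are finite for almost every \<xi>. They are the finiteness
  hypotheses of \<open>mode_unique\<close>.\<close>

lemma mode_energy_finite_AE:
  fixes u :: "real \<Rightarrow> 'a \<Rightarrow> real \<Rightarrow> complex"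
  assumes u: "(\<lambda>(t, \<omega>, \<xi>). u t \<omega> \<xi>) \<in> borel_measurable (restrict_space borel {0..T} \<Otimes>\<^sub>M M \<Otimes>\<^sub>M borel)"
    and K: "\<And>t. t \<in> {0..T} \<Longrightarrow> field_energy M 0 (u t) \<le> ennreal K" and T: "0 \<le> T"
  shows "AE \<xi> in lborel. (\<integral>\<^sup>+t\<in>{0..T}. (\<integral>\<^sup>+\<omega>. ennreal ((cmod (u t \<omega> \<xi>))\<^sup>2) \<partial>M) \<partial>lborel) < \<infinity>"
proof -
  interpret L: pair_sigma_finite "lborel :: real measure" M ..
  interpret P: pair_sigma_finite "(lborel :: real measure) \<Otimes>\<^sub>M M" "lborel :: real measure" ..
  define cl where "cl s = max 0 (min T s)" for s
  have cl: "cl s = s" if "s \<in> {0..T}" for s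
    using that by (simp add: cl_def)
  have [measurable]: "cl \<in> measurable lborel (restrict_space borel {0..T})"
    unfolding cl_def[abs_def] using T by (intro measurable_restrict_space2) auto
  have "(\<lambda>p. (cl (fst (fst p)), snd (fst p), snd p)) \<in> (lborel \<Otimes>\<^sub>M M) \<Otimes>\<^sub>M lborel \<rightarrow>\<^sub>M restrict_space borel {0..T} \<Otimes>\<^sub>M (M \<Otimes>\<^sub>M borel)"
    by measurable
  from measurable_compose[OF this u]
  have [measurable]: "(\<lambda>p. u (cl (fst (fst p))) (snd (fst p)) (snd p)) \<in> borel_measurable ((lborel \<Otimes>\<^sub>M M) \<Otimes>\<^sub>M lborel)"
    by simp
  define h where "h q \<xi> = ennreal ((cmod (u (cl (fst q)) (snd q) \<xi>))\<^sup>2) * indicator {0..T} (fst q)" for q :: "real \<times> 'a" and \<xi>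
  have hm [measurable]: "(\<lambda>p. h (fst p) (snd p)) \<in> borel_measurable ((lborel \<Otimes>\<^sub>M M) \<Otimes>\<^sub>M lborel)"
    unfolding h_def by measurable
  have "(\<integral>\<^sup>+\<xi>. (\<integral>\<^sup>+q. h q \<xi> \<partial>(lborel \<Otimes>\<^sub>M M)) \<partial>lborel) = (\<integral>\<^sup>+q. (\<integral>\<^sup>+\<xi>. h q \<xi> \<partial>lborel) \<partial>(lborel \<Otimes>\<^sub>M M))"
    using P.Fubini'[of h] by (simp add: case_prod_beta')
  also have "\<dots> = (\<integral>\<^sup>+t. (\<integral>\<^sup>+\<omega>. (\<integral>\<^sup>+\<xi>. h (t, \<omega>) \<xi> \<partial>lborel) \<partial>M) \<partial>lborel)"
  proof (rule nn_integral_fst[symmetric])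
    show "(\<lambda>q. \<integral>\<^sup>+\<xi>. h q \<xi> \<partial>lborel) \<in> borel_measurable (lborel \<Otimes>\<^sub>M M)"
      using lborel.borel_measurable_nn_integral_fst[OF hm] by simp
  qed
  also have "\<dots> \<le> (\<integral>\<^sup>+t. ennreal K * indicator {0..T} t \<partial>lborel)"
  proof (rule nn_integral_mono)
    fix t :: real
    show "(\<integral>\<^sup>+\<omega>. (\<integral>\<^sup>+\<xi>. h (t, \<omega>) \<xi> \<partial>lborel) \<partial>M) \<le> ennreal K * indicator {0..T} t"
    proof (cases "t \<in> {0..T}")
      case True
      then have "(\<integral>\<^sup>+\<omega>. (\<integral>\<^sup>+\<xi>. h (t, \<omega>) \<xi> \<partial>lborel) \<partial>M) = field_energy M 0 (u t)"
        by (simp add: field_energy_iterated[OF time_slice_joint_field[OF u True]] weighted_energy_def h_def cl mode_weight_0 del: powr_zero_eq_one)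
      then show ?thesis
        using K[OF True] True by simp
    qed (simp add: h_def)
  qed
  also have "\<dots> < \<infinity>"
    using T by (simp add: nn_integral_cmult ennreal_mult_less_top)
  finally have "AE \<xi> in lborel. (\<integral>\<^sup>+q. h q \<xi> \<partial>(lborel \<Otimes>\<^sub>M M)) \<noteq> \<infinity>"
    using L.P.borel_measurable_nn_integral_fst[OF measurable_pair_swap[OF hm]]
    by (intro nn_integral_noteq_infinite) auto
  then show ?thesis
  proof eventually_elim
    case (elim \<xi>)
    have "(\<lambda>q. h q \<xi>) \<in> borel_measurable (lborel \<Otimes>\<^sub>M M)"
      using measurable_compose[OF measurable_Pair2'[of \<xi> lborel] hm] by simp
    from nn_integral_fst[OF this]
    have "(\<integral>\<^sup>+q. h q \<xi> \<partial>(lborel \<Otimes>\<^sub>M M)) = (\<integral>\<^sup>+t. (\<integral>\<^sup>+\<omega>. h (t, \<omega>) \<xi> \<partial>M) \<partial>lborel)"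
      by simp
    also have "\<dots> = (\<integral>\<^sup>+t\<in>{0..T}. (\<integral>\<^sup>+\<omega>. ennreal ((cmod (u t \<omega> \<xi>))\<^sup>2) \<partial>M) \<partial>lborel)"
      by (rule nn_integral_cong) (auto simp: h_def cl indicator_def)
    finally show ?case
      using elim by (simp add: less_top)
  qed
qed

text \<open>Mode by mode equality holds almost surely with a null event depending on \<xi>.
  Integrating the squared difference over the product space exchanges the two quantifiers.\<close>

lemma joint_fields_AE_eq:
  assumes G: "joint_field M G" and H: "joint_field M H"
    and eq: "AE \<xi> in lborel. AE \<omega> in M. G \<omega> \<xi> = H \<omega> \<xi>"
  shows "AE \<omega> in M. AE \<xi> in lborel. G \<omega> \<xi> = H \<omega> \<xi>"
proof -
  note J = joint_field_diff[OF G H]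
  have "field_energy M 0 (\<lambda>\<omega> \<xi>. G \<omega> \<xi> - H \<omega> \<xi>) = (\<integral>\<^sup>+\<xi>. 0 \<partial>(lborel :: real measure))"
    unfolding field_energy_swap[OF sigma_finite_measure_axioms J]
  proof (rule nn_integral_cong_AE)
    show "AE \<xi> in lborel. ennreal (mode_weight 0 \<xi>) * (\<integral>\<^sup>+\<omega>. ennreal ((cmod (G \<omega> \<xi> - H \<omega> \<xi>))\<^sup>2) \<partial>M) = 0"
      using eq
    proof eventually_elim
      case (elim \<xi>)
      then have "(\<integral>\<^sup>+\<omega>. ennreal ((cmod (G \<omega> \<xi> - H \<omega> \<xi>))\<^sup>2) \<partial>M) = (\<integral>\<^sup>+\<omega>. 0 \<partial>M)"
        by (intro nn_integral_cong_AE) auto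
      then show ?case by simp
    qed
  qed
  then have "(\<integral>\<^sup>+\<omega>. weighted_energy 0 (\<lambda>\<xi>. G \<omega> \<xi> - H \<omega> \<xi>) \<partial>M) = 0"
    by (simp add: field_energy_iterated[OF J])
  then have "AE \<omega> in M. weighted_energy 0 (\<lambda>\<xi>. G \<omega> \<xi> - H \<omega> \<xi>) = 0"
    using weighted_energy_joint[OF J] by (subst (asm) nn_integral_0_iff_AE) auto
  then show ?thesis
    using AE_space
  proof eventually_elim
    case (elim \<omega>)
    have [measurable]: "G \<omega> \<in> borel_measurable borel" "H \<omega> \<in> borel_measurable borel"
      using joint_field_section[OF G elim(2)] joint_field_section[OF H elim(2)] by auto
    have "AE \<xi> in lborel. ennreal (mode_weight 0 \<xi> * (cmod (G \<omega> \<xi> - H \<omega> \<xi>))\<^sup>2) = 0"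
      using elim(1) unfolding weighted_energy_def by (subst (asm) nn_integral_0_iff_AE) auto
    then show ?case
      unfolding mode_weight_0 by eventually_elim simp
  qed
qed

text \<open>Order 0 continuity makes the mode energies finite for almost every \<xi>, so two
  solutions share almost all modes. Exchanging the quantifiers gives transforms equal almost
  everywhere, and a distribution is determined by its transform.\<close>

lemma cauchy_solution_unique:
  assumes S1: "cauchy_solution M F B \<sigma> T \<phi>0 \<phi>1 U1 V1" and S2: "cauchy_solution M F B \<sigma> T \<phi>0 \<phi>1 U2 V2"
    and L1: "continuous_L2_sobolev M T 0 U1" and L2: "continuous_L2_sobolev M T 0 U2"
    and T: "0 < T" and t: "t \<in> {0..T}"
  shows "AE \<omega> in M. U1 t \<omega> = U2 t \<omega> \<and> V1 t \<omega> = V2 t \<omega>"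
proof -
  let ?R = "restrict_space (borel :: real measure) {0..T}"
  obtain u1 v1 a1 b1 where a1: "has_fourier \<phi>0 a1" and b1: "has_fourier \<phi>1 b1"
    and u1: "(\<lambda>(t, \<omega>, \<xi>). u1 t \<omega> \<xi>) \<in> borel_measurable (?R \<Otimes>\<^sub>M M \<Otimes>\<^sub>M borel)"
    and v1: "(\<lambda>(t, \<omega>, \<xi>). v1 t \<omega> \<xi>) \<in> borel_measurable (?R \<Otimes>\<^sub>M M \<Otimes>\<^sub>M borel)"
    and m1: "AE \<xi> in lborel. mode_solution M F B \<sigma> T \<xi> (a1 \<xi>) (b1 \<xi>) (\<lambda>t \<omega>. u1 t \<omega> \<xi>) (\<lambda>t \<omega>. v1 t \<omega> \<xi>)"
    and f1: "\<And>t. t \<in> {0..T} \<Longrightarrow> AE \<omega> in M. has_fourier (U1 t \<omega>) (u1 t \<omega>) \<and> has_fourier (V1 t \<omega>) (v1 t \<omega>)"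
    using S1 unfolding cauchy_solution_def by blast
  obtain u2 v2 a2 b2 where a2: "has_fourier \<phi>0 a2" and b2: "has_fourier \<phi>1 b2"
    and u2: "(\<lambda>(t, \<omega>, \<xi>). u2 t \<omega> \<xi>) \<in> borel_measurable (?R \<Otimes>\<^sub>M M \<Otimes>\<^sub>M borel)"
    and v2: "(\<lambda>(t, \<omega>, \<xi>). v2 t \<omega> \<xi>) \<in> borel_measurable (?R \<Otimes>\<^sub>M M \<Otimes>\<^sub>M borel)"
    and m2: "AE \<xi> in lborel. mode_solution M F B \<sigma> T \<xi> (a2 \<xi>) (b2 \<xi>) (\<lambda>t \<omega>. u2 t \<omega> \<xi>) (\<lambda>t \<omega>. v2 t \<omega> \<xi>)"
    and f2: "\<And>t. t \<in> {0..T} \<Longrightarrow> AE \<omega> in M. has_fourier (U2 t \<omega>) (u2 t \<omega>) \<and> has_fourier (V2 t \<omega>) (v2 t \<omega>)"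
    using S2 unfolding cauchy_solution_def by blast
  have slice: "(\<lambda>(t, \<omega>). u t \<omega> \<xi>) \<in> borel_measurable (?R \<Otimes>\<^sub>M M)"
    if u: "(\<lambda>(t, \<omega>, \<xi>). u t \<omega> \<xi>) \<in> borel_measurable (?R \<Otimes>\<^sub>M M \<Otimes>\<^sub>M borel)" for u :: "real \<Rightarrow> 'a \<Rightarrow> real \<Rightarrow> complex" and \<xi>
  proof -
    have "(\<lambda>p. (fst p, snd p, \<xi>)) \<in> ?R \<Otimes>\<^sub>M M \<rightarrow>\<^sub>M ?R \<Otimes>\<^sub>M M \<Otimes>\<^sub>M borel"
      by measurable
    from measurable_compose[OF this u] show ?thesis
      by (simp add: case_prod_beta')
  qed
  have T0: "0 \<le> T" using T by simp
  have e1: "AE \<xi> in lborel. (\<integral>\<^sup>+t\<in>{0..T}. (\<integral>\<^sup>+\<omega>. ennreal ((cmod (u1 t \<omega> \<xi>))\<^sup>2) \<partial>M) \<partial>lborel) < \<infinity>"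
  proof -
    have "AE \<omega> in M. has_fourier (U1 t \<omega>) (u1 t \<omega>)" if "t \<in> {0..T}" for t
      using f1[OF that] by eventually_elim simp
    from energy_bounded[OF u1 this L1 T0] obtain K where "\<And>t. t \<in> {0..T} \<Longrightarrow> field_energy M 0 (u1 t) \<le> ennreal K"
      by blast
    from mode_energy_finite_AE[OF u1 this T0] show ?thesis .
  qed
  have e2: "AE \<xi> in lborel. (\<integral>\<^sup>+t\<in>{0..T}. (\<integral>\<^sup>+\<omega>. ennreal ((cmod (u2 t \<omega> \<xi>))\<^sup>2) \<partial>M) \<partial>lborel) < \<infinity>"
  proof -
    have "AE \<omega> in M. has_fourier (U2 t \<omega>) (u2 t \<omega>)" if "t \<in> {0..T}" for t
      using f2[OF that] by eventually_elim simp
    from energy_bounded[OF u2 this L2 T0] obtain K where "\<And>t. t \<in> {0..T} \<Longrightarrow> field_energy M 0 (u2 t) \<le> ennreal K"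
      by blast
    from mode_energy_finite_AE[OF u2 this T0] show ?thesis .
  qed
  have eq: "AE \<xi> in lborel. AE \<omega> in M. u1 t \<omega> \<xi> = u2 t \<omega> \<xi> \<and> v1 t \<omega> \<xi> = v2 t \<omega> \<xi>"
    using m1 m2 e1 e2 has_fourier_unique[OF a1 a2] has_fourier_unique[OF b1 b2]
  proof eventually_elim
    case (elim \<xi>)
    show ?case
      \<comment> \<open>The two solutions may use different representatives of the transformed data.
        At this \<xi> they agree, and folding the equations gives both modes the same initial
        values.\<close>
      by (rule mode_unique[OF elim(1) elim(2)[folded elim(5,6)] T slice[OF u1] slice[OF u2] elim(3,4) t])
  qed
  have "AE \<omega> in M. AE \<xi> in lborel. u1 t \<omega> \<xi> = u2 t \<omega> \<xi>"
    by (rule joint_fields_AE_eq[OF time_slice_joint_field[OF u1 t] time_slice_joint_field[OF u2 t]])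
      (use eq in \<open>auto elim!: eventually_mono\<close>)
  moreover have "AE \<omega> in M. AE \<xi> in lborel. v1 t \<omega> \<xi> = v2 t \<omega> \<xi>"
    by (rule joint_fields_AE_eq[OF time_slice_joint_field[OF v1 t] time_slice_joint_field[OF v2 t]])
      (use eq in \<open>auto elim!: eventually_mono\<close>)
  ultimately show ?thesis
    using f1[OF t] f2[OF t]
  proof eventually_elim
    case (elim \<omega>)
    then show ?case
      using has_fourier_eqI[of "U1 t \<omega>" "u1 t \<omega>" "U2 t \<omega>" "u2 t \<omega>"] has_fourier_eqI[of "V1 t \<omega>" "v1 t \<omega>" "V2 t \<omega>" "v2 t \<omega>"]
      by blast
  qed
qed

end

theorem theorem1p1:
  fixes M :: "'a measure" and F :: "real \<Rightarrow> 'a measure" and B :: "real \<Rightarrow> 'a \<Rightarrow> real"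
    and \<sigma> T :: real
  assumes "brownian_motion M F B" and "\<sigma> > 0" and "T > 0"
  shows "\<forall>\<phi>0\<in>sobolev_inf. \<forall>\<phi>1\<in>sobolev_inf.
    \<exists>U V.
      (cauchy_solution M F B \<sigma> T \<phi>0 \<phi>1 U V \<and>
       (\<forall>k\<ge>0. continuous_L2_sobolev M T k U) \<and>
       (\<forall>k\<ge>0. continuous_L2_sobolev M T (k - 1/2) V)) \<and>
      (\<forall>U' V'.
         cauchy_solution M F B \<sigma> T \<phi>0 \<phi>1 U' V' \<and>
         (\<forall>k\<ge>0. continuous_L2_sobolev M T k U') \<and>
         (\<forall>k\<ge>0. continuous_L2_sobolev M T (k - 1/2) V') \<longrightarrow>
         (\<forall>t\<in>{0..T}. AE \<omega> in M. U' t \<omega> = U t \<omega> \<and> V' t \<omega> = V t \<omega>))"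
proof (intro ballI)
  interpret brownian_motion M F B by (rule assms(1))
  fix \<phi>0 \<phi>1 assume "\<phi>0 \<in> sobolev_inf" "\<phi>1 \<in> sobolev_inf"
  then obtain a b where a: "has_fourier \<phi>0 a" "\<And>p. weighted_energy p a < \<infinity>"
    and b: "has_fourier \<phi>1 b" "\<And>p. weighted_energy p b < \<infinity>"
    by (metis sobolev_inf_fourier)
  let ?U = "\<lambda>t \<omega>. dist_of (mode_field \<sigma> a b True t \<omega>)" and ?V = "\<lambda>t \<omega>. dist_of (mode_field \<sigma> a b False t \<omega>)"
  have S: "cauchy_solution M F B \<sigma> T \<phi>0 \<phi>1 ?U ?V"
    by (rule cauchy_solution_exists[OF assms(2,3) a(1) b(1) a(2) b(2)])
  \<comment> \<open>Valid for every real s and for both components, hence for the orders k of U and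
    k - 1/2 of V alike.\<close>
  have C: "continuous_L2_sobolev M T s (\<lambda>t \<omega>. dist_of (mode_field \<sigma> a b c t \<omega>))" for s c
    by (rule mode_field_continuous_L2(1)[OF assms(2,3) has_fourierD(1)[OF a(1)] has_fourierD(1)[OF b(1)] a(2) b(2)])
  show "\<exists>U V. (cauchy_solution M F B \<sigma> T \<phi>0 \<phi>1 U V \<and>
       (\<forall>k\<ge>0. continuous_L2_sobolev M T k U) \<and>
       (\<forall>k\<ge>0. continuous_L2_sobolev M T (k - 1/2) V)) \<and>
      (\<forall>U' V'.
         cauchy_solution M F B \<sigma> T \<phi>0 \<phi>1 U' V' \<and>
         (\<forall>k\<ge>0. continuous_L2_sobolev M T k U') \<and>
         (\<forall>k\<ge>0. continuous_L2_sobolev M T (k - 1/2) V') \<longrightarrow>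
         (\<forall>t\<in>{0..T}. AE \<omega> in M. U' t \<omega> = U t \<omega> \<and> V' t \<omega> = V t \<omega>))"
  proof (rule exI[of _ ?U], rule exI[of _ ?V], intro conjI allI impI ballI)
    fix U' V' t
    assume "cauchy_solution M F B \<sigma> T \<phi>0 \<phi>1 U' V' \<and> (\<forall>k\<ge>0. continuous_L2_sobolev M T k U') \<and>
       (\<forall>k\<ge>0. continuous_L2_sobolev M T (k - 1/2) V')" and t: "t \<in> {0..T}"
    then have S': "cauchy_solution M F B \<sigma> T \<phi>0 \<phi>1 U' V'" and C': "continuous_L2_sobolev M T 0 U'"
      by auto
    show "AE \<omega> in M. U' t \<omega> = ?U t \<omega> \<and> V' t \<omega> = ?V t \<omega>"
      by (rule cauchy_solution_unique[OF S' S C' C assms(3) t])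
  qed (rule S C)+
qed

end
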